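(* For $0<p\le 1$, we have $H^p_{\Delta_d}(\mathbb Z)\equiv H^p(\mathbb Z)$ with equivalent norms.
   Context: $\mathbb N=\{0,1,2,\dots\}$; $\mathbb Z$ carries counting measure and functions are complex valued. The discrete Laplacian is $\Delta_d f(n)=-f(n+1)+2f(n)-f(n-1)$. Its heat semigroup is $e^{-t\Delta_d}f(n)=\sum_{m\in\mathbb Z}h_t(n-m)f(m)$, $t>0$, with $h_t(n)=\frac1\pi\int_0^\pi e^{-2t(1-\cos\theta)}\cos(n\theta)\,d\theta$. $\mathcal S(\mathbb Z)$ is the space of functions $f$ on $\mathbb Z$ with $\|f\|_m=\sup_{n}(1+|n|)^m\sup_{0\le\ell\le m}|\Delta_d^\ell f(n)|<\infty$ for all $m\in\mathbb N$, topologized by these seminorms; $\mathcal S'(\mathbb Z)$ is its dual, identified with the functions on $\mathbb Z$ of at most polynomial growth. A distribution $f\in\mathcal S'(\mathbb Z)$ vanishes weakly at infinity if $(t\Delta_d)^k e^{-t\Delta_d}f\to0$ in $\mathcal S'(\mathbb Z)$ as $t\to\infty$ for every $k\in\mathbb N$. $S_{\Delta_d}f(n)=\Big(\int_0^\infty\sum_{m:|m-n|<t}|t^2\Delta_d e^{-t^2\Delta_d}f(m)|^2\frac{dt}{t(t+1)}\Big)^{1/2}$. For $0<p\le1$, $H^p_{\Delta_d}(\mathbb Z)$ is the set of $f\in\mathcal S'(\mathbb Z)$ vanishing weakly at infinity with $\|f\|_{H^p_{\Delta_d}(\mathbb Z)}:=\|S_{\Delta_d}f\|_{\ell^p(\mathbb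 Z)}<\infty$. Classical Hardy space: let $0<p<q$ and $p\le1\le q\le\infty$. A function $a$ is a $(p,q)$ atom if there is an interval $I\subset\mathbb Z$ (a set of consecutive integers, with cardinality $|I|$) such that $\operatorname{supp}a\subset I$; $\|a\|_{\ell^q(\mathbb Z)}\le|I|^{1/q-1/p}$; and $\sum_{n\in\mathbb Z}n^\alpha a(n)=0$ for every $\alpha\in\mathbb N$ with $\alpha\le 1/p-1$. $H^{p,q}(\mathbb Z)$ is the set of $f$ ($f\in\ell^1(\mathbb Z)$ if $p=1$, $f\in\mathcal S'(\mathbb Z)$ if $0<p<1$) for which there exist $(p,q)$ atoms $a_j$ and numbers $\lambda_j$, $j\in\mathbb N$, with $\sum_j|\lambda_j|^p<\infty$ and $f=\sum_j\lambda_ja_j$, convergence in $\ell^1(\mathbb Z)$ if $p=1$ and in $\mathcal S'(\mathbb Z)$ if $0<p<1$; $\|f\|^p_{H^{p,q}(\mathbb Z)}=\inf\sum_j|\lambda_j|^p$ over all such decompositions. It is well known that $H^{p,q}(\mathbb Z)=H^{p,\infty}(\mathbb Z)$ for all such $q$; $H^p(\mathbb Z)$ denotes any of these spaces. *)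

theory Defs
  imports "HOL-Analysis.Analysis"
begin

text \<open>Powers of extended nonnegative reals, only used with a positive exponent.\<close>

definition epowr :: "ennreal \<Rightarrow> real \<Rightarrow> ennreal" where
  "epowr x r = (if x = \<infinity> then \<infinity> else ennreal (enn2real x powr r))"

definition lq_norm :: "ennreal \<Rightarrow> (int \<Rightarrow> ennreal) \<Rightarrow> ennreal" where
  "lq_norm q g =
     (if q = \<infinity> then (SUP n. g n)
      else epowr (\<integral>\<^sup>+n. epowr (g n) (enn2real q) \<partial>count_space UNIV) (1 / enn2real q))"

definition discrete_laplacian :: "(int \<Rightarrow> complex) \<Rightarrow> int \<Rightarrow> complex" where
  "discrete_laplacian f n = - f (n + 1) + 2 * f n - f (n - 1)"

definition heat_kernel :: "real \<Rightarrow> int \<Rightarrow> real" where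
  "heat_kernel t n =
     (1 / pi) * integral {0..pi} (\<lambda>\<theta>. exp (- 2 * t * (1 - cos \<theta>)) * cos (of_int n * \<theta>))"

text \<open>For fixed \<open>t\<close> the kernel decays faster than any power of \<open>n\<close>, so the sum converges
  absolutely whenever \<open>f\<close> has at most polynomial growth.\<close>

definition heat_semigroup :: "real \<Rightarrow> (int \<Rightarrow> complex) \<Rightarrow> int \<Rightarrow> complex" where
  "heat_semigroup t f n = (\<Sum>\<^sub>\<infinity>m\<in>UNIV. complex_of_real (heat_kernel t (n - m)) * f m)"

definition schwartz_seminorm :: "nat \<Rightarrow> (int \<Rightarrow> complex) \<Rightarrow> ennreal" where
  "schwartz_seminorm m f =
     (SUP n. ennreal ((1 + \<bar>real_of_int n\<bar>) ^ m) *
        (SUP l\<in>{0..m}. ennreal (norm ((discrete_laplacian ^^ l) f n))))"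

definition schwartz :: "(int \<Rightarrow> complex) set" where
  "schwartz = {f. \<forall>m. schwartz_seminorm m f < \<infinity>}"

text \<open>The dual of \<open>schwartz\<close> is identified with the functions of at most polynomial growth,
  a function \<open>f\<close> acting on \<open>\<phi>\<close> by the absolutely convergent sum \<open>pairing f \<phi>\<close>.\<close>

definition tempered :: "(int \<Rightarrow> complex) set" where
  "tempered = {f. \<exists>C m. \<forall>n. norm (f n) \<le> C * (1 + \<bar>real_of_int n\<bar>) ^ (m::nat)}"

definition pairing :: "(int \<Rightarrow> complex) \<Rightarrow> (int \<Rightarrow> complex) \<Rightarrow> complex" where
  "pairing f \<phi> = (\<Sum>\<^sub>\<infinity>n\<in>UNIV. f n * \<phi> n)"

text \<open>Convergence in the weak dual topology. For sequences, and for limits as \<open>t\<close> tends to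
  infinity along the reals, it coincides with convergence in the strong dual topology.\<close>

definition tempered_tendsto ::
    "('a \<Rightarrow> int \<Rightarrow> complex) \<Rightarrow> (int \<Rightarrow> complex) \<Rightarrow> 'a filter \<Rightarrow> bool" where
  "tempered_tendsto u f F \<longleftrightarrow>
     (\<forall>\<phi>\<in>schwartz. ((\<lambda>x. pairing (u x) \<phi>) \<longlongrightarrow> pairing f \<phi>) F)"

definition vanishes_weakly_at_infinity :: "(int \<Rightarrow> complex) \<Rightarrow> bool" where
  "vanishes_weakly_at_infinity f \<longleftrightarrow>
     (\<forall>k::nat. tempered_tendsto
        (\<lambda>t. ((\<lambda>g n. complex_of_real t * discrete_laplacian g n) ^^ k) (heat_semigroup t f))
        (\<lambda>n. 0) at_top)"

definition square_function :: "(int \<Rightarrow> complex) \<Rightarrow> int \<Rightarrow> ennreal" where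
  "square_function f n = epowr
     (\<integral>\<^sup>+t\<in>{0<..}. ennreal
        ((\<Sum>m | real_of_int \<bar>m - n\<bar> < t.
            (norm (complex_of_real (t\<^sup>2) * discrete_laplacian (heat_semigroup (t\<^sup>2) f) m))\<^sup>2)
         / (t * (t + 1))) \<partial>lborel)
     (1 / 2)"

definition hardy_laplacian_norm :: "real \<Rightarrow> (int \<Rightarrow> complex) \<Rightarrow> ennreal" where
  "hardy_laplacian_norm p f = lq_norm (ennreal p) (square_function f)"

definition hardy_laplacian :: "real \<Rightarrow> (int \<Rightarrow> complex) set" where
  "hardy_laplacian p =
     {f \<in> tempered. vanishes_weakly_at_infinity f \<and> hardy_laplacian_norm p f < \<infinity>}"

text \<open>The exponent \<open>q\<close> may be infinite, in which case \<open>1 / q = 0\<close>. The zero function is the only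
  one satisfying the size condition on an infinite or empty interval, and it is also an atom on
  any bounded interval \<open>{c..d}\<close>, so nothing is lost by considering only these.\<close>

definition hardy_atom :: "real \<Rightarrow> ennreal \<Rightarrow> (int \<Rightarrow> complex) \<Rightarrow> bool" where
  "hardy_atom p q a \<longleftrightarrow>
     (\<exists>c d. c \<le> d \<and>
        {n. a n \<noteq> 0} \<subseteq> {c..d} \<and>
        lq_norm q (\<lambda>n. ennreal (norm (a n)))
          \<le> ennreal (real (card {c..d}) powr (enn2real (1 / q) - 1 / p)) \<and>
        (\<forall>\<alpha>::nat. real \<alpha> \<le> 1 / p - 1 \<longrightarrow> (\<Sum>n\<in>{c..d}. of_int n ^ \<alpha> * a n) = 0))"

definition atomic_decomposition ::
    "real \<Rightarrow> ennreal \<Rightarrow> (int \<Rightarrow> complex) \<Rightarrow> (nat \<Rightarrow> complex) \<Rightarrow> (nat \<Rightarrow> int \<Rightarrow> complex) \<Rightarrow> bool"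
  where
  "atomic_decomposition p q f c a \<longleftrightarrow>
     (\<forall>j. hardy_atom p q (a j)) \<and>
     summable (\<lambda>j. norm (c j) powr p) \<and>
     (if p = 1
      then (\<lambda>N. lq_norm 1 (\<lambda>n. ennreal (norm (f n - (\<Sum>j<N. c j * a j n))))) \<longlonglongrightarrow> 0
      else tempered_tendsto (\<lambda>N n. \<Sum>j<N. c j * a j n) f sequentially)"

definition hardy_classical :: "real \<Rightarrow> ennreal \<Rightarrow> (int \<Rightarrow> complex) set" where
  "hardy_classical p q =
     {f. (if p = 1 then lq_norm 1 (\<lambda>n. ennreal (norm (f n))) < \<infinity> else f \<in> tempered) \<and>
         (\<exists>c a. atomic_decomposition p q f c a)}"

definition hardy_classical_norm :: "real \<Rightarrow> ennreal \<Rightarrow> (int \<Rightarrow> complex) \<Rightarrow> ennreal" where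
  "hardy_classical_norm p q f = epowr
     (Inf {ennreal (\<Sum>j. norm (c j) powr p) |c a. atomic_decomposition p q f c a})
     (1 / p)"

end

theory Submission
  imports Defs "HOL-Computational_Algebra.Polynomial"
begin

text \<open>
Both spaces are compared with the space of sums \<open>\<Sum>\<^sub>j c\<^sub>j a\<^sub>j\<close> of \<open>L\<^sup>\<infinity>\<close>-normalised atoms with
\<open>\<Sum>\<^sub>j |c\<^sub>j|\<^sup>p < \<infinity>\<close>.

From the square function to atoms: a distribution that vanishes weakly at infinity is recovered from
its heat evolution by a discrete Calderon reproducing formula, and weak vanishing is exactly what
kills the remainder at \<open>t = \<infinity>\<close>. The formula is cut into dyadic scales and positions. A stopping time
on the level sets \<open>S f > 2\<^sup>k\<close> groups the pieces into dyadic trees on which the energy of the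
square function is controlled, and duality with the quadratic estimate bounds the \<open>\<ell>\<^sup>2\<close> norm of each
group. Since the heat kernels have tails, a group is only a molecule, and its moments have to be
corrected annulus by annulus to split it into atoms.

From atoms to the square function: the quadratic estimate handles the part near the supporting
interval. Far away, a Taylor expansion of the kernel against the vanishing moments gives decay of order
\<open>N + 2\<close> with \<open>p (N + 2) > 1\<close>. Minkowski's inequality and \<open>p \<le> 1\<close> then give the bound for sums.

For finite \<open>q\<close>, a \<open>(p,q)\<close> atom is split into bounded atoms by iterated Calderon-Zygmund decompositions.
\<close>

section \<open>Sums over the integers\<close>

text \<open>Everything passes through \<open>asum B f\<close>, where \<open>B\<close> bounds the sum
  of p-th powers of the coefficients. Atoms have l^1 norm at most 1 and p <= 1, so atomic sums
  converge in l^1; thus l^1 convergence (p = 1) and distributional convergence (p < 1) are treated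
  together. All facts on the heat kernel come from its cosine integral: a Gaussian above the symbol
  gives the size, and integration by parts trades a factor n for s times a difference, which gives
  spatial decay. The semigroup law then turns the quadratic estimate into an instance of the
  reproducing formula. With \<open>N\<close> the integer part of 1/p - 1, so that p (N + 2) > 1, the
  formula has order M = N + 1: its kernels kill polynomials of degree below 2M > N and decay to the
  power 2M + 1 >= N + 2. Discreteness helps twice: all times t <= 2 form one level, and the
  Calderon-Zygmund recursion is finite. The delicate point is the order of summation: the formula
  converges along increasing scales, but the atoms are grouped by stopping times. Dominated
  convergence, with a majorant from the embedding of l^p in l^1, reconciles the two.\<close>

lemma summable_on_inverse_square_int: "(\<lambda>n::int. 1 / (1 + \<bar>real_of_int n\<bar>) ^ 2) summable_on UNIV"
proof -
  let ?f = "\<lambda>n::int. 1 / (1 + \<bar>real_of_int n\<bar>) ^ 2"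
  have "summable (\<lambda>n. inverse ((real (Suc n)) ^ 2))"
    using inverse_power_summable[of 2, where 'a=real] by (subst summable_Suc_iff) simp_all
  then have s: "summable (\<lambda>n. norm (?f (int n)))"
    by (simp add: field_simps)
  have 1: "(?f \<circ> int) summable_on UNIV" "(?f \<circ> (\<lambda>n. - int n)) summable_on UNIV"
    using norm_summable_imp_summable_on[OF s] by (simp_all add: o_def)
  have "inj int" "inj (\<lambda>n. - int n)"
    by (auto simp: inj_on_def)
  then have a: "?f summable_on (range int)" and b: "?f summable_on (range (\<lambda>n. - int n))"
    using 1 by (simp_all add: summable_on_reindex)
  have "x \<in> range int \<union> range (\<lambda>n. - int n)" for x by (cases x rule: int_cases2) auto
  then have "range int \<union> (range (\<lambda>n. - int n) - range int) = UNIV" by blast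
  moreover have "?f summable_on (range int \<union> (range (\<lambda>n. - int n) - range int))"
    by (rule summable_on_Un_disjoint[OF a summable_on_subset_banach[OF b]]) blast+
  ultimately show ?thesis by simp
qed

lemma bij_shift_int: "bij_betw (\<lambda>m. m + c) (UNIV::int set) UNIV" "bij_betw (\<lambda>m. c - m) (UNIV::int set) UNIV"
  by (rule bij_betwI[where g="\<lambda>m. m - c"]; simp) (rule bij_betwI[where g="\<lambda>m. c - m"]; simp)

lemma summable_on_inverse_square_int_shift:
  "(\<lambda>m::int. 1 / (1 + \<bar>real_of_int (n - m)\<bar>) ^ 2) summable_on UNIV"
  "(\<lambda>m::int. 1 / (1 + \<bar>real_of_int (m - n)\<bar>) ^ 2) summable_on UNIV"
  using summable_on_inverse_square_int
    summable_on_reindex_bij_betw[OF bij_shift_int(2), of "\<lambda>n. 1 / (1 + \<bar>real_of_int n\<bar>) ^ 2" n]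
  by (simp_all add: abs_minus_commute)

lemma has_sum_shift_int:
  "((\<lambda>m. f (m + c :: int)) has_sum S) UNIV \<longleftrightarrow> (f has_sum S) UNIV"
  "((\<lambda>m. f (c - m :: int)) has_sum S) UNIV \<longleftrightarrow> (f has_sum S) UNIV"
  using has_sum_reindex_bij_betw[OF bij_shift_int(1), of f c S]
    has_sum_reindex_bij_betw[OF bij_shift_int(2), of f c S] by simp_all

lemma summable_on_norm_bound:
  fixes f :: "'i \<Rightarrow> 'a::banach"
  assumes "B summable_on A" "\<And>i. i \<in> A \<Longrightarrow> norm (f i) \<le> B i"
  shows "f summable_on A"
proof -
  have "(\<lambda>i. norm (f i)) summable_on A"
    by (rule summable_on_comparison_test[OF assms(1)]) (use assms in auto)
  then show ?thesis by (rule abs_summable_summable)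
qed

text \<open>Weierstrass' M-test: the finite partial sums converge uniformly in \<open>t\<close>, so
  continuity and the integral pass to the limit. It serves the exchanges of a sum over the integers
  with an integral over a bounded time interval.\<close>

lemma
  fixes g :: "'i \<Rightarrow> real \<Rightarrow> complex"
  assumes c: "\<And>i. continuous_on {a..b} (g i)"
    and B: "\<And>i t. t \<in> {a..b} \<Longrightarrow> norm (g i t) \<le> B i" "B summable_on UNIV"
  shows continuous_on_infsum: "continuous_on {a..b} (\<lambda>t. \<Sum>\<^sub>\<infinity>i. g i t)"
    and has_sum_integral_infsum:
      "((\<lambda>i. integral {a..b} (g i)) has_sum integral {a..b} (\<lambda>t. \<Sum>\<^sub>\<infinity>i. g i t)) UNIV"
proof -
  have u: "uniform_limit {a..b} (\<lambda>X t. \<Sum>i\<in>X. g i t) (\<lambda>t. \<Sum>\<^sub>\<infinity>i. g i t) (finite_subsets_at_top UNIV)"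
    by (rule Weierstrass_m_test_general) (use B in auto)
  have c': "continuous_on {a..b} (\<lambda>t. \<Sum>i\<in>X. g i t)" for X
    by (intro continuous_on_sum c)
  show "continuous_on {a..b} (\<lambda>t. \<Sum>\<^sub>\<infinity>i. g i t)"
    by (rule uniform_limit_theorem[OF _ u]) (use c' in auto)
  obtain I J where I: "\<And>X. ((\<lambda>t. \<Sum>i\<in>X. g i t) has_integral I X) {a..b}"
    and J: "((\<lambda>t. \<Sum>\<^sub>\<infinity>i. g i t) has_integral J) {a..b}"
    and IJ: "(I \<longlongrightarrow> J) (finite_subsets_at_top UNIV)"
    by (rule uniform_limit_integral[OF u]) (use c' in auto)
  have "I X = (\<Sum>i\<in>X. integral {a..b} (g i))" if "finite X" for X
  proof -
    have "integral {a..b} (\<lambda>t. \<Sum>i\<in>X. g i t) = (\<Sum>i\<in>X. integral {a..b} (g i))"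
      by (rule integral_sum) (use that c integrable_continuous_real in auto)
    then show ?thesis using I[of X] by (simp add: integral_unique)
  qed
  then have "((\<lambda>X. \<Sum>i\<in>X. integral {a..b} (g i)) \<longlongrightarrow> J) (finite_subsets_at_top UNIV)"
    by (intro Lim_transform_eventually[OF IJ] eventually_finite_subsets_at_top_weakI) auto
  then show "((\<lambda>i. integral {a..b} (g i)) has_sum integral {a..b} (\<lambda>t. \<Sum>\<^sub>\<infinity>i. g i t)) UNIV"
    using J by (simp add: has_sum_def integral_unique)
qed

section \<open>Finite differences\<close>

definition fdiff :: "(int \<Rightarrow> 'a::ab_group_add) \<Rightarrow> int \<Rightarrow> 'a" where
  "fdiff f n = f (n + 1) - f n"

lemma fdiff_pow_Suc: "(fdiff ^^ Suc j) f n = (fdiff ^^ j) f (n + 1) - (fdiff ^^ j) f n"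
  by (simp add: fdiff_def[of "(fdiff ^^ j) f"])

lemma fdiff_pow_shift: "(fdiff ^^ j) (\<lambda>n. f (n + c)) n = (fdiff ^^ j) f (n + c)"
  by (induction j arbitrary: n) (simp_all add: fdiff_def algebra_simps)

lemma fdiff_pow_of_real: "(fdiff ^^ j) (\<lambda>n. complex_of_real (f n)) n = complex_of_real ((fdiff ^^ j) f n)"
  by (induction j arbitrary: n) (simp_all add: fdiff_def)

lemma discrete_laplacian_fdiff: "discrete_laplacian f n = - fdiff (fdiff f) (n - 1)"
  by (simp add: discrete_laplacian_def fdiff_def)

text \<open>The Laplacian is minus a shifted second difference, so bounds for iterated forward
  differences of the heat kernel cover all powers of the Laplacian as well, at the price of a shift
  by \<open>k\<close>.\<close>

lemma fdiff_pow_laplacian: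
  "(fdiff ^^ j) ((discrete_laplacian ^^ k) f) n = (- 1) ^ k * (fdiff ^^ (j + 2 * k)) f (n - int k)"
proof (induction k arbitrary: j n f)
  case (Suc k)
  have "(fdiff ^^ j) (discrete_laplacian g) n = - (fdiff ^^ (j + 2)) g (n - 1)" for j n and g :: "int \<Rightarrow> complex"
  proof (induction j arbitrary: n)
    case 0 then show ?case by (simp add: discrete_laplacian_fdiff numeral_2_eq_2)
  next
    case (Suc j) then show ?case
      unfolding add_Suc fdiff_pow_Suc by (simp only: Suc.IH) (simp add: algebra_simps)
  qed
  from this[of j "(discrete_laplacian ^^ k) f" n]
  have "(fdiff ^^ j) ((discrete_laplacian ^^ Suc k) f) n = - (fdiff ^^ (j + 2)) ((discrete_laplacian ^^ k) f) (n - 1)"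
    by simp
  also have "\<dots> = (- 1) ^ Suc k * (fdiff ^^ (j + 2 + 2 * k)) f (n - 1 - int k)"
    by (simp only: Suc.IH) simp
  also have "n - 1 - int k = n - int (Suc k)" by simp
  also have "j + 2 + 2 * k = j + 2 * Suc k" by simp
  finally show ?case .
qed simp

section \<open>The heat kernel\<close>

lemma sin_ge_quarter:
  assumes "0 \<le> x" "x \<le> pi / 2"
  shows "x / 4 \<le> sin x"
proof (cases "x \<le> pi / 3")
  case True
  have "(\<lambda>x. sin x - x / 4) 0 \<le> (\<lambda>x. sin x - x / 4) x"
  proof (rule DERIV_nonneg_imp_nondecreasing[OF assms(1)])
    fix y assume y: "0 \<le> y" "y \<le> x"
    have "cos (pi / 3) \<le> cos y" using y True by (intro cos_monotone_0_pi_le) auto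
    then have "0 \<le> cos y - 1 / 4" by (simp add: cos_60)
    moreover have "DERIV (\<lambda>x. sin x - x / 4) y :> cos y - 1 / 4"
      by (auto intro!: derivative_eq_intros)
    ultimately show "\<exists>z. DERIV (\<lambda>x. sin x - x / 4) y :> z \<and> 0 \<le> z" by blast
  qed
  then show ?thesis by simp
next
  case False
  have "sin (pi / 6) \<le> sin x" using False assms by (intro sin_monotone_2pi_le) auto
  then have "1 / 2 \<le> sin x" by (simp add: sin_30)
  moreover have "x / 4 \<le> 1 / 2" using assms pi_less_4 by simp
  ultimately show ?thesis by simp
qed

text \<open>\<open>1 - cos \<theta>\<close> is twice the squared sine of the half angle, and
  \<open>sin x\<close> is at least \<open>x / 4\<close>. On a half period the symbol therefore lies
  below a Gaussian in \<open>\<theta>\<close>.\<close>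

lemma cos_gap:
  assumes "0 \<le> \<theta>" "\<theta> \<le> pi"
  shows "\<theta>\<^sup>2 / 16 \<le> 2 * (1 - cos \<theta>)"
proof -
  have "cos \<theta> = cos (2 * (\<theta> / 2))" by simp
  then have "2 * (1 - cos \<theta>) = 4 * (sin (\<theta> / 2))\<^sup>2"
    by (simp only: cos_double_sin) simp
  moreover have "(\<theta> / 2 / 4)\<^sup>2 \<le> (sin (\<theta> / 2))\<^sup>2"
    using sin_ge_quarter[of "\<theta> / 2"] assms by (intro power_mono) auto
  ultimately show ?thesis by (simp add: power2_eq_square)
qed

lemma norm_cis_diff_one: "norm (cis \<theta> - 1) \<le> \<bar>\<theta>\<bar>"
proof -
  have "norm (cis \<theta> - 1) = 2 * \<bar>sin (\<theta> / 2)\<bar>"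
    using dist_exp_i_1[of \<theta>] by (simp add: dist_norm cis_conv_exp)
  also have "\<dots> \<le> 2 * \<bar>\<theta> / 2\<bar>" using abs_sin_x_le_abs_x[of "\<theta>/2"] by linarith
  finally show ?thesis by simp
qed

lemma power_le_fact_exp: "0 \<le> y \<Longrightarrow> y ^ n \<le> fact n * exp (y::real)"
proof (induction n arbitrary: y)
  case (Suc n)
  have "(\<lambda>y. fact (Suc n) * exp y - y ^ Suc n) 0 \<le> (\<lambda>y. fact (Suc n) * exp y - y ^ Suc n) y"
  proof (rule DERIV_nonneg_imp_nondecreasing[OF Suc.prems])
    fix x :: real assume x: "0 \<le> x" "x \<le> y"
    have "real (Suc n) * x ^ n \<le> real (Suc n) * (fact n * exp x)"
      using Suc.IH[OF x(1)] by (intro mult_left_mono) auto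
    then have "0 \<le> fact (Suc n) * exp x - real (Suc n) * x ^ n" by (simp add: algebra_simps)
    moreover have "DERIV (\<lambda>y. fact (Suc n) * exp y - y ^ Suc n) x :> fact (Suc n) * exp x - real (Suc n) * x ^ n"
      by (rule derivative_eq_intros refl | simp)+
    ultimately show "\<exists>z. DERIV (\<lambda>y. fact (Suc n) * exp y - y ^ Suc n) x :> z \<and> 0 \<le> z" by blast
  qed
  then have "fact (Suc n) \<le> fact (Suc n) * exp y - y ^ Suc n" by simp
  then show ?case using fact_ge_zero[of "Suc n", where 'a=real] by linarith
qed simp

text \<open>The majorant \<open>1 / (1 + u^2)\<close> is chosen because its primitive is an
  arctangent, bounded uniformly under rescaling. Powers are absorbed by
  \<open>y ^ n <= fact n * exp y\<close> at \<open>y = (1 + u^2) / 16\<close>, hence the factor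
  \<open>exp (1 / 16)\<close>.\<close>

lemma gauss_moment_bound:
  "\<exists>C>0. \<forall>u\<ge>0. u ^ j * exp (- u\<^sup>2 / 16) \<le> C / (1 + u\<^sup>2::real)"
proof (intro exI conjI allI impI)
  let ?C = "16 ^ Suc j * fact (Suc j) * exp (1 / 16) :: real"
  show "?C > 0" by simp
  fix u :: real assume u: "0 \<le> u"
  have "u \<le> 1 + u\<^sup>2"
  proof (cases "u \<le> 1")
    case True then show ?thesis by (smt (verit) zero_le_power2)
  next
    case False then show ?thesis using self_le_power[of u 2] by simp
  qed
  then have "u ^ j \<le> (1 + u\<^sup>2) ^ j" using u by (intro power_mono) auto
  then have "u ^ j * (1 + u\<^sup>2) \<le> (1 + u\<^sup>2) ^ Suc j" 
    by (simp only: power_Suc2) (simp add: mult_right_mono)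
  also have "\<dots> = 16 ^ Suc j * ((1 + u\<^sup>2) / 16) ^ Suc j" by (simp add: power_divide)
  also have "\<dots> \<le> 16 ^ Suc j * (fact (Suc j) * exp ((1 + u\<^sup>2) / 16))"
    by (intro mult_left_mono power_le_fact_exp) auto
  also have "\<dots> = ?C * exp (u\<^sup>2 / 16)" by (simp add: add_divide_distrib exp_add)
  finally have "u ^ j * (1 + u\<^sup>2) * exp (- u\<^sup>2 / 16) \<le> ?C * exp (u\<^sup>2 / 16) * exp (- u\<^sup>2 / 16)"
    by (intro mult_right_mono) auto
  also have "\<dots> = ?C" by (simp add: exp_minus)
  finally show "u ^ j * exp (- u\<^sup>2 / 16) \<le> ?C / (1 + u\<^sup>2)"
    by (simp add: pos_le_divide_eq mult_ac add_pos_nonneg)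
qed

text \<open>The cosine is replaced by \<open>cis\<close>, for which a difference in \<open>n\<close>
  is multiplication by \<open>cis \<theta> - 1\<close>; \<open>j\<close> counts these factors. Only
  a half period is integrated, so the kernel is recovered as a real part.\<close>

definition heat_mode :: "nat \<Rightarrow> real \<Rightarrow> int \<Rightarrow> complex" where
  "heat_mode j s n = integral {0..pi} (\<lambda>\<theta>. exp (- 2 * s * (1 - cos \<theta>)) *\<^sub>R ((cis \<theta> - 1) ^ j * cis (of_int n * \<theta>)))"

lemma heat_mode_integrable:
  "(\<lambda>\<theta>. exp (- 2 * s * (1 - cos \<theta>)) *\<^sub>R ((cis \<theta> - 1) ^ j * cis (of_int n * \<theta>))) integrable_on {0..pi}"
  by (intro integrable_continuous_real continuous_intros)

lemma fdiff_heat_mode: "fdiff (heat_mode j s) n = heat_mode (Suc j) s n"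
proof -
  have "exp (- 2 * s * (1 - cos \<theta>)) *\<^sub>R ((cis \<theta> - 1) ^ j * cis (of_int (n + 1) * \<theta>)) -
      exp (- 2 * s * (1 - cos \<theta>)) *\<^sub>R ((cis \<theta> - 1) ^ j * cis (of_int n * \<theta>)) =
      exp (- 2 * s * (1 - cos \<theta>)) *\<^sub>R ((cis \<theta> - 1) ^ Suc j * cis (of_int n * \<theta>))" for \<theta>
    by (simp add: ring_distribs cis_mult[symmetric] flip: scaleR_diff_right)
  then show ?thesis
    unfolding fdiff_def heat_mode_def by (subst integral_diff[symmetric]) (simp_all only: heat_mode_integrable)
qed

lemma heat_kernel_heat_mode: "heat_kernel s n = Re (heat_mode 0 s n) / pi"
proof -
  have "Re (heat_mode 0 s n) = integral {0..pi} (Re \<circ> (\<lambda>\<theta>. exp (- 2 * s * (1 - cos \<theta>)) *\<^sub>R ((cis \<theta> - 1) ^ 0 * cis (of_int n * \<theta>))))"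
    unfolding heat_mode_def by (intro integral_linear[symmetric] heat_mode_integrable bounded_linear_Re)
  then show ?thesis by (simp add: heat_kernel_def o_def)
qed

lemma fdiff_pow_heat_kernel: "(fdiff ^^ j) (heat_kernel s) n = Re (heat_mode j s n) / pi"
proof (induction j arbitrary: n)
  case (Suc j)
  have "(fdiff ^^ Suc j) (heat_kernel s) n = (Re (heat_mode j s (n + 1)) - Re (heat_mode j s n)) / pi"
    unfolding fdiff_pow_Suc by (simp only: Suc.IH diff_divide_distrib)
  also have "\<dots> = Re (heat_mode (Suc j) s n) / pi"
    by (simp flip: fdiff_heat_mode add: fdiff_def)
  finally show ?case .
qed (simp add: heat_kernel_heat_mode)

text \<open>Rescale by \<open>\<rho> = sqrt (1 + s)\<close>: every difference contributes a factor
  of size at most \<open>\<theta>\<close>, hence one \<open>1 / \<rho>\<close>, and the measure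
  contributes one more, which explains \<open>Suc j\<close>. Taking \<open>1 + s\<close> instead of
  \<open>s\<close> keeps the bound meaningful down to \<open>s = 0\<close>.\<close>

lemma fdiff_pow_heat_kernel_bound:
  "\<exists>C>0. \<forall>s\<ge>0. \<forall>n. \<bar>(fdiff ^^ j) (heat_kernel s) n\<bar> * sqrt (1 + s) ^ Suc j \<le> C"
proof -
  obtain C where C: "C > 0" "\<And>u::real. u \<ge> 0 \<Longrightarrow> u ^ j * exp (- u\<^sup>2 / 16) \<le> C / (1 + u\<^sup>2)"
    using gauss_moment_bound[of j] by auto
  show ?thesis
  proof (intro exI conjI allI impI)
    let ?K = "exp 1 * C * (pi / 2) / pi"
    show "?K > 0" using C(1) by simp
    fix s :: real and n assume s: "0 \<le> s"
    define \<rho> where "\<rho> = sqrt (1 + s)"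
    have \<rho>: "\<rho> > 0" "\<rho>\<^sup>2 = 1 + s" using s by (auto simp: \<rho>_def)
    have bd: "norm (exp (- 2 * s * (1 - cos \<theta>)) *\<^sub>R ((cis \<theta> - 1) ^ j * cis (of_int n * \<theta>)))
        \<le> exp 1 * C / \<rho> ^ j * (1 / (1 + (\<rho> * \<theta>)\<^sup>2))" if \<theta>: "\<theta> \<in> {0..pi}" for \<theta>
    proof -
      have "s * (\<theta>\<^sup>2 / 16) \<le> s * (2 * (1 - cos \<theta>))"
        using cos_gap[of \<theta>] \<theta> s by (intro mult_left_mono) auto
      \<comment> \<open>Replacing \<open>s\<close> by \<open>1 + s\<close> in the Gaussian exponent
        costs \<open>\<theta>^2 / 16\<close>, at most 1 because \<open>pi < 4\<close>; the factor
        \<open>exp 1\<close> pays for it.\<close>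
      moreover have "\<theta>\<^sup>2 \<le> 4\<^sup>2" using \<theta> pi_less_4 by (intro power_mono) auto
      ultimately have "- 2 * s * (1 - cos \<theta>) \<le> 1 - (\<rho> * \<theta>)\<^sup>2 / 16"
        by (simp add: power_mult_distrib \<rho> algebra_simps add_divide_distrib)
      then have "exp (- 2 * s * (1 - cos \<theta>)) \<le> exp (1 + - (\<rho> * \<theta>)\<^sup>2 / 16)" by simp
      also have "\<dots> = exp 1 * exp (- (\<rho> * \<theta>)\<^sup>2 / 16)" by (simp only: exp_add)
      finally have 1: "exp (- 2 * s * (1 - cos \<theta>)) \<le> exp 1 * exp (- (\<rho> * \<theta>)\<^sup>2 / 16)" .
      have 2: "norm ((cis \<theta> - 1) ^ j) \<le> \<theta> ^ j"
        using norm_cis_diff_one[of \<theta>] \<theta> by (simp add: norm_power power_mono)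
      have "norm (exp (- 2 * s * (1 - cos \<theta>)) *\<^sub>R ((cis \<theta> - 1) ^ j * cis (of_int n * \<theta>)))
         = exp (- 2 * s * (1 - cos \<theta>)) * norm ((cis \<theta> - 1) ^ j)" by (simp add: norm_mult)
      also have "\<dots> \<le> exp 1 * exp (- (\<rho> * \<theta>)\<^sup>2 / 16) * \<theta> ^ j"
        using 1 2 by (intro mult_mono) auto
      also have "\<dots> = exp 1 / \<rho> ^ j * ((\<rho> * \<theta>) ^ j * exp (- (\<rho> * \<theta>)\<^sup>2 / 16))"
        using \<rho> by (simp add: power_mult_distrib field_simps)
      also have "\<dots> \<le> exp 1 / \<rho> ^ j * (C / (1 + (\<rho> * \<theta>)\<^sup>2))"
        using \<rho> \<theta> by (intro mult_left_mono C(2)) auto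
      finally show ?thesis by simp
    qed
    have int: "((\<lambda>\<theta>. 1 / (1 + (\<rho> * \<theta>)\<^sup>2)) has_integral (arctan (\<rho> * pi) / \<rho> - arctan (\<rho> * 0) / \<rho>)) {0..pi}"
    proof (rule fundamental_theorem_of_calculus)
      fix x assume "x \<in> {0..pi}"
      have "((\<lambda>x. \<rho> * x) has_real_derivative \<rho>) (at x within {0..pi})"
        by (auto intro!: derivative_eq_intros)
      from DERIV_cdivide[OF DERIV_chain2[OF DERIV_arctan this], of \<rho>]
      have "((\<lambda>x. arctan (\<rho> * x) / \<rho>) has_real_derivative inverse (1 + (\<rho> * x)\<^sup>2) * \<rho> / \<rho>) (at x within {0..pi})" .
      moreover have "inverse (1 + (\<rho> * x)\<^sup>2) * \<rho> / \<rho> = 1 / (1 + (\<rho> * x)\<^sup>2)"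
        using \<rho>(1) by (simp add: divide_inverse)
      ultimately have "((\<lambda>x. arctan (\<rho> * x) / \<rho>) has_real_derivative 1 / (1 + (\<rho> * x)\<^sup>2)) (at x within {0..pi})"
        by simp
      then show "((\<lambda>x. arctan (\<rho> * x) / \<rho>) has_vector_derivative 1 / (1 + (\<rho> * x)\<^sup>2)) (at x within {0..pi})"
        by (simp add: has_real_derivative_iff_has_vector_derivative)
    qed simp
    have "norm (heat_mode j s n) \<le> exp 1 * C / \<rho> ^ j * (arctan (\<rho> * pi) / \<rho>)"
      unfolding heat_mode_def
    proof (rule order_trans[OF integral_norm_bound_integral])
      show "(\<lambda>\<theta>. exp 1 * C / \<rho> ^ j * (1 / (1 + (\<rho> * \<theta>)\<^sup>2))) integrable_on {0..pi}"
        using int by (intro integrable_on_mult_right) auto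
      show "integral {0..pi} (\<lambda>\<theta>. exp 1 * C / \<rho> ^ j * (1 / (1 + (\<rho> * \<theta>)\<^sup>2)))
          \<le> exp 1 * C / \<rho> ^ j * (arctan (\<rho> * pi) / \<rho>)"
        using integral_unique[OF int] by (simp only: integral_mult_right) simp
    qed (use heat_mode_integrable bd in auto)
    also have "\<dots> \<le> exp 1 * C / \<rho> ^ j * ((pi / 2) / \<rho>)"
      using \<rho> C arctan_ubound[of "\<rho> * pi"] by (intro mult_left_mono divide_right_mono) auto
    finally have "norm (heat_mode j s n) * \<rho> ^ Suc j \<le> exp 1 * C * (pi / 2)"
      using \<rho> by (simp add: field_simps)
    moreover have "\<bar>Re (heat_mode j s n)\<bar> \<le> norm (heat_mode j s n)" by (rule abs_Re_le_cmod)
    ultimately have "\<bar>Re (heat_mode j s n)\<bar> * \<rho> ^ Suc j \<le> exp 1 * C * (pi / 2)"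
      using \<rho> by (meson mult_right_mono order_trans zero_le_power less_imp_le)
    then show "\<bar>(fdiff ^^ j) (heat_kernel s) n\<bar> * sqrt (1 + s) ^ Suc j \<le> ?K"
      by (simp add: fdiff_pow_heat_kernel \<rho>_def[symmetric] pos_divide_le_eq mult_ac)
  qed
qed

section \<open>Recurrence in space, derivative in time and spatial decay of the kernel\<close>

lemma heat_kernel_integrable:
  "(\<lambda>\<theta>. exp (- 2 * s * (1 - cos \<theta>)) * cos (of_int n * \<theta>)) integrable_on {0..pi}"
  by (intro integrable_continuous_real continuous_intros)

lemma heat_kernel_minus: "heat_kernel s (- n) = heat_kernel s n"
  by (simp add: heat_kernel_def)

text \<open>Integration by parts in \<open>\<theta>\<close>: the integrand is the derivative of the
  exponential times \<open>sin (n * \<theta>)\<close>, which vanishes at both ends. This is the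
  recurrence of the modified Bessel functions, since the kernel is
  \<open>exp (- 2 * s) * I_n (2 * s)\<close>. Trading a factor \<open>n\<close> for \<open>s\<close>
  times a difference is the source of all spatial decay.\<close>

lemma heat_kernel_recurrence:
  "of_int n * heat_kernel s n = s * (heat_kernel s (n - 1) - heat_kernel s (n + 1))"
proof -
  let ?e = "\<lambda>\<theta>. exp (- 2 * s * (1 - cos \<theta>))"
  have "((\<lambda>\<theta>. of_int n * (?e \<theta> * cos (of_int n * \<theta>)) -
       s * (?e \<theta> * cos (of_int (n - 1) * \<theta>) - ?e \<theta> * cos (of_int (n + 1) * \<theta>))) has_integral
     (?e pi * sin (of_int n * pi) - ?e 0 * sin (of_int n * 0))) {0..pi}"
  proof (rule fundamental_theorem_of_calculus)
    fix x assume "x \<in> {0..pi}"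
    have "cos (of_int (n - 1) * x) - cos (of_int (n + 1) * x) = 2 * sin x * sin (of_int n * x)"
      by (simp add: ring_distribs cos_add cos_diff)
    then have e: "of_int n * (?e x * cos (of_int n * x)) - s * (?e x * cos (of_int (n - 1) * x) - ?e x * cos (of_int (n + 1) * x))
       = of_int n * (?e x * cos (of_int n * x)) - s * (?e x * (2 * sin x * sin (of_int n * x)))"
      by (metis right_diff_distrib)
    have "((\<lambda>x. ?e x * sin (of_int n * x)) has_real_derivative
        of_int n * (?e x * cos (of_int n * x)) - s * (?e x * (2 * sin x * sin (of_int n * x)))) (at x within {0..pi})"
      by (auto intro!: derivative_eq_intros simp: algebra_simps)
    then show "((\<lambda>x. ?e x * sin (of_int n * x)) has_vector_derivative
        of_int n * (?e x * cos (of_int n * x)) - s * (?e x * cos (of_int (n - 1) * x) - ?e x * cos (of_int (n + 1) * x))) (at x within {0..pi})"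
      unfolding e by (simp add: has_real_derivative_iff_has_vector_derivative)
  qed simp
  moreover have "sin (of_int n * pi) = 0" by (metis sin_npi_int mult.commute)
  moreover note I = integrable_integral[OF heat_kernel_integrable[of s]]
  have "((\<lambda>\<theta>. of_int n * (?e \<theta> * cos (of_int n * \<theta>)) -
       s * (?e \<theta> * cos (of_int (n - 1) * \<theta>) - ?e \<theta> * cos (of_int (n + 1) * \<theta>))) has_integral
      of_int n * integral {0..pi} (\<lambda>\<theta>. ?e \<theta> * cos (of_int n * \<theta>)) -
        s * (integral {0..pi} (\<lambda>\<theta>. ?e \<theta> * cos (of_int (n - 1) * \<theta>)) - integral {0..pi} (\<lambda>\<theta>. ?e \<theta> * cos (of_int (n + 1) * \<theta>)))) {0..pi}"
    by (intro has_integral_diff has_integral_mult_right I)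
  ultimately have "of_int n * integral {0..pi} (\<lambda>\<theta>. ?e \<theta> * cos (of_int n * \<theta>)) -
        s * (integral {0..pi} (\<lambda>\<theta>. ?e \<theta> * cos (of_int (n - 1) * \<theta>)) - integral {0..pi} (\<lambda>\<theta>. ?e \<theta> * cos (of_int (n + 1) * \<theta>))) = 0"
    by (metis (no_types, lifting) has_integral_unique diff_zero mult_zero_left mult_zero_right sin_zero)
  then show ?thesis by (simp add: heat_kernel_def field_simps)
qed

lemma heat_kernel_0: "heat_kernel 0 n = (if n = 0 then 1 else 0)"
  using heat_kernel_recurrence[of n 0] by (auto simp: heat_kernel_def)

lemma heat_kernel_has_derivative:
  "((\<lambda>s. heat_kernel s n) has_real_derivative
      heat_kernel s (n + 1) + heat_kernel s (n - 1) - 2 * heat_kernel s n) (at s)"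
proof -
  let ?e = "\<lambda>s \<theta>. exp (- 2 * s * (1 - cos \<theta>))"
  have d: "((\<lambda>s. integral (cbox 0 pi) (\<lambda>\<theta>. ?e s \<theta> * cos (of_int n * \<theta>))) has_field_derivative
      integral (cbox 0 pi) (\<lambda>\<theta>. - 2 * (1 - cos \<theta>) * (?e s \<theta> * cos (of_int n * \<theta>)))) (at s within UNIV)"
  proof (rule leibniz_rule_field_derivative)
    show "((\<lambda>s. ?e s \<theta> * cos (of_int n * \<theta>)) has_field_derivative - 2 * (1 - cos \<theta>) * (?e s \<theta> * cos (of_int n * \<theta>))) (at s within UNIV)" for s \<theta>
      by (auto intro!: derivative_eq_intros)
    show "continuous_on (UNIV \<times> cbox 0 pi) (\<lambda>(s, \<theta>). - 2 * (1 - cos \<theta>) * (?e s \<theta> * cos (of_int n * \<theta>)))"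
      by (auto simp: case_prod_unfold intro!: continuous_intros)
  qed (use heat_kernel_integrable in auto)
  have "- 2 * (1 - cos \<theta>) * (?e s \<theta> * cos (of_int n * \<theta>)) =
     ?e s \<theta> * cos (of_int (n + 1) * \<theta>) + ?e s \<theta> * cos (of_int (n - 1) * \<theta>) - 2 * (?e s \<theta> * cos (of_int n * \<theta>))" for \<theta>
    by (simp add: ring_distribs cos_add cos_diff)
  moreover note I = integrable_integral[OF heat_kernel_integrable[of s]]
  have "((\<lambda>\<theta>. ?e s \<theta> * cos (of_int (n + 1) * \<theta>) + ?e s \<theta> * cos (of_int (n - 1) * \<theta>) - 2 * (?e s \<theta> * cos (of_int n * \<theta>)))
    has_integral integral {0..pi} (\<lambda>\<theta>. ?e s \<theta> * cos (of_int (n + 1) * \<theta>)) + integral {0..pi} (\<lambda>\<theta>. ?e s \<theta> * cos (of_int (n - 1) * \<theta>))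
      - 2 * integral {0..pi} (\<lambda>\<theta>. ?e s \<theta> * cos (of_int n * \<theta>))) {0..pi}"
    by (intro has_integral_diff has_integral_add has_integral_mult_right I)
  ultimately have "integral {0..pi} (\<lambda>\<theta>. - 2 * (1 - cos \<theta>) * (?e s \<theta> * cos (of_int n * \<theta>))) =
    integral {0..pi} (\<lambda>\<theta>. ?e s \<theta> * cos (of_int (n + 1) * \<theta>)) + integral {0..pi} (\<lambda>\<theta>. ?e s \<theta> * cos (of_int (n - 1) * \<theta>))
      - 2 * integral {0..pi} (\<lambda>\<theta>. ?e s \<theta> * cos (of_int n * \<theta>))"
    by (simp only: integral_unique)
  then have "((\<lambda>s. integral {0..pi} (\<lambda>\<theta>. ?e s \<theta> * cos (of_int n * \<theta>))) has_field_derivative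
      integral {0..pi} (\<lambda>\<theta>. ?e s \<theta> * cos (of_int (n + 1) * \<theta>)) + integral {0..pi} (\<lambda>\<theta>. ?e s \<theta> * cos (of_int (n - 1) * \<theta>))
      - 2 * integral {0..pi} (\<lambda>\<theta>. ?e s \<theta> * cos (of_int n * \<theta>))) (at s)"
    using d by simp
  then have "((\<lambda>s. 1 / pi * integral {0..pi} (\<lambda>\<theta>. ?e s \<theta> * cos (of_int n * \<theta>))) has_field_derivative
      1 / pi * (integral {0..pi} (\<lambda>\<theta>. ?e s \<theta> * cos (of_int (n + 1) * \<theta>)) + integral {0..pi} (\<lambda>\<theta>. ?e s \<theta> * cos (of_int (n - 1) * \<theta>))
      - 2 * integral {0..pi} (\<lambda>\<theta>. ?e s \<theta> * cos (of_int n * \<theta>)))) (at s)"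
    by (rule DERIV_cmult)
  then show ?thesis by (simp add: heat_kernel_def algebra_simps)
qed

lemma has_sum_minus:
  fixes f g :: "'i \<Rightarrow> 'a::real_normed_vector"
  assumes "(f has_sum a) A" "(g has_sum b) A"
  shows "((\<lambda>x. f x - g x) has_sum (a - b)) A"
  using has_sum_add[OF assms(1), of "\<lambda>x. - g x" "- b"] assms(2) by (simp add: has_sum_uminus)

lemma has_sum_neg:
  fixes f :: "'i \<Rightarrow> 'a::real_normed_vector"
  shows "(f has_sum a) A \<Longrightarrow> ((\<lambda>x. - f x) has_sum - a) A"
  by (simp add: has_sum_uminus)

lemma fdiff_mult_id:
  fixes f :: "int \<Rightarrow> real"
  shows "(fdiff ^^ j) (\<lambda>n. of_int n * f n) n = of_int n * (fdiff ^^ j) f n + of_nat j * (fdiff ^^ (j - 1)) f (n + 1)"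
proof (induction j arbitrary: n)
  case (Suc j)
  show ?case
  proof (cases j)
    case 0 then show ?thesis by (simp add: fdiff_def algebra_simps)
  next
    case (Suc i)
    then show ?thesis
      unfolding fdiff_pow_Suc[of j] Suc.IH
      by (simp add: fdiff_def[of "(fdiff ^^ i) f"] algebra_simps)
  qed
qed simp

text \<open>Discrete Leibniz rule applied to the recurrence. The central difference is split into
  two forward ones, so that orders \<open>j - 1\<close> and \<open>Suc j\<close> appear with the
  powers of \<open>sqrt (1 + s)\<close> that scaling predicts. For \<open>j = 0\<close> the
  truncated \<open>j - 1\<close> meets the coefficient zero.\<close>

lemma fdiff_pow_heat_kernel_recurrence:
  "of_int n * (fdiff ^^ j) (heat_kernel s) n =
    - of_nat j * (fdiff ^^ (j - 1)) (heat_kernel s) (n + 1)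
    - s * ((fdiff ^^ Suc j) (heat_kernel s) n + (fdiff ^^ Suc j) (heat_kernel s) (n - 1))"
proof -
  let ?h = "heat_kernel s"
  have e: "(fdiff ^^ j) (\<lambda>n. s * (?h (n - 1) - ?h (n + 1))) n = s * ((fdiff ^^ j) ?h (n - 1) - (fdiff ^^ j) ?h (n + 1))" for n
  proof (induction j arbitrary: n)
    case (Suc j) then show ?case unfolding fdiff_pow_Suc by (simp only: Suc.IH) (simp add: algebra_simps)
  qed simp
  have "(fdiff ^^ j) (\<lambda>n. of_int n * ?h n) n = (fdiff ^^ j) (\<lambda>n. s * (?h (n - 1) - ?h (n + 1))) n"
    by (simp only: heat_kernel_recurrence)
  also note e
  finally show ?thesis unfolding fdiff_mult_id fdiff_pow_Suc by (simp add: algebra_simps)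
qed

text \<open>The induction step of the decay estimate, separated from the kernel. With
  \<open>\<rho> = sqrt (1 + s)\<close> the lower-order term is one \<open>\<rho>\<close> too large,
  and \<open>s <= \<rho>^2\<close> makes the higher-order term one \<open>\<rho>\<close> too large
  as well: a further power of the weight costs one factor \<open>\<rho>\<close>. The factors
  \<open>2 ^ r\<close> pay for moving the weight by one site.\<close>

lemma weighted_step:
  fixes s n' :: real and n :: int
  assumes s: "0 \<le> s"
    and 0: "\<And>n. (1 + \<bar>real_of_int n\<bar>) ^ r * \<bar>u0 n\<bar> * sqrt (1 + s) ^ Suc j \<le> C0 * sqrt (1 + s) ^ r"
    and 1: "\<And>n. (1 + \<bar>real_of_int n\<bar>) ^ r * \<bar>u1 n\<bar> * sqrt (1 + s) ^ j \<le> C1 * sqrt (1 + s) ^ r"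
    and 2: "\<And>n. (1 + \<bar>real_of_int n\<bar>) ^ r * \<bar>u2 n\<bar> * sqrt (1 + s) ^ Suc (Suc j) \<le> C2 * sqrt (1 + s) ^ r"
    and C: "C0 \<ge> 0" "C1 \<ge> 0" "C2 \<ge> 0"
    and eq: "of_int n * u0 n = - k * u1 (n + 1) - s * (u2 n + u2 (n - 1))" and k: "k \<ge> 0"
  shows "(1 + \<bar>real_of_int n\<bar>) ^ Suc r * \<bar>u0 n\<bar> * sqrt (1 + s) ^ Suc j
    \<le> (C0 + k * (2 ^ r * C1) + C2 + 2 ^ r * C2) * sqrt (1 + s) ^ Suc r"
proof -
  define \<rho> where "\<rho> = sqrt (1 + s)"
  have \<rho>: "1 \<le> \<rho>" "0 \<le> \<rho>" "s \<le> \<rho> * \<rho>" using s by (auto simp: \<rho>_def)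
  define w where "w = (\<lambda>n::int. 1 + \<bar>real_of_int n\<bar>)"
  have w: "w n > 0" "w n \<le> 2 * w (n + 1)" "w n \<le> 2 * w (n - 1)" for n
    by (auto simp: w_def abs_if)
  have w2: "w n ^ r \<le> 2 ^ r * w (n + 1) ^ r" "w n ^ r \<le> 2 ^ r * w (n - 1) ^ r"
    using power_mono[OF w(2)[of n], of r] power_mono[OF w(3)[of n], of r] w(1)[of n]
    by (auto simp: power_mult_distrib)
  have "w n * \<bar>u0 n\<bar> = \<bar>u0 n\<bar> + \<bar>of_int n * u0 n\<bar>" by (simp add: w_def abs_mult ring_distribs)
  also have "\<bar>of_int n * u0 n\<bar> \<le> k * \<bar>u1 (n + 1)\<bar> + s * (\<bar>u2 n\<bar> + \<bar>u2 (n - 1)\<bar>)"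
  proof -
    have "\<bar>of_int n * u0 n\<bar> \<le> \<bar>k * u1 (n + 1)\<bar> + \<bar>s * (u2 n + u2 (n - 1))\<bar>" unfolding eq by linarith
    also have "\<bar>k * u1 (n + 1)\<bar> = k * \<bar>u1 (n + 1)\<bar>" using k by (simp add: abs_mult)
    also have "\<bar>s * (u2 n + u2 (n - 1))\<bar> \<le> s * (\<bar>u2 n\<bar> + \<bar>u2 (n - 1)\<bar>)"
      using s by (simp add: abs_mult mult_left_mono abs_triangle_ineq)
    finally show ?thesis by simp
  qed
  finally have "w n ^ r * (w n * \<bar>u0 n\<bar>) * \<rho> ^ Suc j \<le>
      w n ^ r * (\<bar>u0 n\<bar> + (k * \<bar>u1 (n + 1)\<bar> + s * (\<bar>u2 n\<bar> + \<bar>u2 (n - 1)\<bar>))) * \<rho> ^ Suc j"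
    using w(1)[of n] \<rho> by (intro mult_right_mono mult_left_mono) auto
  also have "\<dots> = w n ^ r * \<bar>u0 n\<bar> * \<rho> ^ Suc j + k * ((w n ^ r * \<bar>u1 (n + 1)\<bar> * \<rho> ^ j) * \<rho>)
     + s * (w n ^ r * \<bar>u2 n\<bar> * \<rho> ^ Suc j) + s * (w n ^ r * \<bar>u2 (n - 1)\<bar> * \<rho> ^ Suc j)"
    by (simp add: algebra_simps)
  also have "\<dots> \<le> C0 * \<rho> ^ Suc r + k * ((2 ^ r * C1 * \<rho> ^ r) * \<rho>) + C2 * \<rho> ^ Suc r + 2 ^ r * C2 * \<rho> ^ Suc r"
  proof (intro add_mono mult_left_mono mult_right_mono k \<rho>)
    have "w n ^ r * \<bar>u0 n\<bar> * \<rho> ^ Suc j \<le> C0 * \<rho> ^ r" using 0[of n] by (simp add: w_def \<rho>_def)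
    also have "\<dots> \<le> C0 * \<rho> ^ Suc r" using \<rho> C by (intro mult_left_mono power_increasing) auto
    finally show "w n ^ r * \<bar>u0 n\<bar> * \<rho> ^ Suc j \<le> C0 * \<rho> ^ Suc r" .
    have "w n ^ r * \<bar>u1 (n + 1)\<bar> * \<rho> ^ j \<le> 2 ^ r * w (n + 1) ^ r * \<bar>u1 (n + 1)\<bar> * \<rho> ^ j"
      using w2 \<rho> by (intro mult_right_mono) auto
    also have "\<dots> \<le> 2 ^ r * (C1 * \<rho> ^ r)"
      using 1[of "n + 1"] by (simp add: w_def \<rho>_def mult.assoc)
    finally show "w n ^ r * \<bar>u1 (n + 1)\<bar> * \<rho> ^ j \<le> 2 ^ r * C1 * \<rho> ^ r" by simp
    have "s * (w n ^ r * \<bar>u2 n\<bar> * \<rho> ^ Suc j) \<le> (\<rho> * \<rho>) * (w n ^ r * \<bar>u2 n\<bar> * \<rho> ^ Suc j)" for n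
      using w(1)[of n] \<rho> by (intro mult_right_mono) auto
    moreover have "(\<rho> * \<rho>) * (w n ^ r * \<bar>u2 n\<bar> * \<rho> ^ Suc j) \<le> \<rho> * (C2 * \<rho> ^ r)" for n
    proof -
      have "(\<rho> * \<rho>) * (w n ^ r * \<bar>u2 n\<bar> * \<rho> ^ Suc j) = \<rho> * (w n ^ r * \<bar>u2 n\<bar> * \<rho> ^ Suc (Suc j))"
        by (simp add: algebra_simps)
      also have "\<dots> \<le> \<rho> * (C2 * \<rho> ^ r)"
        using 2[of n] \<rho> by (intro mult_left_mono) (auto simp: w_def \<rho>_def)
      finally show ?thesis .
    qed
    ultimately have s2: "s * (w n ^ r * \<bar>u2 n\<bar> * \<rho> ^ Suc j) \<le> C2 * \<rho> ^ Suc r" for n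
      by (smt (verit) mult.left_commute power_Suc)
    show "s * (w n ^ r * \<bar>u2 n\<bar> * \<rho> ^ Suc j) \<le> C2 * \<rho> ^ Suc r" by (rule s2)
    have "s * (w n ^ r * \<bar>u2 (n - 1)\<bar> * \<rho> ^ Suc j) \<le> s * ((2 ^ r * w (n - 1) ^ r) * \<bar>u2 (n - 1)\<bar> * \<rho> ^ Suc j)"
      using w2 \<rho> s by (intro mult_left_mono mult_right_mono) auto
    also have "\<dots> = 2 ^ r * (s * (w (n - 1) ^ r * \<bar>u2 (n - 1)\<bar> * \<rho> ^ Suc j))" by simp
    also have "\<dots> \<le> 2 ^ r * (C2 * \<rho> ^ Suc r)" by (intro mult_left_mono s2) auto
    finally show "s * (w n ^ r * \<bar>u2 (n - 1)\<bar> * \<rho> ^ Suc j) \<le> 2 ^ r * C2 * \<rho> ^ Suc r" by simp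
  qed
  also have "\<dots> = (C0 + k * (2 ^ r * C1) + C2 + 2 ^ r * C2) * \<rho> ^ Suc r" by (simp add: algebra_simps)
  finally show ?thesis by (simp add: w_def \<rho>_def mult_ac)
qed

text \<open>Relative to the diagonal bound, the kernel decays like any power of
  \<open>sqrt (1 + s) / (1 + |n|)\<close>. Induction on \<open>r\<close>: the step uses orders
  \<open>j - 1\<close>, \<open>j\<close> and \<open>Suc j\<close> at the previous \<open>r\<close>,
  so \<open>j\<close> has to stay arbitrary.\<close>

lemma fdiff_pow_heat_kernel_decay:
  "\<exists>C>0. \<forall>s\<ge>0. \<forall>n. (1 + \<bar>real_of_int n\<bar>) ^ r * \<bar>(fdiff ^^ j) (heat_kernel s) n\<bar> * sqrt (1 + s) ^ Suc j
     \<le> C * sqrt (1 + s) ^ r"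
proof (induction r arbitrary: j)
  case 0 then show ?case using fdiff_pow_heat_kernel_bound[of j] by simp
next
  case (Suc r)
  obtain C0 where C0: "C0 > 0" "\<And>s n. s \<ge> 0 \<Longrightarrow> (1 + \<bar>real_of_int n\<bar>) ^ r * \<bar>(fdiff ^^ j) (heat_kernel s) n\<bar> * sqrt (1 + s) ^ Suc j
     \<le> C0 * sqrt (1 + s) ^ r" using Suc.IH[of j] by auto
  obtain C1 where C1: "C1 > 0" "\<And>s n. s \<ge> 0 \<Longrightarrow> (1 + \<bar>real_of_int n\<bar>) ^ r * \<bar>(fdiff ^^ (j - 1)) (heat_kernel s) n\<bar> * sqrt (1 + s) ^ Suc (j - 1)
     \<le> C1 * sqrt (1 + s) ^ r" using Suc.IH[of "j - 1"] by auto
  obtain C2 where C2: "C2 > 0" "\<And>s n. s \<ge> 0 \<Longrightarrow> (1 + \<bar>real_of_int n\<bar>) ^ r * \<bar>(fdiff ^^ (Suc j)) (heat_kernel s) n\<bar> * sqrt (1 + s) ^ Suc (Suc j)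
     \<le> C2 * sqrt (1 + s) ^ r" using Suc.IH[of "Suc j"] by auto
  have "(1 + \<bar>real_of_int n\<bar>) ^ Suc r * \<bar>(fdiff ^^ j) (heat_kernel s) n\<bar> * sqrt (1 + s) ^ Suc j
    \<le> (C0 + real j * (2 ^ r * C1) + C2 + 2 ^ r * C2) * sqrt (1 + s) ^ Suc r" if s: "s \<ge> 0" for s n
  proof (cases "j = 0")
    case True
    show ?thesis
      by (rule weighted_step[where ?u1.0="\<lambda>_. 0" and ?u2.0="(fdiff ^^ Suc j) (heat_kernel s)"])
        (use True s C0 C1 C2 fdiff_pow_heat_kernel_recurrence[of n j s] in auto)
  next
    case False
    then have j: "Suc (j - 1) = j" by simp
    show ?thesis
      by (rule weighted_step[where ?u1.0="(fdiff ^^ (j - 1)) (heat_kernel s)" and ?u2.0="(fdiff ^^ Suc j) (heat_kernel s)"])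
        (use s C0 C1(1) C1(2)[unfolded j] C2 fdiff_pow_heat_kernel_recurrence[of n j s] in auto)
  qed
  moreover have "C0 + real j * (2 ^ r * C1) + C2 + 2 ^ r * C2 > 0"
    using C0 C1 C2 by (intro add_pos_pos add_pos_nonneg mult_pos_pos) auto
  ultimately show ?case by blast
qed

text \<open>The kernel of \<open>\<Delta>\<^sup>k e\<^sup>-\<^sup>s\<^sup>\<Delta>\<close>.\<close>

definition hk :: "nat \<Rightarrow> real \<Rightarrow> int \<Rightarrow> complex" where
  "hk k s = (discrete_laplacian ^^ k) (\<lambda>n. complex_of_real (heat_kernel s n))"

lemma hk_Suc: "hk (Suc k) s n = - hk k s (n + 1) + 2 * hk k s n - hk k s (n - 1)"
  by (simp add: hk_def discrete_laplacian_def)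

lemma hk_minus: "hk k s (- n) = hk k s n"
proof (induction k arbitrary: n)
  case 0 then show ?case by (simp add: hk_def heat_kernel_minus)
next
  case (Suc k)
  have "- n + 1 = - (n - 1)" "- n - 1 = - (n + 1)" by simp_all
  then show ?case unfolding hk_Suc by (simp only: Suc.IH) simp
qed

lemma hk_cnj: "cnj (hk k s n) = hk k s n"
  by (induction k arbitrary: n) (simp_all add: hk_Suc, simp add: hk_def)

lemma hk_0_0: "hk 0 0 n = (if n = 0 then 1 else 0)"
  by (simp add: hk_def heat_kernel_0)

lemma hk_has_derivative: "((\<lambda>s. hk k s n) has_vector_derivative - hk (Suc k) s n) (at s within A)"
proof (induction k arbitrary: n)
  case 0
  have "((\<lambda>s. complex_of_real (heat_kernel s n)) has_vector_derivative
      complex_of_real (heat_kernel s (n + 1) + heat_kernel s (n - 1) - 2 * heat_kernel s n)) (at s within A)"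
    by (rule has_vector_derivative_of_real)
      (rule has_field_derivative_at_within[OF heat_kernel_has_derivative])
  then show ?case by (simp add: hk_def discrete_laplacian_def algebra_simps)
next
  case (Suc k)
  have "((\<lambda>s. - hk k s (n + 1) + 2 * hk k s n - hk k s (n - 1)) has_vector_derivative
     - (- hk (Suc k) s (n + 1)) + 2 * (- hk (Suc k) s n) - (- hk (Suc k) s (n - 1))) (at s within A)"
    by (intro has_vector_derivative_diff has_vector_derivative_add has_vector_derivative_minus has_vector_derivative_mult_right Suc.IH)
  then show ?case by (simp add: hk_Suc[of k] hk_Suc[of "Suc k"] algebra_simps)
qed

lemma hk_continuous: "continuous_on A (\<lambda>s. hk k s n)"
  by (rule continuous_on_vector_derivative) (rule hk_has_derivative)

lemma fdiff_hk_decay: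
  "\<exists>C>0. \<forall>s\<ge>0. \<forall>n. (1 + \<bar>real_of_int n\<bar>) ^ r * norm ((fdiff ^^ j) (hk k s) n) * sqrt (1 + s) ^ Suc (j + 2 * k)
     \<le> C * sqrt (1 + s) ^ r"
proof -
  obtain C where C: "C > 0" "\<And>s n. s \<ge> 0 \<Longrightarrow> (1 + \<bar>real_of_int n\<bar>) ^ r * \<bar>(fdiff ^^ (j + 2 * k)) (heat_kernel s) n\<bar> * sqrt (1 + s) ^ Suc (j + 2 * k)
     \<le> C * sqrt (1 + s) ^ r" using fdiff_pow_heat_kernel_decay by blast
  have "(1 + \<bar>real_of_int n\<bar>) ^ r * norm ((fdiff ^^ j) (hk k s) n) * sqrt (1 + s) ^ Suc (j + 2 * k)
     \<le> ((1 + real k) ^ r * C) * sqrt (1 + s) ^ r" if s: "s \<ge> 0" for s n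
  proof -
    have "1 + \<bar>real_of_int n\<bar> \<le> 1 + \<bar>real_of_int (n - int k)\<bar> + real k" by simp
    also have "\<dots> \<le> (1 + real k) * (1 + \<bar>real_of_int (n - int k)\<bar>)" by (simp add: ring_distribs)
    finally have w: "(1 + \<bar>real_of_int n\<bar>) ^ r \<le> (1 + real k) ^ r * (1 + \<bar>real_of_int (n - int k)\<bar>) ^ r"
      by (subst power_mult_distrib[symmetric]) (rule power_mono, auto)
    have e: "norm ((fdiff ^^ j) (hk k s) n) = \<bar>(fdiff ^^ (j + 2 * k)) (heat_kernel s) (n - int k)\<bar>"
      by (simp add: hk_def fdiff_pow_laplacian fdiff_pow_of_real norm_mult norm_power)
    have "(1 + \<bar>real_of_int n\<bar>) ^ r * norm ((fdiff ^^ j) (hk k s) n) * sqrt (1 + s) ^ Suc (j + 2 * k)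
       \<le> ((1 + real k) ^ r * (1 + \<bar>real_of_int (n - int k)\<bar>) ^ r) * norm ((fdiff ^^ j) (hk k s) n) * sqrt (1 + s) ^ Suc (j + 2 * k)"
      using w s by (intro mult_right_mono) auto
    also have "\<dots> = (1 + real k) ^ r * ((1 + \<bar>real_of_int (n - int k)\<bar>) ^ r * \<bar>(fdiff ^^ (j + 2 * k)) (heat_kernel s) (n - int k)\<bar> * sqrt (1 + s) ^ Suc (j + 2 * k))"
      unfolding e by (simp only: mult.assoc)
    also have "\<dots> \<le> (1 + real k) ^ r * (C * sqrt (1 + s) ^ r)" by (intro mult_left_mono C s) auto
    finally show ?thesis by simp
  qed
  then show ?thesis using C(1) by (intro exI[of _ "(1 + real k) ^ r * C"]) auto
qed

lemma hk_decay:
  "\<exists>C>0. \<forall>s\<ge>0. \<forall>n. (1 + \<bar>real_of_int n\<bar>) ^ r * norm (hk k s n) * sqrt (1 + s) ^ Suc (2 * k)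
     \<le> C * sqrt (1 + s) ^ r"
  using fdiff_hk_decay[of r 0 k] by simp

lemma hk_decay_compact:
  "\<exists>C>0. \<forall>s\<in>{0..R}. \<forall>n. norm (hk k s n) \<le> C / (1 + \<bar>real_of_int n\<bar>) ^ r"
proof -
  obtain C where C: "C > 0" "\<And>s n. s \<ge> 0 \<Longrightarrow> (1 + \<bar>real_of_int n\<bar>) ^ r * norm (hk k s n) * sqrt (1 + s) ^ Suc (2 * k)
     \<le> C * sqrt (1 + s) ^ r" using hk_decay by blast
  have "norm (hk k s n) \<le> C * sqrt (1 + \<bar>R\<bar>) ^ r / (1 + \<bar>real_of_int n\<bar>) ^ r" if s: "s \<in> {0..R}" for s n
  proof -
    have "(1 + \<bar>real_of_int n\<bar>) ^ r * norm (hk k s n) * 1 \<le> (1 + \<bar>real_of_int n\<bar>) ^ r * norm (hk k s n) * sqrt (1 + s) ^ Suc (2 * k)"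
      using s by (intro mult_left_mono one_le_power) auto
    also have "\<dots> \<le> C * sqrt (1 + s) ^ r" using s by (intro C) auto
    also have "\<dots> \<le> C * sqrt (1 + \<bar>R\<bar>) ^ r" using s C(1) by (intro mult_left_mono power_mono) auto
    finally show ?thesis by (simp add: field_simps add_pos_nonneg)
  qed
  moreover have "C * sqrt (1 + \<bar>R\<bar>) ^ r > 0" using C(1) by (intro mult_pos_pos zero_less_power) auto
  ultimately show ?thesis by blast
qed

lemma hk_bounded: "\<exists>C>0. \<forall>s\<ge>0. \<forall>n. norm (hk k s n) * sqrt (1 + s) ^ Suc (2 * k) \<le> C"
  using hk_decay[of 0 k] by simp

text \<open>Interpolate with \<open>\<phi> m r\<close>: at \<open>r = 0\<close> it is the summand of
  the convolution, at \<open>r = t\<close> one factor is the unit mass at \<open>n\<close>. The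
  derivative in \<open>r\<close>, summed over \<open>m\<close>, is zero because the Laplacian is
  symmetric, so both ends have the same sum.\<close>

lemma hk_semigroup_base:
  assumes s: "0 \<le> s" and t: "0 \<le> t"
  shows "((\<lambda>m. hk 0 t (n - m) * hk 0 s m) has_sum hk 0 (s + t) n) UNIV"
proof -
  define g where "g = (\<lambda>m r. hk 1 (t - r) (n - m) * hk 0 (s + r) m - hk 0 (t - r) (n - m) * hk 1 (s + r) m)"
  define \<phi> where "\<phi> = (\<lambda>m r. hk 0 (t - r) (n - m) * hk 0 (s + r) m)"
  obtain C0 where C0: "C0 > 0" "\<And>r m. r \<in> {0..s + t} \<Longrightarrow> norm (hk 0 r m) \<le> C0 / (1 + \<bar>real_of_int m\<bar>) ^ 2"
    using hk_decay_compact by blast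
  obtain C1 where C1: "C1 > 0" "\<And>r m. r \<in> {0..s + t} \<Longrightarrow> norm (hk 1 r m) \<le> C1 / (1 + \<bar>real_of_int m\<bar>) ^ 2"
    using hk_decay_compact by blast
  have le1: "C / (1 + \<bar>real_of_int m\<bar>) ^ 2 \<le> C" if "C > 0" for C m
    using that divide_left_mono[of 1 "(1 + \<bar>real_of_int m\<bar>) ^ 2" C] by (simp add: one_le_power)
  have prod: "norm (hk a (t - r) (n - m) * hk b (s + r) m) \<le> A * (B / (1 + \<bar>real_of_int m\<bar>) ^ 2)"
    if "r \<in> {0..t}" "A > 0" "\<And>r m. r \<in> {0..s + t} \<Longrightarrow> norm (hk a r m) \<le> A / (1 + \<bar>real_of_int m\<bar>) ^ 2"
      "\<And>r m. r \<in> {0..s + t} \<Longrightarrow> norm (hk b r m) \<le> B / (1 + \<bar>real_of_int m\<bar>) ^ 2" for a b r m A B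
  proof -
    have "norm (hk a (t - r) (n - m)) \<le> A"
      using that(3)[of "t - r" "n - m"] le1[OF that(2), of "n - m"] that(1) s by force
    moreover have "norm (hk b (s + r) m) \<le> B / (1 + \<bar>real_of_int m\<bar>) ^ 2"
      using that s by auto
    ultimately show ?thesis unfolding norm_mult using that(2) by (intro mult_mono) auto
  qed
  define K where "K = C1 * C0 + C0 * C1"
  have gb: "norm (g m r) \<le> K * (1 / (1 + \<bar>real_of_int m\<bar>) ^ 2)" if "r \<in> {0..t}" for m r
  proof -
    have "norm (g m r) \<le> C1 * (C0 / (1 + \<bar>real_of_int m\<bar>) ^ 2) + C0 * (C1 / (1 + \<bar>real_of_int m\<bar>) ^ 2)"
      unfolding g_def by (rule order_trans[OF norm_triangle_ineq4 add_mono])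
        (rule prod; use that C0 C1 in blast)+
    then show ?thesis by (simp add: K_def ring_distribs add_divide_distrib)
  qed
  have sumK: "(\<lambda>m::int. K * (1 / (1 + \<bar>real_of_int m\<bar>) ^ 2)) summable_on UNIV"
    by (intro summable_on_cmult_right summable_on_inverse_square_int)
  have \<phi>b: "norm (\<phi> m r) \<le> C0 * C0 * (1 / (1 + \<bar>real_of_int m\<bar>) ^ 2)" if "r \<in> {0..t}" for m r
    using prod[OF that C0(1) C0(2) C0(2), of m] by (simp add: \<phi>_def)
  have \<phi>s: "(\<lambda>m. \<phi> m r) summable_on UNIV" if "r \<in> {0..t}" for r
    by (rule summable_on_norm_bound[OF summable_on_cmult_right[OF summable_on_inverse_square_int] \<phi>b[OF that]])
  have cont: "continuous_on {0..t} (g m)" for m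
    unfolding g_def
    by (intro continuous_intros continuous_on_compose2[OF hk_continuous[of UNIV], of _ "\<lambda>r. t - r"]
        continuous_on_compose2[OF hk_continuous[of UNIV], of _ "\<lambda>r. s + r"]) auto
  have der: "(\<phi> m has_vector_derivative g m r) (at r within {0..t})" for m r
  proof -
    have 1: "((\<lambda>r. hk 0 (t - r) (n - m)) has_vector_derivative (- 1) *\<^sub>R (- hk 1 (t - r) (n - m))) (at r within {0..t})"
      by (rule vector_diff_chain_within[unfolded o_def, where f="\<lambda>r. t - r" and g="\<lambda>r. hk 0 r (n - m)"])
        (auto intro!: derivative_eq_intros hk_has_derivative[of 0, simplified])
    have 2: "((\<lambda>r. hk 0 (s + r) m) has_vector_derivative 1 *\<^sub>R (- hk 1 (s + r) m)) (at r within {0..t})"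
      by (rule vector_diff_chain_within[unfolded o_def, where f="\<lambda>r. s + r" and g="\<lambda>r. hk 0 r m"])
        (auto intro!: derivative_eq_intros hk_has_derivative[of 0, simplified])
    show ?thesis
      unfolding \<phi>_def g_def using has_vector_derivative_mult[OF 1 2] by (simp add: algebra_simps)
  qed
  have int: "integral {0..t} (g m) = \<phi> m t - \<phi> m 0" for m
    by (rule integral_unique[OF fundamental_theorem_of_calculus[OF t der]])
  have zero: "(\<Sum>\<^sub>\<infinity>m. g m r) = 0" if r: "r \<in> {0..t}" for r
  proof -
    define h where "h = (\<lambda>m. hk 0 (t - r) (n - m))"
    define H where "H = hk 0 (s + r)"
    define v where "v = (\<lambda>m. h m * H (m + 1))"
    define v' where "v' = (\<lambda>m. h m * H (m - 1))"
    \<comment> \<open>Summation by parts: the diagonal terms cancel and each bracket is a sequence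
      minus its own shift, whose sum over the integers is zero.\<close>
    have g: "g m r = (v m - v (m - 1)) + (v' m - v' (m + 1))" for m
      by (simp add: g_def v_def v'_def h_def H_def hk_Suc[of 0, simplified] algebra_simps)
    have sv: "v summable_on UNIV" "v' summable_on UNIV"
    proof -
      have hb: "norm (h m) \<le> C0 / (1 + \<bar>real_of_int (n - m)\<bar>) ^ 2" and Hb: "norm (H m') \<le> C0" for m m'
        using C0(2)[of "t - r" "n - m"] order_trans[OF C0(2)[of "s + r" m'] le1[OF C0(1)]] r s
        by (auto simp: h_def H_def)
      have "(\<lambda>m. C0 * (C0 * (1 / (1 + \<bar>real_of_int (n - m)\<bar>) ^ 2))) summable_on UNIV"
        by (intro summable_on_cmult_right summable_on_inverse_square_int_shift)
      moreover have "norm (h m * H m') \<le> C0 * (C0 * (1 / (1 + \<bar>real_of_int (n - m)\<bar>) ^ 2))" for m m'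
        using mult_mono[OF hb[of m] Hb[of m']] C0(1) by (simp add: norm_mult mult_ac)
      ultimately show "v summable_on UNIV" "v' summable_on UNIV"
        unfolding v_def v'_def by (auto intro: summable_on_norm_bound)
    qed
    have "((\<lambda>m. v (m + (- 1))) has_sum infsum v UNIV) UNIV" "((\<lambda>m. v' (m + 1)) has_sum infsum v' UNIV) UNIV"
      unfolding has_sum_shift_int using sv by auto
    then have "((\<lambda>m. g m r) has_sum ((infsum v UNIV - infsum v UNIV) + (infsum v' UNIV - infsum v' UNIV))) UNIV"
      unfolding g using sv by (intro has_sum_add has_sum_minus) auto
    then show ?thesis by (simp add: infsumI)
  qed
  have "((\<lambda>m. \<phi> m t - \<phi> m 0) has_sum integral {0..t} (\<lambda>r. \<Sum>\<^sub>\<infinity>m. g m r)) UNIV"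
    using has_sum_integral_infsum[OF cont gb sumK] by (simp add: int)
  moreover have "integral {0..t} (\<lambda>r. \<Sum>\<^sub>\<infinity>m. g m r) = integral {0..t} (\<lambda>r. 0)"
    by (rule integral_cong) (rule zero)
  ultimately have D: "((\<lambda>m. \<phi> m t - \<phi> m 0) has_sum 0) UNIV" by simp
  have "((\<lambda>m. \<phi> m t) has_sum hk 0 (s + t) n) UNIV"
  proof -
    have "((\<lambda>m. \<phi> m t) has_sum hk 0 (s + t) n) {n}"
      using has_sum_finite[of "{n}" "\<lambda>m. \<phi> m t"] by (simp add: \<phi>_def hk_0_0)
    then show ?thesis
      by (rule has_sum_cong_neutral[THEN iffD1, rotated -1]) (auto simp: \<phi>_def hk_0_0)
  qed
  from has_sum_minus[OF this D] show ?thesis by (simp add: \<phi>_def)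
qed

text \<open>Applying the Laplacian in \<open>n\<close> raises the order of the first factor only.
  The reflection of \<open>m\<close> to \<open>n - m\<close> exchanges the factors, so both orders
  can be raised in turn from the base case.\<close>

lemma hk_semigroup:
  assumes s: "0 \<le> s" and t: "0 \<le> t"
  shows "((\<lambda>m. hk j t (n - m) * hk k s m) has_sum hk (j + k) (s + t) n) UNIV"
proof -
  have step: "((\<lambda>m. hk (Suc j) t (n - m) * f m) has_sum (- S (n + 1) + 2 * S n - S (n - 1))) UNIV"
    if "\<And>n. ((\<lambda>m. hk j t (n - m) * f m) has_sum S n) UNIV" for j t n and f S :: "int \<Rightarrow> complex"
  proof -
    have "((\<lambda>m. - (hk j t (n + 1 - m) * f m) + 2 * (hk j t (n - m) * f m) - hk j t (n - 1 - m) * f m)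
        has_sum (- S (n + 1) + 2 * S n - S (n - 1))) UNIV"
      by (intro has_sum_minus has_sum_add has_sum_cmult_right that has_sum_neg)
    moreover have "n + 1 - m = n - m + 1" "n - 1 - m = n - m - 1" for m by simp_all
    ultimately show ?thesis by (simp add: hk_Suc algebra_simps)
  qed
  have *: "((\<lambda>m. hk j t (n - m) * f m) has_sum (hk (j + i) r n)) UNIV"
    if "\<And>n. ((\<lambda>m. hk 0 t (n - m) * f m) has_sum (hk i r n)) UNIV" for i r t n j and f :: "int \<Rightarrow> complex"
  proof (induction j arbitrary: n)
    case (Suc j)
    show ?case using step[OF Suc.IH, of n] by (simp add: hk_Suc)
  qed (use that in simp)
  have "((\<lambda>m. hk k s (n - m) * hk 0 t m) has_sum hk (k + 0) (s + t) n) UNIV" for n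
    by (rule *) (use hk_semigroup_base[OF t s] in \<open>simp add: add.commute\<close>)
  then have "((\<lambda>m. hk k s (n - (n - m)) * hk 0 t (n - m)) has_sum hk (k + 0) (s + t) n) UNIV" for n
    by (subst has_sum_shift_int(2)[of "\<lambda>m. hk k s (n - m) * hk 0 t m"])
  then have "((\<lambda>m. hk 0 t (n - m) * hk k s m) has_sum hk k (s + t) n) UNIV" for n
    by (simp add: mult.commute)
  then show ?thesis by (rule *)
qed

section \<open>Convolution with the heat kernel\<close>

lemma has_sum_fubini:
  fixes G :: "'a \<times> 'b \<Rightarrow> complex"
  assumes H: "H summable_on UNIV" "\<And>x y. norm (G (x, y)) \<le> H (x, y)"
    and g: "\<And>x. ((\<lambda>y. G (x, y)) has_sum g x) UNIV"
    and h: "\<And>y. ((\<lambda>x. G (x, y)) has_sum h y) UNIV" and S: "(h has_sum S) UNIV"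
  shows "(g has_sum S) UNIV"
proof -
  have "G summable_on (UNIV \<times> UNIV)"
    using summable_on_norm_bound[OF H(1), of G] H(2) by (simp add: split_paired_all)
  then have G: "(G has_sum infsum G UNIV) (UNIV \<times> UNIV)" by simp
  have 1: "(g has_sum infsum G UNIV) UNIV"
    by (rule has_sum_SigmaD[OF G g])
  have "(h has_sum infsum G UNIV) UNIV"
    by (rule has_sum_SigmaD[OF has_sum_swap[THEN iffD1, OF G]]) (simp add: h)
  then show ?thesis using 1 S has_sum_unique by blast
qed

definition hconv :: "nat \<Rightarrow> real \<Rightarrow> (int \<Rightarrow> complex) \<Rightarrow> int \<Rightarrow> complex" where
  "hconv k s f n = (\<Sum>\<^sub>\<infinity>m. hk k s (n - m) * f m)"

text \<open>Membership in \<open>tempered\<close> with constant and degree exposed, so that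
  estimates can name them.\<close>

definition poly_growth :: "real \<Rightarrow> nat \<Rightarrow> (int \<Rightarrow> complex) \<Rightarrow> bool" where
  "poly_growth F d f \<longleftrightarrow> (\<forall>n. norm (f n) \<le> F * (1 + \<bar>real_of_int n\<bar>) ^ d)"

lemma temperedE:
  assumes "f \<in> tempered"
  obtains F d where "F > 0" "poly_growth F d f"
proof -
  from assms obtain C d where C: "\<And>n. norm (f n) \<le> C * (1 + \<bar>real_of_int n\<bar>) ^ d"
    by (auto simp: tempered_def)
  have "norm (f n) \<le> (\<bar>C\<bar> + 1) * (1 + \<bar>real_of_int n\<bar>) ^ d" for n
    by (rule order_trans[OF C]) (intro mult_right_mono, auto)
  then show ?thesis by (intro that[of "\<bar>C\<bar> + 1" d]) (auto simp: poly_growth_def)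
qed

text \<open>Peetre's inequality for the weight. It moves the growth of a function from
  \<open>m\<close> to \<open>n\<close>, leaving powers of the distance that the kernel
  absorbs.\<close>

lemma weight_mult: "1 + \<bar>real_of_int m\<bar> \<le> (1 + \<bar>real_of_int n\<bar>) * (1 + \<bar>real_of_int (n - m)\<bar>)"
proof -
  have "1 + z \<le> (1 + x) * (1 + y)" if "z \<le> x + y" "0 \<le> x * y" for x y z :: real
    using that by (simp add: ring_distribs)
  then show ?thesis by this simp_all
qed

lemma hconv_term_bound:
  assumes F: "F > 0" "poly_growth F d f"
  shows "\<exists>C>0. \<forall>s\<in>{0..R}. \<forall>n m. norm (hk k s (n - m) * f m)
     \<le> C * (1 + \<bar>real_of_int n\<bar>) ^ d * (1 / (1 + \<bar>real_of_int (n - m)\<bar>) ^ 2)"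
proof -
  \<comment> \<open>Of the \<open>d + 2\<close> powers of decay, \<open>d\<close> absorb the growth
    of \<open>f\<close> and two make the sum over \<open>m\<close> converge.\<close>
  obtain C where C: "C > 0" "\<And>s n. s \<in> {0..R} \<Longrightarrow> norm (hk k s n) \<le> C / (1 + \<bar>real_of_int n\<bar>) ^ (d + 2)"
    using hk_decay_compact by blast
  have "norm (hk k s (n - m) * f m) \<le> (C * F) * (1 + \<bar>real_of_int n\<bar>) ^ d * (1 / (1 + \<bar>real_of_int (n - m)\<bar>) ^ 2)"
    if "s \<in> {0..R}" for s n m
  proof -
    define w where "w = 1 + \<bar>real_of_int (n - m)\<bar>"
    have w: "w > 0" by (simp add: w_def)
    have "norm (f m) \<le> F * (1 + \<bar>real_of_int m\<bar>) ^ d" using F(2) by (simp add: poly_growth_def)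
    also have "\<dots> \<le> F * ((1 + \<bar>real_of_int n\<bar>) * w) ^ d"
      unfolding w_def using F(1) by (intro mult_left_mono power_mono weight_mult) auto
    finally have "norm (hk k s (n - m) * f m) \<le> (C / w ^ (d + 2)) * (F * ((1 + \<bar>real_of_int n\<bar>) * w) ^ d)"
      unfolding norm_mult w_def using C(1) by (intro mult_mono C(2)[OF that]) auto
    also have "(C / w ^ (d + 2)) * (F * (v * w) ^ d) = (C * F) * v ^ d * (1 / w ^ 2)" for v
      using w by (simp add: power_mult_distrib power_add power2_eq_square field_simps)
    finally show ?thesis by (simp add: w_def)
  qed
  then show ?thesis using C(1) F(1) by (intro exI[of _ "C * F"]) auto
qed

lemma hconv_has_sum:
  assumes F: "F > 0" "poly_growth F d f" and s: "0 \<le> s"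
  shows "((\<lambda>m. hk k s (n - m) * f m) has_sum hconv k s f n) UNIV"
proof -
  obtain C where C: "C > 0" "\<And>r n m. r \<in> {0..s} \<Longrightarrow> norm (hk k r (n - m) * f m)
     \<le> C * (1 + \<bar>real_of_int n\<bar>) ^ d * (1 / (1 + \<bar>real_of_int (n - m)\<bar>) ^ 2)"
    using hconv_term_bound[OF F] by blast
  have "(\<lambda>m. hk k s (n - m) * f m) summable_on UNIV"
    by (rule summable_on_norm_bound[OF summable_on_cmult_right[OF summable_on_inverse_square_int_shift(1)] C(2)])
      (use s in auto)
  then show ?thesis by (simp add: hconv_def)
qed

lemma poly_growth_hconv:
  assumes F: "F > 0" "poly_growth F d f"
  shows "\<exists>C>0. \<forall>s\<in>{0..R}. poly_growth C d (hconv k s f)"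
proof -
  obtain C where C: "C > 0" "\<And>r n m. r \<in> {0..R} \<Longrightarrow> norm (hk k r (n - m) * f m)
     \<le> C * (1 + \<bar>real_of_int n\<bar>) ^ d * (1 / (1 + \<bar>real_of_int (n - m)\<bar>) ^ 2)"
    using hconv_term_bound[OF F] by blast
  define Z where "Z = (\<Sum>\<^sub>\<infinity>m::int. 1 / (1 + \<bar>real_of_int m\<bar>) ^ 2)"
  have Z: "((\<lambda>m. 1 / (1 + \<bar>real_of_int (n - m)\<bar>) ^ 2) has_sum Z) UNIV" for n
    unfolding has_sum_shift_int(2)[where f="\<lambda>m. 1 / (1 + \<bar>real_of_int m\<bar>) ^ 2"]
    using summable_on_inverse_square_int by (simp add: Z_def)
  have Z0: "Z \<ge> 0" by (rule has_sum_nonneg[OF Z[of 0]]) auto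
  have "norm (hconv k s f n) \<le> (C * Z + 1) * (1 + \<bar>real_of_int n\<bar>) ^ d" if s: "s \<in> {0..R}" for s n
  proof -
    have H: "((\<lambda>m. C * (1 + \<bar>real_of_int n\<bar>) ^ d * (1 / (1 + \<bar>real_of_int (n - m)\<bar>) ^ 2)) has_sum C * (1 + \<bar>real_of_int n\<bar>) ^ d * Z) UNIV"
      by (intro has_sum_cmult_right Z)
    have a: "(\<lambda>m. norm (hk k s (n - m) * f m)) summable_on UNIV"
      by (rule summable_on_comparison_test[OF has_sum_imp_summable[OF H]]) (use C s in auto)
    have "norm (hconv k s f n) \<le> (\<Sum>\<^sub>\<infinity>m. norm (hk k s (n - m) * f m))"
      unfolding hconv_def by (rule norm_infsum_bound[OF a])
    also have "\<dots> \<le> C * (1 + \<bar>real_of_int n\<bar>) ^ d * Z"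
      by (rule has_sum_mono[OF has_sum_infsum[OF a] H]) (use C s in auto)
    also have "\<dots> \<le> (C * Z + 1) * (1 + \<bar>real_of_int n\<bar>) ^ d" by (simp add: algebra_simps)
    finally show ?thesis .
  qed
  moreover have "C * Z + 1 > 0" using C(1) Z0 by (simp add: add_nonneg_pos)
  ultimately show ?thesis unfolding poly_growth_def by blast
qed

lemma hconv_0_0: "hconv 0 0 f n = f n"
proof -
  have "((\<lambda>m. hk 0 0 (n - m) * f m) has_sum f n) {n}"
    by (rule has_sum_finiteI) (simp_all add: hk_0_0)
  then have "((\<lambda>m. hk 0 0 (n - m) * f m) has_sum f n) UNIV"
    by (rule has_sum_cong_neutral[THEN iffD1, rotated -1]) (auto simp: hk_0_0)
  then show ?thesis by (simp add: hconv_def infsumI)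
qed

lemma laplacian_hconv:
  assumes F: "F > 0" "poly_growth F d f" and s: "0 \<le> s"
  shows "(discrete_laplacian ^^ j) (hconv k s f) = hconv (k + j) s f"
proof (induction j)
  case (Suc j)
  have "((\<lambda>m. - (hk k s (n + 1 - m) * f m) + 2 * (hk k s (n - m) * f m) - hk k s (n - 1 - m) * f m)
        has_sum (- hconv k s f (n + 1) + 2 * hconv k s f n - hconv k s f (n - 1))) UNIV" for k n
    by (intro has_sum_minus has_sum_add has_sum_cmult_right has_sum_neg hconv_has_sum[OF F s])
  moreover have "hk (Suc k) s (n - m) * f m = - (hk k s (n + 1 - m) * f m) + 2 * (hk k s (n - m) * f m) - hk k s (n - 1 - m) * f m" for k n m
  proof -
    have e: "n - m + 1 = n + 1 - m" "n - m - 1 = n - 1 - m" by simp_all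
    show ?thesis unfolding hk_Suc e by (simp only: ring_distribs mult_minus_left) simp
  qed
  ultimately have "((\<lambda>m. hk (Suc k) s (n - m) * f m) has_sum discrete_laplacian (hconv k s f) n) UNIV" for n k
    by (simp only: discrete_laplacian_def)
  then have "hconv (Suc k) s f n = discrete_laplacian (hconv k s f) n" for n k
    by (simp add: hconv_def infsumI)
  then have "hconv (Suc k) s f = discrete_laplacian (hconv k s f)" for k by (rule ext)
  then show ?case by (simp add: Suc.IH)
qed simp

lemma heat_semigroup_hconv: "heat_semigroup s f = hconv 0 s f"
  by (simp add: fun_eq_iff heat_semigroup_def hconv_def hk_def)

lemma hconv_continuous:
  assumes F: "F > 0" "poly_growth F d f"
  shows "continuous_on {0..R} (\<lambda>s. hconv k s f n)"
proof -
  obtain C where C: "C > 0" "\<And>r n m. r \<in> {0..R} \<Longrightarrow> norm (hk k r (n - m) * f m)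
     \<le> C * (1 + \<bar>real_of_int n\<bar>) ^ d * (1 / (1 + \<bar>real_of_int (n - m)\<bar>) ^ 2)"
    using hconv_term_bound[OF F] by blast
  show ?thesis
    unfolding hconv_def
    by (rule continuous_on_infsum[OF _ C(2) summable_on_cmult_right[OF summable_on_inverse_square_int_shift(1)]])
      (intro continuous_intros hk_continuous)
qed

lemma hconv_continuous':
  assumes F: "F > 0" "poly_growth F d f"
  shows "continuous_on {0..} (\<lambda>s. hconv k s f n)"
  unfolding continuous_on_eq_continuous_within
proof
  fix s :: real assume "s \<in> {0..}"
  then have "continuous (at s within {0..s + 1}) (\<lambda>s. hconv k s f n)"
    using hconv_continuous[OF F, of "s + 1"] by (auto simp: continuous_on_eq_continuous_within)
  moreover have "at s within {0..} = at s within {0..s + 1}"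
    by (rule at_within_nhd[of s "{..<s + 1}"]) auto
  ultimately show "continuous (at s within {0..}) (\<lambda>s. hconv k s f n)" by simp
qed

text \<open>Termwise differentiation is avoided by integrating first: the time integral of the order
  \<open>Suc k\<close> convolution is computed term by term, and the fundamental theorem then gives
  the derivative because the integrand is continuous. At \<open>s = 0\<close> the derivative is
  one-sided.\<close>

lemma hconv_has_derivative:
  assumes F: "F > 0" "poly_growth F d f" and s: "0 \<le> s"
  shows "((\<lambda>s. hconv k s f n) has_vector_derivative - hconv (Suc k) s f n) (at s within {0..})"
proof -
  define R where "R = s + 1"
  obtain C where C: "C > 0" "\<And>r n m. r \<in> {0..R} \<Longrightarrow> norm (hk (Suc k) r (n - m) * f m)
     \<le> C * (1 + \<bar>real_of_int n\<bar>) ^ d * (1 / (1 + \<bar>real_of_int (n - m)\<bar>) ^ 2)"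
    using hconv_term_bound[OF F] by blast
  have int: "integral {0..u} (\<lambda>r. hconv (Suc k) r f n) = hconv k 0 f n - hconv k u f n" if u: "u \<in> {0..R}" for u
  proof -
    have "integral {0..u} (\<lambda>r. hk (Suc k) r (n - m) * f m) = hk k 0 (n - m) * f m - hk k u (n - m) * f m" for m
    proof -
      have "((\<lambda>r. - (hk k r (n - m) * f m)) has_vector_derivative (- (- hk (Suc k) r (n - m) * f m))) (at r within {0..u})" for r
        by (intro has_vector_derivative_minus has_vector_derivative_mult_left hk_has_derivative)
      then have "((\<lambda>r. hk (Suc k) r (n - m) * f m) has_integral (- (hk k u (n - m) * f m) - - (hk k 0 (n - m) * f m))) {0..u}"
        using u by (intro fundamental_theorem_of_calculus) auto
      from integral_unique[OF this] show ?thesis by (simp only:) simp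
    qed
    then have "((\<lambda>m. hk k 0 (n - m) * f m - hk k u (n - m) * f m) has_sum integral {0..u} (\<lambda>r. hconv (Suc k) r f n)) UNIV"
      unfolding hconv_def
      using has_sum_integral_infsum[of 0 u "\<lambda>m r. hk (Suc k) r (n - m) * f m" "\<lambda>m. C * (1 + \<bar>real_of_int n\<bar>) ^ d * (1 / (1 + \<bar>real_of_int (n - m)\<bar>) ^ 2)"]
        C u summable_on_cmult_right[OF summable_on_inverse_square_int_shift(1)]
      by (force intro!: continuous_intros hk_continuous)
    moreover have "((\<lambda>m. hk k 0 (n - m) * f m - hk k u (n - m) * f m) has_sum (hconv k 0 f n - hconv k u f n)) UNIV"
      using u by (intro has_sum_minus hconv_has_sum[OF F]) auto
    ultimately show ?thesis using has_sum_unique by blast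
  qed
  have "((\<lambda>u. integral {0..u} (\<lambda>r. hconv (Suc k) r f n)) has_vector_derivative hconv (Suc k) s f n) (at s within {0..R})"
    by (rule integral_has_vector_derivative[OF hconv_continuous[OF F]]) (use s in \<open>auto simp: R_def\<close>)
  from has_vector_derivative_diff[OF has_vector_derivative_const[of "hconv k 0 f n"] this]
  have "((\<lambda>u. hconv k 0 f n - integral {0..u} (\<lambda>r. hconv (Suc k) r f n)) has_vector_derivative - hconv (Suc k) s f n) (at s within {0..R})"
    by simp
  then have "((\<lambda>s. hconv k s f n) has_vector_derivative - hconv (Suc k) s f n) (at s within {0..R})"
    by (rule has_vector_derivative_transform[rotated -1]) (use s int in \<open>auto simp: R_def\<close>)
  moreover have "at s within {0..} = at s within {0..R}"
    by (rule at_within_nhd[of s "{..<R}"]) (auto simp: R_def)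
  ultimately show ?thesis by simp
qed

text \<open>Fubini for the double series, reduced to \<open>hk_semigroup\<close>. The growth of
  \<open>f\<close> is moved from \<open>m\<close> to \<open>n\<close> by \<open>weight_mult\<close>,
  leaving the product of two summable inverse squares as majorant.\<close>

lemma hconv_semigroup:
  assumes F: "F > 0" "poly_growth F d f" and s: "0 \<le> s" and t: "0 \<le> t"
  shows "((\<lambda>m. hk j t (n - m) * hconv k s f m) has_sum hconv (j + k) (s + t) f n) UNIV"
proof -
  obtain C where C: "C > 0" "\<And>r n m. r \<in> {0..s} \<Longrightarrow> norm (hk k r (n - m) * f m)
     \<le> C * (1 + \<bar>real_of_int n\<bar>) ^ d * (1 / (1 + \<bar>real_of_int (n - m)\<bar>) ^ 2)"
    using hconv_term_bound[OF F] by blast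
  obtain K where K: "K > 0" "\<And>r n. r \<in> {0..t} \<Longrightarrow> norm (hk j r n) \<le> K / (1 + \<bar>real_of_int n\<bar>) ^ (d + 2)"
    using hk_decay_compact by blast
  define a where "a = (\<lambda>m::int. 1 / (1 + \<bar>real_of_int m\<bar>) ^ 2)"
  have a0: "a m \<ge> 0" for m by (simp add: a_def)
  define H where "H = (\<lambda>(m, i). (K * C * (1 + \<bar>real_of_int n\<bar>) ^ d) * (a (n - m) * a (m - i)))"
  define Z where "Z = (\<Sum>\<^sub>\<infinity>m. a m)"
  have Z: "((\<lambda>i. a (m - i)) has_sum Z) UNIV" for m
    unfolding has_sum_shift_int(2) using summable_on_inverse_square_int by (simp add: Z_def a_def)
  have "(\<lambda>(m, i). a (n - m) * a (m - i)) summable_on (UNIV \<times> UNIV)"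
  proof (rule summable_on_SigmaI[where g="\<lambda>m. a (n - m) * Z"])
    show "(\<lambda>m. a (n - m) * Z) summable_on UNIV"
      using Z by (intro summable_on_cmult_left) (auto intro: has_sum_imp_summable)
    show "((\<lambda>i. case (m, i) of (m, i) \<Rightarrow> a (n - m) * a (m - i)) has_sum a (n - m) * Z) UNIV" for m
      by (simp add: has_sum_cmult_right[OF Z])
  qed (use a0 in auto)
  then have Hs: "H summable_on UNIV"
    unfolding H_def case_prod_unfold by (intro summable_on_cmult_right) simp
  show ?thesis
  proof (rule has_sum_fubini[OF Hs, where G="\<lambda>(m, i). hk j t (n - m) * (hk k s (m - i) * f i)"
        and h="\<lambda>i. hk (j + k) (s + t) (n - i) * f i"])
    show "norm (case (m, i) of (m, i) \<Rightarrow> hk j t (n - m) * (hk k s (m - i) * f i)) \<le> H (m, i)" for m i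
    proof -
      define w where "w = 1 + \<bar>real_of_int (n - m)\<bar>"
      have w: "w > 0" by (simp add: w_def)
      have "norm (hk k s (m - i) * f i) \<le> C * (1 + \<bar>real_of_int m\<bar>) ^ d * a (m - i)"
        using C(2)[of s m i] s by (simp add: a_def)
      also have "\<dots> \<le> C * ((1 + \<bar>real_of_int n\<bar>) * w) ^ d * a (m - i)"
        unfolding w_def using C(1) a0 by (intro mult_left_mono mult_right_mono power_mono weight_mult) auto
      finally have "norm (hk j t (n - m)) * norm (hk k s (m - i) * f i) \<le> (K / w ^ (d + 2)) * (C * ((1 + \<bar>real_of_int n\<bar>) * w) ^ d * a (m - i))"
        using K(1) K(2)[of t "n - m"] t w unfolding w_def by (intro mult_mono) auto
      also have "\<dots> = H (m, i)"
      proof -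
        have aw: "a (n - m) = 1 / w ^ 2" by (simp add: a_def w_def)
        have "(K / w ^ (d + 2)) * (C * (v * w) ^ d * b) = (K * C * v ^ d) * (1 / w ^ 2 * b)" for v b
          using w by (simp add: power_mult_distrib power_add power2_eq_square field_simps)
        then show ?thesis unfolding H_def prod.case aw .
      qed
      finally show ?thesis by (simp add: norm_mult)
    qed
    show "((\<lambda>i. case (m, i) of (m, i) \<Rightarrow> hk j t (n - m) * (hk k s (m - i) * f i)) has_sum hk j t (n - m) * hconv k s f m) UNIV" for m
      using has_sum_cmult_right[OF hconv_has_sum[OF F s]] by simp
    show "((\<lambda>m. case (m, i) of (m, i) \<Rightarrow> hk j t (n - m) * (hk k s (m - i) * f i)) has_sum hk (j + k) (s + t) (n - i) * f i) UNIV" for i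
    proof -
      have "((\<lambda>m. hk j t (n - i - (m + (- i))) * hk k s (m + (- i))) has_sum hk (j + k) (s + t) (n - i)) UNIV"
        unfolding has_sum_shift_int(1)[where f="\<lambda>m. hk j t (n - i - m) * hk k s m"] by (rule hk_semigroup[OF s t])
      from has_sum_cmult_left[OF this, of "f i"] show ?thesis by (simp add: mult.assoc)
    qed
    show "((\<lambda>i. hk (j + k) (s + t) (n - i) * f i) has_sum hconv (j + k) (s + t) f n) UNIV"
      using s t by (intro hconv_has_sum[OF F]) auto
  qed
qed

section \<open>The Calderon reproducing formula\<close>

text \<open>The coefficient of \<open>t ^ (2 * M + 1)\<close> in
  \<open>4 * t * (2 * t^2) ^ M / fact M\<close>: the chain rule at \<open>s = 2 * t^2\<close> times
  the last term of a truncated exponential series.\<close>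

definition cald :: "nat \<Rightarrow> real" where "cald M = 4 * 2 ^ M / fact M"

lemma cald_pos: "cald M > 0" by (simp add: cald_def)

text \<open>On a mode with eigenvalue \<open>x\<close> this is \<open>exp (- s * x)\<close> times
  the truncated exponential series in \<open>s * x\<close>, at \<open>s = 2 * t^2\<close>: a
  normalised incomplete gamma function, equal to 1 at \<open>t = 0\<close> and tending to 0 for
  \<open>x > 0\<close>.\<close>

definition cald_rest :: "nat \<Rightarrow> (nat \<Rightarrow> real \<Rightarrow> complex) \<Rightarrow> real \<Rightarrow> complex" where
  "cald_rest M w t = (\<Sum>k\<le>M. ((2 * t\<^sup>2) ^ k / fact k) *\<^sub>R w k (2 * t\<^sup>2))"

text \<open>Here \<open>w k s\<close> stands for \<open>\<Delta>\<^sup>k e\<^sup>-\<^sup>s\<^sup>\<Delta> f\<close> at a point; the derivative telescopes.\<close>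

lemma cald_rest_has_derivative:
  assumes w: "\<And>k s. s \<ge> 0 \<Longrightarrow> (w k has_vector_derivative - w (Suc k) s) (at s within {0..})"
    and t: "t \<ge> 0"
  shows "(cald_rest M w has_vector_derivative - ((cald M * t ^ (2 * M + 1)) *\<^sub>R w (Suc M) (2 * t\<^sup>2))) (at t within {0..})"
proof -
  have sq: "((\<lambda>t. 2 * t\<^sup>2) has_vector_derivative 4 * t) (at t within {0..})"
    by (auto intro!: derivative_eq_intros simp flip: has_real_derivative_iff_has_vector_derivative)
  have "(w k has_vector_derivative - w (Suc k) (2 * t\<^sup>2)) (at (2 * t\<^sup>2) within (\<lambda>t. 2 * t\<^sup>2) ` {0..})" for k
    by (rule has_vector_derivative_within_subset[OF w]) auto
  from vector_diff_chain_within[OF sq this]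
  have W: "((\<lambda>t. w k (2 * t\<^sup>2)) has_vector_derivative (4 * t) *\<^sub>R (- w (Suc k) (2 * t\<^sup>2))) (at t within {0..})" for k
    by (simp add: o_def)
  show ?thesis
  proof (induction M)
    case 0
    then show ?case using W[of 0] by (simp add: cald_rest_def[abs_def] cald_def)
  next
    case (Suc M)
    have P: "((\<lambda>t. (2 * t\<^sup>2) ^ Suc M / fact (Suc M)) has_real_derivative 4 * t * (2 * t\<^sup>2) ^ M / fact M) (at t within {0..})"
      by (rule derivative_eq_intros refl | simp)+
    have D: "((\<lambda>t. ((2 * t\<^sup>2) ^ Suc M / fact (Suc M)) *\<^sub>R w (Suc M) (2 * t\<^sup>2)) has_vector_derivative
       ((2 * t\<^sup>2) ^ Suc M / fact (Suc M)) *\<^sub>R ((4 * t) *\<^sub>R (- w (Suc (Suc M)) (2 * t\<^sup>2))) + (4 * t * (2 * t\<^sup>2) ^ M / fact M) *\<^sub>R w (Suc M) (2 * t\<^sup>2)) (at t within {0..})"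
      by (rule has_vector_derivative_scaleR[OF P W])
    have "4 * t * (2 * t\<^sup>2) ^ M / fact M = cald M * t ^ (2 * M + 1)"
      "(2 * t\<^sup>2) ^ Suc M / fact (Suc M) * (4 * t) = cald (Suc M) * t ^ (2 * Suc M + 1)"
      by (simp_all add: cald_def power_mult_distrib power_mult power_add power2_eq_square field_simps)
    then have D': "((\<lambda>t. ((2 * t\<^sup>2) ^ Suc M / fact (Suc M)) *\<^sub>R w (Suc M) (2 * t\<^sup>2)) has_vector_derivative
       - ((cald (Suc M) * t ^ (2 * Suc M + 1)) *\<^sub>R w (Suc (Suc M)) (2 * t\<^sup>2)) + (cald M * t ^ (2 * M + 1)) *\<^sub>R w (Suc M) (2 * t\<^sup>2)) (at t within {0..})"
      using D by (simp only: scaleR_scaleR scaleR_minus_right)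
    have "cald_rest (Suc M) w = (\<lambda>t. cald_rest M w t + ((2 * t\<^sup>2) ^ Suc M / fact (Suc M)) *\<^sub>R w (Suc M) (2 * t\<^sup>2))"
      by (simp only: fun_eq_iff cald_rest_def sum.atMost_Suc) blast
    then show ?case
      using has_vector_derivative_add[OF Suc.IH D'] by (simp only:) simp
  qed
qed

text \<open>The reproducing formula on a bounded range of times. The time \<open>2 * t^2\<close>
  allows the kernel of order \<open>Suc M\<close> to be split as order \<open>M\<close> at time
  \<open>t^2\<close> applied to order 1 at time \<open>t^2\<close>, the latter being what the square
  function measures.\<close>

lemma cald_integral:
  assumes w: "\<And>k s. s \<ge> 0 \<Longrightarrow> (w k has_vector_derivative - w (Suc k) s) (at s within {0..})"
    and ab: "0 \<le> a" "a \<le> b"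
  shows "((\<lambda>t. (cald M * t ^ (2 * M + 1)) *\<^sub>R w (Suc M) (2 * t\<^sup>2)) has_integral cald_rest M w a - cald_rest M w b) {a..b}"
proof -
  have "((\<lambda>t. - ((cald M * t ^ (2 * M + 1)) *\<^sub>R w (Suc M) (2 * t\<^sup>2))) has_integral cald_rest M w b - cald_rest M w a) {a..b}"
    by (rule fundamental_theorem_of_calculus[OF ab(2)], rule has_vector_derivative_within_subset[where S="{0..}"],
      rule cald_rest_has_derivative) (use w ab in auto)
  from has_integral_neg[OF this] show ?thesis by simp
qed

lemma cald_rest_0: "cald_rest M w 0 = w 0 0"
proof -
  have "cald_rest M w 0 = (\<Sum>k\<le>M. if k = 0 then w 0 0 else 0)"
    unfolding cald_rest_def by (rule sum.cong) auto
  then show ?thesis by simp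
qed

lemma cald_rest_tendsto_0:
  assumes "\<And>k. ((\<lambda>s. (s ^ k) *\<^sub>R w k s) \<longlongrightarrow> 0) at_top"
  shows "(cald_rest M w \<longlongrightarrow> 0) at_top"
proof -
  have "filterlim (\<lambda>t::real. 2 * t\<^sup>2) at_top at_top"
    by (intro filterlim_tendsto_pos_mult_at_top[OF tendsto_const] filterlim_pow_at_top filterlim_ident) auto
  from filterlim_compose[OF assms this]
  have "((\<lambda>t. (1 / fact k) *\<^sub>R (((2 * t\<^sup>2) ^ k) *\<^sub>R w k (2 * t\<^sup>2))) \<longlongrightarrow> (1 / fact k) *\<^sub>R 0) at_top" for k
    by (intro tendsto_scaleR tendsto_const)
  then have "((\<lambda>t. \<Sum>k\<le>M. (1 / fact k) *\<^sub>R (((2 * t\<^sup>2) ^ k) *\<^sub>R w k (2 * t\<^sup>2))) \<longlongrightarrow> (\<Sum>k\<le>M. (1 / fact k) *\<^sub>R 0)) at_top"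
    by (intro tendsto_sum)
  then show ?thesis by (simp add: cald_rest_def[abs_def])
qed

lemma hk_power_tendsto_0: "((\<lambda>s. (s ^ k) *\<^sub>R hk k s n) \<longlongrightarrow> 0) at_top"
proof -
  obtain C where C: "C > 0" "\<And>s n. s \<ge> 0 \<Longrightarrow> norm (hk k s n) * sqrt (1 + s) ^ Suc (2 * k) \<le> C"
    using hk_bounded by blast
  have "norm ((s ^ k) *\<^sub>R hk k s n) \<le> C / sqrt (1 + s)" if s: "s \<ge> 0" for s
  proof -
    have "s ^ k \<le> (1 + s) ^ k" using s by (intro power_mono) auto
    also have "\<dots> = sqrt (1 + s) ^ (2 * k)" using s by (simp add: power_mult)
    finally have "norm ((s ^ k) *\<^sub>R hk k s n) * sqrt (1 + s) \<le> sqrt (1 + s) ^ (2 * k) * norm (hk k s n) * sqrt (1 + s)"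
      using s by (auto intro!: mult_right_mono)
    also have "\<dots> \<le> C" using C(2)[OF s, of n] by (simp add: mult_ac)
    finally show ?thesis using s by (simp add: pos_le_divide_eq)
  qed
  then have "\<forall>\<^sub>F s in at_top. norm ((s ^ k) *\<^sub>R hk k s n) \<le> C / sqrt (1 + s)"
    using eventually_ge_at_top[of 0] by (rule eventually_mono[rotated])
  moreover have "filterlim (\<lambda>s::real. sqrt (1 + s)) at_top at_top"
    by (rule filterlim_compose[OF sqrt_at_top filterlim_tendsto_add_at_top[OF tendsto_const filterlim_ident]])
  then have "((\<lambda>s. C / sqrt (1 + s)) \<longlongrightarrow> 0) at_top"
    by (intro tendsto_divide_0[OF tendsto_const] filterlim_at_top_imp_at_infinity)
  ultimately show ?thesis by (rule Lim_null_comparison)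
qed

section \<open>The quadratic estimate\<close>

lemma has_sum_sum:
  fixes f :: "'i \<Rightarrow> 'a \<Rightarrow> 'b::topological_comm_monoid_add"
  assumes "finite I" "\<And>i. i \<in> I \<Longrightarrow> (f i has_sum S i) A"
  shows "((\<lambda>x. \<Sum>i\<in>I. f i x) has_sum (\<Sum>i\<in>I. S i)) A"
  using assms by (induction I rule: finite_induct) (auto intro!: has_sum_add)

lemma hconv_finite_support:
  assumes "finite Y" "\<And>m. m \<notin> Y \<Longrightarrow> \<gamma> m = 0"
  shows "hconv k s \<gamma> n = (\<Sum>m\<in>Y. hk k s (n - m) * \<gamma> m)"
proof -
  have "hconv k s \<gamma> n = (\<Sum>\<^sub>\<infinity>m\<in>Y. hk k s (n - m) * \<gamma> m)"
    unfolding hconv_def by (rule infsum_cong_neutral) (use assms in auto)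
  then show ?thesis using assms by simp
qed

text \<open>By symmetry and the semigroup law, the squared l^2 norm of order \<open>M\<close> at
  time \<open>s\<close> is the quadratic form of order \<open>2 * M\<close> at time
  \<open>2 * s\<close>. Its integral against \<open>t ^ (4 * M - 1)\<close> is the reproducing
  formula of order \<open>2 * M - 1\<close> paired with \<open>\<gamma>\<close>, whose limit is the
  squared norm of \<open>\<gamma>\<close>.\<close>

lemma quadratic_estimate:
  assumes M: "M \<ge> 1" and Y: "finite Y" "\<And>m. m \<notin> Y \<Longrightarrow> \<gamma> m = 0" and X: "finite X" and R: "R \<ge> 0"
  shows "(\<Sum>n\<in>X. integral {0..R} (\<lambda>t. t ^ (4 * M - 1) * (norm (hconv M (t\<^sup>2) \<gamma> n))\<^sup>2))
    \<le> 1 / cald (2 * M - 1) * (\<Sum>m\<in>Y. (norm (\<gamma> m))\<^sup>2)"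
proof -
  have hf: "hconv k s \<gamma> n = (\<Sum>m\<in>Y. hk k s (n - m) * \<gamma> m)" for k s n
    by (rule hconv_finite_support[OF Y])
  define E where "E = (\<lambda>s. \<Sum>m\<in>Y. \<Sum>m'\<in>Y. \<gamma> m * cnj (\<gamma> m') * hk (2 * M) (2 * s) (m - m'))"
  define c where "c = cald (2 * M - 1)"
  have c: "c > 0" by (simp add: c_def cald_pos)
  \<comment> \<open>The order \<open>2 * M - 1\<close> in \<open>cald\<close> is the one for which
    kernel order and power of \<open>t\<close> both match.\<close>
  have Mp: "Suc (2 * M - 1) = 2 * M" "2 * (2 * M - 1) + 1 = 4 * M - 1" using M by auto
  have nsum: "((\<lambda>n. (norm (hconv M s \<gamma> n))\<^sup>2) has_sum Re (E s)) UNIV" if s: "s \<ge> 0" for s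
  proof -
    have "((\<lambda>n. hk M s (n - m) * hk M s (n - m')) has_sum hk (2 * M) (2 * s) (m - m')) UNIV" for m m'
    proof -
      have "((\<lambda>n. hk M s (m - m' - (n + (- m'))) * hk M s (n + (- m'))) has_sum hk (M + M) (s + s) (m - m')) UNIV"
        unfolding has_sum_shift_int(1)[where f="\<lambda>n. hk M s (m - m' - n) * hk M s n"]
        by (rule hk_semigroup[OF s s])
      moreover have "hk M s (m - m' - (n + (- m'))) * hk M s (n + (- m')) = hk M s (n - m) * hk M s (n - m')" for n
        using hk_minus[of M s "n - m"] by simp
      ultimately show ?thesis by (simp only: mult_2)
    qed
    then have "((\<lambda>n. \<gamma> m * cnj (\<gamma> m') * (hk M s (n - m) * hk M s (n - m'))) has_sum
       \<gamma> m * cnj (\<gamma> m') * hk (2 * M) (2 * s) (m - m')) UNIV" for m m'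
      by (rule has_sum_cmult_right)
    then have "((\<lambda>n. \<Sum>m\<in>Y. \<Sum>m'\<in>Y. \<gamma> m * cnj (\<gamma> m') * (hk M s (n - m) * hk M s (n - m'))) has_sum E s) UNIV"
      unfolding E_def by (intro has_sum_sum Y)
    moreover have "(\<Sum>m\<in>Y. \<Sum>m'\<in>Y. \<gamma> m * cnj (\<gamma> m') * (hk M s (n - m) * hk M s (n - m'))) =
       complex_of_real ((norm (hconv M s \<gamma> n))\<^sup>2)" for n
    proof -

      have "complex_of_real ((norm (hconv M s \<gamma> n))\<^sup>2) = (\<Sum>m\<in>Y. hk M s (n - m) * \<gamma> m) * (\<Sum>m\<in>Y. cnj (hk M s (n - m) * \<gamma> m))"
        by (simp only: complex_norm_square hf cnj_sum)
      also have "\<dots> = (\<Sum>m\<in>Y. \<Sum>m'\<in>Y. \<gamma> m * cnj (\<gamma> m') * (hk M s (n - m) * hk M s (n - m')))"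
        unfolding sum_product by (intro sum.cong refl) (simp add: hk_cnj)
      finally show ?thesis by simp
    qed
    ultimately have "((\<lambda>n. complex_of_real ((norm (hconv M s \<gamma> n))\<^sup>2)) has_sum E s) UNIV" by simp
    from has_sum_Re[OF this] show ?thesis by simp
  qed
  have Enn: "Re (E s) \<ge> 0" if "s \<ge> 0" for s by (rule has_sum_nonneg[OF nsum[OF that]]) auto
  have Ec: "continuous_on A (\<lambda>t. E (t\<^sup>2))" for A
    unfolding E_def by (intro continuous_intros continuous_on_compose2[OF hk_continuous[of UNIV], of _ "\<lambda>t. 2 * t\<^sup>2"]) auto
  have hc: "continuous_on {0..r} (\<lambda>t. t ^ (4 * M - 1) * (norm (hconv M (t\<^sup>2) \<gamma> n))\<^sup>2)" for r n
    unfolding hf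
    by (intro continuous_intros continuous_on_compose2[OF hk_continuous[of UNIV], of _ "\<lambda>t. t\<^sup>2"]) auto
  define w where "w = (\<lambda>x k s. hk k s x)"
  have cald: "((\<lambda>t. (c * t ^ (4 * M - 1)) *\<^sub>R w x (2 * M) (2 * t\<^sup>2)) has_integral cald_rest (2 * M - 1) (w x) 0 - cald_rest (2 * M - 1) (w x) r) {0..r}" if "r \<ge> 0" for r x
    using cald_integral[of "w x" 0 r "2 * M - 1"] that hk_has_derivative unfolding Mp c_def[symmetric] by (simp add: w_def)
  define J where "J = (\<lambda>r. integral {0..r} (\<lambda>t. (c * t ^ (4 * M - 1)) * Re (E (t\<^sup>2))))"
  define Q where "Q = (\<lambda>r. \<Sum>m\<in>Y. \<Sum>m'\<in>Y. \<gamma> m * cnj (\<gamma> m') * (cald_rest (2 * M - 1) (w (m - m')) 0 - cald_rest (2 * M - 1) (w (m - m')) r))"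
  have J: "J r = Re (Q r)" if "r \<ge> 0" for r
  proof -
    have "((\<lambda>t. \<Sum>m\<in>Y. \<Sum>m'\<in>Y. \<gamma> m * cnj (\<gamma> m') * ((c * t ^ (4 * M - 1)) *\<^sub>R w (m - m') (2 * M) (2 * t\<^sup>2))) has_integral Q r) {0..r}"
      unfolding Q_def by (intro has_integral_sum Y has_integral_mult_right cald that)
    moreover have "(\<Sum>m\<in>Y. \<Sum>m'\<in>Y. \<gamma> m * cnj (\<gamma> m') * ((c * t ^ (4 * M - 1)) *\<^sub>R w (m - m') (2 * M) (2 * t\<^sup>2))) = (c * t ^ (4 * M - 1)) *\<^sub>R E (t\<^sup>2)" for t
      by (simp add: E_def w_def scaleR_sum_right)
    ultimately have "((\<lambda>t. (c * t ^ (4 * M - 1)) *\<^sub>R E (t\<^sup>2)) has_integral Q r) {0..r}" by simp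
    from has_integral_linear[OF this bounded_linear_Re]
    show ?thesis by (simp add: J_def o_def integral_unique)
  qed
  have Jlim: "(J \<longlongrightarrow> (\<Sum>m\<in>Y. (norm (\<gamma> m))\<^sup>2)) at_top"
  proof -
    have "(cald_rest (2 * M - 1) (w x) \<longlongrightarrow> 0) at_top" for x
      by (rule cald_rest_tendsto_0) (simp add: w_def hk_power_tendsto_0)
    then have "(Q \<longlongrightarrow> (\<Sum>m\<in>Y. \<Sum>m'\<in>Y. \<gamma> m * cnj (\<gamma> m') * (cald_rest (2 * M - 1) (w (m - m')) 0 - 0))) at_top"
      unfolding Q_def by (intro tendsto_sum tendsto_mult tendsto_diff tendsto_const)
    also have "(\<Sum>m\<in>Y. \<Sum>m'\<in>Y. \<gamma> m * cnj (\<gamma> m') * (cald_rest (2 * M - 1) (w (m - m')) 0 - 0)) =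
      (\<Sum>m\<in>Y. \<Sum>m'\<in>Y. if m' = m then \<gamma> m * cnj (\<gamma> m) else 0)"
      by (intro sum.cong refl) (simp add: cald_rest_0 w_def hk_0_0)
    also have "\<dots> = complex_of_real (\<Sum>m\<in>Y. (norm (\<gamma> m))\<^sup>2)"
      using Y by (simp add: sum.delta' complex_norm_square del: of_real_power)
    finally have "((\<lambda>r. Re (Q r)) \<longlongrightarrow> (\<Sum>m\<in>Y. (norm (\<gamma> m))\<^sup>2)) at_top"
      using tendsto_Re by fastforce
    moreover have "\<forall>\<^sub>F r in at_top. Re (Q r) = J r"
      using eventually_ge_at_top[of 0] by eventually_elim (simp add: J)
    ultimately show ?thesis by (rule Lim_transform_eventually)
  qed
  \<comment> \<open>The integrand is nonnegative, so the truncated integral is below its limit; this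
    makes the estimate uniform in \<open>R\<close>.\<close>
  have Jmono: "J R \<le> J r" if "R \<le> r" for r
    unfolding J_def
    by (rule integral_subset_le) (use that R c Enn in \<open>auto intro!: integrable_continuous_real continuous_intros Ec mult_nonneg_nonneg\<close>)
  have JR: "J R \<le> (\<Sum>m\<in>Y. (norm (\<gamma> m))\<^sup>2)"
    by (rule tendsto_lowerbound[OF Jlim eventually_mono[OF eventually_ge_at_top[of R] Jmono]]) simp_all
  have "(\<Sum>n\<in>X. integral {0..R} (\<lambda>t. t ^ (4 * M - 1) * (norm (hconv M (t\<^sup>2) \<gamma> n))\<^sup>2))
     = integral {0..R} (\<lambda>t. \<Sum>n\<in>X. t ^ (4 * M - 1) * (norm (hconv M (t\<^sup>2) \<gamma> n))\<^sup>2)"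
    by (rule integral_sum[symmetric]) (use X hc in \<open>auto intro: integrable_continuous_real\<close>)
  also have "\<dots> \<le> integral {0..R} (\<lambda>t. 1 / c * ((c * t ^ (4 * M - 1)) * Re (E (t\<^sup>2))))"
  proof (rule integral_le)
    show "(\<lambda>t. \<Sum>n\<in>X. t ^ (4 * M - 1) * (norm (hconv M (t\<^sup>2) \<gamma> n))\<^sup>2) integrable_on {0..R}"
      by (intro integrable_continuous_real continuous_on_sum hc)
    show "(\<lambda>t. 1 / c * (c * t ^ (4 * M - 1) * Re (E (t\<^sup>2)))) integrable_on {0..R}"
      by (intro integrable_continuous_real continuous_intros Ec)
    fix t assume t: "t \<in> {0..R}"
    have "(\<Sum>n\<in>X. (norm (hconv M (t\<^sup>2) \<gamma> n))\<^sup>2) \<le> Re (E (t\<^sup>2))"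
      by (rule finite_sum_le_has_sum[OF nsum X]) auto
    then show "(\<Sum>n\<in>X. t ^ (4 * M - 1) * (norm (hconv M (t\<^sup>2) \<gamma> n))\<^sup>2) \<le> 1 / c * (c * t ^ (4 * M - 1) * Re (E (t\<^sup>2)))"
      using c t by (simp add: sum_distrib_left[symmetric] mult_left_mono)
  qed
  also have "\<dots> = 1 / c * J R" unfolding J_def by (rule integral_mult_right)
  also have "\<dots> \<le> 1 / c * (\<Sum>m\<in>Y. (norm (\<gamma> m))\<^sup>2)" using JR c by (intro mult_left_mono) auto
  finally show ?thesis by (simp only: c_def)
qed

section \<open>Moments\<close>

text \<open>Stated for all polynomials, not for monomials at the origin, so that powers centred
  anywhere, translates and Newton polynomials can be tested directly. \<open>has_sum\<close> admits
  functions of infinite support, which molecules have.\<close>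

definition annihilates :: "nat \<Rightarrow> (int \<Rightarrow> complex) \<Rightarrow> bool" where
  "annihilates N a \<longleftrightarrow>
     (\<forall>q::complex poly. degree q \<le> N \<longrightarrow> ((\<lambda>n. poly q (of_int n) * a n) has_sum 0) UNIV)"

lemma annihilates_0 [simp]: "annihilates N (\<lambda>n. 0)"
  by (simp add: annihilates_def)

lemma annihilates_add: "annihilates N a \<Longrightarrow> annihilates N b \<Longrightarrow> annihilates N (\<lambda>n. a n + b n)"
  unfolding annihilates_def using has_sum_add[where a=0 and b=0] by (fastforce simp: ring_distribs)

lemma annihilates_diff: "annihilates N a \<Longrightarrow> annihilates N b \<Longrightarrow> annihilates N (\<lambda>n. a n - b n)"
  unfolding annihilates_def using has_sum_minus[where a=0 and b=0] by (fastforce simp: ring_distribs)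

lemma annihilates_cmult: "annihilates N a \<Longrightarrow> annihilates N (\<lambda>n. c * a n)"
  unfolding annihilates_def mult.left_commute[of _ c] using has_sum_cmult_right[where a=0 and c=c] by fastforce

lemma annihilates_sum:
  "(\<And>i. i \<in> I \<Longrightarrow> annihilates N (a i)) \<Longrightarrow> annihilates N (\<lambda>n. \<Sum>i\<in>I. a i n)"
  by (induction I rule: infinite_finite_induct) (auto intro: annihilates_add)

lemma has_sum_finite_support:
  assumes "finite S" "\<And>n. n \<notin> S \<Longrightarrow> f n = 0"
  shows "(f has_sum (\<Sum>n\<in>S. f n)) UNIV"
proof -
  have "(f has_sum (\<Sum>n\<in>S. f n)) S" using assms by simp
  then show ?thesis by (rule has_sum_cong_neutral[THEN iffD1, rotated -1]) (use assms in auto)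
qed

lemma annihilates_finite_support:
  assumes "finite S" "\<And>n. n \<notin> S \<Longrightarrow> a n = 0"
  shows "annihilates N a \<longleftrightarrow> (\<forall>q::complex poly. degree q \<le> N \<longrightarrow> (\<Sum>n\<in>S. poly q (of_int n) * a n) = 0)"
proof -
  have "((\<lambda>n. poly q (of_int n) * a n) has_sum 0) UNIV \<longleftrightarrow> (\<Sum>n\<in>S. poly q (of_int n) * a n) = 0" for q
    using has_sum_finite_support[of S "\<lambda>n. poly q (of_int n) * a n"] assms has_sum_unique by fastforce
  then show ?thesis by (simp add: annihilates_def)
qed

lemma annihilates_iff_monomials:
  assumes "finite S" "\<And>n. n \<notin> S \<Longrightarrow> a n = 0"
  shows "annihilates N a \<longleftrightarrow> (\<forall>\<alpha>\<le>N. (\<Sum>n\<in>S. of_int n ^ \<alpha> * a n) = 0)"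
proof
  assume A: "annihilates N a"
  show "\<forall>\<alpha>\<le>N. (\<Sum>n\<in>S. of_int n ^ \<alpha> * a n) = 0"
  proof (intro allI impI)
    fix \<alpha> assume "\<alpha> \<le> N"
    then have "degree (monom 1 \<alpha> :: complex poly) \<le> N" by (simp add: degree_monom_eq)
    then have "(\<Sum>n\<in>S. poly (monom 1 \<alpha>) (of_int n) * a n) = 0"
      using A by (simp add: annihilates_finite_support[OF assms])
    then show "(\<Sum>n\<in>S. of_int n ^ \<alpha> * a n) = 0" by (simp add: poly_monom)
  qed
next
  assume A: "\<forall>\<alpha>\<le>N. (\<Sum>n\<in>S. of_int n ^ \<alpha> * a n) = 0"
  have "\<forall>q::complex poly. degree q \<le> N \<longrightarrow> (\<Sum>n\<in>S. poly q (of_int n) * a n) = 0"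
  proof (intro allI impI)
    fix q :: "complex poly" assume q: "degree q \<le> N"
    have "(\<Sum>n\<in>S. poly q (of_int n) * a n) = (\<Sum>n\<in>S. \<Sum>i\<le>degree q. coeff q i * (of_int n ^ i * a n))"
      by (simp add: poly_altdef sum_distrib_right mult.assoc)
    also have "\<dots> = (\<Sum>i\<le>degree q. coeff q i * (\<Sum>n\<in>S. of_int n ^ i * a n))"
      by (subst sum.swap) (simp add: sum_distrib_left)
    also have "\<dots> = 0" using A q by (intro sum.neutral) auto
    finally show "(\<Sum>n\<in>S. poly q (of_int n) * a n) = 0" .
  qed
  then show "annihilates N a" by (simp add: annihilates_finite_support[OF assms])
qed

section \<open>Differences of polynomials and functions with prescribed moments\<close>

definition poly_diff :: "complex \<Rightarrow> complex poly \<Rightarrow> complex poly" where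
  "poly_diff h q = pcompose q [:h, 1:] - q"

lemma poly_poly_diff: "poly (poly_diff h q) x = poly q (x + h) - poly q x"
  by (simp add: poly_diff_def poly_pcompose add.commute)

lemma poly_diff_pCons: "poly_diff h (pCons a r) = [:h, 1:] * poly_diff h r + smult h r"
proof -
  have "poly (poly_diff h (pCons a r)) x = poly ([:h, 1:] * poly_diff h r + smult h r) x" for x
    by (simp add: poly_poly_diff algebra_simps)
  then show ?thesis by (simp add: poly_eq_poly_eq_iff[symmetric] fun_eq_iff)
qed

text \<open>Phrased through vanishing coefficients rather than \<open>degree\<close>, so that a zero
  leading coefficient needs no separate case. The induction peels off the constant coefficient by
  \<open>poly_diff_pCons\<close>.\<close>

lemma poly_diff_degree:
  "(\<forall>i>Suc k. coeff q i = 0) \<Longrightarrow> (\<forall>i>k. coeff (poly_diff h q) i = 0) \<and>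
     coeff (poly_diff h q) k = of_nat (Suc k) * h * coeff q (Suc k)"
proof (induction k arbitrary: q)
  case 0
  obtain a r where q: "q = pCons a r" by (cases q)
  have r: "coeff r i = 0" if "i > 0" for i
    using spec[OF 0, of "Suc i"] that by (simp add: q)
  then have "r = [:coeff r 0:]"
    by (intro poly_eqI) (auto simp: coeff_pCons split: nat.splits)
  then obtain b where b: "r = [:b:]" by blast
  have "poly_diff h q = [:h * b:]"
    by (simp add: q b poly_diff_pCons) (simp add: poly_diff_def)
  then show ?case by (simp add: q b coeff_pCons split: nat.splits)
next
  case (Suc k)
  obtain a r where q: "q = pCons a r" by (cases q)
  have r: "\<forall>i>Suc k. coeff r i = 0"
  proof (intro allI impI)
    fix i assume "i > Suc k" then show "coeff r i = 0" using spec[OF Suc.prems, of "Suc i"] by (simp add: q)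
  qed
  note IH = Suc.IH[OF r]
  have c: "coeff (poly_diff h q) (Suc i) = h * coeff (poly_diff h r) (Suc i) + coeff (poly_diff h r) i + h * coeff r (Suc i)" for i
    by (simp add: q poly_diff_pCons)
  have "coeff (poly_diff h q) i = 0" if "i > Suc k" for i
    using that IH r by (cases i) (auto simp: c)
  moreover have "coeff (poly_diff h q) (Suc k) = of_nat (Suc (Suc k)) * h * coeff q (Suc (Suc k))"
    unfolding c using IH r by (simp add: q algebra_simps)
  ultimately show ?case by simp
qed

text \<open>Piecewise constant functions on \<open>k + 1\<close> consecutive blocks of length \<open>l\<close>: iterated step-\<open>l\<close>
  differences of an indicator, so that they see only the \<open>k\<close>-th coefficient of polynomials of degree \<open>k\<close>.\<close>

fun block :: "nat \<Rightarrow> int \<Rightarrow> int \<Rightarrow> int \<Rightarrow> complex" where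
  "block 0 c l n = (if c \<le> n \<and> n < c + l then 1 else 0)"
| "block (Suc k) c l n = block k c l (n - l) - block k c l n"

lemma block_support: "l \<ge> 1 \<Longrightarrow> n \<notin> {c..<c + (int k + 1) * l} \<Longrightarrow> block k c l n = 0"
proof (induction k arbitrary: n)
  case (Suc k)
  have "n \<notin> {c..<c + (int k + 1) * l}" "n - l \<notin> {c..<c + (int k + 1) * l}"
    using Suc.prems by (auto simp: algebra_simps)
  then show ?case using Suc by simp
qed auto

lemma norm_block: "norm (block k c l n) \<le> 2 ^ k"
proof (induction k arbitrary: n)
  case (Suc k)
  show ?case using norm_triangle_ineq4[of "block k c l (n - l)" "block k c l n"] Suc[of "n - l"] Suc[of n] by simp
qed simp

text \<open>Summation by parts moves each difference from the block to the polynomial: the degree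
  drops by one and the leading coefficient gains a factor \<open>Suc k\<close> times
  \<open>l\<close>. After \<open>k\<close> steps a constant is summed over \<open>l\<close>
  points.\<close>

lemma block_moments:
  assumes l: "l \<ge> 1" and q: "\<forall>i>k. coeff q i = 0"
  shows "((\<lambda>n. poly q (of_int n) * block k c l n) has_sum fact k * of_int l ^ Suc k * coeff q k) UNIV"
  using q
proof (induction k arbitrary: q)
  case 0
  then have "q = [:coeff q 0:]"
    by (intro poly_eqI) (auto simp: coeff_pCons split: nat.splits)
  then obtain a where a: "q = [:a:]" by blast
  have "((\<lambda>n. poly q (of_int n) * block 0 c l n) has_sum (\<Sum>n\<in>{c..<c + l}. poly q (of_int n) * block 0 c l n)) UNIV"
    by (rule has_sum_finite_support) auto
  also have "(\<Sum>n\<in>{c..<c + l}. poly q (of_int n) * block 0 c l n) = fact 0 * of_int l ^ Suc 0 * coeff q 0"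
    using l by (simp add: a)
  finally show ?case .
next
  case (Suc k)
  have S: "((\<lambda>n. poly (poly_diff (of_int l) q) (of_int n) * block k c l n) has_sum
      fact k * of_int l ^ Suc k * coeff (poly_diff (of_int l) q) k) UNIV"
    by (rule Suc.IH) (use poly_diff_degree[OF Suc.prems] in blast)
  have sm: "(\<lambda>n. poly r (of_int n) * block k c l n) summable_on UNIV" for r
    by (rule has_sum_imp_summable[OF has_sum_finite_support[of "{c..<c + (int k + 1) * l}"]])
      (use block_support[OF l] in auto)
  have "((\<lambda>n. poly (pcompose q [:of_int l, 1:]) (of_int n) * block k c l n) has_sum
     infsum (\<lambda>n. poly (pcompose q [:of_int l, 1:]) (of_int n) * block k c l n) UNIV) UNIV"
    using sm by simp
  then have "((\<lambda>n. poly (pcompose q [:of_int l, 1:]) (of_int (n + (- l))) * block k c l (n + (- l))) has_sum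
     infsum (\<lambda>n. poly (pcompose q [:of_int l, 1:]) (of_int n) * block k c l n) UNIV) UNIV"
    by (subst has_sum_shift_int(1)[where f="\<lambda>n. poly (pcompose q [:of_int l, 1:]) (of_int n) * block k c l n"])
  then have A: "((\<lambda>n. poly q (of_int n) * block k c l (n - l)) has_sum
     infsum (\<lambda>n. poly (pcompose q [:of_int l, 1:]) (of_int n) * block k c l n) UNIV) UNIV"
    by (simp add: poly_pcompose)
  have "((\<lambda>n. poly q (of_int n) * block k c l (n - l) - poly q (of_int n) * block k c l n) has_sum
     infsum (\<lambda>n. poly (pcompose q [:of_int l, 1:]) (of_int n) * block k c l n) UNIV - infsum (\<lambda>n. poly q (of_int n) * block k c l n) UNIV) UNIV"
    by (intro has_sum_minus A) (use sm in simp)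
  moreover have "((\<lambda>n. poly (pcompose q [:of_int l, 1:]) (of_int n) * block k c l n - poly q (of_int n) * block k c l n) has_sum
     infsum (\<lambda>n. poly (pcompose q [:of_int l, 1:]) (of_int n) * block k c l n) UNIV - infsum (\<lambda>n. poly q (of_int n) * block k c l n) UNIV) UNIV"
    by (intro has_sum_minus) (use sm in simp_all)
  then have "((\<lambda>n. poly (poly_diff (of_int l) q) (of_int n) * block k c l n) has_sum
     infsum (\<lambda>n. poly (pcompose q [:of_int l, 1:]) (of_int n) * block k c l n) UNIV - infsum (\<lambda>n. poly q (of_int n) * block k c l n) UNIV) UNIV"
    by (simp add: poly_diff_def left_diff_distrib)
  with S have "infsum (\<lambda>n. poly (pcompose q [:of_int l, 1:]) (of_int n) * block k c l n) UNIV - infsum (\<lambda>n. poly q (of_int n) * block k c l n) UNIV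
     = fact k * of_int l ^ Suc k * coeff (poly_diff (of_int l) q) k"
    using has_sum_unique by blast
  moreover have "coeff (poly_diff (of_int l) q) k = of_nat (Suc k) * of_int l * coeff q (Suc k)"
    using poly_diff_degree[OF Suc.prems] by blast
  ultimately show ?case by (simp add: right_diff_distrib mult_ac)
qed

text \<open>\<open>B * l ^ Suc j\<close> is the natural size of the \<open>j\<close>-th moment about
  \<open>c\<close> of a function bounded by \<open>B\<close> at scale \<open>l\<close>. Moments are
  matched one degree at a time: \<open>block N\<close> does not see lower degrees, so a multiple of
  it repairs the top moment without spoiling the others. The constant depends on the number of
  moments only.\<close>

lemma realize_moments:
  "\<exists>C>0. \<forall>l c B (\<Lambda>::complex poly \<Rightarrow> complex). l \<ge> 1 \<longrightarrow> B \<ge> 0 \<longrightarrow>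
     (\<forall>q r. \<Lambda> (q + r) = \<Lambda> q + \<Lambda> r) \<longrightarrow> (\<forall>a q. \<Lambda> (smult a q) = a * \<Lambda> q) \<longrightarrow>
     (\<forall>j<N. norm (\<Lambda> ([:- of_int c, 1:] ^ j)) \<le> B * of_int l ^ Suc j) \<longrightarrow>
     (\<exists>g. (\<forall>n. n \<notin> {c..<c + int N * l} \<longrightarrow> g n = 0) \<and> (\<forall>n. norm (g n) \<le> C * B) \<and>
        (\<forall>q. (\<forall>i\<ge>N. coeff q i = 0) \<longrightarrow> ((\<lambda>n. poly q (of_int n) * g n) has_sum \<Lambda> q) UNIV))"
proof (induction N)
  case 0
  show ?case
  proof (rule exI[of _ 1], intro conjI allI impI)
    fix l c :: int and B :: real and \<Lambda> :: "complex poly \<Rightarrow> complex"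
    assume L: "l \<ge> 1" "B \<ge> 0" "\<forall>a q. \<Lambda> (smult a q) = a * \<Lambda> q"
    have "\<Lambda> 0 = 0" using L(3)[rule_format, of 0 0] by simp
    moreover have "q = 0" if "\<forall>i\<ge>0. coeff q i = 0" for q :: "complex poly"
      using that by (simp add: poly_eq_iff)
    ultimately show "\<exists>g. (\<forall>n. n \<notin> {c..<c + int 0 * l} \<longrightarrow> g n = 0) \<and> (\<forall>n. norm (g n) \<le> 1 * B) \<and>
        (\<forall>q. (\<forall>i\<ge>0. coeff q i = 0) \<longrightarrow> ((\<lambda>n. poly q (of_int n) * g n) has_sum \<Lambda> q) UNIV)"
      using L by (intro exI[of _ "\<lambda>n. 0"]) (metis (no_types, lifting) mult_1 mult_zero_right norm_zero has_sum_0)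
  qed simp
next
  case (Suc N)
  then obtain C where C: "C > 0" "\<And>l c B (\<Lambda>::complex poly \<Rightarrow> complex). l \<ge> 1 \<Longrightarrow> B \<ge> 0 \<Longrightarrow>
     (\<forall>q r. \<Lambda> (q + r) = \<Lambda> q + \<Lambda> r) \<Longrightarrow> (\<forall>a q. \<Lambda> (smult a q) = a * \<Lambda> q) \<Longrightarrow>
     (\<forall>j<N. norm (\<Lambda> ([:- of_int c, 1:] ^ j)) \<le> B * of_int l ^ Suc j) \<Longrightarrow>
     (\<exists>g. (\<forall>n. n \<notin> {c..<c + int N * l} \<longrightarrow> g n = 0) \<and> (\<forall>n. norm (g n) \<le> C * B) \<and>
        (\<forall>q. (\<forall>i\<ge>N. coeff q i = 0) \<longrightarrow> ((\<lambda>n. poly q (of_int n) * g n) has_sum \<Lambda> q) UNIV))"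
    by blast
  \<comment> \<open>\<open>2 ^ N\<close> bounds the block; the bracket bounds the required top
    moment plus the top moment already produced by a function of size \<open>C * B\<close> on
    \<open>N\<close> blocks.\<close>
  define D where "D = (1 + real N ^ Suc N * C) * 2 ^ N"
  have D: "D \<ge> 0" using C(1) by (simp add: D_def)
  show ?case
  proof (rule exI[of _ "C + D"], intro conjI allI impI)
    show "C + D > 0" using C(1) D by simp
    fix l c :: int and B :: real and \<Lambda> :: "complex poly \<Rightarrow> complex"
    assume l: "l \<ge> 1" and B: "B \<ge> 0" and add: "\<forall>q r. \<Lambda> (q + r) = \<Lambda> q + \<Lambda> r" and sm: "\<forall>a q. \<Lambda> (smult a q) = a * \<Lambda> q"
      and bd: "\<forall>j<Suc N. norm (\<Lambda> ([:- of_int c, 1:] ^ j)) \<le> B * of_int l ^ Suc j"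
    obtain g where g: "\<And>n. n \<notin> {c..<c + int N * l} \<Longrightarrow> g n = 0" "\<And>n. norm (g n) \<le> C * B"
        "\<And>q. (\<forall>i\<ge>N. coeff q i = 0) \<Longrightarrow> ((\<lambda>n. poly q (of_int n) * g n) has_sum \<Lambda> q) UNIV"
      using C(2)[OF l B add sm, of c] bd by (auto simp: less_Suc_eq)
    define X :: "complex poly" where "X = [:- of_int c, 1:] ^ N"
    have X: "coeff X N = 1" "\<forall>i>N. coeff X i = 0"
    proof -
      have "degree X = N" unfolding X_def by (simp add: degree_power_eq)
      moreover have "lead_coeff X = 1" unfolding X_def by (simp add: lead_coeff_power)
      ultimately show "coeff X N = 1" "\<forall>i>N. coeff X i = 0" by (auto simp: coeff_eq_0)
    qed
    have X_eval: "poly X (of_int n) = of_int (n - c) ^ N" for n by (simp add: X_def poly_power)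
    define G where "G = (\<lambda>q. \<Sum>n\<in>{c..<c + int N * l}. poly q (of_int n) * g n)"
    have G: "((\<lambda>n. poly q (of_int n) * g n) has_sum G q) UNIV" for q
      unfolding G_def by (rule has_sum_finite_support) (use g(1) in auto)
    \<comment> \<open>The discrepancy in the top moment left by the function that matches the lower
      ones.\<close>
    define \<mu> where "\<mu> = \<Lambda> X - G X"
    define e where "e = (\<lambda>n. \<mu> / (fact N * of_int l ^ Suc N) * block N c l n)"
    have l0: "real_of_int l > 0" using l by simp
    have "norm (G X) \<le> (\<Sum>n\<in>{c..<c + int N * l}. (real N * of_int l) ^ N * (C * B))"
      unfolding G_def
    proof (rule sum_norm_le)
      fix n assume n: "n \<in> {c..<c + int N * l}"
      have "real_of_int (n - c) \<le> real_of_int (int N * l)" using n by (intro of_int_le_iff[THEN iffD2]) auto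
      then have "\<bar>real_of_int (n - c)\<bar> ^ N \<le> (real N * of_int l) ^ N" using n by (intro power_mono) auto
      then have "norm (poly X (of_int n)) \<le> (real N * of_int l) ^ N"
        unfolding X_eval by (simp only: norm_power norm_of_int)
      then show "norm (poly X (of_int n) * g n) \<le> (real N * of_int l) ^ N * (C * B)"
        unfolding norm_mult using g(2) l0 by (intro mult_mono) auto
    qed
    also have "\<dots> = (real N * of_int l) * ((real N * of_int l) ^ N * (C * B))" using l by simp
    also have "\<dots> = real N ^ Suc N * C * (B * of_int l ^ Suc N)" by (simp add: power_mult_distrib mult_ac)
    finally have "norm \<mu> \<le> B * of_int l ^ Suc N + real N ^ Suc N * C * (B * of_int l ^ Suc N)"
      unfolding \<mu>_def using bd[rule_format, of N] norm_triangle_ineq4[of "\<Lambda> X" "G X"] by (simp add: X_def)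
    then have \<mu>: "norm \<mu> \<le> (1 + real N ^ Suc N * C) * B * of_int l ^ Suc N" by (simp add: algebra_simps)
    have eb: "norm (e n) \<le> D * B" for n
    proof -
      have "1 * real_of_int l ^ Suc N \<le> fact N * of_int l ^ Suc N" using l0 by (intro mult_right_mono) auto
      then have "norm \<mu> \<le> (1 + real N ^ Suc N * C) * B * (fact N * of_int l ^ Suc N)"
        using \<mu> C(1) B by (smt (verit) mult_left_mono mult_nonneg_nonneg of_nat_0_le_iff zero_le_power)
      then have "norm \<mu> / (fact N * real_of_int l ^ Suc N) \<le> (1 + real N ^ Suc N * C) * B"
        using l0 by (simp add: pos_divide_le_eq)
      then have "norm (\<mu> / (fact N * of_int l ^ Suc N)) * norm (block N c l n) \<le> ((1 + real N ^ Suc N * C) * B) * 2 ^ N"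
        using l C(1) B by (intro mult_mono norm_block) (auto simp: norm_divide norm_mult norm_power)
      then show ?thesis unfolding e_def D_def by (simp only: norm_mult mult_ac)
    qed
    have em: "((\<lambda>n. poly q (of_int n) * e n) has_sum \<mu> * coeff q N) UNIV" if q: "\<forall>i>N. coeff q i = 0" for q
    proof -
      have "(\<lambda>n. poly q (of_int n) * e n) = (\<lambda>n. \<mu> / (fact N * of_int l ^ Suc N) * (poly q (of_int n) * block N c l n))"
        by (simp add: e_def fun_eq_iff)
      moreover have "\<mu> / (fact N * of_int l ^ Suc N) * (fact N * of_int l ^ Suc N * coeff q N) = \<mu> * coeff q N"
        using l by simp
      ultimately show ?thesis using has_sum_cmult_right[OF block_moments[OF l q, of c], of "\<mu> / (fact N * of_int l ^ Suc N)"]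
        by (simp only:)
    qed
    show "\<exists>g. (\<forall>n. n \<notin> {c..<c + int (Suc N) * l} \<longrightarrow> g n = 0) \<and> (\<forall>n. norm (g n) \<le> (C + D) * B) \<and>
        (\<forall>q. (\<forall>i\<ge>Suc N. coeff q i = 0) \<longrightarrow> ((\<lambda>n. poly q (of_int n) * g n) has_sum \<Lambda> q) UNIV)"
    proof (intro exI[of _ "\<lambda>n. g n + e n"] conjI allI impI)
      fix n
      have "norm (g n + e n) \<le> C * B + D * B" by (rule norm_triangle_le) (intro add_mono g eb)
      then show "norm (g n + e n) \<le> (C + D) * B" by (simp add: ring_distribs)
      assume n: "n \<notin> {c..<c + int (Suc N) * l}"
      have "n \<notin> {c..<c + int N * l}" using n l by (auto simp: algebra_simps)
      moreover have "block N c l n = 0" using n block_support[OF l, of n c N] by (simp add: algebra_simps)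
      ultimately show "g n + e n = 0" using g(1) by (simp add: e_def)
    next
      fix q :: "complex poly" assume q: "\<forall>i\<ge>Suc N. coeff q i = 0"
      define r where "r = q - smult (coeff q N) X"
      have r: "\<forall>i\<ge>N. coeff r i = 0"
      proof (intro allI impI)
        fix i assume "i \<ge> N" then show "coeff r i = 0" using X q by (cases "i = N") (auto simp: r_def)
      qed
      have "q = r + smult (coeff q N) X" by (simp add: r_def)
      then have "\<Lambda> q = \<Lambda> r + coeff q N * \<Lambda> X" using add sm by metis
      moreover have "G q = \<Lambda> r + coeff q N * G X"
      proof -
        have "G r = \<Lambda> r" using g(3)[OF r] G has_sum_unique by blast
        moreover have "G q = G r + coeff q N * G X"
          by (simp add: G_def r_def sum_distrib_left algebra_simps flip: sum.distrib)
        ultimately show ?thesis by simp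
      qed
      ultimately have "G q + \<mu> * coeff q N = \<Lambda> q" by (simp add: \<mu>_def algebra_simps)
      moreover have "((\<lambda>n. poly q (of_int n) * g n + poly q (of_int n) * e n) has_sum G q + \<mu> * coeff q N) UNIV"
        by (intro has_sum_add G em) (use q in auto)
      ultimately show "((\<lambda>n. poly q (of_int n) * (g n + e n)) has_sum \<Lambda> q) UNIV"
        by (simp add: ring_distribs)
    qed
  qed
qed

text \<open>Replaces the polynomial projection of a Calderon-Zygmund decomposition: subtracting
  \<open>g\<close> removes the moments on the interval, while the supremum of \<open>g\<close> is
  controlled by the mean of \<open>|a|\<close>. The moments of \<open>a\<close> are realised on
  \<open>Suc N\<close> blocks inside the interval.\<close>

lemma poly_projection:
  "\<exists>C>0. \<forall>a::int \<Rightarrow> complex. \<forall>c. \<forall>L\<ge>1. \<exists>g. (\<forall>n. n \<notin> {c..<c + L} \<longrightarrow> g n = 0) \<and>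
     (\<forall>n. norm (g n) \<le> C * (\<Sum>n\<in>{c..<c + L}. norm (a n)) / of_int L) \<and>
     annihilates N (\<lambda>n. (if n \<in> {c..<c + L} then a n else 0) - g n)"
proof -
  obtain C where C: "C > 0" "\<And>l c B (\<Lambda>::complex poly \<Rightarrow> complex). l \<ge> 1 \<Longrightarrow> B \<ge> 0 \<Longrightarrow>
     (\<forall>q r. \<Lambda> (q + r) = \<Lambda> q + \<Lambda> r) \<Longrightarrow> (\<forall>a q. \<Lambda> (smult a q) = a * \<Lambda> q) \<Longrightarrow>
     (\<forall>j<Suc N. norm (\<Lambda> ([:- of_int c, 1:] ^ j)) \<le> B * of_int l ^ Suc j) \<Longrightarrow>
     (\<exists>g. (\<forall>n. n \<notin> {c..<c + int (Suc N) * l} \<longrightarrow> g n = 0) \<and> (\<forall>n. norm (g n) \<le> C * B) \<and>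
        (\<forall>q. (\<forall>i\<ge>Suc N. coeff q i = 0) \<longrightarrow> ((\<lambda>n. poly q (of_int n) * g n) has_sum \<Lambda> q) UNIV))"
    using realize_moments[of "Suc N"] by blast
  \<comment> \<open>Bounds the ratio of \<open>L\<close> to the block length \<open>l\<close>:
    rounding \<open>L / (N + 1)\<close> down loses at most a factor 2 once at least one block length
    fits.\<close>
  define A where "A = 2 * (real N + 1)"
  have A: "A \<ge> 1" by (simp add: A_def)
  define D where "D = C * A ^ Suc N + A"
  show ?thesis
  proof (rule exI[of _ D], intro conjI allI impI)
    show "D > 0" using C(1) A by (simp add: D_def add_pos_pos)
    fix a :: "int \<Rightarrow> complex" and c L :: int assume L: "L \<ge> 1"
    define S where "S = (\<Sum>n\<in>{c..<c + L}. norm (a n))"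
    have S: "S \<ge> 0" by (simp add: S_def sum_nonneg)
    define a' where "a' = (\<lambda>n. if n \<in> {c..<c + L} then a n else 0)"
    have a': "((\<lambda>n. poly q (of_int n) * a' n) has_sum (\<Sum>n\<in>{c..<c + L}. poly q (of_int n) * a n)) UNIV" for q
    proof -
      have "((\<lambda>n. poly q (of_int n) * a' n) has_sum (\<Sum>n\<in>{c..<c + L}. poly q (of_int n) * a' n)) UNIV"
        by (rule has_sum_finite_support) (auto simp: a'_def)
      then show ?thesis by (simp add: a'_def)
    qed
    have "\<exists>g. (\<forall>n. n \<notin> {c..<c + L} \<longrightarrow> g n = 0) \<and> (\<forall>n. norm (g n) \<le> D * S / of_int L) \<and> annihilates N (\<lambda>n. a' n - g n)"
    proof (cases "L < int (Suc N)")
      \<comment> \<open>The interval is too short for \<open>N + 1\<close> blocks. The truncation of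
        \<open>a\<close> to it serves as its own projection, and its values are bounded by the mean
        because \<open>L\<close> is bounded in terms of \<open>N\<close>.\<close>
      case True
      have "norm (a' n) \<le> D * S / of_int L" for n
      proof -
        have "norm (a' n) \<le> S"
          unfolding a'_def S_def by (auto intro!: member_le_sum[where f="\<lambda>n. norm (a n)"] sum_nonneg)
        moreover have "real_of_int L * S \<le> D * S"
        proof (rule mult_right_mono[OF _ S])
          have "real_of_int L \<le> A" using True by (simp add: A_def)
          moreover have "0 \<le> C * A ^ Suc N" using C(1) A by simp
          ultimately show "real_of_int L \<le> D" by (simp add: D_def)
        qed
        then have "S \<le> D * S / of_int L" using L by (simp add: pos_le_divide_eq mult.commute)
        ultimately show ?thesis by simp
      qed
      then show ?thesis by (intro exI[of _ a']) (auto simp: a'_def)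
    next
      case False
      define l where "l = L div int (Suc N)"
      have l: "l \<ge> 1" using False by (simp add: l_def pos_imp_zdiv_pos_iff int_one_le_iff_zero_less)
      have lL: "int (Suc N) * l \<le> L" unfolding l_def
        by (smt (verit) mult_div_mod_eq pos_mod_sign of_nat_0_less_iff zero_less_Suc)
      have "L < int (Suc N) * l + int (Suc N)" unfolding l_def
        by (metis mult_div_mod_eq add_strict_left_mono pos_mod_bound of_nat_0_less_iff zero_less_Suc)
      moreover have "int (Suc N) * 1 \<le> int (Suc N) * l" using l by (intro mult_left_mono) auto
      moreover have "L \<le> 2 * w" if "L < w + k" "k * 1 \<le> w" for w k :: int using that by simp
      ultimately have "L \<le> 2 * (int (Suc N) * l)" by blast
      then have LA: "real_of_int L \<le> A * of_int l"
        unfolding A_def by (metis (no_types, opaque_lifting) of_int_le_iff of_int_mult of_int_of_nat_eq of_int_numeral of_nat_Suc mult.assoc add.commute)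
      define B where "B = A ^ N * S / of_int l"
      have B: "B \<ge> 0" using S A l by (simp add: B_def)
      define \<Lambda> where "\<Lambda> = (\<lambda>q. \<Sum>n\<in>{c..<c + L}. poly q (of_int n) * a n)"
      have "norm (\<Lambda> ([:- of_int c, 1:] ^ j)) \<le> B * of_int l ^ Suc j" if j: "j < Suc N" for j
      proof -
        have "norm (\<Lambda> ([:- of_int c, 1:] ^ j)) \<le> (\<Sum>n\<in>{c..<c + L}. of_int L ^ j * norm (a n))"
          unfolding \<Lambda>_def
        proof (rule sum_norm_le)
          fix n assume n: "n \<in> {c..<c + L}"
          have "poly ([:- of_int c, 1:] ^ j) (of_int n :: complex) = of_int (n - c) ^ j" by (simp add: poly_power)
          moreover have "\<bar>real_of_int (n - c)\<bar> ^ j \<le> of_int L ^ j" using n by (intro power_mono) auto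
          ultimately have "norm (poly ([:- of_int c, 1:] ^ j) (of_int n :: complex)) \<le> of_int L ^ j"
            by (simp only: norm_power norm_of_int)
          then show "norm (poly ([:- of_int c, 1:] ^ j) (of_int n) * a n) \<le> of_int L ^ j * norm (a n)"
            unfolding norm_mult by (intro mult_right_mono) auto
        qed
        also have "\<dots> = of_int L ^ j * S" by (simp add: S_def sum_distrib_left)
        also have "\<dots> \<le> (A * of_int l) ^ j * S" using LA L S by (intro mult_right_mono power_mono) auto
        also have "\<dots> \<le> A ^ N * of_int l ^ j * S"
          unfolding power_mult_distrib using A l S j by (intro mult_right_mono power_increasing) auto
        also have "\<dots> = B * of_int l ^ Suc j" using l by (simp add: B_def)
        finally show ?thesis .
      qed
      then obtain g where g: "\<And>n. n \<notin> {c..<c + int (Suc N) * l} \<Longrightarrow> g n = 0" "\<And>n. norm (g n) \<le> C * B"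
        "\<And>q. (\<forall>i\<ge>Suc N. coeff q i = 0) \<Longrightarrow> ((\<lambda>n. poly q (of_int n) * g n) has_sum \<Lambda> q) UNIV"
        using C(2)[OF l B, of \<Lambda> c] by (auto simp: \<Lambda>_def ring_distribs sum.distrib sum_distrib_left mult.assoc)
      have "g n = 0" if "n \<notin> {c..<c + L}" for n using that lL by (intro g) auto
      moreover have "norm (g n) \<le> D * S / of_int L" for n
      proof -
        have "1 / real_of_int l \<le> A / of_int L" using LA l L by (simp add: field_simps)
        then have "B \<le> A ^ N * S * (A / of_int L)"
          unfolding B_def using A S mult_left_mono[of "1 / real_of_int l" "A / of_int L" "A ^ N * S"] by simp
        then have "C * B \<le> C * (A ^ N * S * (A / of_int L))" using C(1) by (intro mult_left_mono) auto
        also have "\<dots> = (C * A ^ Suc N) * (S / of_int L)" by simp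
        also have "\<dots> \<le> D * (S / of_int L)" using S L A by (intro mult_right_mono) (auto simp: D_def)
        finally show ?thesis using g(2)[of n] by simp
      qed
      moreover have "annihilates N (\<lambda>n. a' n - g n)"
        unfolding annihilates_def
      proof (intro allI impI)
        fix q :: "complex poly" assume "degree q \<le> N"
        then have "\<forall>i\<ge>Suc N. coeff q i = 0" by (auto intro: coeff_eq_0)
        from has_sum_minus[OF a'[of q] g(3)[OF this]]
        show "((\<lambda>n. poly q (of_int n) * (a' n - g n)) has_sum 0) UNIV"
          by (simp add: \<Lambda>_def ring_distribs)
      qed
      ultimately show ?thesis by blast
    qed
    then show "\<exists>g. (\<forall>n. n \<notin> {c..<c + L} \<longrightarrow> g n = 0) \<and>
       (\<forall>n. norm (g n) \<le> D * (\<Sum>n\<in>{c..<c + L}. norm (a n)) / of_int L) \<and>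
       annihilates N (\<lambda>n. (if n \<in> {c..<c + L} then a n else 0) - g n)"
      by (simp add: a'_def S_def)
  qed
qed

section \<open>Atomic sums\<close>

locale hardy_exponent =
  fixes p :: real
  assumes p0: "0 < p" and p1: "p \<le> 1"
begin

definition N :: nat where "N = nat \<lfloor>1 / p - 1\<rfloor>"

lemma N_iff: "real \<alpha> \<le> 1 / p - 1 \<longleftrightarrow> \<alpha> \<le> N"
proof -
  have "1 / p - 1 \<ge> 0" using p0 p1 by (simp add: field_simps)
  then have "\<alpha> \<le> nat \<lfloor>1 / p - 1\<rfloor> \<longleftrightarrow> int \<alpha> \<le> \<lfloor>1 / p - 1\<rfloor>"
    by (intro le_nat_iff) simp
  then show ?thesis unfolding N_def by (simp only: le_floor_iff of_int_of_nat_eq)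
qed

text \<open>By maximality \<open>N + 1\<close> exceeds \<open>1 / p - 1\<close>. This strict
  inequality is what makes decay of order \<open>N + 2\<close> summable in the p-th power.\<close>

lemma N_gt: "p * (real N + 2) > 1"
proof -
  have "\<not> Suc N \<le> N" by simp
  then have "real (Suc N) > 1 / p - 1" using N_iff[of "Suc N"] by linarith
  then have "real N + 2 > 1 / p" by simp
  then show ?thesis using p0 by (simp add: field_simps)
qed

definition batom :: "(int \<Rightarrow> complex) \<Rightarrow> bool" where
  "batom a \<longleftrightarrow> (\<exists>c d. c \<le> d \<and> (\<forall>n. n \<notin> {c..d} \<longrightarrow> a n = 0) \<and>
     (\<forall>n. norm (a n) \<le> real (card {c..d}) powr (- (1 / p))) \<and> annihilates N a)"

lemma batom_norm: assumes "batom a" shows "norm (a n) \<le> 1"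
proof -
  obtain c d where H: "c \<le> d \<and> (\<forall>n. n \<notin> {c..d} \<longrightarrow> a n = 0) \<and>
     (\<forall>n. norm (a n) \<le> real (card {c..d}) powr (- (1 / p))) \<and> annihilates N a"
    using assms unfolding batom_def by (elim exE)
  then have cd: "c \<le> d" "norm (a n) \<le> real (card {c..d}) powr (- (1 / p))" by (blast, metis)
  have "real (card {c..d}) powr (- (1 / p)) \<le> 1"
    using cd(1) p0 by (simp add: powr_minus_divide ge_one_powr_ge_zero)
  then show ?thesis using cd by linarith
qed

lemma batom_0: "batom (\<lambda>n. 0)"
  unfolding batom_def by (rule exI[of _ 0], rule exI[of _ 0]) simp

text \<open>\<open>B\<close> bounds a p-th power, so that bounds add up under sums of functions.
  Pointwise \<open>has_sum\<close> is a convenient demand: the atoms are bounded and the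
  coefficients are absolutely summable, so stronger convergence follows.\<close>

definition asum :: "real \<Rightarrow> (int \<Rightarrow> complex) \<Rightarrow> bool" where
  "asum B f \<longleftrightarrow> (\<exists>c a. (\<forall>j::nat. batom (a j)) \<and> summable (\<lambda>j. norm (c j :: complex) powr p) \<and>
     (\<Sum>j. norm (c j) powr p) \<le> B \<and> (\<forall>n. ((\<lambda>j. c j * a j n) has_sum f n) UNIV))"

lemma asum_mono: "asum B f \<Longrightarrow> B \<le> B' \<Longrightarrow> asum B' f"
  unfolding asum_def by (meson order_trans)

lemma asum_nonneg: "asum B f \<Longrightarrow> B \<ge> 0"
  unfolding asum_def by (meson order_trans suminf_nonneg powr_ge_zero)

lemma asum_0: "asum 0 (\<lambda>n. 0)"
  unfolding asum_def
  by (rule exI[of _ "\<lambda>j. 0"], rule exI[of _ "\<lambda>j n. 0"]) (simp add: batom_0)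

text \<open>The embedding of l^p into l^1, one term at a time: with \<open>S\<close> the total p-th
  power mass, the right side is a summable majorant.\<close>

lemma le_powr_scaled:
  assumes "0 \<le> x" "x powr p \<le> S"
  shows "x \<le> x powr p * S powr ((1 - p) / p)"
proof (cases "x = 0")
  case False
  then have x: "x > 0" using assms by simp
  have "x = x powr p * x powr (1 - p)" using x by (simp flip: powr_add)
  also have "x powr (1 - p) = (x powr p) powr ((1 - p) / p)" using p0 by (simp add: powr_powr)
  also have "\<dots> \<le> S powr ((1 - p) / p)" using assms p0 p1 by (intro powr_mono2) auto
  finally show ?thesis by (simp add: mult_left_mono)
qed simp

lemma has_sum_nat_iff_sums:
  fixes f :: "nat \<Rightarrow> real"
  assumes "\<And>n. f n \<ge> 0"
  shows "(f has_sum S) UNIV \<longleftrightarrow> f sums S"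
proof
  assume S: "f sums S"
  then have "summable (\<lambda>n. norm (f n))" using assms by (simp add: sums_summable)
  from norm_summable_imp_has_sum[OF this S] show "(f has_sum S) UNIV" .
qed (rule has_sum_imp_sums)

text \<open>The p-th powers of all coefficients form a summable double family.
  \<open>le_powr_scaled\<close> makes the double family of values absolutely summable, so the two
  summations may be merged into one.\<close>

lemma asum_countable:
  fixes f :: "'i::countable \<Rightarrow> int \<Rightarrow> complex"
  assumes f: "\<And>i. asum (B i) (f i)" and B: "(B has_sum S) UNIV"
    and g: "\<And>n. ((\<lambda>i. f i n) has_sum g n) UNIV"
  shows "asum S g"
proof -
  have "\<forall>i. \<exists>c a. (\<forall>j::nat. batom (a j)) \<and> summable (\<lambda>j. norm (c j :: complex) powr p) \<and>
     (\<Sum>j. norm (c j) powr p) \<le> B i \<and> (\<forall>n. ((\<lambda>j. c j * a j n) has_sum f i n) UNIV)"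
    using f by (simp add: asum_def)
  then obtain c a where ca: "\<And>i (j::nat). batom (a i j)" "\<And>i. summable (\<lambda>j. norm (c i j :: complex) powr p)"
     "\<And>i. (\<Sum>j. norm (c i j) powr p) \<le> B i" "\<And>i n. ((\<lambda>j. c i j * a i j n) has_sum f i n) UNIV"
    by (simp only: choice_iff) blast
  define b where "b = (\<lambda>i. \<Sum>j. norm (c i j) powr p)"
  have b: "((\<lambda>j. norm (c i j) powr p) has_sum b i) UNIV" for i
    unfolding b_def using ca(2)[of i] by (subst has_sum_nat_iff_sums) (auto simp: summable_sums)
  have b0: "b i \<ge> 0" for i by (rule has_sum_nonneg[OF b]) auto
  have bs: "b summable_on UNIV"
    by (rule summable_on_comparison_test[OF has_sum_imp_summable[OF B]]) (use ca(3) b0 in \<open>auto simp: b_def\<close>)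
  have P: "(\<lambda>(i, j). norm (c i j) powr p) summable_on (UNIV \<times> UNIV)"
    by (rule summable_on_SigmaI[where g=b]) (use b bs in auto)
  define T where "T = infsum (\<lambda>(i, j). norm (c i j) powr p) (UNIV \<times> UNIV)"
  have T: "((\<lambda>(i, j). norm (c i j) powr p) has_sum T) (UNIV \<times> UNIV)"
    using P by (simp add: T_def)
  have "(b has_sum T) UNIV"
    by (rule has_sum_SigmaD[OF T]) (simp add: b)
  then have TS: "T \<le> S" by (rule has_sum_mono[OF _ B]) (use ca(3) in \<open>simp add: b_def\<close>)
  have cT: "norm (c i j) powr p \<le> T" for i j
    using finite_sum_le_has_sum[OF T, of "{(i, j)}"] by auto
  have "(\<lambda>x. (case x of (i, j) \<Rightarrow> norm (c i j) powr p) * T powr ((1 - p) / p)) summable_on (UNIV \<times> UNIV)"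
    by (rule summable_on_cmult_left[OF P])
  then have "(\<lambda>(i, j). c i j * a i j n) summable_on (UNIV \<times> UNIV)" for n
  proof (rule summable_on_norm_bound)
    fix x :: "'i \<times> nat"
    obtain i j where x: "x = (i, j)" by (cases x)
    have "norm (c i j * a i j n) \<le> norm (c i j) * 1"
      unfolding norm_mult by (intro mult_left_mono batom_norm ca) auto
    also have "\<dots> \<le> norm (c i j) powr p * T powr ((1 - p) / p)"
      using le_powr_scaled[OF _ cT] by simp
    finally show "norm (case x of (i, j) \<Rightarrow> c i j * a i j n) \<le> (case x of (i, j) \<Rightarrow> norm (c i j) powr p) * T powr ((1 - p) / p)"
      by (simp add: x)
  qed
  then have G: "((\<lambda>(i, j). c i j * a i j n) has_sum g n) (UNIV \<times> UNIV)" for n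
    by (intro has_sum_SigmaI[OF _ g]) (simp add: ca(4))
  \<comment> \<open>The enumeration \<open>to_nat\<close> need not be onto; indices outside its
    range receive the coefficient 0.\<close>
  define C where "C = (\<lambda>k. if k \<in> range (to_nat :: 'i \<times> nat \<Rightarrow> nat) then case_prod c (from_nat k) else 0)"
  define A where "A = (\<lambda>k. case_prod a (from_nat k :: 'i \<times> nat))"
  have re: "(F has_sum s) UNIV" if F0: "\<And>k. k \<notin> range (to_nat :: 'i \<times> nat \<Rightarrow> nat) \<Longrightarrow> F k = 0"
    and "((\<lambda>x. F (to_nat (x :: 'i \<times> nat))) has_sum s) UNIV" for F :: "nat \<Rightarrow> 'b::real_normed_vector" and s
  proof -
    have "(F has_sum s) (range (to_nat :: 'i \<times> nat \<Rightarrow> nat))"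
      using that(2) has_sum_reindex[OF inj_to_nat[where 'a="'i \<times> nat"], of F s] by (simp add: o_def)
    then show ?thesis
      by (rule has_sum_cong_neutral[THEN iffD1, rotated -1]) (use F0 in auto)
  qed
  have 1: "((\<lambda>k. norm (C k) powr p) has_sum T) UNIV"
    by (rule re) (use T in \<open>auto simp: C_def case_prod_unfold\<close>)
  have 2: "((\<lambda>k. C k * A k n) has_sum g n) UNIV" for n
    by (rule re) (use G in \<open>auto simp: C_def A_def case_prod_unfold\<close>)
  have "(\<lambda>k. norm (C k) powr p) sums T" using 1 by (subst (asm) has_sum_nat_iff_sums) auto
  then have "summable (\<lambda>k. norm (C k) powr p)" "(\<Sum>k. norm (C k) powr p) \<le> S"
    using TS by (auto simp: sums_iff)
  moreover have "batom (A k)" for k by (simp add: A_def case_prod_unfold ca)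
  ultimately show ?thesis unfolding asum_def using 2 by blast
qed

lemma asum_finite:
  fixes f :: "'i::countable \<Rightarrow> int \<Rightarrow> complex"
  assumes "finite I" "\<And>i. i \<in> I \<Longrightarrow> asum (B i) (f i)"
  shows "asum (\<Sum>i\<in>I. B i) (\<lambda>n. \<Sum>i\<in>I. f i n)"
proof (rule asum_countable[of "\<lambda>i. if i \<in> I then B i else 0" "\<lambda>i n. if i \<in> I then f i n else 0"])
  have fin: "((\<lambda>i. if i \<in> I then F i else 0) has_sum (\<Sum>i\<in>I. F i)) UNIV" for F :: "'i \<Rightarrow> 'b::real_normed_vector"
  proof -
    have "((\<lambda>i. if i \<in> I then F i else 0) has_sum (\<Sum>i\<in>I. F i)) I"
      using assms(1) by (intro has_sum_finiteI) auto
    then show ?thesis by (rule has_sum_cong_neutral[THEN iffD1, rotated -1]) auto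
  qed
  show "((\<lambda>i. if i \<in> I then B i else 0) has_sum (\<Sum>i\<in>I. B i)) UNIV" by (rule fin)
  show "((\<lambda>i. if i \<in> I then f i n else 0) has_sum (\<Sum>i\<in>I. f i n)) UNIV" for n by (rule fin)
  show "asum (if i \<in> I then B i else 0) (\<lambda>n. if i \<in> I then f i n else 0)" for i
    using assms(2) asum_0 by auto
qed

lemma asum_add:
  assumes "asum A f" "asum B g"
  shows "asum (A + B) (\<lambda>n. f n + g n)"
  using asum_finite[of "UNIV :: bool set" "\<lambda>b. if b then A else B" "\<lambda>b. if b then f else g"] assms
  by (simp add: UNIV_bool add.commute)

text \<open>A single multiple of an atom: dividing by \<open>B\<close> times the length to the power
  \<open>1 / p\<close> normalises \<open>f\<close>, and the p-th power of that factor is the stated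
  cost.\<close>

lemma asum_bounded:
  assumes cd: "c \<le> d" and f: "\<And>n. n \<notin> {c..d} \<Longrightarrow> f n = 0" "\<And>n. norm (f n) \<le> B" "annihilates N f"
  shows "asum (B powr p * real (card {c..d})) f"
proof (cases "B > 0")
  case False
  then have "f = (\<lambda>n. 0)" using f(2) by (metis norm_le_zero_iff order_trans not_le_imp_less ext)
  then show ?thesis by (auto intro: asum_mono[OF asum_0])
next
  case True
  define L where "L = real (card {c..d})"
  have L: "L \<ge> 1" using cd by (simp add: L_def)
  define r where "r = B * L powr (1 / p)"
  have r: "r > 0" using True L by (simp add: r_def)
  define a where "a = (\<lambda>n. f n / of_real r)"
  have "batom a"
    unfolding batom_def
  proof (intro exI conjI allI impI)
    show "norm (a n) \<le> real (card {c..d}) powr (- (1 / p))" for n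
    proof -
      have "norm (a n) \<le> B / r" using f(2)[of n] r by (simp add: a_def norm_divide divide_right_mono)
      also have "\<dots> = L powr (- (1 / p))" using True by (simp add: r_def powr_minus_divide)
      finally show ?thesis by (simp add: L_def)
    qed
    show "annihilates N a" using annihilates_cmult[OF f(3), of "1 / of_real r"] by (simp add: a_def)
  qed (use cd f in \<open>auto simp: a_def\<close>)
  define C where "C = (\<lambda>j::nat. if j = 0 then complex_of_real r else 0)"
  have z: "((\<lambda>j::nat. if j = 0 then v else 0) has_sum v) UNIV" for v :: "'b::real_normed_vector"
  proof -
    have "((\<lambda>j::nat. if j = 0 then v else 0) has_sum v) {0}" by (rule has_sum_finiteI) auto
    then show ?thesis by (rule has_sum_cong_neutral[THEN iffD1, rotated -1]) auto
  qed
  have "(\<lambda>j. norm (C j) powr p) sums (r powr p)"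
    using z[of "r powr p"] r by (intro has_sum_imp_sums) (simp add: C_def if_distrib[of norm] if_distrib[of "\<lambda>x. x powr p"] cong: if_cong)
  moreover have "r powr p = B powr p * L"
    using True L p0 by (simp add: r_def powr_mult powr_powr)
  moreover have "((\<lambda>j. C j * a n) has_sum f n) UNIV" for n
  proof -
    have "(\<lambda>j. C j * a n) = (\<lambda>j. if j = 0 then f n else 0)"
      using r by (auto simp: C_def a_def fun_eq_iff)
    then show ?thesis using z[of "f n"] by simp
  qed
  ultimately show ?thesis unfolding asum_def using \<open>batom a\<close>
    by (intro exI[of _ C] exI[of _ "\<lambda>j. a"]) (auto simp: sums_iff L_def)
qed

section \<open>From integrable to bounded atoms\<close>

text \<open>Left end and exponent of the length. The left end is arbitrary, not a multiple of the
  length, because only halvings of one given interval are considered.\<close>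

definition dyadic_int :: "int \<times> nat \<Rightarrow> int set" where
  "dyadic_int x = {fst x..<fst x + 2 ^ snd x}"

definition cz_family :: "(int \<Rightarrow> real) \<Rightarrow> real \<Rightarrow> int \<times> nat \<Rightarrow> (int \<times> nat) set \<Rightarrow> bool" where
  "cz_family u \<tau> I F \<longleftrightarrow> finite F \<and>
     (\<forall>x\<in>F. dyadic_int x \<subseteq> dyadic_int I \<and> snd x \<le> snd I \<and>
        \<tau> * 2 ^ snd x < sum u (dyadic_int x) \<and> sum u (dyadic_int x) \<le> 2 * \<tau> * 2 ^ snd x) \<and>
     (\<forall>x\<in>F. \<forall>y\<in>F. x \<noteq> y \<longrightarrow> dyadic_int x \<inter> dyadic_int y = {}) \<and>
     (\<forall>n\<in>dyadic_int I - \<Union> (dyadic_int ` F). u n \<le> \<tau>)"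

text \<open>If the mean exceeds \<open>\<tau>\<close>, the interval itself is selected. Otherwise
  each half has mean at most \<open>2 * \<tau>\<close>, which is the premise of the recursion. The
  recursion ends at single points, where an unselected value is at most
  \<open>\<tau>\<close>.\<close>

lemma cz_family_exists:
  assumes u: "\<And>n. u n \<ge> 0"
  shows "sum u (dyadic_int (c, J)) \<le> 2 * \<tau> * 2 ^ J \<Longrightarrow> \<exists>F. cz_family u \<tau> (c, J) F"
proof (induction J arbitrary: c)
  case 0
  have "dyadic_int (c, 0) = {c}" by (auto simp: dyadic_int_def)
  then have "cz_family u \<tau> (c, 0) (if u c \<le> \<tau> then {} else {(c, 0)})"
    using 0 by (auto simp: cz_family_def)
  then show ?case ..
next
  case (Suc J)
  show ?case
  proof (cases "sum u (dyadic_int (c, Suc J)) \<le> \<tau> * 2 ^ Suc J")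
    case False
    then show ?thesis using Suc.prems by (intro exI[of _ "{(c, Suc J)}"]) (simp add: cz_family_def)
  next
    case True
    define A where "A = dyadic_int (c, J)"
    define B where "B = dyadic_int (c + 2 ^ J, J)"
    have split: "dyadic_int (c, Suc J) = A \<union> B" "A \<inter> B = {}" "finite A" "finite B"
      by (auto simp: A_def B_def dyadic_int_def)
    have s: "sum u (dyadic_int (c, Suc J)) = sum u A + sum u B"
      unfolding split(1) by (rule sum.union_disjoint) (use split in auto)
    have n: "sum u X \<ge> 0" for X by (rule sum_nonneg) (use u in auto)
    have "sum u A \<le> 2 * \<tau> * 2 ^ J" "sum u B \<le> 2 * \<tau> * 2 ^ J"
      using True s n[of A] n[of B] by simp_all
    then obtain F1 F2 where F1: "cz_family u \<tau> (c, J) F1" and F2: "cz_family u \<tau> (c + 2 ^ J, J) F2"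
      using Suc.IH[of c] Suc.IH[of "c + 2 ^ J"] unfolding A_def B_def by blast
    have sub: "dyadic_int x \<subseteq> A \<and> snd x \<le> J" if "x \<in> F1" for x using F1 that by (simp add: cz_family_def A_def)
    have sub': "dyadic_int x \<subseteq> B \<and> snd x \<le> J" if "x \<in> F2" for x using F2 that by (simp add: cz_family_def B_def)
    have avg: "\<tau> * 2 ^ snd x < sum u (dyadic_int x) \<and> sum u (dyadic_int x) \<le> 2 * \<tau> * 2 ^ snd x"
      if "x \<in> F1 \<union> F2" for x using that F1 F2 by (auto simp: cz_family_def)
    have dis: "dyadic_int x \<inter> dyadic_int y = {}" if "x \<noteq> y" "x \<in> F1 \<and> y \<in> F1 \<or> x \<in> F2 \<and> y \<in> F2" for x y
    proof -
      have "\<forall>x\<in>F1. \<forall>y\<in>F1. x \<noteq> y \<longrightarrow> dyadic_int x \<inter> dyadic_int y = {}"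
        "\<forall>x\<in>F2. \<forall>y\<in>F2. x \<noteq> y \<longrightarrow> dyadic_int x \<inter> dyadic_int y = {}"
        by (fact F1[unfolded cz_family_def, THEN conjunct2, THEN conjunct2, THEN conjunct1])
          (fact F2[unfolded cz_family_def, THEN conjunct2, THEN conjunct2, THEN conjunct1])
      then show ?thesis using that by metis
    qed
    have off: "u n \<le> \<tau>" if "n \<in> A - \<Union> (dyadic_int ` F1) \<or> n \<in> B - \<Union> (dyadic_int ` F2)" for n
    proof -
      have "\<forall>n\<in>A - \<Union> (dyadic_int ` F1). u n \<le> \<tau>" "\<forall>n\<in>B - \<Union> (dyadic_int ` F2). u n \<le> \<tau>"
        unfolding A_def B_def
        by (fact F1[unfolded cz_family_def, THEN conjunct2, THEN conjunct2, THEN conjunct2])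
          (fact F2[unfolded cz_family_def, THEN conjunct2, THEN conjunct2, THEN conjunct2])
      then show ?thesis using that by metis
    qed
    have "cz_family u \<tau> (c, Suc J) (F1 \<union> F2)"
      unfolding cz_family_def
    proof (intro conjI ballI impI)
      show "finite (F1 \<union> F2)" using F1 F2 by (simp add: cz_family_def)
      fix x assume x: "x \<in> F1 \<union> F2"
      then show "dyadic_int x \<subseteq> dyadic_int (c, Suc J)" using sub sub' split(1) by blast
      show "snd x \<le> snd (c, Suc J)" using sub sub' x by fastforce
      show "\<tau> * 2 ^ snd x < sum u (dyadic_int x)" "sum u (dyadic_int x) \<le> 2 * \<tau> * 2 ^ snd x"
        using avg[OF x] by simp_all
      fix y assume y: "y \<in> F1 \<union> F2" "x \<noteq> y"
      consider "x \<in> F1" "y \<in> F1" | "x \<in> F2" "y \<in> F2" | "x \<in> F1" "y \<in> F2" | "x \<in> F2" "y \<in> F1"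
        using x y by blast
      then show "dyadic_int x \<inter> dyadic_int y = {}"
      proof cases
        case 1 then show ?thesis using dis[OF y(2)] by simp
      next
        case 2 then show ?thesis using dis[OF y(2)] by simp
      next
        case 3 then show ?thesis using sub[of x] sub'[of y] split(2) by blast
      next
        case 4 then show ?thesis using sub[of y] sub'[of x] split(2) by blast
      qed
    next
      fix n assume "n \<in> dyadic_int (c, Suc J) - \<Union> (dyadic_int ` (F1 \<union> F2))"
      then have "n \<in> A - \<Union> (dyadic_int ` F1) \<or> n \<in> B - \<Union> (dyadic_int ` F2)" using split(1) by blast
      then show "u n \<le> \<tau>" by (rule off)
    qed
    then show ?thesis by blast
  qed
qed

lemma powr_add_le:
  assumes "x \<ge> 0" "y \<ge> 0" "q > (0::real)"
  shows "(x + y) powr q \<le> 2 powr q * (x powr q + y powr q)"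
proof -
  have "(x + y) powr q \<le> (2 * max x y) powr q" using assms by (intro powr_mono2) auto
  also have "\<dots> = 2 powr q * max x y powr q" using assms by (simp add: powr_mult)
  also have "\<dots> \<le> 2 powr q * (x powr q + y powr q)" by (intro mult_left_mono) (auto simp: max_def)
  finally show ?thesis .
qed

text \<open>Strong induction on the length exponent. The good part at height
  \<open>\<beta> * B\<close> is bounded and costs half of the budget; each bad part satisfies the
  hypothesis at a larger height on a strictly shorter interval. The total length of the selected
  intervals is at most \<open>\<beta> powr - q\<close> times the whole, and \<open>q > p\<close>
  lets a large \<open>\<beta>\<close> bring the bad cost below the other half.\<close>

lemma asum_dyadic_powr:
  assumes q: "q \<ge> 1" "q > p"
  shows "\<exists>K>0. \<forall>J c a B. B > 0 \<longrightarrow> (\<forall>n. n \<notin> {c..<c + 2 ^ J} \<longrightarrow> a n = 0) \<longrightarrow>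
    (\<Sum>n\<in>{c..<c + 2 ^ J}. norm (a n) powr q) \<le> B powr q * 2 ^ J \<longrightarrow> annihilates N a \<longrightarrow> asum (K * B powr p * 2 ^ J) a"
proof -
  obtain P where P: "P > 0" "\<And>(a::int \<Rightarrow> complex) c L. L \<ge> 1 \<Longrightarrow> \<exists>g. (\<forall>n. n \<notin> {c..<c + L} \<longrightarrow> g n = 0) \<and>
     (\<forall>n. norm (g n) \<le> P * (\<Sum>n\<in>{c..<c + L}. norm (a n)) / of_int L) \<and>
     annihilates N (\<lambda>n. (if n \<in> {c..<c + L} then a n else 0) - g n)"
    using poly_projection[of N] by blast
  \<comment> \<open>Height factor of a bad part: its q-th power mean is at most
    \<open>2 powr q\<close> times the mean of \<open>u\<close>, at most 2 in units of
    \<open>\<theta> powr q\<close>, plus the q-th power of the projection bound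
    \<open>3 * P\<close>.\<close>
  define D where "D = (2 powr q * (2 + (3 * P) powr q)) powr (1 / q)"
  have D: "D powr q = 2 powr q * (2 + (3 * P) powr q)" "D > 0"
  proof -
    define X where "X = 2 powr q * (2 + (3 * P) powr q)"
    have "X > 0" unfolding X_def by (intro mult_pos_pos add_pos_nonneg) auto
    then show "D powr q = 2 powr q * (2 + (3 * P) powr q)" "D > 0"
      unfolding D_def X_def[symmetric] using q by (simp_all add: powr_powr)
  qed
  \<comment> \<open>Chosen so that \<open>2 * D powr p <= \<beta> powr (q - p)\<close>, the
    inequality that closes the induction.\<close>
  define \<beta> where "\<beta> = max 1 ((2 * D powr p) powr (1 / (q - p)))"
  have \<beta>: "\<beta> \<ge> 1" by (simp add: \<beta>_def)
  have \<beta>D: "2 * D powr p \<le> \<beta> powr (q - p)"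
  proof -
    have "2 * D powr p = ((2 * D powr p) powr (1 / (q - p))) powr (q - p)" using q D(2) by (simp add: powr_powr)
    also have "\<dots> \<le> \<beta> powr (q - p)" using q by (intro powr_mono2) (auto simp: \<beta>_def)
    finally show ?thesis .
  qed
  define G where "G = max 1 (3 * P)"
  define K where "K = 2 * G powr p * \<beta> powr p"
  have K: "K > 0" using \<beta> by (simp add: K_def G_def)
  have main: "asum (K * B powr p * 2 ^ J) a"
    if "B > 0" "\<And>n. n \<notin> {c..<c + 2 ^ J} \<Longrightarrow> a n = 0" "(\<Sum>n\<in>{c..<c + 2 ^ J}. norm (a n) powr q) \<le> B powr q * 2 ^ J"
     "annihilates N a" for J c a B
    using that
  proof (induction J arbitrary: c a B rule: less_induct)
    case (less J)
    note B = less.prems(1) and supp = less.prems(2) and bd = less.prems(3) and ann = less.prems(4)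
    define \<theta> where "\<theta> = \<beta> * B"
    have \<theta>: "\<theta> > 0" using \<beta> B by (simp add: \<theta>_def)
    define u where "u = (\<lambda>n. norm (a n) powr q)"
    define I where "I = {c..<c + 2 ^ J}"
    define Q where Q_eq: "Q = dyadic_int"
    have Q_def: "Q = (\<lambda>x::int \<times> nat. {fst x..<fst x + 2 ^ snd x})"
      by (simp add: Q_eq dyadic_int_def fun_eq_iff)
    have QI: "Q (c, J) = I" by (simp add: Q_def I_def)
    have B\<theta>: "B powr q \<le> \<theta> powr q" using B \<beta> q unfolding \<theta>_def by (intro powr_mono2) auto
    then have sumI: "(\<Sum>n\<in>I. u n) \<le> \<theta> powr q * 2 ^ J"
      using bd by (simp add: I_def u_def) (meson mult_right_mono order_trans zero_le_numeral zero_le_power)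
    also have "\<dots> \<le> 2 * \<theta> powr q * 2 ^ J" by simp
    finally have "sum u (dyadic_int (c, J)) \<le> 2 * \<theta> powr q * 2 ^ J" by (simp add: I_def dyadic_int_def)
    then obtain F where CZ: "cz_family u (\<theta> powr q) (c, J) F"
      using cz_family_exists[of u c J "\<theta> powr q"] by (auto simp: u_def)
    have F: "finite F"
      "\<And>x. x \<in> F \<Longrightarrow> Q x \<subseteq> I" "\<And>x. x \<in> F \<Longrightarrow> snd x \<le> J" "\<And>x. x \<in> F \<Longrightarrow> \<theta> powr q * 2 ^ snd x < (\<Sum>n\<in>Q x. u n)"
      "\<And>x. x \<in> F \<Longrightarrow> (\<Sum>n\<in>Q x. u n) \<le> 2 * \<theta> powr q * 2 ^ snd x"
      "\<And>x y. x\<in>F \<Longrightarrow> y\<in>F \<Longrightarrow> x \<noteq> y \<Longrightarrow> Q x \<inter> Q y = {}"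
      "\<And>n. n\<in>I \<Longrightarrow> (\<forall>x\<in>F. n \<notin> Q x) \<Longrightarrow> u n \<le> \<theta> powr q"
      using CZ unfolding cz_family_def QI[symmetric] Q_eq snd_conv by blast+
    \<comment> \<open>The whole interval cannot be selected, since its mean is at most
      \<open>B powr q\<close>, hence at most \<open>\<theta> powr q\<close>. This is the decrease
      the induction needs.\<close>
    have Fj: "snd x < J" if x: "x \<in> F" for x
    proof (rule ccontr)
      assume "\<not> snd x < J"
      then have "snd x = J" using F(3)[OF x] by simp
      moreover from this have "fst x = c" using F(2)[OF x] by (auto simp: Q_def I_def)
      ultimately have "Q x = I" by (simp add: Q_def I_def)
      then show False using F(4)[OF x] sumI \<open>snd x = J\<close> by simp
    qed
    have cardQ: "card (Q x) = 2 ^ snd x" "finite (Q x)" for x by (simp_all add: Q_def nat_power_eq)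
    have ex_g: "\<forall>x. \<exists>g. (\<forall>n. n \<notin> Q x \<longrightarrow> g n = 0) \<and> (\<forall>n. norm (g n) \<le> P * (\<Sum>n\<in>Q x. norm (a n)) / 2 ^ snd x) \<and>
       annihilates N (\<lambda>n. (if n \<in> Q x then a n else 0) - g n)"
    proof
      fix x :: "int \<times> nat"
      show "\<exists>g. (\<forall>n. n \<notin> Q x \<longrightarrow> g n = 0) \<and> (\<forall>n. norm (g n) \<le> P * (\<Sum>n\<in>Q x. norm (a n)) / 2 ^ snd x) \<and>
       annihilates N (\<lambda>n. (if n \<in> Q x then a n else 0) - g n)"
        using P(2)[of "2 ^ snd x" "fst x" a] by (simp add: Q_def)
    qed
    from choice[OF ex_g] obtain g where g0: "\<forall>x. (\<forall>n. n \<notin> Q x \<longrightarrow> g x n = 0) \<and>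
       (\<forall>n. norm (g x n) \<le> P * (\<Sum>n\<in>Q x. norm (a n)) / 2 ^ snd x) \<and>
       annihilates N (\<lambda>n. (if n \<in> Q x then a n else 0) - g x n)" by (elim exE)
    have g: "g x n = 0" if "n \<notin> Q x" for x n using g0[rule_format, of x] that by blast
    have g2: "norm (g x n) \<le> P * (\<Sum>n\<in>Q x. norm (a n)) / 2 ^ snd x" for x n
      using g0[rule_format, of x] by blast
    have g3: "annihilates N (\<lambda>n. (if n \<in> Q x then a n else 0) - g x n)" for x
      using g0[rule_format, of x] by blast
    have gb: "norm (g x n) \<le> 3 * P * \<theta>" if x: "x \<in> F" for x n
    proof -
      \<comment> \<open>A pointwise substitute for Hoelder's inequality: where \<open>|a|\<close>
        exceeds \<open>\<theta>\<close>, it is at most its q-th power times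
        \<open>\<theta> powr (1 - q)\<close>, as \<open>q >= 1\<close>.\<close>
      have "norm (a n) \<le> \<theta> + \<theta> powr (1 - q) * u n" for n
      proof (cases "norm (a n) \<le> \<theta>")
        case True then show ?thesis using \<theta> by (simp add: u_def add_increasing2)
      next
        case False
        then have "norm (a n) = norm (a n) powr (1 - q) * u n" using \<theta> by (simp add: u_def flip: powr_add)
        also have "\<dots> \<le> \<theta> powr (1 - q) * u n"
          using False \<theta> q by (intro mult_right_mono powr_mono2') (auto simp: u_def)
        finally show ?thesis using \<theta> by simp
      qed
      then have "(\<Sum>n\<in>Q x. norm (a n)) \<le> (\<Sum>n\<in>Q x. \<theta> + \<theta> powr (1 - q) * u n)" by (intro sum_mono)
      also have "\<dots> = \<theta> * 2 ^ snd x + \<theta> powr (1 - q) * (\<Sum>n\<in>Q x. u n)"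
        by (simp add: sum.distrib cardQ sum_distrib_left)
      also have "\<dots> \<le> \<theta> * 2 ^ snd x + \<theta> powr (1 - q) * (2 * \<theta> powr q * 2 ^ snd x)"
        by (intro add_left_mono mult_left_mono F(5)[OF x]) auto
      also have "\<theta> powr (1 - q) * (2 * \<theta> powr q * 2 ^ snd x) = 2 * (\<theta> powr (1 - q) * \<theta> powr q) * 2 ^ snd x" by simp
      also have "\<theta> powr (1 - q) * \<theta> powr q = \<theta>" using \<theta> by (simp flip: powr_add)
      finally have "P * (\<Sum>n\<in>Q x. norm (a n)) \<le> P * (3 * \<theta> * 2 ^ snd x)" using P(1) by (intro mult_left_mono) auto
      then have "P * (\<Sum>n\<in>Q x. norm (a n)) / 2 ^ snd x \<le> 3 * P * \<theta>" by (simp add: divide_le_eq mult_ac)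
      then show ?thesis using g2[of x n] by linarith
    qed
    define b where "b = (\<lambda>x n. (if n \<in> Q x then a n else 0) - g x n)"
    have bx: "asum (K * (D * \<theta>) powr p * 2 ^ snd x) (b x)" if x: "x \<in> F" for x
    proof (rule less.IH[OF Fj[OF x], of "D * \<theta>" "fst x"])
      show "D * \<theta> > 0" using D \<theta> by simp
      show "b x n = 0" if "n \<notin> {fst x..<fst x + 2 ^ snd x}" for n using that g[of n x] by (auto simp: b_def Q_def)
      show "annihilates N (b x)" unfolding b_def by (rule g3)
      have "(\<Sum>n\<in>Q x. norm (b x n) powr q) \<le> (\<Sum>n\<in>Q x. 2 powr q * (u n + (3 * P * \<theta>) powr q))"
      proof (rule sum_mono)
        fix n assume n: "n \<in> Q x"
        have "norm (b x n) \<le> norm (a n) + 3 * P * \<theta>"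
          using n norm_triangle_ineq4[of "a n" "g x n"] gb[OF x, of n] by (simp add: b_def)
        then have "norm (b x n) powr q \<le> (norm (a n) + 3 * P * \<theta>) powr q" using q by (intro powr_mono2) auto
        also have "\<dots> \<le> 2 powr q * (u n + (3 * P * \<theta>) powr q)"
          unfolding u_def using q P(1) \<theta> by (intro powr_add_le) auto
        finally show "norm (b x n) powr q \<le> 2 powr q * (u n + (3 * P * \<theta>) powr q)" .
      qed
      also have "\<dots> = 2 powr q * ((\<Sum>n\<in>Q x. u n) + 2 ^ snd x * (3 * P * \<theta>) powr q)"
        by (simp add: sum_distrib_left[symmetric] sum.distrib cardQ)
      also have "\<dots> \<le> 2 powr q * (2 * \<theta> powr q * 2 ^ snd x + 2 ^ snd x * (3 * P * \<theta>) powr q)"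
        by (intro mult_left_mono add_right_mono F(5)[OF x]) auto
      also have "(3 * P * \<theta>) powr q = (3 * P) powr q * \<theta> powr q" using P(1) \<theta> by (simp add: powr_mult)
      also have "2 powr q * (2 * \<theta> powr q * 2 ^ snd x + 2 ^ snd x * ((3 * P) powr q * \<theta> powr q)) = D powr q * \<theta> powr q * 2 ^ snd x"
        by (simp add: D(1) algebra_simps)
      also have "D powr q * \<theta> powr q = (D * \<theta>) powr q" using D(2) \<theta> by (simp add: powr_mult)
      finally show "(\<Sum>n\<in>{fst x..<fst x + 2 ^ snd x}. norm (b x n) powr q) \<le> (D * \<theta>) powr q * 2 ^ snd x"
        by (simp add: Q_def)
    qed
    \<comment> \<open>The good part: \<open>g x\<close> on a selected interval and \<open>a\<close>
      elsewhere, bounded by \<open>G * \<theta>\<close> in both cases.\<close>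
    define h where "h = (\<lambda>n. a n - (\<Sum>x\<in>F. b x n))"
    have h_val: "norm (h n) \<le> G * \<theta>" for n
    proof (cases "\<exists>x\<in>F. n \<in> Q x")
      case True
      then obtain x where x: "x \<in> F" "n \<in> Q x" by blast
      have "(\<Sum>y\<in>F. b y n) = (\<Sum>y\<in>F. if y = x then b x n else 0)"
      proof (rule sum.cong[OF refl])
        fix y assume y: "y \<in> F"
        show "b y n = (if y = x then b x n else 0)"
        proof (cases "y = x")
          case False
          then have "n \<notin> Q y" using F(6)[OF y x(1) False] x(2) by blast
          then show ?thesis using g False by (simp add: b_def)
        qed simp
      qed
      also have "\<dots> = b x n" using F(1) x(1) by simp
      finally have "h n = g x n" using x(2) by (simp add: h_def b_def)
      then have "norm (h n) \<le> 3 * P * \<theta>" using gb[OF x(1), of n] by simp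
      also have "\<dots> \<le> G * \<theta>" using \<theta> by (intro mult_right_mono) (auto simp: G_def)
      finally show ?thesis .
    next
      case False
      then have "b x n = 0" if "x \<in> F" for x using that g by (simp add: b_def)
      then have hn: "h n = a n" by (simp add: h_def)
      show ?thesis
      proof (cases "n \<in> I")
        case True
        then have "u n \<le> \<theta> powr q" using F(7) False by blast
        then have "norm (a n) \<le> \<theta>"
          using powr_less_mono2[of q \<theta> "norm (a n)"] \<theta> q unfolding u_def by (cases "norm (a n) \<le> \<theta>") auto
        also have "\<dots> \<le> G * \<theta>" using \<theta> by (simp add: G_def)
        finally show ?thesis using hn by simp
      next
        case False
        then show ?thesis using supp hn \<theta> by (simp add: I_def G_def)
      qed
    qed
    have Icd: "I = {c..c + 2 ^ J - 1}" by (auto simp: I_def)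
    have cardI: "real (card {c..c + 2 ^ J - 1}) = 2 ^ J" by (simp add: nat_power_eq)
    have "asum ((G * \<theta>) powr p * real (card {c..c + 2 ^ J - 1})) h"
    proof (rule asum_bounded)
      show "h n = 0" if "n \<notin> {c..c + 2 ^ J - 1}" for n
      proof -
        have n: "n \<notin> I" using that Icd by simp
        have "b x n = 0" if "x \<in> F" for x using F(2)[OF that] n g[of n x] by (auto simp: b_def)
        then show ?thesis using supp n by (simp add: h_def I_def)
      qed
      show "annihilates N h"
        unfolding h_def b_def by (intro annihilates_diff ann annihilates_sum g3)
    qed (use h_val in auto)
    then have A1: "asum (K / 2 * B powr p * 2 ^ J) h"
    proof (rule asum_mono)
      have "(G * \<theta>) powr p = G powr p * \<beta> powr p * B powr p"
        using B \<beta> by (simp add: \<theta>_def G_def powr_mult)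
      then show "(G * \<theta>) powr p * real (card {c..c + 2 ^ J - 1}) \<le> K / 2 * B powr p * 2 ^ J"
        unfolding cardI by (simp add: K_def)
    qed
    have A2: "asum (\<Sum>x\<in>F. K * (D * \<theta>) powr p * 2 ^ snd x) (\<lambda>n. \<Sum>x\<in>F. b x n)"
      by (rule asum_finite[OF F(1) bx])
    have "(\<Sum>x\<in>F. K * (D * \<theta>) powr p * 2 ^ snd x) \<le> K / 2 * B powr p * 2 ^ J"
    proof -
      \<comment> \<open>Weak-type count: disjoint intervals of mean above
        \<open>\<theta> powr q\<close> share the q-th power mass of the whole, so their total length
        is small.\<close>
      have "\<theta> powr q * (\<Sum>x\<in>F. 2 ^ snd x) = (\<Sum>x\<in>F. \<theta> powr q * 2 ^ snd x)" by (rule sum_distrib_left)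
      also have "\<dots> \<le> (\<Sum>x\<in>F. \<Sum>n\<in>Q x. u n)" using F(4) by (intro sum_mono) (auto intro: less_imp_le)
      also have "\<dots> = (\<Sum>n\<in>(\<Union>x\<in>F. Q x). u n)"
        by (rule sum.UNION_disjoint[symmetric]) (use F cardQ in auto)
      also have "\<dots> \<le> (\<Sum>n\<in>I. u n)" by (rule sum_mono2) (use F(2) in \<open>auto simp: I_def u_def\<close>)
      also have "\<dots> \<le> B powr q * 2 ^ J" using bd by (simp add: I_def u_def)
      finally have s1: "\<beta> powr q * (B powr q * (\<Sum>x\<in>F. 2 ^ snd x)) \<le> B powr q * 2 ^ J"
        using B \<beta> by (simp add: \<theta>_def powr_mult mult.assoc)
      have "B powr q * (\<beta> powr q * (\<Sum>x\<in>F. 2 ^ snd x)) \<le> B powr q * 2 ^ J"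
        using s1 by (simp only: mult.left_commute)
      then have s2: "\<beta> powr q * (\<Sum>x\<in>F. 2 ^ snd x) \<le> 2 ^ J"
        by (rule mult_left_le_imp_le) (use B in simp)
      have "2 * D powr p * \<beta> powr p * (\<Sum>x\<in>F. 2 ^ snd x) \<le> \<beta> powr (q - p) * \<beta> powr p * (\<Sum>x\<in>F. 2 ^ snd x)"
        using \<beta>D by (intro mult_right_mono) (auto intro: sum_nonneg)
      also have "\<beta> powr (q - p) * \<beta> powr p = \<beta> powr q" using \<beta> by (simp flip: powr_add)
      finally have s3: "2 * D powr p * \<beta> powr p * (\<Sum>x\<in>F. 2 ^ snd x) \<le> 2 ^ J" using s2 by linarith
      have "(\<Sum>x\<in>F. K * (D * \<theta>) powr p * 2 ^ snd x) = K / 2 * B powr p * (2 * D powr p * \<beta> powr p * (\<Sum>x\<in>F. 2 ^ snd x))"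
        using B D(2) \<beta> by (simp add: \<theta>_def powr_mult sum_distrib_left mult_ac)
      also have "\<dots> \<le> K / 2 * B powr p * 2 ^ J" using s3 K by (intro mult_left_mono) auto
      finally show ?thesis .
    qed
    with A2 have "asum (K / 2 * B powr p * 2 ^ J) (\<lambda>n. \<Sum>x\<in>F. b x n)" by (rule asum_mono)
    from asum_add[OF A1 this] have "asum (K / 2 * B powr p * 2 ^ J + K / 2 * B powr p * 2 ^ J) a"
      by (simp add: h_def)
    then show ?case by (rule asum_mono) simp
  qed
  show ?thesis by (intro exI[of _ K] conjI K allI impI main) (assumption | (erule allE, erule (1) mp))+
qed

text \<open>The length is rounded up to a power of two, which at most doubles it and hence the
  constant.\<close>

lemma asum_powr:
  assumes q: "q \<ge> 1" "q > p"
  shows "\<exists>K>0. \<forall>c d a B. c \<le> d \<longrightarrow> B > 0 \<longrightarrow> (\<forall>n. n \<notin> {c..d} \<longrightarrow> a n = 0) \<longrightarrow>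
    (\<Sum>n\<in>{c..d}. norm (a n) powr q) \<le> B powr q * real (card {c..d}) \<longrightarrow> annihilates N a \<longrightarrow>
    asum (K * B powr p * real (card {c..d})) a"
proof -
  obtain K where K: "K > 0" "\<And>J c a B. B > 0 \<Longrightarrow> (\<forall>n. n \<notin> {c..<c + 2 ^ J} \<longrightarrow> a n = 0) \<Longrightarrow>
    (\<Sum>n\<in>{c..<c + 2 ^ J}. norm (a n) powr q) \<le> B powr q * 2 ^ J \<Longrightarrow> annihilates N a \<Longrightarrow> asum (K * B powr p * 2 ^ J) a"
    using asum_dyadic_powr[OF q] by blast
  have "asum (2 * K * B powr p * real (card {c..d})) a"
    if h: "c \<le> d" "B > 0" "\<forall>n. n \<notin> {c..d} \<longrightarrow> a n = 0"
    "(\<Sum>n\<in>{c..d}. norm (a n) powr q) \<le> B powr q * real (card {c..d})" "annihilates N a" for c d a B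
  proof -
    define L where "L = nat (d - c + 1)"
    have L: "L \<ge> 1" "card {c..d} = L" using h(1) by (auto simp: L_def)
    define J where "J = (LEAST J. L \<le> 2 ^ J)"
    have J1: "L \<le> 2 ^ J" unfolding J_def by (rule LeastI[of _ L]) (simp add: less_imp_le less_exp)
    have J2: "2 ^ J \<le> 2 * L"
    proof (cases J)
      case 0 then show ?thesis using L by simp
    next
      case (Suc j)
      then have "\<not> L \<le> 2 ^ j" using not_less_Least[of j "\<lambda>J. L \<le> 2 ^ J"] by (simp add: J_def)
      then show ?thesis using Suc by simp
    qed
    have "int L \<le> 2 ^ J" using J1 by (metis of_nat_le_iff of_nat_numeral of_nat_power)
    then have sub: "{c..d} \<subseteq> {c..<c + 2 ^ J}" using h(1) by (auto simp: L_def)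
    have "asum (K * B powr p * 2 ^ J) a"
    proof (rule K(2)[OF h(2), of c])
      show "\<forall>n. n \<notin> {c..<c + 2 ^ J} \<longrightarrow> a n = 0" using h(3) sub by blast
      have "(\<Sum>n\<in>{c..<c + 2 ^ J}. norm (a n) powr q) = (\<Sum>n\<in>{c..d}. norm (a n) powr q)"
        by (rule sum.mono_neutral_right[OF _ sub]) (use h(3) in auto)
      also have "\<dots> \<le> B powr q * L" using h(4) by (simp only: L)
      also have "\<dots> \<le> B powr q * 2 ^ J" using J1 by (intro mult_left_mono) (auto simp flip: of_nat_le_iff)
      finally show "(\<Sum>n\<in>{c..<c + 2 ^ J}. norm (a n) powr q) \<le> B powr q * 2 ^ J" .
    qed (rule h)
    then show ?thesis
    proof (rule asum_mono)
      have "(2::real) ^ J \<le> 2 * real L" using J2 by (metis of_nat_le_iff of_nat_numeral of_nat_power of_nat_mult)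
      then have "K * B powr p * 2 ^ J \<le> K * B powr p * (2 * real L)" using K(1) by (intro mult_left_mono) auto
      then show "K * B powr p * 2 ^ J \<le> 2 * K * B powr p * real (card {c..d})" by (simp only: L(2) mult_ac)
    qed
  qed
  then show ?thesis using K(1) by (intro exI[of _ "2 * K"]) auto
qed

end

section \<open>Molecules\<close>

text \<open>Each term is dominated by a difference of consecutive reciprocals, so the sum
  telescopes.\<close>

lemma sum_inverse_square_tail:
  assumes "r \<ge> 1" "finite F" "F \<subseteq> {r<..}"
  shows "(\<Sum>k\<in>F. 1 / real k ^ 2) \<le> 1 / real r"
proof -
  have t: "(\<Sum>k\<in>{r<..r + m}. 1 / real k ^ 2) \<le> 1 / real r - 1 / real (r + m)" for m
  proof (induction m)
    case (Suc m)
    have "{r<..r + Suc m} = insert (r + Suc m) {r<..r + m}" by auto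
    then have "(\<Sum>k\<in>{r<..r + Suc m}. 1 / real k ^ 2) = 1 / real (r + Suc m) ^ 2 + (\<Sum>k\<in>{r<..r + m}. 1 / real k ^ 2)"
      by simp
    moreover have "1 / real (r + Suc m) ^ 2 \<le> 1 / real (r + m) - 1 / real (r + Suc m)"
    proof -
      define x where "x = real (r + m)"
      have x: "x \<ge> 1" using assms(1) by (simp add: x_def)
      have "1 / x - 1 / (x + 1) = 1 / (x * (x + 1))" using x by (simp add: field_simps)
      moreover have "1 / (x + 1) ^ 2 \<le> 1 / (x * (x + 1))"
        using x by (intro divide_left_mono) (auto simp: power2_eq_square)
      ultimately show ?thesis by (simp add: x_def algebra_simps)
    qed
    ultimately show ?case using Suc by linarith
  qed simp
  obtain m where "F \<subseteq> {r<..r + m}"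
  proof
    show "F \<subseteq> {r<..r + Max (insert 0 F)}"
    proof
      fix k assume k: "k \<in> F"
      then have "k \<le> Max (insert 0 F)" using assms(2) by (intro Max_ge) auto
      then show "k \<in> {r<..r + Max (insert 0 F)}" using k assms(3) by auto
    qed
  qed
  then have "(\<Sum>k\<in>F. 1 / real k ^ 2) \<le> (\<Sum>k\<in>{r<..r + m}. 1 / real k ^ 2)" by (intro sum_mono2) auto
  also have "\<dots> \<le> 1 / real r" using t[of m] by (smt (verit) divide_nonneg_nonneg of_nat_0_le_iff)
  finally show ?thesis .
qed

lemma sum_inverse_square_tail_int:
  assumes r: "r \<ge> 1" and F: "finite F" "\<And>n. n \<in> F \<Longrightarrow> \<bar>n - x\<bar> > int r"
  shows "(\<Sum>n\<in>F. 1 / \<bar>real_of_int (n - x)\<bar> ^ 2) \<le> 2 / real r"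
proof -
  define A where "A = {n \<in> F. n > x}"
  define B where "B = {n \<in> F. n < x}"
  have "n \<noteq> x" if "n \<in> F" for n using F(2)[OF that] by auto
  then have FAB: "F = A \<union> B" "A \<inter> B = {}" "finite A" "finite B"
    using F(1) by (auto simp: A_def B_def not_less less_le)
  have "(\<Sum>n\<in>A. 1 / \<bar>real_of_int (n - x)\<bar> ^ 2) = (\<Sum>k\<in>(\<lambda>n. nat (n - x)) ` A. 1 / real k ^ 2)"
    by (subst sum.reindex) (auto simp: A_def inj_on_def)
  also have "\<dots> \<le> 1 / real r"
  proof (rule sum_inverse_square_tail[OF r])
    have "int r < n - x" if "n \<in> A" for n using F(2)[of n] that by (auto simp: A_def)
    then show "(\<lambda>n. nat (n - x)) ` A \<subseteq> {r<..}" by (auto simp: image_subset_iff zless_nat_eq_int_zless)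
  qed (use FAB in simp)
  finally have a: "(\<Sum>n\<in>A. 1 / \<bar>real_of_int (n - x)\<bar> ^ 2) \<le> 1 / real r" .
  have "(\<Sum>n\<in>B. 1 / \<bar>real_of_int (n - x)\<bar> ^ 2) = (\<Sum>k\<in>(\<lambda>n. nat (x - n)) ` B. 1 / real k ^ 2)"
    by (subst sum.reindex) (auto simp: B_def inj_on_def power2_commute)
  also have "\<dots> \<le> 1 / real r"
  proof (rule sum_inverse_square_tail[OF r])
    have "int r < x - n" if "n \<in> B" for n using F(2)[of n] that by (auto simp: B_def)
    then show "(\<lambda>n. nat (x - n)) ` B \<subseteq> {r<..}" by (auto simp: image_subset_iff zless_nat_eq_int_zless)
  qed (use FAB in simp)
  finally have "(\<Sum>n\<in>B. 1 / \<bar>real_of_int (n - x)\<bar> ^ 2) \<le> 1 / real r" .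
  then show ?thesis unfolding FAB(1) using a FAB by (subst sum.union_disjoint) auto
qed

context hardy_exponent
begin

text \<open>Truncate to balls \<open>U i\<close> of radius \<open>2 ^ i * R\<close> and subtract
  bounded functions \<open>P i\<close> with the same moments. The moments inside a ball are minus
  those outside because \<open>g\<close> has none, and the outside ones are small by decay. The
  corrected truncations \<open>G i\<close> converge to \<open>g\<close>, and their increments are
  bounded, supported in \<open>U i\<close> and free of moments. Divisibility of \<open>R\<close>
  makes the block length for \<open>P i\<close> an integer.\<close>

lemma asum_molecule:
  "\<exists>K>0. \<forall>x R B g. R \<ge> 1 \<longrightarrow> (N + 1) dvd R \<longrightarrow> B > 0 \<longrightarrow>
     (\<Sum>n\<in>{x - int R..x + int R}. norm (g n) ^ 2) \<le> B ^ 2 * real R \<longrightarrow>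
     (\<forall>n. \<bar>n - x\<bar> > int R \<longrightarrow> norm (g n) \<le> B * (real R / \<bar>real_of_int (n - x)\<bar>) ^ (N + 2)) \<longrightarrow>
     annihilates N g \<longrightarrow> asum (K * B powr p * real R) g"
proof -
  obtain C where C: "C > 0" "\<And>l c B (\<Lambda>::complex poly \<Rightarrow> complex). l \<ge> 1 \<Longrightarrow> B \<ge> 0 \<Longrightarrow>
     (\<forall>q r. \<Lambda> (q + r) = \<Lambda> q + \<Lambda> r) \<Longrightarrow> (\<forall>a q. \<Lambda> (smult a q) = a * \<Lambda> q) \<Longrightarrow>
     (\<forall>j<Suc N. norm (\<Lambda> ([:- of_int c, 1:] ^ j)) \<le> B * of_int l ^ Suc j) \<Longrightarrow>
     (\<exists>g. (\<forall>n. n \<notin> {c..<c + int (Suc N) * l} \<longrightarrow> g n = 0) \<and> (\<forall>n. norm (g n) \<le> C * B) \<and>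
        (\<forall>q. (\<forall>i\<ge>Suc N. coeff q i = 0) \<longrightarrow> ((\<lambda>n. poly q (of_int n) * g n) has_sum \<Lambda> q) UNIV))"
    using realize_moments[of "Suc N"] by blast
  obtain K2 where K2: "K2 > 0" "\<And>c d a B. c \<le> d \<Longrightarrow> B > 0 \<Longrightarrow> (\<forall>n. n \<notin> {c..d} \<longrightarrow> a n = 0) \<Longrightarrow>
    (\<Sum>n\<in>{c..d}. norm (a n) powr 2) \<le> B powr 2 * real (card {c..d}) \<Longrightarrow> annihilates N a \<Longrightarrow>
    asum (K2 * B powr p * real (card {c..d})) a"
    using asum_powr[of 2] p1 by auto
  \<comment> \<open>The moments are bounded at scale \<open>r i\<close>, which is
    \<open>N + 1\<close> block lengths; converting to one block length costs at most
    \<open>(N + 1) ^ Suc N\<close>. The 2 comes from the two-sided tail sum.\<close>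
  define C1 where "C1 = C * (2 * (real N + 1) ^ Suc N)"
  have C1: "C1 > 0" using C(1) by (simp add: C1_def)
  define C2 where "C2 = 2 * (1 + C1)"
  define C3 where "C3 = 2 ^ (N + 2) + C1 + 2 ^ (N + 2) * C1"
  have C3: "C3 > 0" using C1 by (simp add: C3_def add_pos_pos)
  \<comment> \<open>Ratio of the costs of consecutive increments: the length doubles and the height
    falls by \<open>2 ^ (N + 2)\<close>. It is below 1 by \<open>N_gt\<close>.\<close>
  define \<rho> where "\<rho> = 2 powr (1 - p * (real N + 2))"
  have \<rho>: "0 < \<rho>" "\<rho> < 1" using N_gt by (auto simp: \<rho>_def powr_less_one)
  define K where "K = 3 * K2 * C2 powr p + 3 * C3 powr p * (\<rho> / (1 - \<rho>)) + 1"
  have K: "K > 0" using K2(1) C3 \<rho> by (simp add: K_def add_nonneg_pos)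
  have main: "asum (K * B powr p * real R) g"
    if R: "R \<ge> 1" and dvd: "(N + 1) dvd R" and B: "B > 0"
     and l2: "(\<Sum>n\<in>{x - int R..x + int R}. norm (g n) ^ 2) \<le> B ^ 2 * real R"
     and dec: "\<And>n. \<bar>n - x\<bar> > int R \<Longrightarrow> norm (g n) \<le> B * (real R / \<bar>real_of_int (n - x)\<bar>) ^ (N + 2)"
     and ann: "annihilates N g" for x R B g
  proof -
    obtain R' where R': "R = (N + 1) * R'" using dvd by (auto simp: dvd_def)
    have R'1: "R' \<ge> 1" using R R' by (cases R') auto
    define r where "r = (\<lambda>i::nat. 2 ^ i * R)"
    have r1: "r i \<ge> 1" for i using R by (simp add: r_def)
    have rR: "r i \<ge> R" for i by (simp add: r_def)
    define U where "U = (\<lambda>i. {x - int (r i)..x + int (r i)})"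
    have Ufin: "finite (U i)" for i by (simp add: U_def)
    have Umem: "n \<in> U i \<longleftrightarrow> \<bar>n - x\<bar> \<le> int (r i)" for n i by (auto simp: U_def)
    define \<Lambda> where "\<Lambda> = (\<lambda>i q. \<Sum>n\<in>U i. poly q (of_int n) * g n)"
    define e where "e = (\<lambda>i. B * (1 / 2) ^ (i * (N + 2)))"
    have e0: "e i > 0" for i using B by (simp add: e_def)
    \<comment> \<open>Vanishing total moments turn the inner moment into a tail, where
      \<open>N + 2\<close> powers of decay beat \<open>j <= N\<close> powers of growth and leave an
      inverse square.\<close>
    have Lb: "norm (\<Lambda> i ([:- of_int x, 1:] ^ j)) \<le> 2 * e i * real (r i) ^ Suc j" if j: "j < Suc N" for i j
    proof -
      define X :: "complex poly" where "X = [:- of_int x, 1:] ^ j"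
      have Xd: "degree X \<le> N" using j unfolding X_def by (simp add: degree_power_eq)
      have Xe: "norm (poly X (of_int n)) = \<bar>real_of_int (n - x)\<bar> ^ j" for n
      proof -
        have "poly X (of_int n) = of_int (n - x) ^ j" by (simp add: X_def poly_power)
        then show ?thesis by (simp only: norm_power norm_of_int)
      qed
      have full: "((\<lambda>n. poly X (of_int n) * g n) has_sum 0) UNIV" using ann Xd by (simp add: annihilates_def)
      have "((\<lambda>n. poly X (of_int n) * g n) has_sum \<Lambda> i X) (U i)"
        unfolding \<Lambda>_def by (rule has_sum_finite[OF Ufin])
      from has_sum_Diff[OF full this]
      have tail: "((\<lambda>n. poly X (of_int n) * g n) has_sum - \<Lambda> i X) (- U i)"
        by (simp add: Compl_eq_Diff_UNIV)
      have bound: "norm (\<Sum>n\<in>F. poly X (of_int n) * g n) \<le> 2 * e i * real (r i) ^ Suc j" if F: "finite F" "F \<subseteq> - U i" for F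
      proof -
        have "norm (\<Sum>n\<in>F. poly X (of_int n) * g n) \<le> (\<Sum>n\<in>F. (B * real R ^ (N + 2) * (1 / real (r i) ^ (N - j))) * (1 / \<bar>real_of_int (n - x)\<bar> ^ 2))"
        proof (rule sum_norm_le)
          fix n assume "n \<in> F"
          then have n: "\<bar>n - x\<bar> > int (r i)" using F Umem by force
          define y where "y = \<bar>real_of_int (n - x)\<bar>"
          have y: "y > real (r i)" using n by (simp add: y_def flip: of_int_abs of_int_diff)
          have y0: "y > 0" using y r1[of i] by linarith
          have "norm (poly X (of_int n) * g n) \<le> y ^ j * (B * (real R / y) ^ (N + 2))"
            unfolding norm_mult Xe y_def using n rR[of i] by (intro mult_left_mono dec) auto
          also have "\<dots> = B * real R ^ (N + 2) * (1 / y ^ (N - j)) * (1 / y ^ 2)"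
          proof -
            have "N = j + (N - j)" using j by simp
            then have "y ^ (N + 2) = y ^ j * (y ^ (N - j) * y ^ 2)" by (metis power_add mult.assoc)
            then have "(real R / y) ^ (N + 2) = real R ^ (N + 2) / (y ^ j * (y ^ (N - j) * y ^ 2))"
              by (simp only: power_divide)
            then show ?thesis using y0 by simp
          qed
          also have "\<dots> \<le> B * real R ^ (N + 2) * (1 / real (r i) ^ (N - j)) * (1 / y ^ 2)"
            using y r1[of i] B by (intro mult_right_mono mult_left_mono divide_left_mono power_mono mult_pos_pos) auto
          finally show "norm (poly X (of_int n) * g n) \<le> (B * real R ^ (N + 2) * (1 / real (r i) ^ (N - j))) * (1 / \<bar>real_of_int (n - x)\<bar> ^ 2)"
            by (simp add: y_def)
        qed
        also have "\<dots> = (B * real R ^ (N + 2) * (1 / real (r i) ^ (N - j))) * (\<Sum>n\<in>F. 1 / \<bar>real_of_int (n - x)\<bar> ^ 2)"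
          by (rule sum_distrib_left[symmetric])
        also have "\<dots> \<le> (B * real R ^ (N + 2) * (1 / real (r i) ^ (N - j))) * (2 / real (r i))"
        proof (rule mult_left_mono[OF sum_inverse_square_tail_int[OF r1 F(1)]])
          show "\<bar>n - x\<bar> > int (r i)" if "n \<in> F" for n using that F Umem by force
        qed (use B in simp)
        also have "\<dots> = 2 * e i * real (r i) ^ Suc j"
        proof -
          have "real R = real (r i) * (1 / 2) ^ i" by (simp add: r_def power_divide)
          then have "real R ^ (N + 2) = real (r i) ^ (N + 2) * (1 / 2) ^ (i * (N + 2))"
            by (simp only: power_mult_distrib power_mult)
          moreover have "real (r i) ^ (N + 2) = real (r i) ^ Suc j * (real (r i) ^ (N - j) * real (r i))"
          proof -
            have "N + 2 = Suc j + ((N - j) + 1)" using j by simp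
            then show ?thesis by (metis power_add power_one_right)
          qed
          ultimately show ?thesis using r1[of i] by (simp add: e_def)
        qed
        finally show ?thesis .
      qed
      have "norm (- \<Lambda> i X) \<le> 2 * e i * real (r i) ^ Suc j"
      proof (rule Lim_norm_ubound)
        show "((\<lambda>F. \<Sum>n\<in>F. poly X (of_int n) * g n) \<longlongrightarrow> - \<Lambda> i X) (finite_subsets_at_top (- U i))"
          using tail by (simp add: has_sum_def)
        show "\<forall>\<^sub>F F in finite_subsets_at_top (- U i). norm (\<Sum>n\<in>F. poly X (of_int n) * g n) \<le> 2 * e i * real (r i) ^ Suc j"
          by (rule eventually_finite_subsets_at_top_weakI) (use bound in auto)
      qed simp
      then show ?thesis by (simp add: X_def)
    qed
    have "\<exists>P. (\<forall>n. n \<notin> U i \<longrightarrow> P n = 0) \<and> (\<forall>n. norm (P n) \<le> C1 * e i) \<and>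
        (\<forall>q. degree q \<le> N \<longrightarrow> ((\<lambda>n. poly q (of_int n) * P n) has_sum \<Lambda> i q) UNIV)" for i
    proof -
      define l where "l = int (2 ^ i * R')"
      have "1 * 1 \<le> 2 ^ i * R'" using R'1 by (intro mult_le_mono) auto
      then have l: "l \<ge> 1" unfolding l_def by linarith
      have rl: "real (r i) = (real N + 1) * of_int l" "int (Suc N) * l = int (r i)" by (simp_all add: r_def R' l_def algebra_simps)
      define Bi where "Bi = 2 * (real N + 1) ^ Suc N * e i"
      have "norm (\<Lambda> i ([:- of_int x, 1:] ^ j)) \<le> Bi * of_int l ^ Suc j" if j: "j < Suc N" for j
      proof -
        have "norm (\<Lambda> i ([:- of_int x, 1:] ^ j)) \<le> 2 * e i * ((real N + 1) ^ Suc j * of_int l ^ Suc j)"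
          using Lb[OF j, of i] by (simp only: rl power_mult_distrib)
        also have "\<dots> \<le> 2 * e i * ((real N + 1) ^ Suc N * of_int l ^ Suc j)"
          using j l e0[of i] by (intro mult_left_mono mult_right_mono power_increasing) auto
        finally show ?thesis by (simp add: Bi_def mult_ac)
      qed
      then obtain P where P: "\<And>n. n \<notin> {x..<x + int (Suc N) * l} \<Longrightarrow> P n = 0" "\<And>n. norm (P n) \<le> C * Bi"
        "\<And>q. (\<forall>j\<ge>Suc N. coeff q j = 0) \<Longrightarrow> ((\<lambda>n. poly q (of_int n) * P n) has_sum \<Lambda> i q) UNIV"
        using C(2)[OF l, of Bi "\<Lambda> i" x] e0[of i]
        by (auto simp: \<Lambda>_def Bi_def ring_distribs sum.distrib sum_distrib_left mult.assoc)
      have "P n = 0" if "n \<notin> U i" for n using that P(1)[of n] unfolding rl by (auto simp: U_def)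
      moreover have "norm (P n) \<le> C1 * e i" for n using P(2)[of n] by (simp add: Bi_def C1_def mult_ac)
      moreover have "((\<lambda>n. poly q (of_int n) * P n) has_sum \<Lambda> i q) UNIV" if "degree q \<le> N" for q
        using that by (intro P(3)) (auto intro: coeff_eq_0)
      ultimately show ?thesis by blast
    qed
    then obtain P where P: "\<And>i n. n \<notin> U i \<Longrightarrow> P i n = 0" "\<And>i n. norm (P i n) \<le> C1 * e i"
        "\<And>i q. degree q \<le> N \<Longrightarrow> ((\<lambda>n. poly q (of_int n) * P i n) has_sum \<Lambda> i q) UNIV"
      by metis
    define G where "G = (\<lambda>i n. (if n \<in> U i then g n else 0) - P i n)"
    have Gann: "annihilates N (G i)" for i
      unfolding annihilates_def
    proof (intro allI impI)
      fix q :: "complex poly" assume q: "degree q \<le> N"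
      have "((\<lambda>n. poly q (of_int n) * (if n \<in> U i then g n else 0)) has_sum (\<Sum>n\<in>U i. poly q (of_int n) * (if n \<in> U i then g n else 0))) UNIV"
        by (rule has_sum_finite_support) (use Ufin in auto)
      moreover have "(\<Sum>n\<in>U i. poly q (of_int n) * (if n \<in> U i then g n else 0)) = \<Lambda> i q"
        unfolding \<Lambda>_def by (rule sum.cong) auto
      ultimately have "((\<lambda>n. poly q (of_int n) * (if n \<in> U i then g n else 0) - poly q (of_int n) * P i n) has_sum \<Lambda> i q - \<Lambda> i q) UNIV"
        by (intro has_sum_minus P(3) q) simp
      then show "((\<lambda>n. poly q (of_int n) * G i n) has_sum 0) UNIV" by (simp only: G_def right_diff_distrib diff_self)
    qed
    have Gsupp: "G i n = 0" if "n \<notin> U i" for i n using that P(1) by (simp add: G_def)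
    have Usub: "U i \<subseteq> U (Suc i)" for i by (auto simp: U_def r_def)
    have cardU: "card (U i) = 2 * r i + 1" for i by (simp add: U_def)
    have cardU3: "real (card (U i)) \<le> 3 * (2 ^ i * real R)" for i
    proof -
      have "1 \<le> real (r i)" using r1[of i] by simp
      moreover have "real (r i) = 2 ^ i * real R" by (simp add: r_def)
      ultimately show ?thesis unfolding cardU by (auto simp: mult.commute)
    qed
    have Une: "x - int (r i) \<le> x + int (r i)" for i by simp
    define A where "A = (\<lambda>i. if i = 0 then G 0 else (\<lambda>n. G i n - G (i - 1) n))"
    \<comment> \<open>On the central ball only an l^2 bound is available, so the decomposition of
      square-integrable atoms is used here; the increments below are bounded.\<close>
    have A0: "asum (3 * K2 * C2 powr p * B powr p * real R) (A 0)"
    proof -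
      have "(\<Sum>n\<in>U 0. norm (G 0 n) powr 2) \<le> (\<Sum>n\<in>U 0. 2 * norm (g n) ^ 2 + 2 * (C1 * B) ^ 2)"
      proof (rule sum_mono)
        fix n assume n: "n \<in> U 0"
        have "norm (G 0 n) \<le> norm (g n) + C1 * B"
          using n norm_triangle_ineq4[of "g n" "P 0 n"] P(2)[of 0 n] by (simp add: G_def e_def)
        then have "norm (G 0 n) ^ 2 \<le> (norm (g n) + C1 * B) ^ 2" by (intro power_mono) auto
        also have "\<dots> \<le> 2 * norm (g n) ^ 2 + 2 * (C1 * B) ^ 2"
          using zero_le_power2[of "norm (g n) - C1 * B"] by (simp add: power2_eq_square algebra_simps)
        finally show "norm (G 0 n) powr 2 \<le> 2 * norm (g n) ^ 2 + 2 * (C1 * B) ^ 2" by simp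
      qed
      also have "\<dots> = 2 * (\<Sum>n\<in>U 0. norm (g n) ^ 2) + real (card (U 0)) * (2 * (C1 * B) ^ 2)"
        by (simp add: sum.distrib sum_distrib_left)
      also have "\<dots> \<le> 2 * (B ^ 2 * real R) + real (card (U 0)) * (2 * (C1 * B) ^ 2)"
        using l2 by (simp add: U_def r_def)
      also have "\<dots> \<le> real (card (U 0)) * (2 * B ^ 2) + real (card (U 0)) * (2 * (C1 * B) ^ 2)"
        using B by (simp add: cardU r_def algebra_simps)
      also have "\<dots> = (2 * (1 + C1 ^ 2)) * B ^ 2 * real (card (U 0))" by (simp add: power_mult_distrib algebra_simps)
      also have "\<dots> \<le> C2 ^ 2 * B ^ 2 * real (card (U 0))"
      proof (intro mult_right_mono)
        show "2 * (1 + C1 ^ 2) \<le> C2 ^ 2" using C1 by (simp add: C2_def power2_eq_square algebra_simps)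
      qed auto
      also have "C2 ^ 2 * B ^ 2 = (C2 * B) powr 2" using B C1 by (simp add: C2_def power_mult_distrib)
      finally have "asum (K2 * (C2 * B) powr p * real (card (U 0))) (G 0)"
        unfolding U_def using Gsupp Gann B C1 by (intro K2(2) Une) (auto simp: C2_def U_def)
      moreover have "K2 * (C2 * B) powr p * real (card (U 0)) \<le> K2 * (C2 * B) powr p * (3 * (2 ^ 0 * real R))"
        using K2(1) by (intro mult_left_mono cardU3) auto
      moreover have "(C2 * B) powr p = C2 powr p * B powr p" using C1 B by (simp add: C2_def powr_mult)
      ultimately show ?thesis by (auto elim!: asum_mono simp: A_def mult_ac)
    qed
    have eSuc: "e i = 2 ^ (N + 2) * e (Suc i)" for i
      by (simp add: e_def power_add power_divide)
    have Abound: "norm (A (Suc i) n) \<le> C3 * e (Suc i)" for i n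
    proof -
      have "norm (A (Suc i) n) \<le> norm ((if n \<in> U (Suc i) then g n else 0) - (if n \<in> U i then g n else 0)) + (norm (P (Suc i) n) + norm (P i n))"
      proof -
        have "A (Suc i) n = ((if n \<in> U (Suc i) then g n else 0) - (if n \<in> U i then g n else 0)) + (P i n - P (Suc i) n)"
          by (simp add: A_def G_def)
        then show ?thesis
          using norm_triangle_ineq[of "(if n \<in> U (Suc i) then g n else 0) - (if n \<in> U i then g n else 0)" "P i n - P (Suc i) n"]
            norm_triangle_ineq4[of "P i n" "P (Suc i) n"] by simp
      qed
      also have "norm ((if n \<in> U (Suc i) then g n else 0) - (if n \<in> U i then g n else 0)) \<le> e i"
      proof (cases "n \<in> U i")
        case True then show ?thesis using Usub[of i] e0[of i] by (auto simp: less_imp_le)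
      next
        case False
        then have n: "\<bar>n - x\<bar> > int (r i)" using Umem by simp
        then have y: "\<bar>real_of_int (n - x)\<bar> > real (r i)" by (simp flip: of_int_abs of_int_diff)
        have "norm (g n) \<le> B * (real R / \<bar>real_of_int (n - x)\<bar>) ^ (N + 2)" using n rR[of i] by (intro dec) simp
        also have "\<dots> \<le> B * (real R / real (r i)) ^ (N + 2)"
          using y r1[of i] B by (intro mult_left_mono power_mono divide_left_mono mult_pos_pos) auto
        also have "real R / real (r i) = (1 / 2) ^ i" using R by (simp add: r_def power_divide)
        also have "B * ((1 / 2) ^ i) ^ (N + 2) = e i" unfolding e_def by (simp only: power_mult)
        finally show ?thesis using False e0[of i] by (auto simp: less_imp_le)
      qed
      also have "norm (P (Suc i) n) + norm (P i n) \<le> C1 * e (Suc i) + C1 * e i" by (intro add_mono P)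
      finally show ?thesis by (simp add: C3_def eSuc[of i] algebra_simps)
    qed
    define b where "b = (\<lambda>i. if i = 0 then 3 * K2 * C2 powr p * B powr p * real R else 3 * C3 powr p * B powr p * real R * \<rho> ^ i)"
    have As: "asum (b i) (A i)" for i
    proof (cases i)
      case 0 then show ?thesis using A0 by (simp add: b_def)
    next
      case (Suc k)
      have "asum ((C3 * e i) powr p * real (card {x - int (r i)..x + int (r i)})) (A i)"
      proof (rule asum_bounded[OF Une])
        show "A i n = 0" if "n \<notin> {x - int (r i)..x + int (r i)}" for n
          using that Gsupp[of n i] Gsupp[of n k] Usub[of k] Suc by (auto simp: A_def U_def)
        show "annihilates N (A i)" using Suc Gann by (auto simp: A_def intro: annihilates_diff)
      qed (use Abound Suc in auto)
      then show ?thesis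
      proof (rule asum_mono)
        have ep: "(C3 * e i) powr p = C3 powr p * (B powr p * 2 powr (- (p * (real N + 2)) * real i))"
        proof -
          have "(1 / 2 :: real) ^ k = 2 powr (- real k)" for k
            by (simp add: powr_minus powr_realpow power_one_over inverse_eq_divide)
          from this[of "i * (N + 2)"] have "((1 / 2 :: real) ^ (i * (N + 2))) powr p = 2 powr (- (p * (real N + 2)) * real i)"
            by (simp add: powr_powr algebra_simps)
          then show ?thesis using B C3 by (simp add: e_def powr_mult)
        qed
        have \<rho>i: "\<rho> ^ i = 2 ^ i * 2 powr (- (p * (real N + 2)) * real i)"
        proof -
          have "\<rho> ^ i = 2 powr ((1 - p * (real N + 2)) * real i)"
            by (simp add: \<rho>_def powr_powr flip: powr_realpow)
          also have "\<dots> = 2 powr (real i + - (p * (real N + 2)) * real i)" by (simp add: algebra_simps)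
          also have "\<dots> = 2 powr real i * 2 powr (- (p * (real N + 2)) * real i)" by (rule powr_add)
          finally show ?thesis by (simp add: powr_realpow)
        qed
        have "(C3 * e i) powr p * real (card (U i)) \<le> (C3 * e i) powr p * (3 * (2 ^ i * real R))"
          by (intro mult_left_mono cardU3) auto
        also have "\<dots> = 3 * C3 powr p * B powr p * real R * \<rho> ^ i" unfolding ep \<rho>i by simp
        also have "\<dots> = b i" using Suc by (simp add: b_def)
        finally show "(C3 * e i) powr p * real (card {x - int (r i)..x + int (r i)}) \<le> b i" by (simp add: U_def)
      qed
    qed
    have "(\<lambda>i. \<rho> ^ Suc i) sums (\<rho> * (1 / (1 - \<rho>)))"
      using sums_mult[OF geometric_sums[of \<rho>], of \<rho>] \<rho> by simp
    from sums_mult[OF this, of "3 * C3 powr p * B powr p * real R"]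
    have "(\<lambda>i. b (Suc i)) sums (3 * C3 powr p * B powr p * real R * (\<rho> * (1 / (1 - \<rho>))))"
      by (simp add: b_def)
    then have bsum: "b sums (3 * C3 powr p * B powr p * real R * (\<rho> * (1 / (1 - \<rho>))) + b 0)"
      by (subst (asm) sums_Suc_iff) simp
    have b0: "b i \<ge> 0" for i by (rule asum_nonneg[OF As])
    have bhas: "(b has_sum (3 * C3 powr p * B powr p * real R * (\<rho> * (1 / (1 - \<rho>))) + b 0)) UNIV"
      using bsum has_sum_nat_iff_sums[of b] b0 by simp
    have pt: "((\<lambda>i. A i n) has_sum g n) UNIV" for n
    proof -
      \<comment> \<open>The increments telescope, so pointwise convergence is that of the corrected
        truncations.\<close>
      have part: "(\<Sum>i<Suc m. A i n) = G m n" for m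
        by (induction m) (auto simp: A_def)
      define h where "h = (1 / 2 :: real) ^ (N + 2)"
      have "h \<le> (1 / 2) ^ 1" unfolding h_def by (intro power_decreasing) auto
      then have h: "norm h < 1" by (simp add: h_def)
      have eh: "e i = B * h ^ i" for i
        unfolding e_def h_def by (simp only: mult.commute[of i "N + 2"] power_mult)
      have elim: "e \<longlonglongrightarrow> 0"
      proof -
        have "(\<lambda>i. B * h ^ i) \<longlonglongrightarrow> B * 0"
          by (intro tendsto_mult tendsto_const LIMSEQ_power_zero h)
        then show ?thesis by (simp add: eh[abs_def])
      qed
      have P0: "(\<lambda>m. P m n) \<longlonglongrightarrow> 0"
      proof (rule Lim_null_comparison)
        show "\<forall>\<^sub>F m in sequentially. norm (P m n) \<le> C1 * e m" using P(2) by auto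
        show "(\<lambda>m. C1 * e m) \<longlonglongrightarrow> 0" using tendsto_mult[OF tendsto_const elim, of C1] by simp
      qed
      have "\<forall>\<^sub>F m in sequentially. (if n \<in> U m then g n else 0) = g n"
      proof (rule eventually_sequentiallyI[of "nat \<bar>n - x\<bar>"])
        fix m assume "nat \<bar>n - x\<bar> \<le> m"
        moreover have "m \<le> r m"
        proof -
          have "m * 1 \<le> 2 ^ m * R" using R by (intro mult_le_mono) (auto intro: less_imp_le less_exp)
          then show ?thesis by (simp add: r_def)
        qed
        ultimately have "n \<in> U m" unfolding Umem by linarith
        then show "(if n \<in> U m then g n else 0) = g n" by simp
      qed
      then have "(\<lambda>m. if n \<in> U m then g n else 0) \<longlonglongrightarrow> g n" by (rule tendsto_eventually)
      from tendsto_diff[OF this P0] have "(\<lambda>m. G m n) \<longlonglongrightarrow> g n" by (simp add: G_def)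
      then have "(\<lambda>m. \<Sum>i<Suc m. A i n) \<longlonglongrightarrow> g n" by (simp only: part)
      then have S: "(\<lambda>i. A i n) sums g n" unfolding sums_def by (subst (asm) filterlim_sequentially_Suc)
      have "summable (\<lambda>i. norm (A (Suc i) n))"
      proof (rule summable_comparison_test')
        have "summable (\<lambda>i. C3 * (B * h ^ Suc i))"
          by (intro summable_mult) (subst summable_Suc_iff, rule summable_geometric[OF h])
        then show "summable (\<lambda>i. C3 * e (Suc i))" by (simp only: eh)
        show "norm (norm (A (Suc i) n)) \<le> C3 * e (Suc i)" for i using Abound by simp
      qed
      then have "summable (\<lambda>i. norm (A i n))" by (subst (asm) summable_Suc_iff)
      from norm_summable_imp_has_sum[OF this S] show ?thesis .
    qed
    have "asum (3 * C3 powr p * B powr p * real R * (\<rho> * (1 / (1 - \<rho>))) + b 0) g"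
      by (rule asum_countable[OF As bhas pt])
    then show ?thesis
    proof (rule asum_mono)
      have "3 * C3 powr p * B powr p * real R * (\<rho> * (1 / (1 - \<rho>))) + b 0 = (K - 1) * (B powr p * real R)"
        by (simp add: b_def K_def algebra_simps)
      also have "\<dots> \<le> K * (B powr p * real R)" by (intro mult_right_mono) auto
      finally show "3 * C3 powr p * B powr p * real R * (\<rho> * (1 / (1 - \<rho>))) + b 0 \<le> K * B powr p * real R"
        by (simp add: mult_ac)
    qed
  qed
  show ?thesis by (intro exI[of _ K] conjI K allI impI main) (assumption | (erule allE, erule (1) mp))+
qed

end

section \<open>Dyadic pieces of the reproducing formula\<close>

text \<open>Dominated convergence for unordered sums. It is needed because the reproducing formula
  converges only along increasing levels \<open>L\<close>, while the atomic sum runs over groups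
  containing many levels.\<close>

lemma has_sum_dominated:
  fixes a :: "'i \<Rightarrow> nat \<Rightarrow> complex"
  assumes b: "b summable_on UNIV" and ab: "\<And>i L. norm (a i L) \<le> b i"
    and lim: "\<And>i. (\<lambda>L. a i L) \<longlonglongrightarrow> c i"
    and S: "\<And>L. ((\<lambda>i. a i L) has_sum S L) UNIV" "S \<longlonglongrightarrow> s"
  shows "(c has_sum s) UNIV"
proof -
  have "norm (c i) \<le> b i" for i
    by (rule Lim_norm_ubound[OF _ lim]) (use ab in auto)
  then have "c summable_on UNIV" by (intro summable_on_norm_bound[OF b]) auto
  then have c: "(c has_sum infsum c UNIV) UNIV" by simp
  have "uniform_limit UNIV (\<lambda>X L. \<Sum>i\<in>X. a i L) (\<lambda>L. \<Sum>\<^sub>\<infinity>i. a i L) (finite_subsets_at_top UNIV)"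
    by (rule Weierstrass_m_test_general) (use ab b in auto)
  moreover have "(\<lambda>L. \<Sum>\<^sub>\<infinity>i. a i L) = S" using S(1) by (auto simp: infsumI)
  ultimately have u: "uniform_limit UNIV (\<lambda>X L. \<Sum>i\<in>X. a i L) S (finite_subsets_at_top UNIV)" by simp
  have "(S \<longlongrightarrow> infsum c UNIV) sequentially"
    by (rule swap_uniform_limit'[OF _ _ u, where g="\<lambda>X. \<Sum>i\<in>X. c i"])
      (use c lim in \<open>auto simp: has_sum_def intro: tendsto_sum always_eventually\<close>)
  then show ?thesis using c S(2) LIMSEQ_unique by blast
qed

text \<open>Stands in for Cauchy-Schwarz under integrals and sums: the bound is linear in
  \<open>a\<close> and \<open>b\<close>, so it can be summed first and \<open>\<epsilon>\<close>
  tuned once for a whole group.\<close>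

lemma amgm_weighted:
  fixes y a b \<epsilon> :: real
  assumes "y\<^sup>2 = a * b" "a \<ge> 0" "b \<ge> 0" "\<epsilon> > 0"
  shows "y \<le> (\<epsilon> * a + b / \<epsilon>) / 2"
proof (rule power2_le_imp_le)
  have "4 * x * z \<le> (x + z)\<^sup>2" for x z :: real
    using zero_le_power2[of "x - z"] by (simp add: power2_eq_square algebra_simps)
  from this[of "\<epsilon> * a" "b / \<epsilon>"]
  have "4 * ((\<epsilon> * a) * (b / \<epsilon>)) \<le> (\<epsilon> * a + b / \<epsilon>)\<^sup>2" by (simp only: mult.assoc)
  moreover have "(\<epsilon> * a) * (b / \<epsilon>) = a * b" using assms(4) by simp
  ultimately show "y\<^sup>2 \<le> ((\<epsilon> * a + b / \<epsilon>) / 2)\<^sup>2" using assms(1) by (simp add: power_divide)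
  show "0 \<le> (\<epsilon> * a + b / \<epsilon>) / 2" using assms by simp
qed

lemma sum_affine:
  fixes a b :: "'i \<Rightarrow> real"
  shows "(\<Sum>x\<in>S. K * ((\<epsilon> * a x + b x / \<epsilon>) / 2)) = K * ((\<epsilon> * (\<Sum>x\<in>S. a x) + (\<Sum>x\<in>S. b x) / \<epsilon>) / 2)"
  by (simp only: sum_distrib_left sum_divide_distrib sum.distrib[symmetric])

text \<open>Level 0 is the whole range from 0 to 2 and later levels are octaves: in a discrete space
  no scales below 1 have to be resolved.\<close>

definition lo :: "nat \<Rightarrow> real" where "lo l = (if l = 0 then 0 else 2 ^ l)"
definition hi :: "nat \<Rightarrow> real" where "hi l = 2 ^ Suc l"

lemma lo_Suc: "lo (Suc l) = hi l" by (simp add: lo_def hi_def)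
lemma lo_0: "lo 0 = 0" by (simp add: lo_def)
lemma lo_hi: "0 \<le> lo l" "lo l \<le> hi l" "hi l > 0" by (auto simp: lo_def hi_def)

text \<open>The part of the reproducing formula with \<open>t\<close> in level \<open>l\<close> and
  source point \<open>m\<close>: the kernel of order \<open>M\<close> is centred at
  \<open>m\<close>, and its amplitude is \<open>t\<close>-dependent through the order 1 evolution of
  \<open>f\<close>.\<close>

definition pix :: "nat \<Rightarrow> (int \<Rightarrow> complex) \<Rightarrow> nat \<Rightarrow> int \<Rightarrow> int \<Rightarrow> complex" where
  "pix M f l m n = integral {lo l..hi l} (\<lambda>t. (cald M * t ^ (2 * M + 1)) *\<^sub>R (hk M (t\<^sup>2) (n - m) * hconv 1 (t\<^sup>2) f m))"

text \<open>\<open>t ^ 3 * v^2\<close> is \<open>(t^2 * v)^2 / t\<close>, so this is the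
  contribution of level \<open>l\<close> and point \<open>m\<close> to the square function, with the
  factor \<open>1 / (t + 1)\<close> left out.\<close>

definition pen :: "(int \<Rightarrow> complex) \<Rightarrow> nat \<Rightarrow> int \<Rightarrow> real" where
  "pen f l m = integral {lo l..hi l} (\<lambda>t. t ^ 3 * (norm (hconv 1 (t\<^sup>2) f m))\<^sup>2)"

lemma hk_continuous_sq: "continuous_on A (\<lambda>t. hk k (t\<^sup>2) n)"
  by (intro continuous_on_compose2[OF hk_continuous[of UNIV], of _ "\<lambda>t. t\<^sup>2"] continuous_intros) auto

context
  fixes f :: "int \<Rightarrow> complex" and F :: real and d :: nat
  assumes F: "F > 0" "poly_growth F d f"
begin

lemma hconv_continuous_sq: "continuous_on A (\<lambda>t. hconv k (t\<^sup>2) f n)"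
  by (intro continuous_on_compose2[OF hconv_continuous'[OF F], of _ "\<lambda>t. t\<^sup>2"] continuous_intros) auto

lemma pix_continuous:
  "continuous_on A (\<lambda>t. (cald M * t ^ (2 * M + 1)) *\<^sub>R (hk M (t\<^sup>2) (n - m) * hconv 1 (t\<^sup>2) f m))"
  by (intro continuous_intros hk_continuous_sq hconv_continuous_sq)

lemma pen_continuous: "continuous_on A (\<lambda>t. t ^ 3 * (norm (hconv 1 (t\<^sup>2) f m))\<^sup>2)"
  by (intro continuous_intros hconv_continuous_sq)

lemma pen_nonneg: "pen f l m \<ge> 0"
  unfolding pen_def
  by (rule integral_nonneg[OF integrable_continuous_real[OF pen_continuous]]) (use lo_hi[of l] in auto)

lemma pix_integrand_bound:
  "\<exists>C>0. \<forall>t\<in>{lo l..hi l}. \<forall>m. norm ((cald M * t ^ (2 * M + 1)) *\<^sub>R (hk M (t\<^sup>2) (n - m) * hconv 1 (t\<^sup>2) f m))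
     \<le> C * (1 / (1 + \<bar>real_of_int (n - m)\<bar>) ^ 2)"
proof -
  obtain A where A: "A > 0" "\<And>s. s \<in> {0..(hi l)\<^sup>2} \<Longrightarrow> poly_growth A d (hconv 1 s f)"
    using poly_growth_hconv[OF F] by blast
  obtain C where C: "C > 0" "\<And>s n. s \<in> {0..(hi l)\<^sup>2} \<Longrightarrow> norm (hk M s n) \<le> C / (1 + \<bar>real_of_int n\<bar>) ^ (d + 2)"
    using hk_decay_compact by blast
  define D where "D = cald M * hi l ^ (2 * M + 1) * (C * A * (1 + \<bar>real_of_int n\<bar>) ^ d)"
  have D: "D > 0" using A C lo_hi[of l] by (simp add: D_def cald_pos)
  have "norm ((cald M * t ^ (2 * M + 1)) *\<^sub>R (hk M (t\<^sup>2) (n - m) * hconv 1 (t\<^sup>2) f m)) \<le> D * (1 / (1 + \<bar>real_of_int (n - m)\<bar>) ^ 2)"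
    if t: "t \<in> {lo l..hi l}" for t m
  proof -
    have t0: "0 \<le> t" "t \<le> hi l" using t lo_hi[of l] by auto
    then have t2: "t\<^sup>2 \<in> {0..(hi l)\<^sup>2}" by (auto intro: power_mono)
    define w where "w = 1 + \<bar>real_of_int (n - m)\<bar>"
    have w: "w > 0" by (simp add: w_def)
    have "norm (hconv 1 (t\<^sup>2) f m) \<le> A * (1 + \<bar>real_of_int m\<bar>) ^ d" using A(2)[OF t2] by (simp add: poly_growth_def)
    also have "\<dots> \<le> A * ((1 + \<bar>real_of_int n\<bar>) * w) ^ d"
      unfolding w_def using A(1) by (intro mult_left_mono power_mono weight_mult) auto
    finally have "norm (hk M (t\<^sup>2) (n - m) * hconv 1 (t\<^sup>2) f m) \<le> (C / w ^ (d + 2)) * (A * ((1 + \<bar>real_of_int n\<bar>) * w) ^ d)"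
      unfolding norm_mult w_def using C(1) by (intro mult_mono C(2)[OF t2]) auto
    also have "(C / w ^ (d + 2)) * (A * (v * w) ^ d) = (C * A * v ^ d) * (1 / w ^ 2)" for v
      using w by (simp add: power_mult_distrib power_add power2_eq_square field_simps)
    finally have "norm (hk M (t\<^sup>2) (n - m) * hconv 1 (t\<^sup>2) f m) \<le> (C * A * (1 + \<bar>real_of_int n\<bar>) ^ d) * (1 / w ^ 2)" .
    moreover have "cald M * t ^ (2 * M + 1) \<le> cald M * hi l ^ (2 * M + 1)"
      using t0 cald_pos[of M] by (intro mult_left_mono power_mono) auto
    ultimately have "(cald M * t ^ (2 * M + 1)) * norm (hk M (t\<^sup>2) (n - m) * hconv 1 (t\<^sup>2) f m)
       \<le> (cald M * hi l ^ (2 * M + 1)) * ((C * A * (1 + \<bar>real_of_int n\<bar>) ^ d) * (1 / w ^ 2))"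
      using cald_pos[of M] lo_hi[of l] t0 by (intro mult_mono) auto
    moreover have "\<bar>cald M * t ^ (2 * M + 1)\<bar> = cald M * t ^ (2 * M + 1)" using t0 cald_pos[of M] by simp
    ultimately show ?thesis unfolding norm_scaleR D_def w_def by (simp only: mult.assoc)
  qed
  then show ?thesis using D by blast
qed

text \<open>Summing over the source applies the semigroup law: order \<open>M\<close> at
  \<open>t^2\<close> and order 1 at \<open>t^2\<close> combine to order \<open>Suc M\<close> at
  \<open>2 * t^2\<close>, to which \<open>cald_integral\<close> applies.\<close>

lemma pix_has_sum:
  "((\<lambda>m. pix M f l m n) has_sum
     (cald_rest M (\<lambda>k s. hconv k s f n) (lo l) - cald_rest M (\<lambda>k s. hconv k s f n) (hi l))) UNIV"
proof -
  obtain C where C: "C > 0" "\<And>t m. t \<in> {lo l..hi l} \<Longrightarrow> norm ((cald M * t ^ (2 * M + 1)) *\<^sub>R (hk M (t\<^sup>2) (n - m) * hconv 1 (t\<^sup>2) f m))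
     \<le> C * (1 / (1 + \<bar>real_of_int (n - m)\<bar>) ^ 2)" using pix_integrand_bound by blast
  have "((\<lambda>m. pix M f l m n) has_sum integral {lo l..hi l} (\<lambda>t. \<Sum>\<^sub>\<infinity>m. (cald M * t ^ (2 * M + 1)) *\<^sub>R (hk M (t\<^sup>2) (n - m) * hconv 1 (t\<^sup>2) f m))) UNIV"
    unfolding pix_def
    by (rule has_sum_integral_infsum[OF pix_continuous C(2) summable_on_cmult_right[OF summable_on_inverse_square_int_shift(1)]])
  also have "(\<lambda>t. \<Sum>\<^sub>\<infinity>m. (cald M * t ^ (2 * M + 1)) *\<^sub>R (hk M (t\<^sup>2) (n - m) * hconv 1 (t\<^sup>2) f m)) =
    (\<lambda>t. (cald M * t ^ (2 * M + 1)) *\<^sub>R hconv (Suc M) (2 * t\<^sup>2) f n)"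
  proof
    fix t :: real
    have "((\<lambda>m. hk M (t\<^sup>2) (n - m) * hconv 1 (t\<^sup>2) f m) has_sum hconv (M + 1) (t\<^sup>2 + t\<^sup>2) f n) UNIV"
      by (rule hconv_semigroup[OF F]) auto
    then have "((\<lambda>m. of_real (cald M * t ^ (2 * M + 1)) * (hk M (t\<^sup>2) (n - m) * hconv 1 (t\<^sup>2) f m)) has_sum
        of_real (cald M * t ^ (2 * M + 1)) * hconv (M + 1) (t\<^sup>2 + t\<^sup>2) f n) UNIV"
      by (rule has_sum_cmult_right)
    then show "(\<Sum>\<^sub>\<infinity>m. (cald M * t ^ (2 * M + 1)) *\<^sub>R (hk M (t\<^sup>2) (n - m) * hconv 1 (t\<^sup>2) f m)) = (cald M * t ^ (2 * M + 1)) *\<^sub>R hconv (Suc M) (2 * t\<^sup>2) f n"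
      by (simp add: scaleR_conv_of_real infsumI mult.assoc flip: mult_2)
  qed
  also have "integral {lo l..hi l} (\<lambda>t. (cald M * t ^ (2 * M + 1)) *\<^sub>R hconv (Suc M) (2 * t\<^sup>2) f n) =
     cald_rest M (\<lambda>k s. hconv k s f n) (lo l) - cald_rest M (\<lambda>k s. hconv k s f n) (hi l)"
    by (rule integral_unique, rule cald_integral) (use lo_hi[of l] hconv_has_derivative[OF F] in auto)
  finally show ?thesis .
qed

end

section \<open>Sums of pieces below one dyadic interval: decay, l^2 bound and moments\<close>

definition group_sum :: "nat \<Rightarrow> (int \<Rightarrow> complex) \<Rightarrow> (nat \<times> int) set \<Rightarrow> int \<Rightarrow> complex" where
  "group_sum M f S n = (\<Sum>(l, m)\<in>S. pix M f l m n)"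

text \<open>Away from the base interval the kernel is bounded by a power of the distance, uniformly
  in time. What remains is Cauchy-Schwarz between the energy of \<open>f\<close> and the integrals
  of \<open>t ^ (4 * M - 1)\<close>, which grow geometrically in the level and are dominated by the
  top one.\<close>

lemma group_sum_decay:
  assumes M: "M \<ge> 1"
  shows "\<exists>C>0. \<forall>f F d l0 x0 S B n. F > 0 \<longrightarrow> poly_growth F d f \<longrightarrow> S \<subseteq> {..l0} \<times> {x0..<x0 + 2 ^ l0} \<longrightarrow> B > 0 \<longrightarrow>
     (\<Sum>(l, m)\<in>S. pen f l m) \<le> B\<^sup>2 * 2 ^ l0 \<longrightarrow> \<bar>n - x0\<bar> \<ge> 2 * 2 ^ l0 \<longrightarrow>
     norm (group_sum M f S n) \<le> C * B * (2 ^ l0 / \<bar>real_of_int (n - x0)\<bar>) ^ (2 * M + 1)"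
proof -
  \<comment> \<open>The decay exponent equal to the order of the kernel, for which the powers of
    \<open>sqrt (1 + s)\<close> cancel.\<close>
  define e where "e = 2 * M + 1"
  obtain C0 where C0: "C0 > 0" "\<And>s n. s \<ge> 0 \<Longrightarrow> (1 + \<bar>real_of_int n\<bar>) ^ e * norm (hk M s n) * sqrt (1 + s) ^ Suc (2 * M)
     \<le> C0 * sqrt (1 + s) ^ e" using hk_decay[of e M] by blast
  have hkb: "norm (hk M s n) \<le> C0 / (1 + \<bar>real_of_int n\<bar>) ^ e" if s: "s \<ge> 0" for s n
  proof -
    have "sqrt (1 + s) ^ e > 0" using s by simp
    moreover have "(1 + \<bar>real_of_int n\<bar>) ^ e * norm (hk M s n) * sqrt (1 + s) ^ e \<le> C0 * sqrt (1 + s) ^ e"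
      using C0(2)[OF s, of n] by (simp add: e_def)
    ultimately have "(1 + \<bar>real_of_int n\<bar>) ^ e * norm (hk M s n) \<le> C0" by (rule mult_right_le_imp_le[rotated])
    then show ?thesis by (simp add: pos_le_divide_eq add_pos_nonneg mult.commute)
  qed
  define A :: real where "A = 1 + 2 * 2 ^ (4 * M)"
  define K0 where "K0 = cald M * C0 * 2 ^ e"
  have K0: "K0 > 0" using C0(1) cald_pos[of M] by (simp add: K0_def)
  have main: "norm (group_sum M f S n) \<le> (K0 * A) * B * (2 ^ l0 / \<bar>real_of_int (n - x0)\<bar>) ^ (2 * M + 1)"
    if F: "F > 0" "poly_growth F d f" and S: "S \<subseteq> {..l0} \<times> {x0..<x0 + 2 ^ l0}" and B: "B > 0"
     and E: "(\<Sum>(l, m)\<in>S. pen f l m) \<le> B\<^sup>2 * 2 ^ l0" and n: "\<bar>n - x0\<bar> \<ge> 2 * 2 ^ l0"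
    for f F d l0 x0 S B n
  proof -
    define L where "L = (2::real) ^ l0"
    have L: "L > 0" by (simp add: L_def)
    define y where "y = \<bar>real_of_int (n - x0)\<bar>"
    have yL: "y \<ge> 2 * L"
    proof -
      have "real_of_int \<bar>n - x0\<bar> \<ge> real_of_int (2 * 2 ^ l0)" using n by (simp only: of_int_le_iff)
      then show ?thesis by (simp add: y_def L_def)
    qed
    have y: "y > 0" using yL L by linarith
    \<comment> \<open>Balances the two halves: both the energy term and the power integrals become a
      constant times \<open>B * L ^ e\<close>.\<close>
    define \<epsilon> where "\<epsilon> = L ^ (2 * M) / B"
    have \<epsilon>: "\<epsilon> > 0" using L B by (simp add: \<epsilon>_def)
    have finS: "finite S" using S by (rule finite_subset) auto
    have trm: "norm (pix M f l m n) \<le> K0 / y ^ e * ((\<epsilon> * pen f l m + (hi l ^ (4 * M)) / \<epsilon>) / 2)" if lm: "(l, m) \<in> S" for l m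
    proof -
      have m: "m \<in> {x0..<x0 + 2 ^ l0}" using S lm by auto
      have "\<bar>real_of_int (n - m)\<bar> \<ge> y / 2"
      proof -
        have "real_of_int m < real_of_int (x0 + 2 ^ l0)" using m by (intro of_int_less_iff[THEN iffD2]) simp
        then have "\<bar>real_of_int (m - x0)\<bar> \<le> L" using m by (simp add: L_def)
        moreover have "y \<le> \<bar>real_of_int (n - m)\<bar> + \<bar>real_of_int (m - x0)\<bar>" by (simp add: y_def)
        ultimately show ?thesis using yL by linarith
      qed
      then have w: "(y / 2) ^ e \<le> (1 + \<bar>real_of_int (n - m)\<bar>) ^ e" using y by (intro power_mono) auto
      have hk2: "norm (hk M (t\<^sup>2) (n - m)) \<le> C0 * 2 ^ e / y ^ e" for t
      proof -
        have "norm (hk M (t\<^sup>2) (n - m)) \<le> C0 / (1 + \<bar>real_of_int (n - m)\<bar>) ^ e" by (rule hkb) simp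
        also have "\<dots> \<le> C0 / (y / 2) ^ e" using w C0(1) y by (intro divide_left_mono mult_pos_pos) (auto simp: add_pos_nonneg)
        finally show ?thesis by (simp add: power_divide)
      qed
      have b: "norm ((cald M * t ^ (2 * M + 1)) *\<^sub>R (hk M (t\<^sup>2) (n - m) * hconv 1 (t\<^sup>2) f m))
          \<le> K0 / y ^ e * ((\<epsilon> * (t ^ 3 * (norm (hconv 1 (t\<^sup>2) f m))\<^sup>2) + t ^ (4 * M - 1) / \<epsilon>) / 2)"
        if t: "t \<in> {lo l..hi l}" for t
      proof -
        have t0: "t \<ge> 0" using t lo_hi[of l] by auto
        define v where "v = norm (hconv 1 (t\<^sup>2) f m)"
        have "t ^ (2 * M + 1) * v \<le> (\<epsilon> * (t ^ 3 * v\<^sup>2) + t ^ (4 * M - 1) / \<epsilon>) / 2"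
        proof (rule amgm_weighted)
          have "(2 * M + 1) * 2 = 3 + (4 * M - 1)" using M by simp
          then have "(t ^ (2 * M + 1))\<^sup>2 = t ^ 3 * t ^ (4 * M - 1)" by (metis power_mult power_add)
          then show "(t ^ (2 * M + 1) * v)\<^sup>2 = (t ^ 3 * v\<^sup>2) * t ^ (4 * M - 1)" by (simp add: power_mult_distrib)
        qed (use t0 \<epsilon> in auto)
        moreover have "norm ((cald M * t ^ (2 * M + 1)) *\<^sub>R (hk M (t\<^sup>2) (n - m) * hconv 1 (t\<^sup>2) f m)) = cald M * norm (hk M (t\<^sup>2) (n - m)) * (t ^ (2 * M + 1) * v)"
          using t0 cald_pos[of M] by (simp add: norm_mult v_def)
        moreover have "cald M * norm (hk M (t\<^sup>2) (n - m)) \<le> K0 / y ^ e"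
          using hk2[of t] cald_pos[of M] by (simp add: K0_def mult.assoc flip: times_divide_eq_right)
        ultimately show ?thesis
          unfolding v_def[symmetric] using t0 K0 y
          by (simp only:) (intro mult_mono, auto simp: v_def)
      qed
      have "norm (pix M f l m n) \<le> integral {lo l..hi l} (\<lambda>t. K0 / y ^ e * ((\<epsilon> * (t ^ 3 * (norm (hconv 1 (t\<^sup>2) f m))\<^sup>2) + t ^ (4 * M - 1) / \<epsilon>) / 2))"
        unfolding pix_def
        by (rule integral_norm_bound_integral[OF integrable_continuous_real[OF pix_continuous[OF F]] _ b])
          (intro integrable_continuous_real continuous_intros hconv_continuous_sq[OF F]; use \<epsilon> in simp)
      also have "\<dots> = K0 / y ^ e * ((\<epsilon> * pen f l m + integral {lo l..hi l} (\<lambda>t. t ^ (4 * M - 1)) / \<epsilon>) / 2)"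
      proof -
        have i1: "((\<lambda>t. t ^ 3 * (norm (hconv 1 (t\<^sup>2) f m))\<^sup>2) has_integral pen f l m) {lo l..hi l}"
          unfolding pen_def by (intro integrable_integral integrable_continuous_real pen_continuous[OF F])
        have i2: "((\<lambda>t. t ^ (4 * M - 1)) has_integral integral {lo l..hi l} (\<lambda>t. t ^ (4 * M - 1))) {lo l..hi l}"
          by (intro integrable_integral integrable_continuous_real continuous_intros)
        show ?thesis
          by (rule integral_unique) (intro has_integral_mult_right has_integral_divide has_integral_add i1 i2)
      qed
      also have "\<dots> \<le> K0 / y ^ e * ((\<epsilon> * pen f l m + (hi l ^ (4 * M)) / \<epsilon>) / 2)"
      proof -
        have "integral {lo l..hi l} (\<lambda>t. t ^ (4 * M - 1)) \<le> integral {lo l..hi l} (\<lambda>t. hi l ^ (4 * M - 1))"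
          by (rule integral_le) (use lo_hi[of l] in \<open>auto intro!: integrable_continuous_real continuous_intros power_mono\<close>)
        also have "\<dots> = hi l ^ (4 * M - 1) * (hi l - lo l)" using lo_hi[of l] by simp
        also have "\<dots> \<le> hi l ^ (4 * M - 1) * hi l" using lo_hi[of l] by (intro mult_left_mono) auto
        also have "\<dots> = hi l ^ (4 * M)" using M by (simp flip: power_Suc2)
        finally show ?thesis using \<epsilon> K0 y by (intro mult_left_mono divide_right_mono add_left_mono) auto
      qed
      finally show ?thesis .
    qed
    have "(\<Sum>(l, m)\<in>S. hi l ^ (4 * M)) \<le> (\<Sum>(l, m)\<in>{..l0} \<times> {x0..<x0 + 2 ^ l0}. hi l ^ (4 * M))"
      using S lo_hi(3) by (intro sum_mono2) (auto simp: less_imp_le)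
    also have "\<dots> = L * (\<Sum>l\<le>l0. hi l ^ (4 * M))"
      by (simp add: sum.cartesian_product[symmetric] sum_distrib_left L_def nat_power_eq)
    also have "(\<Sum>l\<le>l0. hi l ^ (4 * M)) \<le> 2 * (2 * L) ^ (4 * M)"
      unfolding L_def
    proof (induction l0)
      case 0 then show ?case by (simp add: hi_def)
    next
      case (Suc k)
      have "2 * (2 * 2 ^ k) ^ (4 * M) \<le> (2 * 2 ^ Suc k :: real) ^ (4 * M)"
      proof -
        have "2 ^ 1 \<le> (2::real) ^ (4 * M)" using M by (intro power_increasing) auto
        then have "2 * (2 * 2 ^ k) ^ (4 * M) \<le> 2 ^ (4 * M) * (2 * 2 ^ k :: real) ^ (4 * M)" by (intro mult_right_mono) auto
        moreover have "2 ^ (4 * M) * (2 * 2 ^ k) ^ (4 * M) = (2 * 2 ^ Suc k :: real) ^ (4 * M)"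
          unfolding power_mult_distrib[symmetric] by simp
        ultimately show ?thesis by linarith
      qed
      moreover have "hi (Suc k) ^ (4 * M) = (2 * 2 ^ Suc k) ^ (4 * M)" by (simp add: hi_def)
      ultimately show ?case using Suc.IH unfolding sum.atMost_Suc by linarith
    qed
    finally have hs: "(\<Sum>(l, m)\<in>S. hi l ^ (4 * M)) \<le> 2 * (2 * L) ^ (4 * M) * L" using L by (simp add: mult.commute)
    have "norm (group_sum M f S n) \<le> (\<Sum>(l, m)\<in>S. K0 / y ^ e * ((\<epsilon> * pen f l m + (hi l ^ (4 * M)) / \<epsilon>) / 2))"
      unfolding group_sum_def by (rule sum_norm_le) (use trm in auto)
    also have "\<dots> = K0 / y ^ e * ((\<epsilon> * (\<Sum>(l, m)\<in>S. pen f l m) + (\<Sum>(l, m)\<in>S. hi l ^ (4 * M)) / \<epsilon>) / 2)"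
      unfolding case_prod_unfold by (rule sum_affine)
    also have "\<dots> \<le> K0 / y ^ e * ((\<epsilon> * (B\<^sup>2 * L) + (2 * (2 * L) ^ (4 * M) * L) / \<epsilon>) / 2)"
      using E hs \<epsilon> K0 y unfolding L_def[symmetric] by (intro mult_left_mono divide_right_mono add_mono) auto
    also have "\<dots> \<le> K0 / y ^ e * (A * (B * L ^ e))"
    proof -
      have "\<epsilon> * (B\<^sup>2 * L) = B * L ^ e" using B by (simp add: \<epsilon>_def e_def power2_eq_square field_simps)
      moreover have "(2 * (2 * L) ^ (4 * M) * L) / \<epsilon> = 2 * 2 ^ (4 * M) * (B * L ^ e)"
      proof -
        have "L ^ (4 * M) = L ^ (2 * M) * L ^ (2 * M)" by (simp flip: power_add)
        then show ?thesis using B L by (simp add: \<epsilon>_def e_def power_mult_distrib)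
      qed
      ultimately have "(\<epsilon> * (B\<^sup>2 * L) + (2 * (2 * L) ^ (4 * M) * L) / \<epsilon>) / 2 = A * (B * L ^ e) / 2"
        by (simp add: A_def algebra_simps)
      moreover have "0 \<le> A * (B * L ^ e)" using B L by (simp add: A_def)
      moreover have "u / 2 \<le> v" if "u / 2 = v / 2" "0 \<le> v" for u v :: real using that by simp
      ultimately have le: "(\<epsilon> * (B\<^sup>2 * L) + (2 * (2 * L) ^ (4 * M) * L) / \<epsilon>) / 2 \<le> A * (B * L ^ e)" by blast
      show ?thesis by (rule mult_left_mono[OF le]) (use K0 y in simp)
    qed
    also have "\<dots> = (K0 * A) * B * (L / y) ^ e" by (simp add: power_divide)
    finally show ?thesis by (simp only: L_def y_def e_def)
  qed
  have "K0 * A > 0" using K0 by (simp add: A_def add_pos_pos)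
  then show ?thesis by (intro exI[of _ "K0 * A"] conjI allI impI main)
qed

lemma integral_levels:
  fixes g :: "real \<Rightarrow> real"
  assumes "continuous_on UNIV g"
  shows "(\<Sum>l\<le>l0. integral {lo l..hi l} g) = integral {0..hi l0} g"
proof (induction l0)
  case 0 then show ?case by (simp add: lo_0)
next
  case (Suc k)
  have "integral {0..hi k} g + integral {hi k..hi (Suc k)} g = integral {0..hi (Suc k)} g"
    by (rule Henstock_Kurzweil_Integration.integral_combine)
      (use lo_hi[of k] lo_hi[of "Suc k"] lo_Suc[of k] in \<open>auto intro: integrable_continuous_real continuous_on_subset[OF assms]\<close>)
  then show ?case using Suc by (simp add: lo_Suc)
qed

text \<open>Duality: the sum of squares over \<open>Y\<close> is paired with its own conjugate
  \<open>\<gamma>\<close>. The symmetric kernel is moved onto \<open>\<gamma>\<close>, where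
  \<open>quadratic_estimate\<close> applies, and half of the result is absorbed on the left.\<close>

lemma group_sum_l2:
  assumes M: "M \<ge> 1" and F: "F > 0" "poly_growth F d f" and S: "S \<subseteq> {..l0} \<times> {x0..<x0 + 2 ^ l0}" and Y: "finite Y"
  shows "(\<Sum>n\<in>Y. (norm (group_sum M f S n))\<^sup>2) \<le> (cald M)\<^sup>2 / cald (2 * M - 1) * (\<Sum>(l, m)\<in>S. pen f l m)"
proof -
  define g where "g = group_sum M f S"
  define \<gamma> where "\<gamma> = (\<lambda>n. if n \<in> Y then cnj (g n) else 0)"
  have \<gamma>0: "\<And>m. m \<notin> Y \<Longrightarrow> \<gamma> m = 0" by (simp add: \<gamma>_def)
  define G where "G = (\<Sum>n\<in>Y. (norm (g n))\<^sup>2)"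
  define E where "E = (\<Sum>(l, m)\<in>S. pen f l m)"
  define c where "c = cald M"
  define c' where "c' = 1 / cald (2 * M - 1)"
  have c: "c > 0" "c' > 0" by (simp_all add: c_def c'_def cald_pos)
  \<comment> \<open>With this value the quadratic term in \<open>\<gamma>\<close> becomes exactly
    \<open>G / 2\<close>, ready for absorption.\<close>
  define \<epsilon> where "\<epsilon> = c * c'"
  have \<epsilon>: "\<epsilon> > 0" using c by (simp add: \<epsilon>_def)
  have finS: "finite S" using S by (rule finite_subset) auto
  define v where "v = (\<lambda>t m. hconv M (t\<^sup>2) \<gamma> m)"
  have v: "v t m = (\<Sum>n\<in>Y. hk M (t\<^sup>2) (n - m) * \<gamma> n)" for t m
  proof -
    have e: "hk M (t\<^sup>2) (m - n) = hk M (t\<^sup>2) (n - m)" for n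
      using hk_minus[of M "t\<^sup>2" "n - m"] by simp
    have "hconv M (t\<^sup>2) \<gamma> m = (\<Sum>n\<in>Y. hk M (t\<^sup>2) (m - n) * \<gamma> n)"
      by (rule hconv_finite_support[OF Y \<gamma>0])
    then show ?thesis unfolding v_def e .
  qed
  have vc: "continuous_on A (\<lambda>t. v t m)" for A m
    unfolding v by (intro continuous_intros hk_continuous_sq)
  define q where "q = (\<lambda>l m. integral {lo l..hi l} (\<lambda>t. t ^ (4 * M - 1) * (norm (v t m))\<^sup>2))"
  have trm: "norm (\<Sum>n\<in>Y. pix M f l m n * \<gamma> n) \<le> c * ((\<epsilon> * pen f l m + q l m / \<epsilon>) / 2)" for l m
  proof -
    have "((\<lambda>t. \<Sum>n\<in>Y. (cald M * t ^ (2 * M + 1)) *\<^sub>R (hk M (t\<^sup>2) (n - m) * hconv 1 (t\<^sup>2) f m) * \<gamma> n) has_integral (\<Sum>n\<in>Y. pix M f l m n * \<gamma> n)) {lo l..hi l}"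
      unfolding pix_def
      by (intro has_integral_sum Y has_integral_mult_left integrable_integral integrable_continuous_real pix_continuous[OF F])
    moreover have "(\<Sum>n\<in>Y. (cald M * t ^ (2 * M + 1)) *\<^sub>R (hk M (t\<^sup>2) (n - m) * hconv 1 (t\<^sup>2) f m) * \<gamma> n) = (c * t ^ (2 * M + 1)) *\<^sub>R (v t m * hconv 1 (t\<^sup>2) f m)" for t
      by (simp add: v c_def sum_distrib_left sum_distrib_right scaleR_sum_right mult_ac)
    ultimately have "(\<Sum>n\<in>Y. pix M f l m n * \<gamma> n) = integral {lo l..hi l} (\<lambda>t. (c * t ^ (2 * M + 1)) *\<^sub>R (v t m * hconv 1 (t\<^sup>2) f m))"
      by (simp add: integral_unique)
    also have "norm \<dots> \<le> integral {lo l..hi l} (\<lambda>t. c * ((\<epsilon> * (t ^ 3 * (norm (hconv 1 (t\<^sup>2) f m))\<^sup>2) + t ^ (4 * M - 1) * (norm (v t m))\<^sup>2 / \<epsilon>) / 2))"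
    proof (rule integral_norm_bound_integral)
      fix t assume "t \<in> {lo l..hi l}"
      then have t0: "t \<ge> 0" using lo_hi[of l] by auto
      define a where "a = norm (hconv 1 (t\<^sup>2) f m)"
      define b where "b = norm (v t m)"
      have "t ^ (2 * M + 1) * (b * a) \<le> (\<epsilon> * (t ^ 3 * a\<^sup>2) + t ^ (4 * M - 1) * b\<^sup>2 / \<epsilon>) / 2"
      proof (rule amgm_weighted)
        have "(2 * M + 1) * 2 = 3 + (4 * M - 1)" using M by simp
        then have "(t ^ (2 * M + 1))\<^sup>2 = t ^ 3 * t ^ (4 * M - 1)" by (metis power_mult power_add)
        then show "(t ^ (2 * M + 1) * (b * a))\<^sup>2 = (t ^ 3 * a\<^sup>2) * (t ^ (4 * M - 1) * b\<^sup>2)" by (simp add: power_mult_distrib)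
      qed (use t0 \<epsilon> in auto)
      then have "c * (t ^ (2 * M + 1) * (b * a)) \<le> c * ((\<epsilon> * (t ^ 3 * a\<^sup>2) + t ^ (4 * M - 1) * b\<^sup>2 / \<epsilon>) / 2)"
        using c by (intro mult_left_mono) auto
      then show "norm ((c * t ^ (2 * M + 1)) *\<^sub>R (v t m * hconv 1 (t\<^sup>2) f m)) \<le> c * ((\<epsilon> * (t ^ 3 * (norm (hconv 1 (t\<^sup>2) f m))\<^sup>2) + t ^ (4 * M - 1) * (norm (v t m))\<^sup>2 / \<epsilon>) / 2)"
        using t0 c by (simp add: a_def b_def norm_mult mult.assoc)
    qed (intro integrable_continuous_real continuous_intros vc hconv_continuous_sq[OF F]; use \<epsilon> in simp)+
    also have "\<dots> = c * ((\<epsilon> * pen f l m + q l m / \<epsilon>) / 2)"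
      unfolding pen_def q_def
      by (intro integral_unique has_integral_mult_right has_integral_divide has_integral_add integrable_integral integrable_continuous_real pen_continuous[OF F] continuous_intros vc)
    finally show ?thesis .
  qed
  have q0: "q l m \<ge> 0" for l m
    unfolding q_def by (rule integral_nonneg) (use lo_hi[of l] in \<open>auto intro!: integrable_continuous_real continuous_intros vc\<close>)
  have "(\<Sum>(l, m)\<in>S. q l m) \<le> (\<Sum>(l, m)\<in>{..l0} \<times> {x0..<x0 + 2 ^ l0}. q l m)"
    using S q0 by (intro sum_mono2) auto
  also have "\<dots> = (\<Sum>m\<in>{x0..<x0 + 2 ^ l0}. \<Sum>l\<le>l0. q l m)"
    by (subst sum.swap) (simp add: sum.cartesian_product)
  also have "\<dots> = (\<Sum>m\<in>{x0..<x0 + 2 ^ l0}. integral {0..hi l0} (\<lambda>t. t ^ (4 * M - 1) * (norm (v t m))\<^sup>2))"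
    unfolding q_def by (intro sum.cong refl integral_levels continuous_intros vc)
  also have "\<dots> \<le> c' * (\<Sum>m\<in>Y. (norm (\<gamma> m))\<^sup>2)"
    unfolding v_def c'_def by (rule quadratic_estimate[OF M Y \<gamma>0]) (use lo_hi[of l0] in auto)
  also have "(\<Sum>m\<in>Y. (norm (\<gamma> m))\<^sup>2) = G" unfolding G_def by (rule sum.cong) (auto simp: \<gamma>_def)
  finally have qs: "(\<Sum>(l, m)\<in>S. q l m) \<le> c' * G" .
  have "complex_of_real G = (\<Sum>n\<in>Y. g n * \<gamma> n)"
    unfolding G_def of_real_sum by (rule sum.cong) (auto simp: \<gamma>_def complex_norm_square simp del: of_real_power)
  also have "\<dots> = (\<Sum>(l, m)\<in>S. \<Sum>n\<in>Y. pix M f l m n * \<gamma> n)"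
    unfolding g_def group_sum_def sum_distrib_right case_prod_unfold by (rule sum.swap)
  finally have "norm (complex_of_real G) = norm (\<Sum>(l, m)\<in>S. \<Sum>n\<in>Y. pix M f l m n * \<gamma> n)" by simp
  also have "\<dots> \<le> (\<Sum>(l, m)\<in>S. c * ((\<epsilon> * pen f l m + q l m / \<epsilon>) / 2))"
    by (rule sum_norm_le) (use trm in auto)
  also have "\<dots> = c * ((\<epsilon> * E + (\<Sum>(l, m)\<in>S. q l m) / \<epsilon>) / 2)"
    unfolding case_prod_unfold E_def by (rule sum_affine)
  also have "\<dots> \<le> c * ((\<epsilon> * E + (c' * G) / \<epsilon>) / 2)"
    using qs c \<epsilon> by (intro mult_left_mono divide_right_mono add_left_mono) auto
  also have "\<dots> = (c\<^sup>2 * c' * E + G) / 2" using c by (simp add: \<epsilon>_def power2_eq_square field_simps)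
  finally have "G \<le> (c\<^sup>2 * c' * E + G) / 2" by simp
  then show ?thesis by (simp add: G_def g_def E_def c_def c'_def)
qed

section \<open>Vanishing moments of the pieces\<close>

lemma poly_of_int_bound:
  fixes q :: "complex poly"
  assumes "degree q \<le> D"
  shows "\<exists>C>0. \<forall>n::int. norm (poly q (of_int n)) \<le> C * (1 + \<bar>real_of_int n\<bar>) ^ D"
proof -
  define C where "C = (\<Sum>i\<le>degree q. norm (coeff q i)) + 1"
  have "C > 0" by (simp add: C_def add_nonneg_pos sum_nonneg)
  moreover have "norm (poly q (of_int n)) \<le> C * (1 + \<bar>real_of_int n\<bar>) ^ D" for n :: int
  proof -
    have "norm (poly q (of_int n)) \<le> (\<Sum>i\<le>degree q. norm (coeff q i) * (1 + \<bar>real_of_int n\<bar>) ^ D)"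
      unfolding poly_altdef
    proof (rule sum_norm_le)
      fix i assume "i \<in> {..degree q}"
      then have i: "i \<le> D" using assms by simp
      have "\<bar>real_of_int n\<bar> ^ i \<le> (1 + \<bar>real_of_int n\<bar>) ^ i" by (intro power_mono) auto
      also have "\<dots> \<le> (1 + \<bar>real_of_int n\<bar>) ^ D" using i by (intro power_increasing) auto
      finally show "norm (coeff q i * of_int n ^ i) \<le> norm (coeff q i) * (1 + \<bar>real_of_int n\<bar>) ^ D"
        unfolding norm_mult norm_power norm_of_int by (intro mult_left_mono) auto
    qed
    also have "\<dots> \<le> C * (1 + \<bar>real_of_int n\<bar>) ^ D"
      unfolding sum_distrib_right[symmetric] by (intro mult_right_mono) (auto simp: C_def)
    finally show ?thesis .
  qed
  ultimately show ?thesis by blast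
qed

lemma poly_diff_drop:
  assumes "\<forall>i\<ge>Suc K. coeff q i = 0"
  shows "\<forall>i\<ge>K. coeff (poly_diff h q) i = 0"
proof (cases K)
  case 0
  have "q = [:coeff q 0:]"
    using assms 0 by (intro poly_eqI) (auto simp: coeff_pCons split: nat.splits)
  then obtain a where "q = [:a:]" by blast
  then show ?thesis by (simp add: poly_diff_def)
next
  case (Suc k)
  have "\<forall>i>Suc k. coeff q i = 0" using assms Suc by simp
  from poly_diff_degree[OF this, of h] show ?thesis by (simp add: Suc Suc_le_eq)
qed

text \<open>Each Laplacian on the kernel can be moved to the polynomial as a second difference,
  lowering the degree by two. After \<open>k\<close> steps the polynomial is zero, so moments of the
  heat kernel itself never enter.\<close>

lemma hk_moments:
  "(\<forall>i\<ge>2 * k. coeff q i = 0) \<Longrightarrow> s \<ge> 0 \<Longrightarrow> ((\<lambda>n. poly q (of_int n) * hk k s n) has_sum 0) UNIV"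
proof (induction k arbitrary: q)
  case 0
  then have "q = 0" by (simp add: poly_eq_iff)
  then show ?case by simp
next
  case (Suc k)
  define h where "h = hk k s"
  have sm: "(\<lambda>n. poly r (of_int n) * h n) summable_on UNIV" for r
  proof -
    obtain C where C: "C > 0" "\<And>n. norm (poly r (of_int n)) \<le> C * (1 + \<bar>real_of_int n\<bar>) ^ degree r"
      using poly_of_int_bound[of r "degree r"] by auto
    obtain A where A: "A > 0" "\<And>t n. t \<in> {0..s} \<Longrightarrow> norm (hk k t n) \<le> A / (1 + \<bar>real_of_int n\<bar>) ^ (degree r + 2)"
      using hk_decay_compact by blast
    have "norm (poly r (of_int n) * h n) \<le> C * A * (1 / (1 + \<bar>real_of_int n\<bar>) ^ 2)" for n
    proof -
      define w where "w = 1 + \<bar>real_of_int n\<bar>"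
      have w: "w > 0" by (simp add: w_def)
      have "norm (poly r (of_int n) * h n) \<le> (C * w ^ degree r) * (A / w ^ (degree r + 2))"
        unfolding norm_mult w_def h_def using C(1) Suc.prems(2) by (intro mult_mono C(2) A(2)) auto
      also have "\<dots> = C * A * (1 / w ^ 2)" using w by (simp add: power_add power2_eq_square)
      finally show ?thesis by (simp add: w_def)
    qed
    then show ?thesis by (intro summable_on_norm_bound[OF summable_on_cmult_right[OF summable_on_inverse_square_int]])
  qed
  define r where "r = poly_diff 1 (poly_diff (- 1) q)"
  have "\<forall>i\<ge>Suc (Suc (2 * k)). coeff q i = 0" using Suc.prems by simp
  then have "\<forall>i\<ge>2 * k. coeff r i = 0" unfolding r_def by (intro poly_diff_drop)
  then have IH: "((\<lambda>n. poly r (of_int n) * h n) has_sum 0) UNIV" unfolding h_def by (rule Suc.IH) (rule Suc.prems)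
  have sh: "\<exists>a. ((\<lambda>n. poly q (of_int (n + c)) * h n) has_sum a) UNIV \<and> ((\<lambda>n. poly q (of_int n) * h (n - c)) has_sum a) UNIV" for c :: int
  proof -
    have "(\<lambda>n. poly (pcompose q [:of_int c, 1:]) (of_int n) * h n) = (\<lambda>n. poly q (of_int (n + c)) * h n)"
      by (simp add: poly_pcompose add.commute)
    then have 1: "((\<lambda>n. poly q (of_int (n + c)) * h n) has_sum infsum (\<lambda>n. poly q (of_int (n + c)) * h n) UNIV) UNIV"
      using sm[of "pcompose q [:of_int c, 1:]"] by simp
    then have "((\<lambda>n. poly q (of_int (n + (- c) + c)) * h (n + (- c))) has_sum infsum (\<lambda>n. poly q (of_int (n + c)) * h n) UNIV) UNIV"
      by (subst has_sum_shift_int(1)[where f="\<lambda>n. poly q (of_int (n + c)) * h n"])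
    then have "((\<lambda>n. poly q (of_int n) * h (n - c)) has_sum infsum (\<lambda>n. poly q (of_int (n + c)) * h n) UNIV) UNIV"
      by simp
    then show ?thesis using 1 by blast
  qed
  obtain a where a: "((\<lambda>n. poly q (of_int (n + 1)) * h n) has_sum a) UNIV" "((\<lambda>n. poly q (of_int n) * h (n - 1)) has_sum a) UNIV"
    using sh[of 1] by auto
  obtain b where b: "((\<lambda>n. poly q (of_int (n + (- 1))) * h n) has_sum b) UNIV" "((\<lambda>n. poly q (of_int n) * h (n - (- 1))) has_sum b) UNIV"
    using sh[of "- 1"] by auto
  obtain c where c: "((\<lambda>n. poly q (of_int n) * h n) has_sum c) UNIV"
    using sm[of q] by (auto simp: summable_on_def)
  have "((\<lambda>n. - (poly q (of_int n) * h (n - (- 1))) + 2 * (poly q (of_int n) * h n) - poly q (of_int n) * h (n - 1)) has_sum (- b + 2 * c - a)) UNIV"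
    by (intro has_sum_minus has_sum_add has_sum_neg has_sum_cmult_right a b c)
  then have 1: "((\<lambda>n. poly q (of_int n) * hk (Suc k) s n) has_sum (- b + 2 * c - a)) UNIV"
    by (simp add: hk_Suc h_def algebra_simps)
  have "((\<lambda>n. - (poly q (of_int (n + (- 1))) * h n) + 2 * (poly q (of_int n) * h n) - poly q (of_int (n + 1)) * h n) has_sum (- b + 2 * c - a)) UNIV"
    by (intro has_sum_minus has_sum_add has_sum_neg has_sum_cmult_right a b c)
  moreover have "- (poly q (of_int (n + (- 1))) * h n) + 2 * (poly q (of_int n) * h n) - poly q (of_int (n + 1)) * h n = poly r (of_int n) * h n" for n
    by (simp add: r_def poly_poly_diff algebra_simps)
  ultimately have "((\<lambda>n. poly r (of_int n) * h n) has_sum (- b + 2 * c - a)) UNIV" by simp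
  with IH have "- b + 2 * c - a = 0" using has_sum_unique by blast
  then show ?case using 1 by simp
qed

text \<open>The kernel has vanishing moments at each time; the decay chosen for degree
  \<open>D\<close> permits summing before integrating in \<open>t\<close>.\<close>

lemma annihilates_pix:
  assumes M: "D < 2 * M" and F: "F > 0" "poly_growth F d f"
  shows "annihilates D (pix M f l m)"
  unfolding annihilates_def
proof (intro allI impI)
  fix q :: "complex poly" assume q: "degree q \<le> D"
  obtain Cq where Cq: "Cq > 0" "\<And>n::int. norm (poly q (of_int n)) \<le> Cq * (1 + \<bar>real_of_int n\<bar>) ^ D"
    using poly_of_int_bound[OF q] by blast
  obtain A where A: "A > 0" "\<And>t n. t \<in> {0..(hi l)\<^sup>2} \<Longrightarrow> norm (hk M t n) \<le> A / (1 + \<bar>real_of_int n\<bar>) ^ (D + 2)"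
    using hk_decay_compact by blast
  define v where "v = (\<lambda>t. complex_of_real (cald M * t ^ (2 * M + 1)) * hconv 1 (t\<^sup>2) f m)"
  have vc: "continuous_on X v" for X
    unfolding v_def by (intro continuous_intros hconv_continuous_sq[OF F])
  have "bounded (v ` {lo l..hi l})" by (intro compact_imp_bounded compact_continuous_image vc) simp
  then obtain V where V: "V > 0" "\<And>t. t \<in> {lo l..hi l} \<Longrightarrow> norm (v t) \<le> V"
    unfolding bounded_pos by auto
  define g where "g = (\<lambda>n t. poly q (of_int n) * (hk M (t\<^sup>2) (n - m) * v t))"
  define K where "K = Cq * (1 + \<bar>real_of_int m\<bar>) ^ D * A * V"
  have gb: "norm (g n t) \<le> K * (1 / (1 + \<bar>real_of_int (n - m)\<bar>) ^ 2)" if t: "t \<in> {lo l..hi l}" for n t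
  proof -
    define w where "w = 1 + \<bar>real_of_int (n - m)\<bar>"
    have w: "w > 0" by (simp add: w_def)
    have "t\<^sup>2 \<in> {0..(hi l)\<^sup>2}" using t lo_hi[of l] by (auto intro: power_mono)
    then have hb: "norm (hk M (t\<^sup>2) (n - m)) \<le> A / w ^ (D + 2)" unfolding w_def by (rule A)
    have "norm (poly q (of_int n)) \<le> Cq * (1 + \<bar>real_of_int n\<bar>) ^ D" by (rule Cq)
    also have "\<dots> \<le> Cq * ((1 + \<bar>real_of_int m\<bar>) * w) ^ D"
      unfolding w_def using Cq(1) weight_mult[of n m] by (intro mult_left_mono power_mono) (auto simp: abs_minus_commute)
    finally have "norm (g n t) \<le> (Cq * ((1 + \<bar>real_of_int m\<bar>) * w) ^ D) * ((A / w ^ (D + 2)) * V)"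
      unfolding g_def norm_mult using hb V(2)[OF t] A(1) w Cq(1) by (intro mult_mono) auto
    also have "(Cq * (u * w) ^ D) * ((A / w ^ (D + 2)) * V) = Cq * u ^ D * A * V * (1 / w ^ 2)" for u
      using w by (simp add: power_mult_distrib power_add power2_eq_square field_simps)
    finally show ?thesis by (simp add: K_def w_def)
  qed
  have gc: "continuous_on {lo l..hi l} (g n)" for n
    unfolding g_def by (intro continuous_intros hk_continuous_sq vc)
  have "((\<lambda>n. integral {lo l..hi l} (g n)) has_sum integral {lo l..hi l} (\<lambda>t. \<Sum>\<^sub>\<infinity>n. g n t)) UNIV"
    by (rule has_sum_integral_infsum[OF gc gb summable_on_cmult_right[OF summable_on_inverse_square_int_shift(2)]])
  moreover have "integral {lo l..hi l} (g n) = poly q (of_int n) * pix M f l m n" for n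
    unfolding g_def pix_def integral_mult_right v_def
    by (simp add: scaleR_conv_of_real mult_ac)
  moreover have "(\<Sum>\<^sub>\<infinity>n. g n t) = 0" for t
  proof -
    define r where "r = pcompose q [:of_int m, 1:]"
    have "degree r \<le> D" unfolding r_def using q by (simp add: degree_pcompose)
    then have "\<forall>i\<ge>2 * M. coeff r i = 0" using M by (auto intro: coeff_eq_0)
    then have "((\<lambda>n. poly r (of_int n) * hk M (t\<^sup>2) n) has_sum 0) UNIV" by (rule hk_moments) simp
    then have "((\<lambda>n. poly r (of_int (n + (- m))) * hk M (t\<^sup>2) (n + (- m))) has_sum 0) UNIV"
      by (subst has_sum_shift_int(1)[where f="\<lambda>n. poly r (of_int n) * hk M (t\<^sup>2) n"])
    then have "((\<lambda>n. poly q (of_int n) * hk M (t\<^sup>2) (n - m)) has_sum 0) UNIV"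
      by (simp add: r_def poly_pcompose)
    from has_sum_cmult_left[OF this, of "v t"] show ?thesis
      by (intro infsumI) (simp add: g_def mult.assoc)
  qed
  ultimately show "((\<lambda>n. poly q (of_int n) * pix M f l m n) has_sum 0) UNIV" by simp
qed

lemma annihilates_group_sum:
  assumes "D < 2 * M" "F > 0" "poly_growth F d f"
  shows "annihilates D (group_sum M f S)"
  unfolding group_sum_def case_prod_unfold
  by (intro annihilates_sum annihilates_pix[OF assms])

context hardy_exponent
begin

text \<open>Order \<open>N + 1\<close> gives both the \<open>N\<close> vanishing moments and decay
  \<open>2 * N + 3\<close>, which exceeds the \<open>N + 2\<close> of a molecule. The crude
  pointwise bound is recorded because it later serves as majorant when the groups are
  summed.\<close>

lemma asum_group_sum:
  "\<exists>K>0. \<forall>f F d l0 x0 S B. F > 0 \<longrightarrow> poly_growth F d f \<longrightarrow> S \<subseteq> {..l0} \<times> {x0..<x0 + 2 ^ l0} \<longrightarrow> B > 0 \<longrightarrow>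
     (\<Sum>(l, m)\<in>S. pen f l m) \<le> B\<^sup>2 * 2 ^ l0 \<longrightarrow>
     asum (K * B powr p * 2 ^ l0) (group_sum (N + 1) f S) \<and> (\<forall>n. norm (group_sum (N + 1) f S n) \<le> K * B * 2 ^ l0)"
proof -
  define M where "M = N + 1"
  have M: "M \<ge> 1" "N < 2 * M" by (simp_all add: M_def)
  obtain C where C: "C > 0" "\<And>f F d l0 x0 S B n. F > 0 \<Longrightarrow> poly_growth F d f \<Longrightarrow> S \<subseteq> {..l0} \<times> {x0..<x0 + 2 ^ l0} \<Longrightarrow> B > 0 \<Longrightarrow>
     (\<Sum>(l, m)\<in>S. pen f l m) \<le> B\<^sup>2 * 2 ^ l0 \<Longrightarrow> \<bar>n - x0\<bar> \<ge> 2 * 2 ^ l0 \<Longrightarrow>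
     norm (group_sum M f S n) \<le> C * B * (2 ^ l0 / \<bar>real_of_int (n - x0)\<bar>) ^ (2 * M + 1)"
    using group_sum_decay[OF M(1)] by blast
  obtain K where K: "K > 0" "\<And>x R B g. R \<ge> 1 \<Longrightarrow> (N + 1) dvd R \<Longrightarrow> B > 0 \<Longrightarrow>
     (\<Sum>n\<in>{x - int R..x + int R}. norm (g n) ^ 2) \<le> B ^ 2 * real R \<Longrightarrow>
     (\<forall>n. \<bar>n - x\<bar> > int R \<longrightarrow> norm (g n) \<le> B * (real R / \<bar>real_of_int (n - x)\<bar>) ^ (N + 2)) \<Longrightarrow>
     annihilates N g \<Longrightarrow> asum (K * B powr p * real R) g"
    using asum_molecule by blast
  define A where "A = (cald M)\<^sup>2 / cald (2 * M - 1)"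
  have A: "A > 0" using cald_pos[of M] cald_pos[of "2 * M - 1"] by (simp add: A_def)
  define D where "D = C + sqrt A"
  have D: "D > 0" using C(1) A by (simp add: D_def add_pos_nonneg)
  have DA: "A \<le> D\<^sup>2"
  proof -
    have "(sqrt A)\<^sup>2 \<le> D\<^sup>2" using C(1) A by (intro power_mono) (auto simp: D_def)
    then show ?thesis using A by simp
  qed
  define K' where "K' = K * D powr p * (2 * (real N + 1)) + D"
  have K': "K' > 0" using K(1) D by (simp add: K'_def add_nonneg_pos)
  have main: "asum (K' * B powr p * 2 ^ l0) (group_sum M f S) \<and> (\<forall>n. norm (group_sum M f S n) \<le> K' * B * 2 ^ l0)"
    if h: "F > 0" "poly_growth F d f" "S \<subseteq> {..l0} \<times> {x0..<x0 + 2 ^ l0}" "B > 0" "(\<Sum>(l, m)\<in>S. pen f l m) \<le> B\<^sup>2 * 2 ^ l0"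
    for f F d l0 x0 S B
  proof
    \<comment> \<open>Divisible by \<open>N + 1\<close> as \<open>asum_molecule\<close> requires,
      and at least \<open>2 * 2 ^ l0\<close>, so the decay estimate holds outside the ball.\<close>
    define R where "R = 2 * (N + 1) * 2 ^ l0"
    have "R > 0" by (simp add: R_def)
    then have R: "R \<ge> 1" "real R = 2 * (real N + 1) * 2 ^ l0"
      by linarith (simp add: R_def algebra_simps)
    have R2: "2 * 2 ^ l0 \<le> R" "2 ^ l0 \<le> real R" unfolding R(2) by (simp_all add: R_def)
    have l2: "(\<Sum>n\<in>Y. (norm (group_sum M f S n))\<^sup>2) \<le> (D * B)\<^sup>2 * 2 ^ l0" if "finite Y" for Y
    proof -
      have "(\<Sum>n\<in>Y. (norm (group_sum M f S n))\<^sup>2) \<le> A * (\<Sum>(l, m)\<in>S. pen f l m)"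
        unfolding A_def by (rule group_sum_l2[OF M(1) h(1,2,3) that])
      also have "\<dots> \<le> A * (B\<^sup>2 * 2 ^ l0)" using A h(5) by (intro mult_left_mono) auto
      also have "\<dots> \<le> D\<^sup>2 * (B\<^sup>2 * 2 ^ l0)" using DA by (intro mult_right_mono) auto
      finally show ?thesis by (simp add: power_mult_distrib mult.assoc)
    qed
    have "asum (K * (D * B) powr p * real R) (group_sum M f S)"
    proof (rule K(2)[OF R(1), where B="D * B" and x=x0])
      show "(N + 1) dvd R" unfolding R_def by (intro dvd_mult2 dvd_mult dvd_refl)
      show "D * B > 0" using D h(4) by simp
      show "(\<Sum>n\<in>{x0 - int R..x0 + int R}. norm (group_sum M f S n) ^ 2) \<le> (D * B) ^ 2 * real R"
        by (rule order_trans[OF l2]) (use R2 in \<open>auto intro: mult_left_mono\<close>)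
      show "annihilates N (group_sum M f S)" by (rule annihilates_group_sum[OF M(2) h(1,2)])
      show "\<forall>n. \<bar>n - x0\<bar> > int R \<longrightarrow> norm (group_sum M f S n) \<le> (D * B) * (real R / \<bar>real_of_int (n - x0)\<bar>) ^ (N + 2)"
      proof (intro allI impI)
        fix n assume n: "\<bar>n - x0\<bar> > int R"
        have "int (2 * 2 ^ l0) \<le> int R" using R2(1) by (simp only: of_nat_le_iff)
        then have n2: "\<bar>n - x0\<bar> \<ge> 2 * 2 ^ l0" using n by simp
        define y where "y = \<bar>real_of_int (n - x0)\<bar>"
        have "real_of_int \<bar>n - x0\<bar> > real_of_int (int R)" using n by (simp only: of_int_less_iff)
        then have y: "y > real R" by (simp add: y_def)
        then have y0: "y > 0" using R(1) by linarith
        have "norm (group_sum M f S n) \<le> C * B * (2 ^ l0 / y) ^ (2 * M + 1)"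
          unfolding y_def by (rule C(2)[OF h n2])
        also have "\<dots> \<le> C * B * (real R / y) ^ (2 * M + 1)"
          using C(1) h(4) R2(2) y0 by (intro mult_left_mono power_mono divide_right_mono) auto
        also have "\<dots> \<le> C * B * (real R / y) ^ (N + 2)"
          using C(1) h(4) y y0 by (intro mult_left_mono power_decreasing) (auto simp: M_def)
        also have "\<dots> \<le> (D * B) * (real R / y) ^ (N + 2)"
          using h(4) y0 A by (intro mult_right_mono) (auto simp: D_def)
        finally show "norm (group_sum M f S n) \<le> (D * B) * (real R / \<bar>real_of_int (n - x0)\<bar>) ^ (N + 2)"
          by (simp only: y_def)
      qed
    qed
    then show "asum (K' * B powr p * 2 ^ l0) (group_sum M f S)"
    proof (rule asum_mono)
      have "K * (D * B) powr p * real R = (K * D powr p * (2 * (real N + 1))) * (B powr p * 2 ^ l0)"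
        using D h(4) unfolding R(2) by (simp add: powr_mult)
      also have "\<dots> \<le> K' * (B powr p * 2 ^ l0)" using D by (intro mult_right_mono) (auto simp: K'_def)
      finally show "K * (D * B) powr p * real R \<le> K' * B powr p * 2 ^ l0" by (simp only: mult.assoc)
    qed
    show "\<forall>n. norm (group_sum M f S n) \<le> K' * B * 2 ^ l0"
    proof
      fix n
      have "(norm (group_sum M f S n))\<^sup>2 \<le> (D * B)\<^sup>2 * 2 ^ l0" using l2[of "{n}"] by simp
      also have "\<dots> \<le> (D * B)\<^sup>2 * (2 ^ l0)\<^sup>2" by (intro mult_left_mono self_le_power) auto
      also have "\<dots> = (D * B * 2 ^ l0)\<^sup>2" by (simp only: power_mult_distrib)
      finally have "norm (group_sum M f S n) \<le> D * B * 2 ^ l0" by (rule power2_le_imp_le) (use D h(4) in auto)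
      also have "\<dots> \<le> K' * B * 2 ^ l0" using K(1) h(4) by (intro mult_right_mono) (auto simp: K'_def)
      finally show "norm (group_sum M f S n) \<le> K' * B * 2 ^ l0" .
    qed
  qed
  show ?thesis unfolding M_def[symmetric] by (intro exI[of _ K'] conjI[OF K'] allI impI main)
qed

end

section \<open>Stopping-time decomposition\<close>

text \<open>The grid interval of length \<open>2 ^ l\<close> with index \<open>j\<close>, for the
  pair \<open>(l, j)\<close>. Through floor division, the cell of \<open>m\<close> at level
  \<open>l\<close> has index \<open>m div 2 ^ l\<close>, and nesting is the law for iterated
  division.\<close>

definition cell :: "nat \<times> int \<Rightarrow> int set" where
  "cell x = {m. m div 2 ^ fst x = snd x}"

lemma cell_eq: "cell x = {snd x * 2 ^ fst x..<snd x * 2 ^ fst x + 2 ^ fst x}"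
proof -
  have "m div 2 ^ l = j \<longleftrightarrow> j * 2 ^ l \<le> m \<and> m < j * 2 ^ l + 2 ^ l" for m j :: int and l :: nat
  proof
    assume "m div 2 ^ l = j"
    then have "m = j * 2 ^ l + m mod 2 ^ l" by (metis div_mult_mod_eq)
    moreover have "0 \<le> m mod 2 ^ l" "m mod 2 ^ l < 2 ^ l" by simp_all
    ultimately show "j * 2 ^ l \<le> m \<and> m < j * 2 ^ l + 2 ^ l" by linarith
  next
    assume h: "j * 2 ^ l \<le> m \<and> m < j * 2 ^ l + 2 ^ l"
    have "(m - j * 2 ^ l) div 2 ^ l = 0" using h by (intro div_pos_pos_trivial) auto
    moreover have "((m - j * 2 ^ l) + j * 2 ^ l) div 2 ^ l = j + (m - j * 2 ^ l) div 2 ^ l"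
      by (rule div_mult_self1) simp
    ultimately show "m div 2 ^ l = j" by simp
  qed
  then show ?thesis by (auto simp: cell_def)
qed

lemma finite_cell [simp]: "finite (cell x)" and card_cell: "card (cell x) = 2 ^ fst x"
  by (simp_all add: cell_eq nat_power_eq)

definition anc :: "nat \<Rightarrow> nat \<times> int \<Rightarrow> nat \<times> int" where
  "anc i x = (fst x + i, snd x div 2 ^ i)"

lemma anc_0: "anc 0 x = x" by (simp add: anc_def)

lemma anc_add: "anc i (anc j x) = anc (j + i) x"
proof -
  have "snd x div 2 ^ j div 2 ^ i = snd x div (2 ^ j * 2 ^ i)"
    by (rule zdiv_zmult2_eq[symmetric]) simp
  then show ?thesis by (simp add: anc_def power_add add.assoc)
qed

lemma cell_anc: "cell x \<subseteq> cell (anc i x)"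
proof
  fix m assume "m \<in> cell x"
  then have "m div 2 ^ fst x = snd x" by (simp add: cell_def)
  moreover have "m div (2 ^ fst x * 2 ^ i) = m div 2 ^ fst x div 2 ^ i" by (rule zdiv_zmult2_eq) simp
  ultimately show "m \<in> cell (anc i x)" by (simp add: cell_def anc_def power_add)
qed

lemma cells_nested:
  assumes "m \<in> cell x" "m \<in> cell y" "fst x \<le> fst y"
  shows "y = anc (fst y - fst x) x"
proof -
  have "m \<in> cell (anc (fst y - fst x) x)" using assms(1) cell_anc by blast
  then show ?thesis using assms by (auto simp: cell_def anc_def prod_eq_iff)
qed

text \<open>A geometric series dominated by its largest term. It turns a sum over level sets back
  into the p-th power of the function.\<close>

lemma geometric_powr_sum:
  assumes K: "finite K" "\<And>k. k \<in> K \<Longrightarrow> 2 powr real_of_int k < s" and p: "p > 0"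
  shows "(\<Sum>k\<in>K. 2 powr (real_of_int k * p)) \<le> s powr p / (1 - 2 powr (- p))"
proof (cases "K = {}")
  case True
  have "2 powr (- p) < (1::real)" using p by (simp add: powr_less_one)
  then show ?thesis using True by simp
next
  case False
  define k0 where "k0 = Max K"
  define \<rho> where "\<rho> = 2 powr (- p)"
  have \<rho>: "0 < \<rho>" "\<rho> < 1" using p by (auto simp: \<rho>_def powr_less_one)
  have k0: "k0 \<in> K" "\<And>k. k \<in> K \<Longrightarrow> k \<le> k0" using K False by (auto simp: k0_def)
  have e: "2 powr (real_of_int k * p) = 2 powr (real_of_int k0 * p) * \<rho> ^ nat (k0 - k)" if "k \<in> K" for k
  proof -
    have "\<rho> ^ nat (k0 - k) = 2 powr (- p * real (nat (k0 - k)))" by (simp add: \<rho>_def powr_powr flip: powr_realpow)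
    also have "real (nat (k0 - k)) = real_of_int k0 - real_of_int k" using k0(2)[OF that] by simp
    finally show ?thesis by (simp add: algebra_simps flip: powr_add)
  qed
  have "(\<Sum>k\<in>K. 2 powr (real_of_int k * p)) = 2 powr (real_of_int k0 * p) * (\<Sum>k\<in>K. \<rho> ^ nat (k0 - k))"
    by (simp add: e sum_distrib_left)
  also have "(\<Sum>k\<in>K. \<rho> ^ nat (k0 - k)) = (\<Sum>i\<in>(\<lambda>k. nat (k0 - k)) ` K. \<rho> ^ i)"
  proof -
    have "inj_on (\<lambda>k. nat (k0 - k)) K"
    proof (rule inj_onI)
      fix x y assume "x \<in> K" "y \<in> K" "nat (k0 - x) = nat (k0 - y)"
      then show "x = y" using k0(2)[of x] k0(2)[of y] by linarith
    qed
    then show ?thesis by (simp add: sum.reindex)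
  qed
  also have "\<dots> \<le> (\<Sum>i. \<rho> ^ i)"
    by (rule sum_le_suminf) (use K \<rho> in \<open>auto intro: summable_geometric\<close>)
  also have "\<dots> = 1 / (1 - \<rho>)" using \<rho> by (intro suminf_geometric) auto
  finally have a: "(\<Sum>k\<in>K. 2 powr (real_of_int k * p)) \<le> 2 powr (real_of_int k0 * p) * (1 / (1 - \<rho>))"
    by (simp add: mult_left_mono)
  have b: "2 powr (real_of_int k0 * p) \<le> s powr p"
  proof -
    have "2 powr (real_of_int k0 * p) = (2 powr real_of_int k0) powr p" by (simp add: powr_powr)
    also have "\<dots> \<le> s powr p" using K(2)[OF k0(1)] p by (intro powr_mono2) auto
    finally show ?thesis .
  qed
  have "2 powr (real_of_int k0 * p) * (1 / (1 - \<rho>)) \<le> s powr p * (1 / (1 - \<rho>))"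
    by (rule mult_right_mono[OF b]) (use \<rho> in simp)
  then show ?thesis using a by (simp add: \<rho>_def)
qed

text \<open>Only this much of the square function is needed for the combinatorics:
  \<open>\<sigma>\<close> is p-summable, and its square controls, up to \<open>C0\<close>, the
  averaged energies of all cells through a point.\<close>

locale stopping =
  fixes p :: real and \<sigma> :: "int \<Rightarrow> real" and I :: real and en :: "nat \<Rightarrow> int \<Rightarrow> real" and C0 :: real
  assumes p0: "p > 0" and \<sigma>0: "\<And>n. \<sigma> n \<ge> 0" and \<sigma>I: "((\<lambda>n. \<sigma> n powr p) has_sum I) UNIV"
    and en0: "\<And>l m. en l m \<ge> 0" and C0: "C0 > 0"
    and en_le: "\<And>n L. (\<Sum>l<L. (\<Sum>m\<in>cell (l, n div 2 ^ l). en l m) / 2 ^ l) \<le> C0 * (\<sigma> n)\<^sup>2"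
begin

definition \<Omega> :: "int \<Rightarrow> int set" where "\<Omega> k = {n. \<sigma> n > 2 powr real_of_int k}"

text \<open>More than half of the cell lies in the level set. Half is what is left over, once the
  next level fails, for averaging the energy.\<close>

definition big :: "int \<Rightarrow> nat \<times> int \<Rightarrow> bool" where
  "big k x \<longleftrightarrow> 2 ^ fst x < 2 * card (cell x \<inter> \<Omega> k)"

lemma sum_\<sigma>_le: "finite X \<Longrightarrow> (\<Sum>n\<in>X. \<sigma> n powr p) \<le> I"
  by (rule finite_sum_le_has_sum[OF \<sigma>I]) auto

lemma finite_\<Omega>: "finite (\<Omega> k)"
proof (rule ccontr)
  assume inf: "infinite (\<Omega> k)"
  define c where "c = (2 powr real_of_int k) powr p"
  have c: "c > 0" by (simp add: c_def)
  obtain X where X: "X \<subseteq> \<Omega> k" "finite X" "card X = nat \<lceil>I / c\<rceil> + 1"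
    using infinite_arbitrarily_large[OF inf] by blast
  have "c * card X \<le> (\<Sum>n\<in>X. \<sigma> n powr p)"
  proof -
    have "(\<Sum>n\<in>X. c) \<le> (\<Sum>n\<in>X. \<sigma> n powr p)"
      using X p0 by (intro sum_mono) (auto simp: \<Omega>_def c_def intro!: powr_mono2)
    then show ?thesis by (simp add: mult.commute)
  qed
  also have "\<dots> \<le> I" by (rule sum_\<sigma>_le[OF X(2)])
  finally have "real (card X) \<le> I / c" using c by (simp add: field_simps)
  moreover have "I / c < real (card X)" unfolding X(3) by linarith
  ultimately show False by linarith
qed

definition act :: "(nat \<times> int) set" where "act = {x. \<exists>k. big k x}"

text \<open>The level at which the cell stops being big; it exists for active cells because
  \<open>\<sigma>\<close> is bounded on a finite cell.\<close>

definition \<kappa> :: "nat \<times> int \<Rightarrow> int" where "\<kappa> x = (SOME k. big k x \<and> \<not> big (k + 1) x)"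

lemma \<kappa>: assumes "x \<in> act" shows "big (\<kappa> x) x" "\<not> big (\<kappa> x + 1) x"
proof -
  from assms obtain k where k: "big k x" by (auto simp: act_def)
  have "\<exists>k. big k x \<and> \<not> big (k + 1) x"
  proof (rule ccontr)
    assume "\<nexists>k. big k x \<and> \<not> big (k + 1) x"
    then have step: "big j x \<Longrightarrow> big (j + 1) x" for j by blast
    have all: "big (k + int i) x" for i
    proof (induction i)
      case (Suc i) then show ?case using step[of "k + int i"] by (simp add: algebra_simps)
    qed (use k in simp)
    define s where "s = Max (\<sigma> ` cell x)"
    have s: "\<sigma> n \<le> s" if "n \<in> cell x" for n unfolding s_def using that by (intro Max_ge) auto
    obtain i :: nat where i: "s < 2 ^ i" using real_arch_pow[of 2 s] by auto
    define j where "j = i + nat (- k)"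
    have "2 ^ i = 2 powr real i" by (simp add: powr_realpow)
    also have "\<dots> \<le> 2 powr real_of_int (k + int j)" by (rule powr_mono) (auto simp: j_def)
    finally have "s < 2 powr real_of_int (k + int j)" using i by linarith
    then have "cell x \<inter> \<Omega> (k + int j) = {}" using s by (force simp: \<Omega>_def)
    then show False using all[of j] by (simp add: big_def)
  qed
  from someI_ex[OF this] show "big (\<kappa> x) x" "\<not> big (\<kappa> x + 1) x" by (auto simp: \<kappa>_def)
qed

text \<open>If \<open>\<sigma>\<close> were positive on the whole cell, a sufficiently low level set
  would contain the cell and make it big. Hence \<open>\<sigma>\<close> vanishes somewhere on it,
  and \<open>en_le\<close> at that point leaves no energy.\<close>

lemma inactive:
  assumes "x \<notin> act" "m \<in> cell x"
  shows "en (fst x) m = 0"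
proof -
  have "\<exists>n\<in>cell x. \<sigma> n = 0"
  proof (rule ccontr)
    assume "\<not> (\<exists>n\<in>cell x. \<sigma> n = 0)"
    then have pos: "\<sigma> n > 0" if "n \<in> cell x" for n using that \<sigma>0[of n] by (metis less_eq_real_def)
    define s where "s = Min (\<sigma> ` cell x)"
    have ne: "cell x \<noteq> {}" by (simp add: cell_eq)
    have s: "s \<le> \<sigma> n" if "n \<in> cell x" for n unfolding s_def using that by (intro Min_le) auto
    have "s \<in> \<sigma> ` cell x" unfolding s_def using ne by (intro Min_in) auto
    then have s0: "s > 0" using pos by auto
    obtain i :: nat where i: "1 / s < 2 ^ i" using real_arch_pow[of 2 "1 / s"] by auto
    have "2 powr real_of_int (- int i) = 1 / 2 ^ i" by (simp add: powr_minus_divide powr_realpow)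
    also have "\<dots> < s" using i s0 by (simp add: field_simps)
    finally have "cell x \<inter> \<Omega> (- int i) = cell x" using s by (force simp: \<Omega>_def)
    then have "big (- int i) x" by (simp add: big_def card_cell)
    then show False using assms by (auto simp: act_def)
  qed
  then obtain n where n: "n \<in> cell x" "\<sigma> n = 0" by blast
  have x: "(fst x, n div 2 ^ fst x) = x" using n by (simp add: cell_def)
  have "en (fst x) m / 2 ^ fst x \<le> (\<Sum>m\<in>cell x. en (fst x) m) / 2 ^ fst x"
    using assms(2) en0 by (intro divide_right_mono member_le_sum) auto
  also have "\<dots> = (\<Sum>l\<in>{fst x}. (\<Sum>m\<in>cell (l, n div 2 ^ l). en l m) / 2 ^ l)" by (simp add: x)
  also have "\<dots> \<le> (\<Sum>l<Suc (fst x). (\<Sum>m\<in>cell (l, n div 2 ^ l). en l m) / 2 ^ l)"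
    by (rule sum_mono2) (auto intro!: divide_nonneg_pos sum_nonneg en0)
  also have "\<dots> \<le> C0 * (\<sigma> n)\<^sup>2" by (rule en_le)
  finally have "en (fst x) m \<le> 0" using n by (simp add: pos_divide_le_eq)
  then show ?thesis using en0[of "fst x" m] by linarith
qed

text \<open>A big ancestor is shorter than twice the cardinality of the finite level set.\<close>

lemma finite_big_anc: "finite {i. big k (anc i x)}"
proof (rule finite_subset)
  show "{i. big k (anc i x)} \<subseteq> {..2 * card (\<Omega> k)}"
  proof
    fix i assume "i \<in> {i. big k (anc i x)}"
    then have "2 ^ (fst x + i) < 2 * card (cell (anc i x) \<inter> \<Omega> k)" by (simp add: big_def anc_def)
    also have "\<dots> \<le> 2 * card (\<Omega> k)" using finite_\<Omega> by (intro mult_left_mono card_mono) auto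
    finally have "2 ^ (fst x + i) < 2 * card (\<Omega> k)" .
    moreover have "i < 2 ^ i" by (rule less_exp)
    moreover have "(2::nat) ^ i \<le> 2 ^ (fst x + i)" by (rule power_increasing) auto
    ultimately show "i \<in> {..2 * card (\<Omega> k)}" unfolding atMost_iff by linarith
  qed
qed simp

text \<open>The largest big ancestor at level \<open>k\<close>. Maximality makes distinct tops of
  one level disjoint, so their lengths add up to at most twice the size of the level set.\<close>

definition top :: "int \<Rightarrow> nat \<times> int \<Rightarrow> nat \<times> int" where
  "top k x = anc (Max {i. big k (anc i x)}) x"

lemma top:
  assumes "big k x"
  shows "big k (top k x)" "fst x \<le> fst (top k x)" "cell x \<subseteq> cell (top k x)"
    "\<And>i. i > 0 \<Longrightarrow> \<not> big k (anc i (top k x))"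
proof -
  have ne: "{i. big k (anc i x)} \<noteq> {}" using assms anc_0[of x] by (auto intro: exI[of _ 0])
  have "Max {i. big k (anc i x)} \<in> {i. big k (anc i x)}" by (rule Max_in[OF finite_big_anc ne])
  then show "big k (top k x)" by (simp add: top_def)
  show "fst x \<le> fst (top k x)" by (simp add: top_def anc_def)
  show "cell x \<subseteq> cell (top k x)" by (simp add: top_def cell_anc)
  fix i :: nat assume i: "i > 0"
  show "\<not> big k (anc i (top k x))"
  proof
    assume "big k (anc i (top k x))"
    then have "Max {i. big k (anc i x)} + i \<le> Max {i. big k (anc i x)}"
      by (intro Max_ge finite_big_anc) (simp add: top_def anc_add)
    then show False using i by simp
  qed
qed

lemma tops_disjoint:
  assumes "big k x" "big k y" "top k x \<noteq> top k y"
  shows "cell (top k x) \<inter> cell (top k y) = {}"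
proof -
  have *: "False" if "big k x" "big k y" "fst (top k x) \<le> fst (top k y)" "m \<in> cell (top k x)" "m \<in> cell (top k y)"
     "top k x \<noteq> top k y" for x y m
  proof -
    have e: "top k y = anc (fst (top k y) - fst (top k x)) (top k x)"
      by (rule cells_nested[OF that(4,5,3)])
    then have "fst (top k y) - fst (top k x) > 0" using that(6) by (metis anc_0 neq0_conv)
    then show False using top(4)[OF that(1)] top(1)[OF that(2)] e by metis
  qed
  show ?thesis
  proof (rule ccontr)
    assume "cell (top k x) \<inter> cell (top k y) \<noteq> {}"
    then obtain m where "m \<in> cell (top k x)" "m \<in> cell (top k y)" by blast
    then show False using *[OF assms(1,2)] *[OF assms(2,1)] assms(3) by (metis nat_le_linear)
  qed
qed

definition lab :: "nat \<times> int \<Rightarrow> int \<times> nat \<times> int" where "lab x = (\<kappa> x, top (\<kappa> x) x)"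

lemma lab_sub:
  assumes "x \<in> act" "lab x = (k, T)"
  shows "fst x \<le> fst T" "cell x \<subseteq> cell T"
  using top(2,3)[OF \<kappa>(1)[OF assms(1)]] assms(2) by (auto simp: lab_def)

text \<open>Every cell of the group has at least half of its points outside the next level set, so
  its energy is at most twice its average over those points. Exchanging the sums yields
  \<open>\<sigma>^2\<close> there, at most \<open>(2 * 2 powr k)^2\<close>, on at most
  \<open>2 ^ fst T\<close> points; hence 8 as 2 times 4.\<close>

lemma lab_energy:
  assumes S: "finite S" "\<And>l m. (l, m) \<in> S \<Longrightarrow> (l, m div 2 ^ l) \<in> act \<and> lab (l, m div 2 ^ l) = (k, T)"
  shows "(\<Sum>(l, m)\<in>S. en l m) \<le> (sqrt (8 * C0) * 2 powr real_of_int k)\<^sup>2 * 2 ^ fst T"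
proof (cases "S = {}")
  case True then show ?thesis using C0 by simp
next
  case False
  define W where "W = cell T - \<Omega> (k + 1)"
  have W: "finite W" by (simp add: W_def)
  have inS: "fst T \<ge> l" "cell (l, m div 2 ^ l) \<subseteq> cell T" "2 ^ l \<le> 2 * card (cell (l, m div 2 ^ l) - \<Omega> (k + 1))" if "(l, m) \<in> S" for l m
  proof -
    define x where "x = (l, m div 2 ^ l)"
    have x: "x \<in> act" "\<kappa> x = k" "top k x = T" using S(2)[OF that] by (auto simp: x_def lab_def)
    note kx = \<kappa>[OF x(1), unfolded x(2)]
    show "fst T \<ge> l" "cell (l, m div 2 ^ l) \<subseteq> cell T"
      using top(2,3)[OF kx(1)] x(3) by (auto simp: x_def)
    have "2 * card (cell x \<inter> \<Omega> (k + 1)) \<le> 2 ^ l" using kx(2) by (simp add: big_def x_def)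
    moreover have "card (cell x) = card (cell x \<inter> \<Omega> (k + 1)) + card (cell x - \<Omega> (k + 1))"
      by (metis card_Diff_subset_Int card_mono diff_add_inverse finite_Int finite_cell inf_le1 le_add_diff_inverse)
    ultimately show "2 ^ l \<le> 2 * card (cell (l, m div 2 ^ l) - \<Omega> (k + 1))"
      using card_cell[of x] by (simp add: x_def)
  qed
  have "en l m \<le> 2 * (\<Sum>n\<in>W. if n div 2 ^ l = m div 2 ^ l then en l m / 2 ^ l else 0)" if lm: "(l, m) \<in> S" for l m
  proof -
    have "(\<Sum>n\<in>W. if n div 2 ^ l = m div 2 ^ l then en l m / 2 ^ l else 0) = (\<Sum>n\<in>{n \<in> W. n div 2 ^ l = m div 2 ^ l}. en l m / 2 ^ l)"
      by (rule sum.inter_filter[symmetric, OF W])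
    also have "{n \<in> W. n div 2 ^ l = m div 2 ^ l} = cell (l, m div 2 ^ l) - \<Omega> (k + 1)"
      using inS(2)[OF lm] by (auto simp: W_def cell_def)
    finally have e: "(\<Sum>n\<in>W. if n div 2 ^ l = m div 2 ^ l then en l m / 2 ^ l else 0) = real (card (cell (l, m div 2 ^ l) - \<Omega> (k + 1))) * (en l m / 2 ^ l)"
      by simp
    have "(2::real) ^ l \<le> 2 * real (card (cell (l, m div 2 ^ l) - \<Omega> (k + 1)))"
      using inS(3)[OF lm] by (metis of_nat_le_iff of_nat_mult of_nat_numeral of_nat_power)
    then have "2 ^ l * (en l m / 2 ^ l) \<le> 2 * real (card (cell (l, m div 2 ^ l) - \<Omega> (k + 1))) * (en l m / 2 ^ l)"
      using en0 by (intro mult_right_mono) auto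
    then show ?thesis unfolding e by simp
  qed
  then have "(\<Sum>(l, m)\<in>S. en l m) \<le> (\<Sum>(l, m)\<in>S. 2 * (\<Sum>n\<in>W. if n div 2 ^ l = m div 2 ^ l then en l m / 2 ^ l else 0))"
    by (intro sum_mono) auto
  also have "\<dots> = 2 * (\<Sum>n\<in>W. \<Sum>(l, m)\<in>S. if n div 2 ^ l = m div 2 ^ l then en l m / 2 ^ l else 0)"
    unfolding sum_distrib_left[symmetric] case_prod_unfold by (subst sum.swap) simp
  also have "(\<Sum>n\<in>W. \<Sum>(l, m)\<in>S. if n div 2 ^ l = m div 2 ^ l then en l m / 2 ^ l else 0) \<le> (\<Sum>n\<in>W. C0 * (\<sigma> n)\<^sup>2)"
  proof (rule sum_mono)
    fix n
    have "(\<Sum>(l, m)\<in>S. if n div 2 ^ l = m div 2 ^ l then en l m / 2 ^ l else 0) =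
       (\<Sum>(l, m)\<in>{x\<in>S. n div 2 ^ fst x = snd x div 2 ^ fst x}. en l m / 2 ^ l)"
      unfolding case_prod_unfold by (rule sum.inter_filter[symmetric, OF S(1)])
    also have "\<dots> \<le> (\<Sum>(l, m)\<in>Sigma {..<Suc (fst T)} (\<lambda>l. cell (l, n div 2 ^ l)). en l m / 2 ^ l)"
    proof (rule sum_mono2)
      show "{x \<in> S. n div 2 ^ fst x = snd x div 2 ^ fst x} \<subseteq> Sigma {..<Suc (fst T)} (\<lambda>l. cell (l, n div 2 ^ l))"
        using inS(1) by (auto simp: cell_def less_Suc_eq_le)
    qed (use en0 in \<open>auto intro: divide_nonneg_pos\<close>)
    also have "\<dots> = (\<Sum>l<Suc (fst T). \<Sum>m\<in>cell (l, n div 2 ^ l). en l m / 2 ^ l)"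
      by (rule sum.Sigma[symmetric]) auto
    also have "\<dots> = (\<Sum>l<Suc (fst T). (\<Sum>m\<in>cell (l, n div 2 ^ l). en l m) / 2 ^ l)"
      by (simp add: sum_divide_distrib)
    also have "\<dots> \<le> C0 * (\<sigma> n)\<^sup>2" by (rule en_le)
    finally show "(\<Sum>(l, m)\<in>S. if n div 2 ^ l = m div 2 ^ l then en l m / 2 ^ l else 0) \<le> C0 * (\<sigma> n)\<^sup>2" .
  qed
  also have "(\<Sum>n\<in>W. C0 * (\<sigma> n)\<^sup>2) \<le> (\<Sum>n\<in>W. C0 * (2 * 2 powr real_of_int k)\<^sup>2)"
  proof (intro sum_mono mult_left_mono power_mono \<sigma>0)
    fix n assume "n \<in> W"
    then have "\<sigma> n \<le> 2 powr real_of_int (k + 1)" by (simp add: W_def \<Omega>_def)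
    also have "\<dots> = 2 * 2 powr real_of_int k" by (simp add: powr_add)
    finally show "\<sigma> n \<le> 2 * 2 powr real_of_int k" .
  qed (use C0 in simp)
  also have "\<dots> = real (card W) * (C0 * (2 * 2 powr real_of_int k)\<^sup>2)" by simp
  also have "\<dots> \<le> 2 ^ fst T * (C0 * (2 * 2 powr real_of_int k)\<^sup>2)"
  proof (rule mult_right_mono)
    have "card W \<le> card (cell T)" unfolding W_def by (rule card_mono) auto
    then show "real (card W) \<le> 2 ^ fst T" unfolding card_cell by (metis of_nat_le_iff of_nat_numeral of_nat_power)
  qed (use C0 in simp)
  also have "2 * (2 ^ fst T * (C0 * (2 * 2 powr real_of_int k)\<^sup>2)) = (sqrt (8 * C0) * 2 powr real_of_int k)\<^sup>2 * 2 ^ fst T"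
    using C0 by (simp add: power_mult_distrib)
  finally show ?thesis by simp
qed

text \<open>For fixed \<open>k\<close> the tops are disjoint and more than half full, so their
  lengths sum to at most twice the size of the level set. Summing over \<open>k\<close> is the
  layer-cake formula for \<open>\<sigma> powr p\<close>.\<close>

lemma lab_sum:
  assumes \<Gamma>: "finite \<Gamma>" "\<Gamma> \<subseteq> lab ` act"
  shows "(\<Sum>(k, T)\<in>\<Gamma>. 2 powr (real_of_int k * p) * 2 ^ fst T) \<le> 2 / (1 - 2 powr (- p)) * I"
proof -
  define K where "K = fst ` \<Gamma>"
  have K: "finite K" using \<Gamma> by (simp add: K_def)
  define W where "W = (\<Union>k\<in>K. \<Omega> k)"
  have W: "finite W" using K finite_\<Omega> by (simp add: W_def)
  have \<rho>: "2 powr (- p) < (1::real)" using p0 by (simp add: powr_less_one)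
  have inner: "(\<Sum>(k', T)\<in>{g\<in>\<Gamma>. fst g = k}. 2 powr (real_of_int k' * p) * 2 ^ fst T) \<le> 2 * (2 powr (real_of_int k * p) * card (\<Omega> k))" for k
  proof -
    define Ts where "Ts = snd ` {g\<in>\<Gamma>. fst g = k}"
    have Ts: "finite Ts" using \<Gamma> by (simp add: Ts_def)
    have tp: "\<exists>x. big k x \<and> T = top k x" if T: "T \<in> Ts" for T
    proof -
      have "(k, T) \<in> \<Gamma>" using T by (auto simp: Ts_def)
      then have "(k, T) \<in> lab ` act" using \<Gamma>(2) by blast
      then obtain x where "x \<in> act" "lab x = (k, T)" by (metis imageE)
      then have "big k x \<and> T = top k x" using \<kappa>(1)[of x] by (auto simp: lab_def)
      then show ?thesis by blast
    qed
    have "(\<Sum>(k', T)\<in>{g\<in>\<Gamma>. fst g = k}. 2 powr (real_of_int k' * p) * 2 ^ fst T) = (\<Sum>T\<in>Ts. 2 powr (real_of_int k * p) * 2 ^ fst T)"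
      unfolding Ts_def by (subst sum.reindex) (auto simp: inj_on_def case_prod_unfold intro!: sum.cong)
    also have "\<dots> = 2 powr (real_of_int k * p) * (\<Sum>T\<in>Ts. 2 ^ fst T)" by (simp add: sum_distrib_left)
    also have "\<dots> \<le> 2 powr (real_of_int k * p) * (\<Sum>T\<in>Ts. 2 * real (card (cell T \<inter> \<Omega> k)))"
    proof (intro mult_left_mono sum_mono)
      fix T assume "T \<in> Ts"
      then obtain x where "big k x" "T = top k x" using tp by blast
      then have "2 ^ fst T < 2 * card (cell T \<inter> \<Omega> k)" using top(1)[of k x] by (simp add: big_def)
      then show "2 ^ fst T \<le> 2 * real (card (cell T \<inter> \<Omega> k))"
        by (metis less_imp_le of_nat_le_iff of_nat_mult of_nat_numeral of_nat_power)
    qed simp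
    also have "(\<Sum>T\<in>Ts. 2 * real (card (cell T \<inter> \<Omega> k))) = 2 * real (\<Sum>T\<in>Ts. card (cell T \<inter> \<Omega> k))"
      by (simp add: sum_distrib_left)
    also have "(\<Sum>T\<in>Ts. card (cell T \<inter> \<Omega> k)) = card (\<Union>T\<in>Ts. cell T \<inter> \<Omega> k)"
    proof (rule card_UN_disjoint[symmetric, OF Ts])
      show "\<forall>T\<in>Ts. \<forall>T'\<in>Ts. T \<noteq> T' \<longrightarrow> (cell T \<inter> \<Omega> k) \<inter> (cell T' \<inter> \<Omega> k) = {}"
      proof (intro ballI impI)
        fix T T' assume "T \<in> Ts" "T' \<in> Ts" and ne: "T \<noteq> T'"
        then obtain x y where "big k x" "T = top k x" "big k y" "T' = top k y" using tp by metis
        then show "(cell T \<inter> \<Omega> k) \<inter> (cell T' \<inter> \<Omega> k) = {}" using tops_disjoint[of k x y] ne by blast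
      qed
    qed simp
    also have "real (card (\<Union>T\<in>Ts. cell T \<inter> \<Omega> k)) \<le> real (card (\<Omega> k))"
      using finite_\<Omega> by (intro of_nat_mono card_mono) auto
    finally show ?thesis by (simp add: mult_left_mono mult.left_commute)
  qed
  have "(\<Sum>(k, T)\<in>\<Gamma>. 2 powr (real_of_int k * p) * 2 ^ fst T) = (\<Sum>k\<in>K. \<Sum>(k', T)\<in>{g\<in>\<Gamma>. fst g = k}. 2 powr (real_of_int k' * p) * 2 ^ fst T)"
    unfolding K_def by (rule sum.image_gen[OF \<Gamma>(1)])
  also have "\<dots> \<le> (\<Sum>k\<in>K. 2 * (2 powr (real_of_int k * p) * card (\<Omega> k)))" by (intro sum_mono inner)
  also have "\<dots> = 2 * (\<Sum>k\<in>K. \<Sum>n\<in>W. if n \<in> \<Omega> k then 2 powr (real_of_int k * p) else 0)"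
  proof -
    have "(\<Sum>n\<in>W. if n \<in> \<Omega> k then 2 powr (real_of_int k * p) else 0) = 2 powr (real_of_int k * p) * card (\<Omega> k)" if "k \<in> K" for k
    proof -
      have "{n\<in>W. n \<in> \<Omega> k} = \<Omega> k" using that by (auto simp: W_def)
      then show ?thesis using sum.inter_filter[OF W, of "\<lambda>n. 2 powr (real_of_int k * p)" "\<lambda>n. n \<in> \<Omega> k"] by (simp add: mult.commute)
    qed
    then show ?thesis by (simp add: sum_distrib_left)
  qed
  also have "(\<Sum>k\<in>K. \<Sum>n\<in>W. if n \<in> \<Omega> k then 2 powr (real_of_int k * p) else 0) = (\<Sum>n\<in>W. \<Sum>k\<in>K. if n \<in> \<Omega> k then 2 powr (real_of_int k * p) else 0)"
    by (rule sum.swap)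
  also have "\<dots> \<le> (\<Sum>n\<in>W. \<sigma> n powr p / (1 - 2 powr (- p)))"
  proof (rule sum_mono)
    fix n
    have "(\<Sum>k\<in>K. if n \<in> \<Omega> k then 2 powr (real_of_int k * p) else 0) = (\<Sum>k\<in>{k\<in>K. n \<in> \<Omega> k}. 2 powr (real_of_int k * p))"
      by (rule sum.inter_filter[symmetric, OF K])
    also have "\<dots> \<le> \<sigma> n powr p / (1 - 2 powr (- p))"
      by (rule geometric_powr_sum) (use K p0 in \<open>auto simp: \<Omega>_def\<close>)
    finally show "(\<Sum>k\<in>K. if n \<in> \<Omega> k then 2 powr (real_of_int k * p) else 0) \<le> \<sigma> n powr p / (1 - 2 powr (- p))" .
  qed
  also have "\<dots> = (\<Sum>n\<in>W. \<sigma> n powr p) / (1 - 2 powr (- p))" by (simp add: sum_divide_distrib)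
  also have "\<dots> \<le> I / (1 - 2 powr (- p))" using \<rho> by (intro divide_right_mono sum_\<sigma>_le W) auto
  finally show ?thesis by simp
qed

end

section \<open>Reassembling the function from its groups\<close>

lemma cald_rest_hconv_tendsto_0:
  assumes "\<And>k n. ((\<lambda>s. (s ^ k) *\<^sub>R hconv k s f n) \<longlongrightarrow> 0) at_top"
  shows "(\<lambda>L. cald_rest M (\<lambda>k s. hconv k s f n) (lo L)) \<longlonglongrightarrow> 0"
proof -
  have "filterlim (\<lambda>L. lo (Suc L)) at_top sequentially"
  proof -
    have "filterlim (\<lambda>L. (2::real) ^ L) at_top sequentially" by (rule filterlim_at_top_mono[OF filterlim_real_sequentially]) (intro always_eventually allI, rule less_imp_le, rule of_nat_less_two_power)
    from filterlim_compose[OF this filterlim_Suc] show ?thesis by (simp add: lo_Suc hi_def)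
  qed
  then have "filterlim lo at_top sequentially"
    by (subst (asm) filterlim_sequentially_Suc)
  with cald_rest_tendsto_0[of "\<lambda>k s. hconv k s f n"] assms show ?thesis
    by (rule_tac filterlim_compose) auto
qed

lemma pix_levels_has_sum:
  assumes F: "F > 0" "poly_growth F d f"
  shows "((\<lambda>(l, m). pix M f l m n) has_sum
     (cald_rest M (\<lambda>k s. hconv k s f n) (lo 0) - cald_rest M (\<lambda>k s. hconv k s f n) (lo L))) ({..<L} \<times> UNIV)"
proof (induction L)
  case (Suc L)
  have "((\<lambda>(l, m). pix M f l m n) has_sum
     (cald_rest M (\<lambda>k s. hconv k s f n) (lo L) - cald_rest M (\<lambda>k s. hconv k s f n) (hi L))) (Pair L ` UNIV)"
    by (subst has_sum_reindex) (use pix_has_sum[OF F, of M L n] in \<open>auto simp: o_def inj_on_def\<close>)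
  moreover have "{..<Suc L} \<times> UNIV = ({..<L} \<times> UNIV) \<union> (Pair L ` (UNIV :: int set))" by auto
  moreover have "({..<L} \<times> UNIV) \<inter> (Pair L ` (UNIV :: int set)) = {}" by auto
  ultimately have "((\<lambda>(l, m). pix M f l m n) has_sum
     ((cald_rest M (\<lambda>k s. hconv k s f n) (lo 0) - cald_rest M (\<lambda>k s. hconv k s f n) (lo L)) +
      (cald_rest M (\<lambda>k s. hconv k s f n) (lo L) - cald_rest M (\<lambda>k s. hconv k s f n) (hi L)))) ({..<Suc L} \<times> UNIV)"
    using has_sum_Un_disjoint[OF Suc.IH] by metis
  then show ?case by (simp add: lo_Suc)
qed simp

text \<open>The l^2 bound for a group consisting of one piece: no energy, no piece. It discards the
  inactive cells.\<close>

lemma pix_eq_0: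
  assumes M: "M \<ge> 1" and F: "F > 0" "poly_growth F d f" and "pen f l m = 0"
  shows "pix M f l m n = 0"
proof -
  have "(\<Sum>n\<in>{n}. (norm (group_sum M f {(l, m)} n))\<^sup>2) \<le> (cald M)\<^sup>2 / cald (2 * M - 1) * (\<Sum>(l, m)\<in>{(l, m)}. pen f l m)"
    by (rule group_sum_l2[OF M F, of _ l m]) auto
  then show ?thesis using assms(4) by (simp add: group_sum_def)
qed

context hardy_exponent
begin

text \<open>Pieces are grouped by the label of their cell. Each group costs a power of its level
  times the length of its top, and \<open>lab_sum\<close> adds these costs; the values are recovered
  by \<open>has_sum_dominated\<close>.\<close>

lemma asum_of_stopping:
  "\<exists>K>0. \<forall>f F d \<sigma> I. F > 0 \<longrightarrow> poly_growth F d f \<longrightarrow>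
     (\<forall>k n. ((\<lambda>s. (s ^ k) *\<^sub>R hconv k s f n) \<longlongrightarrow> 0) at_top) \<longrightarrow> stopping p \<sigma> I (pen f) 3 \<longrightarrow> asum (K * I) f"
proof -
  define M where "M = N + 1"
  obtain K0 where K0: "K0 > 0" "\<And>f F d l0 x0 S B. F > 0 \<Longrightarrow> poly_growth F d f \<Longrightarrow> S \<subseteq> {..l0} \<times> {x0..<x0 + 2 ^ l0} \<Longrightarrow> B > 0 \<Longrightarrow>
     (\<Sum>(l, m)\<in>S. pen f l m) \<le> B\<^sup>2 * 2 ^ l0 \<Longrightarrow>
     asum (K0 * B powr p * 2 ^ l0) (group_sum M f S) \<and> (\<forall>n. norm (group_sum M f S n) \<le> K0 * B * 2 ^ l0)"
    using asum_group_sum unfolding M_def[symmetric] by blast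
  \<comment> \<open>The constant of \<open>lab_energy\<close> for \<open>C0 = 3\<close>, the value
    supplied by the square function.\<close>
  define c where "c = sqrt (8 * 3)"
  have c: "c > 0" by (simp add: c_def)
  have \<rho>: "2 powr (- p) < (1::real)" using p0 by (simp add: powr_less_one)
  define K where "K = K0 * c powr p * (2 / (1 - 2 powr (- p)))"
  have K: "K > 0" unfolding K_def using K0(1) c \<rho> by (intro mult_pos_pos divide_pos_pos) auto
  have main: "asum (K * I) f"
    if F: "F > 0" "poly_growth F d f" and van: "\<And>k n. ((\<lambda>s. (s ^ k) *\<^sub>R hconv k s f n) \<longlongrightarrow> 0) at_top"
      and st: "stopping p \<sigma> I (pen f) 3" for f F d \<sigma> I
  proof -
    interpret S: stopping p \<sigma> I "pen f" 3 by (rule st)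
    define \<Gamma> where "\<Gamma> = S.lab ` S.act"
    define SS where "SS = (\<lambda>g. {(l, m). (l, m div 2 ^ l) \<in> S.act \<and> S.lab (l, m div 2 ^ l) = g})"
    define B where "B = (\<lambda>g::int \<times> nat \<times> int. c * 2 powr real_of_int (fst g))"
    have B: "B g > 0" for g using c by (simp add: B_def)
    define y where "y = (\<lambda>g::int \<times> nat \<times> int. if g \<in> \<Gamma> then B g powr p * 2 ^ fst (snd g) else 0)"
    have y0: "y g \<ge> 0" for g by (simp add: y_def)
    have SSsub: "SS (k, T) \<subseteq> {..fst T} \<times> {snd T * 2 ^ fst T..<snd T * 2 ^ fst T + 2 ^ fst T}" for k T
    proof
      fix x assume x: "x \<in> SS (k, T)"
      obtain l m where lm: "x = (l, m)" by (cases x)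
      have h: "(l, m div 2 ^ l) \<in> S.act" "S.lab (l, m div 2 ^ l) = (k, T)" using x by (auto simp: SS_def lm)
      have "m \<in> cell (l, m div 2 ^ l)" by (simp add: cell_def)
      then have "m \<in> cell T" using S.lab_sub(2)[OF h] by blast
      then show "x \<in> {..fst T} \<times> {snd T * 2 ^ fst T..<snd T * 2 ^ fst T + 2 ^ fst T}"
        using S.lab_sub(1)[OF h] by (simp add: lm cell_eq)
    qed
    have SSfin: "finite (SS g)" for g
      using finite_subset[OF SSsub[of "fst g" "snd g"]] by simp
    have SSempty: "SS g = {}" if "g \<notin> \<Gamma>" for g using that by (auto simp: SS_def \<Gamma>_def)
    have grp: "asum (K0 * y g) (group_sum M f S') \<and> (\<forall>n. norm (group_sum M f S' n) \<le> (if g \<in> \<Gamma> then K0 * (B g * 2 ^ fst (snd g)) else 0))"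
      if S': "S' \<subseteq> SS g" for g S'
    proof (cases "g \<in> \<Gamma>")
      case False
      then have "S' = {}" using S' SSempty by blast
      then have "group_sum M f S' = (\<lambda>n. 0)" by (simp add: group_sum_def fun_eq_iff)
      then show ?thesis using False asum_0 by (simp add: y_def)
    next
      case True
      obtain k T where g: "g = (k, T)" by (cases g)
      have "(\<Sum>(l, m)\<in>S'. pen f l m) \<le> (sqrt (8 * 3) * 2 powr real_of_int k)\<^sup>2 * 2 ^ fst T"
        by (rule S.lab_energy) (use S' finite_subset[OF S' SSfin] in \<open>auto simp: SS_def g\<close>)
      then have E: "(\<Sum>(l, m)\<in>S'. pen f l m) \<le> (B g)\<^sup>2 * 2 ^ fst T" by (simp add: B_def c_def g)
      have sub: "S' \<subseteq> {..fst T} \<times> {snd T * 2 ^ fst T..<snd T * 2 ^ fst T + 2 ^ fst T}"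
        using S' SSsub[of k T] by (simp add: g)
      show ?thesis using K0(2)[OF F sub B E] True by (simp add: y_def g mult.assoc)
    qed
    have Y: "sum y X \<le> c powr p * (2 / (1 - 2 powr (- p))) * I" if X: "finite X" for X
    proof -
      have "sum y X = sum y (X \<inter> \<Gamma>)" by (rule sum.mono_neutral_right) (use X in \<open>auto simp: y_def\<close>)
      also have "\<dots> = (\<Sum>g\<in>X \<inter> \<Gamma>. c powr p * (2 powr (real_of_int (fst g) * p) * 2 ^ fst (snd g)))"
        by (rule sum.cong) (use c in \<open>auto simp: y_def B_def powr_mult powr_powr\<close>)
      also have "\<dots> = c powr p * (\<Sum>(k, T)\<in>X \<inter> \<Gamma>. 2 powr (real_of_int k * p) * 2 ^ fst T)"
        by (simp add: sum_distrib_left case_prod_unfold)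
      also have "\<dots> \<le> c powr p * (2 / (1 - 2 powr (- p)) * I)"
        by (intro mult_left_mono S.lab_sum) (use X in \<open>auto simp: \<Gamma>_def\<close>)
      finally show ?thesis by simp
    qed
    have ysum: "y summable_on UNIV"
      by (rule nonneg_bounded_partial_sums_imp_summable_on[OF y0 eventually_finite_subsets_at_top_weakI[OF Y]])
    define Ty where "Ty = infsum y UNIV"
    have Ty: "Ty \<le> c powr p * (2 / (1 - 2 powr (- p))) * I"
      unfolding Ty_def by (rule infsum_le_finite_sums[OF ysum Y])
    have y1: "y g \<le> Ty" for g
      unfolding Ty_def using finite_sum_le_infsum[OF ysum, of "{g}"] y0 by simp
    \<comment> \<open>Majorant for the groups, uniform in the truncation level, obtained from their
      p-th power costs by \<open>le_powr_scaled\<close>.\<close>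
    define b where "b = (\<lambda>g. K0 * (y g * Ty powr ((1 - p) / p)))"
    have b: "b summable_on UNIV" unfolding b_def by (intro summable_on_cmult_right summable_on_cmult_left ysum)
    have bb: "(if g \<in> \<Gamma> then K0 * (B g * 2 ^ fst (snd g)) else 0) \<le> b g" for g
    proof (cases "g \<in> \<Gamma>")
      case True
      define x where "x = B g * 2 ^ fst (snd g)"
      have x: "x > 0" using B by (simp add: x_def)
      \<comment> \<open>Since \<open>p <= 1\<close>, raising the length
        \<open>2 ^ fst (snd g)\<close> to the power \<open>p\<close> only decreases it.\<close>
      have xp: "x powr p \<le> y g"
      proof -
        have "x powr p = B g powr p * (2 ^ fst (snd g)) powr p" unfolding x_def using B[of g] by (intro powr_mult)
        also have "\<dots> \<le> B g powr p * (2 ^ fst (snd g)) powr (1::real)"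
          using p1 by (intro mult_left_mono powr_mono) auto
        finally show ?thesis using True by (simp add: y_def)
      qed
      then have "x powr p \<le> Ty" using y1[of g] by linarith
      then have "x \<le> x powr p * Ty powr ((1 - p) / p)" using x by (intro le_powr_scaled) auto
      also have "\<dots> \<le> y g * Ty powr ((1 - p) / p)" using xp by (intro mult_right_mono) auto
      finally show ?thesis using True K0(1) by (simp add: b_def x_def mult_left_mono)
    next
      case False
      then show ?thesis using K0(1) y0 by (simp add: b_def)
    qed
    have val: "((\<lambda>g. group_sum M f (SS g) n) has_sum f n) UNIV" for n
    proof (rule has_sum_dominated[where a="\<lambda>g L. group_sum M f (SS g \<inter> {x. fst x < L}) n"
          and S="\<lambda>L. cald_rest M (\<lambda>k s. hconv k s f n) (lo 0) - cald_rest M (\<lambda>k s. hconv k s f n) (lo L)", OF b])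
      show "norm (group_sum M f (SS g \<inter> {x. fst x < L}) n) \<le> b g" for g L
        using grp[of "SS g \<inter> {x. fst x < L}" g] bb[of g] by (meson Int_lower1 order_trans)
      show "(\<lambda>L. group_sum M f (SS g \<inter> {x. fst x < L}) n) \<longlonglongrightarrow> group_sum M f (SS g) n" for g
      proof (rule tendsto_eventually, rule eventually_sequentiallyI[of "Suc (fst (snd g))"])
        fix L assume "Suc (fst (snd g)) \<le> L"
        then have "SS g \<inter> {x. fst x < L} = SS g" using SSsub[of "fst g" "snd g"] by fastforce
        then show "group_sum M f (SS g \<inter> {x. fst x < L}) n = group_sum M f (SS g) n" by simp
      qed
      have "(\<lambda>L. cald_rest M (\<lambda>k s. hconv k s f n) (lo 0) - cald_rest M (\<lambda>k s. hconv k s f n) (lo L)) \<longlonglongrightarrow>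
          cald_rest M (\<lambda>k s. hconv k s f n) (lo 0) - 0"
        by (intro tendsto_diff tendsto_const cald_rest_hconv_tendsto_0 van)
      then show "(\<lambda>L. cald_rest M (\<lambda>k s. hconv k s f n) (lo 0) - cald_rest M (\<lambda>k s. hconv k s f n) (lo L)) \<longlonglongrightarrow> f n"
        by (simp add: lo_0 cald_rest_0 hconv_0_0)
      fix L
      define P where "P = {(l, m). l < L \<and> (l, m div 2 ^ l) \<in> S.act}"
      have "((\<lambda>(l, m). pix M f l m n) has_sum
         (cald_rest M (\<lambda>k s. hconv k s f n) (lo 0) - cald_rest M (\<lambda>k s. hconv k s f n) (lo L))) P"
      proof (rule has_sum_cong_neutral[THEN iffD1, OF _ _ _ pix_levels_has_sum[OF F]])
        fix x assume x: "x \<in> {..<L} \<times> UNIV - P"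
        obtain l m where lm: "x = (l, m)" by (cases x)
        have "(l, m div 2 ^ l) \<notin> S.act" using x by (auto simp: P_def lm)
        from S.inactive[OF this, of m] have "pen f l m = 0" by (simp add: cell_def)
        then have "pix M f l m n = 0" by (intro pix_eq_0[OF _ F]) (simp_all add: M_def)
        then show "(case x of (l, m) \<Rightarrow> pix M f l m n) = 0" by (simp add: lm)
      qed (auto simp: P_def)
      \<comment> \<open>Every active index carries exactly one label, so the truncated sum over
        levels regroups into the sum over labels.\<close>
      moreover have "bij_betw snd (Sigma UNIV (\<lambda>g. SS g \<inter> {x. fst x < L})) P"
        by (rule bij_betwI[where g="\<lambda>x. (S.lab (fst x, snd x div 2 ^ fst x), x)"]) (auto simp: P_def SS_def)
      ultimately have "((\<lambda>x. case snd x of (l, m) \<Rightarrow> pix M f l m n) has_sum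
         (cald_rest M (\<lambda>k s. hconv k s f n) (lo 0) - cald_rest M (\<lambda>k s. hconv k s f n) (lo L))) (Sigma UNIV (\<lambda>g. SS g \<inter> {x. fst x < L}))"
        by (subst has_sum_reindex_bij_betw[where f="\<lambda>(l, m). pix M f l m n"])
      then show "((\<lambda>g. group_sum M f (SS g \<inter> {x. fst x < L}) n) has_sum
         (cald_rest M (\<lambda>k s. hconv k s f n) (lo 0) - cald_rest M (\<lambda>k s. hconv k s f n) (lo L))) UNIV"
        by (rule has_sum_SigmaD) (use SSfin in \<open>auto simp: group_sum_def\<close>)
    qed
    have "asum (K0 * Ty) f"
    proof (rule asum_countable[OF _ _ val])
      show "asum (K0 * y g) (group_sum M f (SS g))" for g using grp[of "SS g" g] by simp
      show "((\<lambda>g. K0 * y g) has_sum K0 * Ty) UNIV"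
        using ysum by (intro has_sum_cmult_right) (simp add: Ty_def)
    qed
    moreover have "K0 * Ty \<le> K0 * (c powr p * (2 / (1 - 2 powr (- p))) * I)"
      using Ty K0(1) by (intro mult_left_mono) auto
    then have "K0 * Ty \<le> K * I" unfolding K_def by (simp only: mult.assoc)
    ultimately show ?thesis by (rule asum_mono)
  qed
  then show ?thesis using K by (intro exI[of _ K] conjI allI impI) blast+
qed

end

section \<open>The square function\<close>

definition ssq :: "(int \<Rightarrow> complex) \<Rightarrow> int \<Rightarrow> ennreal" where
  "ssq f n = (\<integral>\<^sup>+t\<in>{0<..}. ennreal ((\<Sum>m | real_of_int \<bar>m - n\<bar> < t.
     (norm (complex_of_real (t\<^sup>2) * hconv 1 (t\<^sup>2) f m))\<^sup>2) / (t * (t + 1))) \<partial>lborel)"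

lemma square_function_ssq:
  assumes F: "F > 0" "poly_growth F d f"
  shows "square_function f n = epowr (ssq f n) (1 / 2)"
proof -
  have "discrete_laplacian (heat_semigroup (t\<^sup>2) f) = hconv 1 (t\<^sup>2) f" for t
    using laplacian_hconv[OF F, of "t\<^sup>2" 1 0] by (simp add: heat_semigroup_hconv)
  then show ?thesis by (simp add: square_function_def ssq_def)
qed

lemma finite_near: "finite {m::int. real_of_int \<bar>m - n\<bar> < t}"
proof (rule finite_subset)
  show "{m::int. real_of_int \<bar>m - n\<bar> < t} \<subseteq> {n - \<lceil>t\<rceil>..n + \<lceil>t\<rceil>}"
  proof
    fix m assume "m \<in> {m::int. real_of_int \<bar>m - n\<bar> < t}"
    then have "real_of_int \<bar>m - n\<bar> < t" by blast
    then have "real_of_int \<bar>m - n\<bar> \<le> real_of_int \<lceil>t\<rceil>" using le_of_int_ceiling[of t] by linarith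
    then have "\<bar>m - n\<bar> \<le> \<lceil>t\<rceil>" by (simp only: of_int_le_iff)
    then show "m \<in> {n - \<lceil>t\<rceil>..n + \<lceil>t\<rceil>}" by auto
  qed
qed simp

text \<open>For \<open>t\<close> in level \<open>l\<close> the dyadic cell through \<open>n\<close>
  lies inside the cone above \<open>n\<close>, and the levels are disjoint in \<open>t\<close>, so
  the averaged energies add up below the square function.\<close>

lemma ssq_lower:
  assumes F: "F > 0" "poly_growth F d f" and fin: "ssq f n < \<infinity>"
  shows "(\<Sum>l<L. (\<Sum>m\<in>cell (l, n div 2 ^ l). pen f l m) / 2 ^ l) \<le> 3 * enn2real (ssq f n)"
proof -
  define C where "C = (\<lambda>l. cell (l, n div 2 ^ l))"
  define w where "w = (\<lambda>t m. norm (hconv 1 (t\<^sup>2) f m))"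
  define h where "h = (\<lambda>l t. (\<Sum>m\<in>C l. t ^ 3 * (w t m)\<^sup>2) / (3 * 2 ^ l))"
  have hint: "(\<integral>\<^sup>+t. ennreal (indicator {lo l<..<hi l} t * h l t) \<partial>lborel) = ennreal ((\<Sum>m\<in>C l. pen f l m) / (3 * 2 ^ l))" for l
  proof -
    have "(h l has_integral (\<Sum>m\<in>C l. pen f l m) / (3 * 2 ^ l)) {lo l..hi l}"
      unfolding h_def w_def pen_def
      by (intro has_integral_divide has_integral_sum integrable_integral integrable_continuous_real pen_continuous[OF F]) (simp add: C_def)
    then have "(h l has_integral (\<Sum>m\<in>C l. pen f l m) / (3 * 2 ^ l)) {lo l<..<hi l}"
      by (simp only: has_integral_Icc_iff_Ioo)
    then show ?thesis
      by (rule nn_integral_has_integral_lebesgue[rotated]) (use lo_hi[of l] in \<open>auto simp: h_def intro!: divide_nonneg_pos sum_nonneg\<close>)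
  qed
  have hmeas: "(\<lambda>t. ennreal (indicator {lo l<..<hi l} t * h l t)) \<in> borel_measurable lborel" for l
  proof -
    have "continuous_on UNIV (h l)" unfolding h_def w_def by (intro continuous_intros hconv_continuous_sq[OF F]) auto
    then have "h l \<in> borel_measurable borel" by (rule borel_measurable_continuous_onI)
    then show ?thesis by measurable
  qed
  have pt: "(\<Sum>l<L. ennreal (indicator {lo l<..<hi l} t * h l t)) \<le>
     ennreal ((\<Sum>m | real_of_int \<bar>m - n\<bar> < t. (norm (complex_of_real (t\<^sup>2) * hconv 1 (t\<^sup>2) f m))\<^sup>2) / (t * (t + 1))) * indicator {0<..} t" for t
  proof (cases "\<exists>l<L. t \<in> {lo l<..<hi l}")
    case False
    then have "(\<Sum>l<L. ennreal (indicator {lo l<..<hi l} t * h l t)) = 0" by (intro sum.neutral) auto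
    then show ?thesis by simp
  next
    case True
    then obtain l where l: "l < L" "t \<in> {lo l<..<hi l}" by blast
    have t0: "t > 0" using l(2) lo_hi[of l] by auto
    have uniq: "l' = l" if "t \<in> {lo l'<..<hi l'}" for l'
    proof -
      have "\<not> l' < l" "\<not> l < l'"
      proof -
        have "hi a \<le> lo b" if "a < b" for a b
          using that by (cases b) (auto simp: hi_def lo_def simp flip: power_Suc intro!: power_increasing)
        then show "\<not> l' < l" "\<not> l < l'" using that l(2) by fastforce+
      qed
      then show ?thesis by simp
    qed
    have "(\<Sum>l'<L. ennreal (indicator {lo l'<..<hi l'} t * h l' t)) = (\<Sum>l'<L. if l' = l then ennreal (h l t) else 0)"
    proof (rule sum.cong[OF refl])
      fix l'
      show "ennreal (indicator {lo l'<..<hi l'} t * h l' t) = (if l' = l then ennreal (h l t) else 0)"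
      proof (cases "l' = l")
        case False
        then have "t \<notin> {lo l'<..<hi l'}" using uniq by blast
        then have "indicator {lo l'<..<hi l'} t = (0::real)" by (rule indicator_eq_0_iff[THEN iffD2])
        then show ?thesis using False by simp
      qed (use l in simp)
    qed
    also have "\<dots> = ennreal (h l t)" using l(1) by simp
    also have "h l t \<le> (\<Sum>m | real_of_int \<bar>m - n\<bar> < t. (norm (complex_of_real (t\<^sup>2) * hconv 1 (t\<^sup>2) f m))\<^sup>2) / (t * (t + 1))"
    proof -
      \<comment> \<open>Points of a cell differ by at most \<open>2 ^ l - 1\<close>. The subtracted
        1 matters at \<open>l = 0\<close>, where the cell is a single point and the lower end of the
        level is 0.\<close>
      have sub: "C l \<subseteq> {m. real_of_int \<bar>m - n\<bar> < t}"
      proof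
        fix m assume m: "m \<in> C l"
        have n: "n \<in> C l" by (simp add: C_def cell_def)
        have "\<bar>m - n\<bar> < 2 ^ l" using m n unfolding C_def cell_eq by auto
        then have "\<bar>m - n\<bar> \<le> 2 ^ l - 1" by simp
        then have "real_of_int \<bar>m - n\<bar> \<le> real_of_int (2 ^ l - 1)" by (simp only: of_int_le_iff)
        also have "real_of_int (2 ^ l - 1) = 2 ^ l - 1" by simp
        also have "2 ^ l - 1 \<le> lo l" by (simp add: lo_def)
        also have "lo l < t" using l(2) by simp
        finally show "m \<in> {m. real_of_int \<bar>m - n\<bar> < t}" by simp
      qed
      \<comment> \<open>Source of the constant 3: the weight \<open>1 / (t + 1)\<close> against the
        normalisation \<open>1 / 2 ^ l\<close> of a cell.\<close>
      have "t + 1 \<le> 3 * 2 ^ l"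
      proof -
        have "t \<le> 2 * 2 ^ l" using l(2) by (simp add: hi_def)
        moreover have "(1::real) \<le> 2 ^ l" by simp
        ultimately show ?thesis by linarith
      qed
      then have "h l t \<le> (\<Sum>m\<in>C l. t ^ 3 * (w t m)\<^sup>2) / (t + 1)"
        unfolding h_def using t0 by (intro divide_left_mono sum_nonneg mult_pos_pos) auto
      also have "\<dots> = (\<Sum>m\<in>C l. (norm (complex_of_real (t\<^sup>2) * hconv 1 (t\<^sup>2) f m))\<^sup>2) / (t * (t + 1))"
      proof -
        have "(norm (complex_of_real (t\<^sup>2) * hconv 1 (t\<^sup>2) f m))\<^sup>2 = t * (t ^ 3 * (w t m)\<^sup>2)" for m
          by (simp add: norm_mult w_def power_mult_distrib norm_power) (simp add: eval_nat_numeral)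
        then show ?thesis using t0 by (simp add: sum_distrib_left[symmetric])
      qed
      also have "\<dots> \<le> (\<Sum>m | real_of_int \<bar>m - n\<bar> < t. (norm (complex_of_real (t\<^sup>2) * hconv 1 (t\<^sup>2) f m))\<^sup>2) / (t * (t + 1))"
        using t0 by (intro divide_right_mono sum_mono2 finite_near sub) auto
      finally show ?thesis .
    qed
    finally show ?thesis using t0 by (simp add: ennreal_leI)
  qed
  have "(\<Sum>l<L. ennreal ((\<Sum>m\<in>C l. pen f l m) / (3 * 2 ^ l))) = (\<Sum>l<L. \<integral>\<^sup>+t. ennreal (indicator {lo l<..<hi l} t * h l t) \<partial>lborel)"
    by (simp only: hint)
  also have "\<dots> = (\<integral>\<^sup>+t. (\<Sum>l<L. ennreal (indicator {lo l<..<hi l} t * h l t)) \<partial>lborel)"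
    by (rule nn_integral_sum[symmetric]) (rule hmeas)
  also have "\<dots> \<le> ssq f n" unfolding ssq_def by (rule nn_integral_mono) (rule pt)
  also have "\<dots> = ennreal (enn2real (ssq f n))" using fin by (simp add: less_top)
  finally have "ennreal (\<Sum>l<L. (\<Sum>m\<in>C l. pen f l m) / (3 * 2 ^ l)) \<le> ennreal (enn2real (ssq f n))"
    by (subst (asm) sum_ennreal) (auto intro!: divide_nonneg_pos sum_nonneg pen_nonneg[OF F])
  then have "(\<Sum>l<L. (\<Sum>m\<in>C l. pen f l m) / (3 * 2 ^ l)) \<le> enn2real (ssq f n)" by simp
  moreover have "(\<Sum>l<L. (\<Sum>m\<in>C l. pen f l m) / (3 * 2 ^ l)) = (\<Sum>l<L. (\<Sum>m\<in>C l. pen f l m) / 2 ^ l) / 3"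
    by (subst sum_divide_distrib, rule sum.cong) (simp_all add: mult.commute)
  ultimately show ?thesis by (simp add: C_def)
qed

section \<open>Extended nonnegative sums and integrals\<close>

lemma epowr_top [simp]: "epowr \<infinity> r = \<infinity>" by (simp add: epowr_def)

lemma epowr_ennreal: "x \<ge> 0 \<Longrightarrow> epowr (ennreal x) r = ennreal (x powr r)" by (simp add: epowr_def)

lemma epowr_eq_top_iff: "epowr x r = \<infinity> \<longleftrightarrow> x = \<infinity>" by (simp add: epowr_def)

lemma epowr_1: "epowr x 1 = x"
  by (cases x) (simp_all add: epowr_def)

lemma epowr_epowr: "epowr (epowr x a) b = epowr x (a * b)"
  by (cases x) (simp_all add: epowr_ennreal powr_powr, simp add: epowr_def)

lemma epowr_mono:
  assumes "x \<le> y" "r \<ge> 0"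
  shows "epowr x r \<le> epowr y r"
proof (cases y)
  case (real v)
  then obtain u where u: "x = ennreal u" "u \<ge> 0" using assms(1) by (cases x) (auto simp: top_unique)
  show ?thesis using assms real u by (simp add: epowr_ennreal powr_mono2)
next
  case top
  then show ?thesis by (simp add: epowr_def)
qed

lemma epowr_cmult:
  assumes "c > 0"
  shows "epowr (ennreal c * x) r = ennreal (c powr r) * epowr x r"
proof (cases x)
  case (real v)
  then show ?thesis using assms by (simp add: epowr_ennreal powr_mult flip: ennreal_mult)
next
  case top
  then show ?thesis using assms by (simp add: epowr_def ennreal_mult_top)
qed

lemma sum_le_nn_integral_count_space:
  assumes "finite F"
  shows "(\<Sum>x\<in>F. f x) \<le> (\<integral>\<^sup>+x. f x \<partial>count_space UNIV)"
proof -
  have "(\<Sum>x\<in>F. f x) = (\<integral>\<^sup>+x. f x \<partial>count_space F)" by (simp add: nn_integral_count_space_finite assms)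
  also have "\<dots> = (\<integral>\<^sup>+x. f x * indicator F x \<partial>count_space UNIV)"
    by (subst nn_integral_restrict_space[symmetric]) (simp_all add: restrict_count_space)
  also have "\<dots> \<le> (\<integral>\<^sup>+x. f x \<partial>count_space UNIV)"
    by (rule nn_integral_mono) (simp add: indicator_def)
  finally show ?thesis .
qed

lemma nn_integral_count_space_int_le:
  fixes f :: "int \<Rightarrow> ennreal"
  assumes "\<And>F. finite F \<Longrightarrow> (\<Sum>n\<in>F. f n) \<le> B"
  shows "(\<integral>\<^sup>+n. f n \<partial>count_space UNIV) \<le> B"
proof -
  have "(\<integral>\<^sup>+n. f n \<partial>count_space UNIV) = (\<integral>\<^sup>+i. f (int_decode i) \<partial>count_space UNIV)"
    by (rule nn_integral_bij_count_space[symmetric]) (rule bij_int_decode)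
  also have "\<dots> = (SUP k. \<Sum>i<k. f (int_decode i))"
    by (simp add: nn_integral_count_space_nat suminf_eq_SUP)
  also have "\<dots> \<le> B"
  proof (rule SUP_least)
    fix k
    have "(\<Sum>i<k. f (int_decode i)) = (\<Sum>n\<in>int_decode ` {..<k}. f n)"
      by (subst sum.reindex) (auto intro: inj_on_subset[OF inj_int_decode])
    then show "(\<Sum>i<k. f (int_decode i)) \<le> B" using assms[of "int_decode ` {..<k}"] by simp
  qed
  finally show ?thesis .
qed

lemma nn_integral_count_space_has_sum:
  fixes f :: "int \<Rightarrow> real"
  assumes f: "\<And>n. f n \<ge> 0" and fin: "(\<integral>\<^sup>+n. ennreal (f n) \<partial>count_space UNIV) < \<infinity>"
  obtains I where "(f has_sum I) UNIV" "I \<le> enn2real (\<integral>\<^sup>+n. ennreal (f n) \<partial>count_space UNIV)"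
proof -
  define X where "X = (\<integral>\<^sup>+n. ennreal (f n) \<partial>count_space UNIV)"
  have le: "(\<Sum>n\<in>F. f n) \<le> enn2real X" if "finite F" for F
  proof -
    have "ennreal (\<Sum>n\<in>F. f n) = (\<Sum>n\<in>F. ennreal (f n))" using f by (simp add: sum_ennreal)
    also have "\<dots> \<le> X" unfolding X_def by (rule sum_le_nn_integral_count_space[OF \<open>finite F\<close>])
    also have "X = ennreal (enn2real X)" using fin unfolding X_def[symmetric] by (simp add: less_top)
    finally show ?thesis by simp
  qed
  have s: "f summable_on UNIV"
    by (rule nonneg_bdd_above_summable_on) (use f le in \<open>auto intro!: bdd_aboveI[of _ "enn2real X"]\<close>)
  show thesis
  proof (rule that)
    show "(f has_sum infsum f UNIV) UNIV" using s by (rule has_sum_infsum)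
    show "infsum f UNIV \<le> enn2real (\<integral>\<^sup>+n. ennreal (f n) \<partial>count_space UNIV)"
      unfolding X_def[symmetric] by (rule infsum_le_finite_sums[OF s]) (use le in auto)
  qed
qed

lemma nn_integral_halfline_le:
  fixes g :: "real \<Rightarrow> real"
  assumes g: "continuous_on UNIV g" "\<And>t. t \<ge> 0 \<Longrightarrow> g t \<ge> 0" and B: "\<And>R. R \<ge> 0 \<Longrightarrow> integral {0..R} g \<le> B"
  shows "(\<integral>\<^sup>+t\<in>{0<..}. ennreal (g t) \<partial>lborel) \<le> ennreal B"
proof -
  have m: "g \<in> borel_measurable borel" by (rule borel_measurable_continuous_onI[OF g(1)])
  have "(\<integral>\<^sup>+t\<in>{0<..}. ennreal (g t) \<partial>lborel) \<le> (\<integral>\<^sup>+t. (SUP i::nat. ennreal (g t) * indicator {0..real i} t) \<partial>lborel)"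
  proof (rule nn_integral_mono)
    fix t :: real
    obtain i :: nat where i: "t \<le> real i" using real_arch_simple by blast
    have "ennreal (g t) * indicator {0<..} t \<le> ennreal (g t) * indicator {0..real i} t"
      using i by (auto simp: indicator_def)
    also have "\<dots> \<le> (SUP i::nat. ennreal (g t) * indicator {0..real i} t)" by (rule SUP_upper) simp
    finally show "ennreal (g t) * indicator {0<..} t \<le> (SUP i::nat. ennreal (g t) * indicator {0..real i} t)" .
  qed
  also have "\<dots> = (SUP i::nat. \<integral>\<^sup>+t. ennreal (g t) * indicator {0..real i} t \<partial>lborel)"
  proof (rule nn_integral_monotone_convergence_SUP)
    show "incseq (\<lambda>(i::nat) t. ennreal (g t) * indicator {0..real i} t)"
      by (auto simp: incseq_def le_fun_def indicator_def)
    show "(\<lambda>t. ennreal (g t) * indicator {0..real i} t) \<in> borel_measurable lborel" for i :: nat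
      using m by measurable
  qed
  also have "\<dots> \<le> ennreal B"
  proof (rule SUP_least)
    fix i :: nat
    have "(g has_integral integral {0..real i} g) {0..real i}"
      by (intro integrable_integral integrable_continuous_real continuous_on_subset[OF g(1)]) simp
    then have "(\<integral>\<^sup>+t. ennreal (indicator {0..real i} t * g t) \<partial>lborel) = ennreal (integral {0..real i} g)"
      by (rule nn_integral_has_integral_lebesgue[rotated]) (use g(2) in auto)
    moreover have "ennreal (g t) * indicator {0..real i} t = ennreal (indicator {0..real i} t * g t)" for t
      by (simp add: indicator_def)
    ultimately show "(\<integral>\<^sup>+t. ennreal (g t) * indicator {0..real i} t \<partial>lborel) \<le> ennreal B"
      using B[of "real i"] by (simp add: ennreal_leI)
  qed
  finally show ?thesis .
qed

section \<open>Atomic decomposition of the square function space\<close>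

text \<open>The Laplacian enlarges the support by one point on each side, so every seminorm is a
  supremum over finitely many points. Point masses thereby become test functions.\<close>

lemma schwartz_finite_support:
  assumes "finite {n. \<phi> n \<noteq> 0}"
  shows "\<phi> \<in> schwartz"
proof -
  have fin: "finite {n. (discrete_laplacian ^^ l) \<phi> n \<noteq> 0}" for l
  proof (induction l)
    case (Suc l)
    define S where "S = {n. (discrete_laplacian ^^ l) \<phi> n \<noteq> 0}"
    have S: "finite S" using Suc by (simp add: S_def)
    have "{n. (discrete_laplacian ^^ Suc l) \<phi> n \<noteq> 0} \<subseteq> S \<union> (\<lambda>n. n - 1) ` S \<union> (\<lambda>n. n + 1) ` S"
    proof
      fix n assume "n \<in> {n. (discrete_laplacian ^^ Suc l) \<phi> n \<noteq> 0}"
      then have "n \<in> S \<or> n + 1 \<in> S \<or> n - 1 \<in> S" by (auto simp: discrete_laplacian_def S_def)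
      moreover have "n + 1 \<in> S \<Longrightarrow> n \<in> (\<lambda>n. n - 1) ` S" by (rule image_eqI[of _ _ "n + 1"]) simp
      moreover have "n - 1 \<in> S \<Longrightarrow> n \<in> (\<lambda>n. n + 1) ` S" by (rule image_eqI[of _ _ "n - 1"]) simp
      ultimately show "n \<in> S \<union> (\<lambda>n. n - 1) ` S \<union> (\<lambda>n. n + 1) ` S" by blast
    qed
    then show ?case by (rule finite_subset) (use S in simp)
  qed (use assms in simp)
  have "schwartz_seminorm m \<phi> < \<infinity>" for m
  proof -
    define G where "G = (\<lambda>n. ennreal ((1 + \<bar>real_of_int n\<bar>) ^ m) *
        (SUP l\<in>{0..m}. ennreal (norm ((discrete_laplacian ^^ l) \<phi> n))))"
    define S where "S = (\<Union>l\<in>{0..m}. {n. (discrete_laplacian ^^ l) \<phi> n \<noteq> 0})"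
    have S: "finite S" using fin by (simp add: S_def)
    have G0: "G n = 0" if "n \<notin> S" for n
    proof -
      have "(SUP l\<in>{0..m}. ennreal (norm ((discrete_laplacian ^^ l) \<phi> n))) \<le> 0"
        by (rule SUP_least) (use \<open>n \<notin> S\<close> in \<open>auto simp: S_def\<close>)
      then show ?thesis by (simp add: G_def)
    qed
    have Gfin: "G n < \<infinity>" for n
    proof -
      have "(SUP l\<in>{0..m}. ennreal (norm ((discrete_laplacian ^^ l) \<phi> n)))
          \<le> (\<Sum>l\<in>{0..m}. ennreal (norm ((discrete_laplacian ^^ l) \<phi> n)))"
        by (rule SUP_least) (rule member_le_sum, auto)
      also have "\<dots> < \<infinity>" by simp
      finally show ?thesis unfolding G_def by (simp add: ennreal_mult_less_top)
    qed
    have "schwartz_seminorm m \<phi> = (SUP n. G n)" by (simp add: schwartz_seminorm_def G_def)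
    also have "\<dots> \<le> (\<Sum>n\<in>S. G n)"
    proof (rule SUP_least)
      fix n
      show "G n \<le> (\<Sum>n\<in>S. G n)"
        by (cases "n \<in> S") (use S G0 in \<open>auto intro!: member_le_sum\<close>)
    qed
    also have "\<dots> < \<infinity>" using Gfin S by simp
    finally show ?thesis .
  qed
  then show ?thesis by (simp add: schwartz_def)
qed

lemma single_schwartz: "(\<lambda>m. if m = n then 1 else 0) \<in> schwartz"
  by (rule schwartz_finite_support) simp

lemma pairing_single: "pairing u (\<lambda>m. if m = n then 1 else 0) = u n"
  unfolding pairing_def
  by (rule infsumI, rule has_sum_cong_neutral[where S = "{n}" and f = "\<lambda>_. u n", THEN iffD1]) (auto simp: has_sum_finite_iff)

lemma tempered_tendsto_pointwise:
  assumes "tempered_tendsto u f F"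
  shows "((\<lambda>x. u x n) \<longlongrightarrow> f n) F"
  using assms single_schwartz[of n] unfolding tempered_tendsto_def by (fastforce simp: pairing_single)

lemma scaled_laplacian_pow:
  "((\<lambda>g n. z * discrete_laplacian g n) ^^ k) h = (\<lambda>n. z ^ k * (discrete_laplacian ^^ k) h n)"
  by (induction k) (simp_all add: fun_eq_iff discrete_laplacian_def algebra_simps)

lemma scaled_laplacian_heat:
  assumes F: "F > 0" "poly_growth F d f" and t: "t \<ge> 0"
  shows "((\<lambda>g n. complex_of_real t * discrete_laplacian g n) ^^ k) (heat_semigroup t f)
    = (\<lambda>n. (t ^ k) *\<^sub>R hconv k t f n)"
  unfolding scaled_laplacian_pow heat_semigroup_hconv laplacian_hconv[OF F t]
  by (simp add: scaleR_conv_of_real)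

lemma vanishes_weakly_pointwise:
  assumes F: "F > 0" "poly_growth F d f" and v: "vanishes_weakly_at_infinity f"
  shows "((\<lambda>s. (s ^ k) *\<^sub>R hconv k s f n) \<longlongrightarrow> 0) at_top"
proof -
  have "((\<lambda>t. ((\<lambda>g n. complex_of_real t * discrete_laplacian g n) ^^ k) (heat_semigroup t f) n) \<longlongrightarrow> 0) at_top"
    using v unfolding vanishes_weakly_at_infinity_def by (intro tempered_tendsto_pointwise) blast
  moreover have "\<forall>\<^sub>F t in at_top. ((\<lambda>g n. complex_of_real t * discrete_laplacian g n) ^^ k) (heat_semigroup t f) n
      = (t ^ k) *\<^sub>R hconv k t f n"
    using eventually_ge_at_top[of 0] by eventually_elim (simp add: scaled_laplacian_heat[OF F])
  ultimately show ?thesis by (rule Lim_transform_eventually)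
qed

definition sf_mass :: "real \<Rightarrow> (int \<Rightarrow> complex) \<Rightarrow> ennreal" where
  "sf_mass p f = (\<integral>\<^sup>+n. epowr (square_function f n) p \<partial>count_space UNIV)"

lemma hardy_laplacian_norm_sf_mass: "p > 0 \<Longrightarrow> hardy_laplacian_norm p f = epowr (sf_mass p f) (1 / p)"
  by (simp add: hardy_laplacian_norm_def lq_norm_def sf_mass_def)

context hardy_exponent
begin

text \<open>The square function itself plays the role of \<open>\<sigma>\<close>: finiteness of the
  p-th power sum makes it finite at every point, and \<open>ssq_lower\<close> supplies the energy
  hypothesis with constant 3.\<close>

lemma asum_of_square_function:
  "\<exists>K>0. \<forall>f. f \<in> tempered \<longrightarrow> vanishes_weakly_at_infinity f \<longrightarrow> sf_mass p f < \<infinity> \<longrightarrow> asum (K * enn2real (sf_mass p f)) f"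
proof -
  obtain K where K: "K > 0" "\<And>f F d \<sigma> I. F > 0 \<Longrightarrow> poly_growth F d f \<Longrightarrow>
     (\<And>k n. ((\<lambda>s. (s ^ k) *\<^sub>R hconv k s f n) \<longlongrightarrow> 0) at_top) \<Longrightarrow> stopping p \<sigma> I (pen f) 3 \<Longrightarrow> asum (K * I) f"
    using asum_of_stopping by blast
  have "asum (K * enn2real (sf_mass p f)) f"
    if f: "f \<in> tempered" "vanishes_weakly_at_infinity f" "sf_mass p f < \<infinity>" for f
  proof -
    obtain F d where F: "F > 0" "poly_growth F d f" using temperedE[OF f(1)] by blast
    have sfin: "square_function f n \<noteq> \<infinity>" for n
    proof -
      have "epowr (square_function f n) p \<le> sf_mass p f"
        unfolding sf_mass_def by (rule nn_integral_ge_point) simp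
      then have "epowr (square_function f n) p \<noteq> \<infinity>" using f(3) by (metis leD infinity_ennreal_def)
      then show ?thesis by (simp only: epowr_eq_top_iff not_False_eq_True)
    qed
    then have ssfin: "ssq f n < \<infinity>" for n
      using sfin[of n] unfolding square_function_ssq[OF F] epowr_eq_top_iff by (simp add: less_top)
    define \<sigma> where "\<sigma> = (\<lambda>n. enn2real (square_function f n))"
    have \<sigma>2: "(\<sigma> n)\<^sup>2 = enn2real (ssq f n)" for n
    proof -
      have "\<sigma> n = enn2real (ssq f n) powr (1 / 2)"
        using ssfin[of n] by (simp add: \<sigma>_def square_function_ssq[OF F] epowr_def)
      then show ?thesis by (simp add: powr_half_sqrt)
    qed
    have ep: "epowr (square_function f n) p = ennreal (\<sigma> n powr p)" for n
      using sfin[of n] by (simp add: epowr_def \<sigma>_def)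
    have mass: "sf_mass p f = (\<integral>\<^sup>+n. ennreal (\<sigma> n powr p) \<partial>count_space UNIV)"
      by (simp add: sf_mass_def ep)
    obtain I where I: "((\<lambda>n. \<sigma> n powr p) has_sum I) UNIV" "I \<le> enn2real (sf_mass p f)"
      using nn_integral_count_space_has_sum[of "\<lambda>n. \<sigma> n powr p"] f(3) unfolding mass by auto
    have "stopping p \<sigma> I (pen f) 3"
    proof (rule stopping.intro)
      show "(\<Sum>l<L. (\<Sum>m\<in>cell (l, n div 2 ^ l). pen f l m) / 2 ^ l) \<le> 3 * (\<sigma> n)\<^sup>2" for n L
        unfolding \<sigma>2 by (rule ssq_lower[OF F ssfin])
    qed (use p0 I pen_nonneg[OF F] in \<open>auto simp: \<sigma>_def\<close>)
    then have "asum (K * I) f"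
      by (rule K(2)[OF F vanishes_weakly_pointwise[OF F f(2)]])
    then show ?thesis by (rule asum_mono) (use K I in simp)
  qed
  then show ?thesis using K(1) by blast
qed

end

section \<open>The square function of finitely supported functions\<close>

text \<open>The index set depends on \<open>t\<close>; over a fixed window the dependence sits in
  indicators, and the windows exhaust the index set.\<close>

lemma near_sum_measurable:
  fixes F :: "real \<Rightarrow> int \<Rightarrow> real"
  assumes "\<And>m. (\<lambda>t. F t m) \<in> borel_measurable borel"
  shows "(\<lambda>t. \<Sum>m | real_of_int \<bar>m - n\<bar> < t. F t m) \<in> borel_measurable borel"
proof (rule borel_measurable_LIMSEQ_real)
  fix i :: nat
  show "(\<lambda>t. \<Sum>m\<in>{n - int i..n + int i}. F t m * indicator {t. real_of_int \<bar>m - n\<bar> < t} t) \<in> borel_measurable borel"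
    using assms by measurable
next
  fix t :: real
  obtain i0 :: nat where i0: "t \<le> real i0" using real_arch_simple by blast
  have "(\<Sum>m\<in>{n - int i..n + int i}. F t m * indicator {t. real_of_int \<bar>m - n\<bar> < t} t) = (\<Sum>m | real_of_int \<bar>m - n\<bar> < t. F t m)" if "i \<ge> i0" for i
  proof (rule sum.mono_neutral_cong_right)
    show "{m. real_of_int \<bar>m - n\<bar> < t} \<subseteq> {n - int i..n + int i}"
    proof
      fix m assume "m \<in> {m. real_of_int \<bar>m - n\<bar> < t}"
      then have "real_of_int \<bar>m - n\<bar> < real i" using i0 \<open>i \<ge> i0\<close> by simp
      then have "\<bar>m - n\<bar> < int i" by linarith
      then show "m \<in> {n - int i..n + int i}" by auto
    qed
  qed auto
  then show "(\<lambda>i. \<Sum>m\<in>{n - int i..n + int i}. F t m * indicator {t. real_of_int \<bar>m - n\<bar> < t} t) \<longlonglongrightarrow> (\<Sum>m | real_of_int \<bar>m - n\<bar> < t. F t m)"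
    by (intro tendsto_eventually) (auto simp: eventually_sequentially)
qed

text \<open>The cone has volume of order \<open>t + 1\<close>, which is what the weight
  \<open>1 / (t + 1)\<close> of the square function normalises.\<close>

lemma card_near:
  assumes "t > 0"
  shows "real (card {m::int. real_of_int \<bar>m - n\<bar> < t}) \<le> 2 * (t + 1)"
proof -
  define k where "k = \<lceil>t\<rceil> - 1"
  have k: "k \<ge> 0" "real_of_int k \<le> t" using assms unfolding k_def by linarith+
  have "{m::int. real_of_int \<bar>m - n\<bar> < t} \<subseteq> {n - k..n + k}"
  proof
    fix m assume "m \<in> {m::int. real_of_int \<bar>m - n\<bar> < t}"
    then have "\<bar>m - n\<bar> < \<lceil>t\<rceil>" by (simp add: less_ceiling_iff)
    then show "m \<in> {n - k..n + k}" unfolding k_def by auto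
  qed
  then have "card {m::int. real_of_int \<bar>m - n\<bar> < t} \<le> card {n - k..n + k}" by (rule card_mono[rotated]) simp
  then have "real (card {m::int. real_of_int \<bar>m - n\<bar> < t}) \<le> real (card {n - k..n + k})" by (rule of_nat_mono)
  moreover have "real (card {n - k..n + k}) = 2 * real_of_int k + 1" using k by simp
  moreover have "2 * real_of_int k + 1 \<le> 2 * (t + 1)" using k(2) by argo
  ultimately show ?thesis by (simp only:)
qed

lemma near_term:
  assumes "t > 0"
  shows "(\<Sum>m\<in>S. (norm (complex_of_real (t\<^sup>2) * v m))\<^sup>2) / (t * (t + 1)) = t ^ 3 / (t + 1) * (\<Sum>m\<in>S. (norm (v m))\<^sup>2)"
proof -
  have "(norm (complex_of_real (t\<^sup>2) * v m))\<^sup>2 = t * (t ^ 3 * (norm (v m))\<^sup>2)" for m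
    by (simp add: norm_mult power_mult_distrib norm_power) (simp add: eval_nat_numeral)
  then show ?thesis using assms by (simp add: sum_distrib_left[symmetric])
qed

lemma ssq_integrand_measurable:
  assumes F: "F > 0" "poly_growth F d f"
  shows "(\<lambda>t. (\<Sum>m | real_of_int \<bar>m - n\<bar> < t. (norm (complex_of_real (t\<^sup>2) * hconv 1 (t\<^sup>2) f m))\<^sup>2) / (t * (t + 1))) \<in> borel_measurable borel"
proof -
  have "(\<lambda>t. \<Sum>m | real_of_int \<bar>m - n\<bar> < t. (norm (complex_of_real (t\<^sup>2) * hconv 1 (t\<^sup>2) f m))\<^sup>2) \<in> borel_measurable borel"
    by (rule near_sum_measurable) (intro borel_measurable_continuous_onI continuous_intros hconv_continuous_sq[OF F])
  then show ?thesis by measurable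
qed

lemma poly_growth_finite_support:
  assumes "finite Y" "\<And>m. m \<notin> Y \<Longrightarrow> \<gamma> m = 0"
  shows "poly_growth (1 + (\<Sum>m\<in>Y. norm (\<gamma> m))) 0 \<gamma>"
  unfolding poly_growth_def
proof
  fix n
  have "norm (\<gamma> n) \<le> (\<Sum>m\<in>Y. norm (\<gamma> m))"
    by (cases "n \<in> Y") (use assms in \<open>auto intro!: member_le_sum sum_nonneg\<close>)
  then show "norm (\<gamma> n) \<le> (1 + (\<Sum>m\<in>Y. norm (\<gamma> m))) * (1 + \<bar>real_of_int n\<bar>) ^ 0" by simp
qed

text \<open>Tonelli: at time \<open>t\<close> each \<open>m\<close> is seen from at most
  \<open>2 * (t + 1)\<close> points \<open>n\<close>. The weight cancels this count, and
  \<open>quadratic_estimate\<close> with \<open>M = 1\<close> finishes.\<close>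

lemma nn_integral_ssq_le:
  assumes Y: "finite Y" "\<And>m. m \<notin> Y \<Longrightarrow> \<gamma> m = 0"
  shows "(\<integral>\<^sup>+n. ssq \<gamma> n \<partial>count_space UNIV) \<le> ennreal (2 / cald 1 * (\<Sum>m\<in>Y. (norm (\<gamma> m))\<^sup>2))"
proof -
  define w where "w = (\<lambda>t m. norm (hconv 1 (t\<^sup>2) \<gamma> m))"
  have F: "1 + (\<Sum>m\<in>Y. norm (\<gamma> m)) > 0" "poly_growth (1 + (\<Sum>m\<in>Y. norm (\<gamma> m))) 0 \<gamma>"
    using poly_growth_finite_support[OF Y] by (auto intro!: add_pos_nonneg sum_nonneg)
  have cont: "continuous_on UNIV (\<lambda>t. t ^ 3 * (w t m)\<^sup>2)" for m
    unfolding w_def by (intro continuous_intros hconv_continuous_sq[OF F])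
  have wm [measurable]: "(\<lambda>t. t ^ 3 * (w t m)\<^sup>2) \<in> borel_measurable borel" for m
    by (rule borel_measurable_continuous_onI[OF cont])
  define D where "D = (\<lambda>n t. (\<Sum>m | real_of_int \<bar>m - n\<bar> < t. (norm (complex_of_real (t\<^sup>2) * hconv 1 (t\<^sup>2) \<gamma> m))\<^sup>2) / (t * (t + 1)))"
  have Dm [measurable]: "D n \<in> borel_measurable borel" for n
    unfolding D_def by (rule ssq_integrand_measurable[OF F])
  have pt: "(\<integral>\<^sup>+n. ennreal (D n t) * indicator {0<..} t \<partial>count_space UNIV)
      \<le> (\<integral>\<^sup>+m. ennreal (2 * (t ^ 3 * (w t m)\<^sup>2)) * indicator {0<..} t \<partial>count_space UNIV)" for t
  proof (cases "t > 0")
    case True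
    define G where "G = (\<lambda>m. ennreal (t ^ 3 / (t + 1) * (w t m)\<^sup>2))"
    have "ennreal (D n t) = (\<integral>\<^sup>+m. G m * indicator {m. real_of_int \<bar>m - n\<bar> < t} m \<partial>count_space UNIV)" for n
    proof -
      have "(\<integral>\<^sup>+m. G m * indicator {m. real_of_int \<bar>m - n\<bar> < t} m \<partial>count_space UNIV)
          = (\<Sum>m | real_of_int \<bar>m - n\<bar> < t. G m * indicator {m. real_of_int \<bar>m - n\<bar> < t} m)"
        by (rule nn_integral_count_space'[OF finite_near]) auto
      also have "\<dots> = (\<Sum>m | real_of_int \<bar>m - n\<bar> < t. G m)" by (rule sum.cong) auto
      also have "\<dots> = ennreal (\<Sum>m | real_of_int \<bar>m - n\<bar> < t. t ^ 3 / (t + 1) * (w t m)\<^sup>2)"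
        unfolding G_def using True by (intro sum_ennreal) auto
      also have "\<dots> = ennreal (D n t)"
        unfolding D_def near_term[OF True] w_def by (simp only: sum_distrib_left)
      finally show ?thesis by simp
    qed
    then have "(\<integral>\<^sup>+n. ennreal (D n t) \<partial>count_space UNIV)
        = (\<integral>\<^sup>+n. \<integral>\<^sup>+m. G m * indicator {m. real_of_int \<bar>m - n\<bar> < t} m \<partial>count_space UNIV \<partial>count_space UNIV)"
      by simp
    also have "\<dots> = (\<integral>\<^sup>+m. \<integral>\<^sup>+n. G m * indicator {m. real_of_int \<bar>m - n\<bar> < t} m \<partial>count_space UNIV \<partial>count_space UNIV)"
      by (rule nn_integral_count_space_nn_integral) auto
    also have "\<dots> \<le> (\<integral>\<^sup>+m. ennreal (2 * (t ^ 3 * (w t m)\<^sup>2)) \<partial>count_space UNIV)"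
    proof (rule nn_integral_mono)
      fix m
      have ind: "indicator {m. real_of_int \<bar>m - n\<bar> < t} m = (indicator {n. real_of_int \<bar>n - m\<bar> < t} n :: ennreal)" for n
        by (simp add: indicator_def abs_minus_commute)
      have "(\<integral>\<^sup>+n. G m * indicator {m. real_of_int \<bar>m - n\<bar> < t} m \<partial>count_space UNIV)
          = (\<Sum>n | real_of_int \<bar>n - m\<bar> < t. G m * indicator {n. real_of_int \<bar>n - m\<bar> < t} n)"
        unfolding ind by (rule nn_integral_count_space'[OF finite_near]) auto
      also have "\<dots> = (\<Sum>n | real_of_int \<bar>n - m\<bar> < t. G m)" by (rule sum.cong) auto
      also have "\<dots> = ennreal (real (card {n. real_of_int \<bar>n - m\<bar> < t}) * (t ^ 3 / (t + 1) * (w t m)\<^sup>2))"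
        using True by (simp only: G_def sum_constant ennreal_of_nat_eq_real_of_nat) (rule ennreal_mult[symmetric], auto)
      also have "\<dots> \<le> ennreal (2 * (t + 1) * (t ^ 3 / (t + 1) * (w t m)\<^sup>2))"
        using True by (intro ennreal_leI mult_right_mono card_near) auto
      also have "2 * (t + 1) * (t ^ 3 / (t + 1) * (w t m)\<^sup>2) = 2 * (t ^ 3 * (w t m)\<^sup>2)" using True by (simp add: divide_simps)
      finally show "(\<integral>\<^sup>+n. G m * indicator {m. real_of_int \<bar>m - n\<bar> < t} m \<partial>count_space UNIV) \<le> ennreal (2 * (t ^ 3 * (w t m)\<^sup>2))" .
    qed
    finally show ?thesis using True by simp
  qed simp
  have "(\<integral>\<^sup>+n. ssq \<gamma> n \<partial>count_space UNIV) = (\<integral>\<^sup>+n. \<integral>\<^sup>+t. ennreal (D n t) * indicator {0<..} t \<partial>lborel \<partial>count_space UNIV)"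
    by (simp add: ssq_def D_def)
  also have "\<dots> = (\<integral>\<^sup>+t. \<integral>\<^sup>+n. ennreal (D n t) * indicator {0<..} t \<partial>count_space UNIV \<partial>lborel)"
    by (rule nn_integral_count_space_nn_integral[symmetric]) (auto, measurable)
  also have "\<dots> \<le> (\<integral>\<^sup>+t. \<integral>\<^sup>+m. ennreal (2 * (t ^ 3 * (w t m)\<^sup>2)) * indicator {0<..} t \<partial>count_space UNIV \<partial>lborel)"
    by (rule nn_integral_mono) (rule pt)
  also have "\<dots> = (\<integral>\<^sup>+m. \<integral>\<^sup>+t. ennreal (2 * (t ^ 3 * (w t m)\<^sup>2)) * indicator {0<..} t \<partial>lborel \<partial>count_space UNIV)"
    by (rule nn_integral_count_space_nn_integral) (auto, measurable)
  also have "\<dots> \<le> ennreal (2 / cald 1 * (\<Sum>m\<in>Y. (norm (\<gamma> m))\<^sup>2))"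
  proof (rule nn_integral_count_space_int_le)
    fix X :: "int set" assume X: "finite X"
    have "(\<Sum>m\<in>X. \<integral>\<^sup>+t. ennreal (2 * (t ^ 3 * (w t m)\<^sup>2)) * indicator {0<..} t \<partial>lborel)
        = (\<integral>\<^sup>+t. (\<Sum>m\<in>X. ennreal (2 * (t ^ 3 * (w t m)\<^sup>2)) * indicator {0<..} t) \<partial>lborel)"
      by (rule nn_integral_sum[symmetric]) measurable
    also have "\<dots> = (\<integral>\<^sup>+t\<in>{0<..}. ennreal (\<Sum>m\<in>X. 2 * (t ^ 3 * (w t m)\<^sup>2)) \<partial>lborel)"
    proof (rule nn_integral_cong)
      fix t :: real
      show "(\<Sum>m\<in>X. ennreal (2 * (t ^ 3 * (w t m)\<^sup>2)) * indicator {0<..} t) = ennreal (\<Sum>m\<in>X. 2 * (t ^ 3 * (w t m)\<^sup>2)) * indicator {0<..} t"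
        by (cases "t > 0") (auto simp: sum_ennreal)
    qed
    also have "\<dots> \<le> ennreal (2 / cald 1 * (\<Sum>m\<in>Y. (norm (\<gamma> m))\<^sup>2))"
    proof (rule nn_integral_halfline_le)
      show "continuous_on UNIV (\<lambda>t. \<Sum>m\<in>X. 2 * (t ^ 3 * (w t m)\<^sup>2))" by (intro continuous_intros cont)
      show "(\<Sum>m\<in>X. 2 * (t ^ 3 * (w t m)\<^sup>2)) \<ge> 0" if "t \<ge> 0" for t using that by (intro sum_nonneg) auto
      fix R :: real assume R: "R \<ge> 0"
      have "integral {0..R} (\<lambda>t. \<Sum>m\<in>X. 2 * (t ^ 3 * (w t m)\<^sup>2)) = (\<Sum>m\<in>X. integral {0..R} (\<lambda>t. 2 * (t ^ 3 * (w t m)\<^sup>2)))"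
        by (rule integral_sum[OF X]) (intro integrable_continuous_real continuous_on_mult_left continuous_on_subset[OF cont] subset_UNIV)
      also have "\<dots> = 2 * (\<Sum>m\<in>X. integral {0..R} (\<lambda>t. t ^ 3 * (w t m)\<^sup>2))"
        by (simp add: sum_distrib_left)
      also have "(\<Sum>m\<in>X. integral {0..R} (\<lambda>t. t ^ 3 * (w t m)\<^sup>2)) \<le> 1 / cald 1 * (\<Sum>m\<in>Y. (norm (\<gamma> m))\<^sup>2)"
        using quadratic_estimate[of 1 Y \<gamma> X R, OF _ Y X R] by (simp add: w_def)
      finally show "integral {0..R} (\<lambda>t. \<Sum>m\<in>X. 2 * (t ^ 3 * (w t m)\<^sup>2)) \<le> 2 / cald 1 * (\<Sum>m\<in>Y. (norm (\<gamma> m))\<^sup>2)"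
        by simp
    qed
    finally show "(\<Sum>m\<in>X. \<integral>\<^sup>+t. ennreal (2 * (t ^ 3 * (w t m)\<^sup>2)) * indicator {0<..} t \<partial>lborel) \<le> ennreal (2 / cald 1 * (\<Sum>m\<in>Y. (norm (\<gamma> m))\<^sup>2))" .
  qed
  finally show ?thesis .
qed

section \<open>The square function of an atom\<close>

text \<open>The binomial \<open>x - c\<close> over \<open>j\<close> as a polynomial: the basis in
  which forward differences at \<open>c\<close> are the Taylor coefficients.\<close>

definition newton_basis :: "int \<Rightarrow> nat \<Rightarrow> complex poly" where
  "newton_basis c j = smult (1 / fact j) (\<Prod>i = 0..<j. [:- of_int c - of_nat i, 1:])"

lemma poly_newton_basis: "poly (newton_basis c j) z = (z - of_int c) gchoose j"
  by (simp add: newton_basis_def poly_prod gbinomial_prod_rev algebra_simps)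

lemma degree_newton_basis: "degree (newton_basis c j) \<le> j"
proof -
  have "degree (\<Prod>i = 0..<j. [:- of_int c - of_nat i, 1 :: complex:]) \<le> sum (degree \<circ> (\<lambda>i. [:- of_int c - of_nat i, 1 :: complex:])) {0..<j}"
    by (rule degree_prod_sum_le) simp
  also have "\<dots> = j" by simp
  finally show ?thesis unfolding newton_basis_def using degree_smult_le le_trans by blast
qed

text \<open>Discrete Taylor formula. By Pascal's rule the increment of the remainder of
  \<open>u\<close> is the remainder of \<open>fdiff u\<close> of one order less; it starts at 0 in
  \<open>c\<close>, so summing the increments raises the power by one.\<close>

lemma newton_remainder:
  fixes u :: "int \<Rightarrow> complex"
  assumes "\<And>k. k \<in> {c..d} \<Longrightarrow> norm ((fdiff ^^ J) u k) \<le> B" and "k \<in> {c..d}"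
  shows "norm (u k - (\<Sum>j<J. (of_int (k - c) gchoose j) * (fdiff ^^ j) u c)) \<le> B * real_of_int (k - c) ^ J"
  using assms
proof (induction J arbitrary: u k)
  case (Suc J)
  define R where "R = (\<lambda>k. u k - (\<Sum>j<Suc J. (of_int (k - c) gchoose j) * (fdiff ^^ j) u c))"
  have IH: "norm (fdiff u k - (\<Sum>j<J. (of_int (k - c) gchoose j) * (fdiff ^^ j) (fdiff u) c)) \<le> B * real_of_int (k - c) ^ J" if "k \<in> {c..d}" for k
  proof (rule Suc.IH)
    fix k assume "k \<in> {c..d}"
    then show "norm ((fdiff ^^ J) (fdiff u) k) \<le> B" using Suc.prems(1)[of k] by (simp only: funpow_Suc_right o_def)
  qed (rule that)
  have Rstep: "R (k + 1) = R k + (fdiff u k - (\<Sum>j<J. (of_int (k - c) gchoose j) * (fdiff ^^ j) (fdiff u) c))" for k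
  proof -
    have g: "(of_int (k + 1 - c) gchoose Suc j :: complex) = (of_int (k - c) gchoose j) + (of_int (k - c) gchoose Suc j)" for j
      using gbinomial_Suc_Suc[of "of_int (k - c) :: complex" j] by (simp add: algebra_simps)
    show ?thesis unfolding R_def sum.lessThan_Suc_shift g
      by (simp add: funpow_Suc_right o_def distrib_right sum.distrib fdiff_def[of u k] del: funpow.simps)
  qed
  have "k \<in> {c..d} \<Longrightarrow> norm (R k) \<le> B * real_of_int (k - c) ^ Suc J" if "c \<le> k" for k
    using that
  proof (induction k rule: int_ge_induct)
    case base
    have "R c = 0" by (simp add: R_def sum.lessThan_Suc_shift gbinomial_0_left del: sum.lessThan_Suc)
    then show ?case by simp
  next
    case (step i)
    have i: "i \<in> {c..d}" using step by auto
    define x where "x = real_of_int (i - c)"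
    have x: "x \<ge> 0" using step by (simp add: x_def)
    have B: "B \<ge> 0" using Suc.prems(1)[OF i] norm_ge_zero order_trans by blast
    have "norm (R (i + 1)) \<le> B * x ^ Suc J + B * x ^ J"
      unfolding Rstep
      using norm_triangle_mono[OF step.IH[OF i] IH[OF i]] by (simp only: x_def)
    also have "\<dots> = B * (x ^ J * (x + 1))" by (simp add: algebra_simps)
    also have "\<dots> \<le> B * ((x + 1) ^ J * (x + 1))" using x B by (intro mult_left_mono mult_right_mono power_mono) auto
    also have "(x + 1) ^ J * (x + 1) = real_of_int (i + 1 - c) ^ Suc J" by (simp add: x_def algebra_simps)
    finally show ?case .
  qed
  then show ?case using Suc.prems(2) by (simp only: R_def atLeastAtMost_iff simp_thms)
qed simp

text \<open>The Newton polynomial of degree \<open>N\<close> at \<open>c\<close> pairs to zero with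
  \<open>a\<close>, so only the remainder of \<open>u\<close> is left.\<close>

lemma annihilates_pairing_bound:
  assumes cd: "c \<le> d" "\<And>n. n \<notin> {c..d} \<Longrightarrow> a n = 0" and ann: "annihilates N a"
    and u: "\<And>k. k \<in> {c..d} \<Longrightarrow> norm ((fdiff ^^ Suc N) u k) \<le> B"
  shows "norm (\<Sum>k\<in>{c..d}. u k * a k) \<le> B * real_of_int (d - c) ^ Suc N * (\<Sum>k\<in>{c..d}. norm (a k))"
proof -
  define q where "q = (\<Sum>j<Suc N. smult ((fdiff ^^ j) u c) (newton_basis c j))"
  have q: "poly q (of_int k) = (\<Sum>j<Suc N. (of_int (k - c) gchoose j) * (fdiff ^^ j) u c)" for k
    by (simp add: q_def poly_sum poly_newton_basis mult.commute)
  have "degree q \<le> N" unfolding q_def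
  proof (rule degree_sum_le)
    fix j assume "j \<in> {..<Suc N}"
    then show "degree (smult ((fdiff ^^ j) u c) (newton_basis c j)) \<le> N"
      using degree_smult_le[of "(fdiff ^^ j) u c" "newton_basis c j"] degree_newton_basis[of c j] by simp
  qed simp
  then have "((\<lambda>n. poly q (of_int n) * a n) has_sum 0) UNIV" using ann unfolding annihilates_def by blast
  moreover have "((\<lambda>n. poly q (of_int n) * a n) has_sum (\<Sum>k\<in>{c..d}. poly q (of_int k) * a k)) UNIV"
    by (rule has_sum_finite_support) (use cd in auto)
  ultimately have z: "(\<Sum>k\<in>{c..d}. poly q (of_int k) * a k) = 0" using has_sum_unique by blast
  have B: "B \<ge> 0" using u[of c] cd(1) norm_ge_zero order_trans by (metis atLeastAtMost_iff order_refl)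
  have "norm (\<Sum>k\<in>{c..d}. u k * a k) = norm (\<Sum>k\<in>{c..d}. (u k - poly q (of_int k)) * a k)"
    using z by (simp add: left_diff_distrib sum_subtractf)
  also have "\<dots> \<le> (\<Sum>k\<in>{c..d}. B * real_of_int (d - c) ^ Suc N * norm (a k))"
  proof (rule sum_norm_le)
    fix k assume k: "k \<in> {c..d}"
    have "norm (u k - poly q (of_int k)) \<le> B * real_of_int (k - c) ^ Suc N"
      unfolding q by (rule newton_remainder[OF u k])
    also have "\<dots> \<le> B * real_of_int (d - c) ^ Suc N" using k B by (intro mult_left_mono power_mono) auto
    finally show "norm ((u k - poly q (of_int k)) * a k) \<le> B * real_of_int (d - c) ^ Suc N * norm (a k)"
      unfolding norm_mult by (rule mult_right_mono) simp
  qed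
  finally show ?thesis by (simp add: sum_distrib_left)
qed

text \<open>Scale-invariant form: decay exponent 0 controls powers of \<open>t\<close>, and the
  exponent equal to the order controls powers of \<open>|x|\<close> without any time factor; the
  larger of the two decides.\<close>

lemma fdiff_hk_space_time:
  "\<exists>C>0. \<forall>t>0. \<forall>x. norm ((fdiff ^^ j) (hk k (t\<^sup>2)) x) * (t + \<bar>real_of_int x\<bar>) ^ Suc (j + 2 * k) \<le> C"
proof -
  define r where "r = Suc (j + 2 * k)"
  obtain C0 where C0: "C0 > 0" "\<And>s n. s \<ge> 0 \<Longrightarrow> (1 + \<bar>real_of_int n\<bar>) ^ 0 * norm ((fdiff ^^ j) (hk k s) n) * sqrt (1 + s) ^ r
     \<le> C0 * sqrt (1 + s) ^ 0" using fdiff_hk_decay[of 0 j k] unfolding r_def by blast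
  obtain C1 where C1: "C1 > 0" "\<And>s n. s \<ge> 0 \<Longrightarrow> (1 + \<bar>real_of_int n\<bar>) ^ r * norm ((fdiff ^^ j) (hk k s) n) * sqrt (1 + s) ^ r
     \<le> C1 * sqrt (1 + s) ^ r" using fdiff_hk_decay[of r j k] unfolding r_def by blast
  have "norm ((fdiff ^^ j) (hk k (t\<^sup>2)) x) * (t + \<bar>real_of_int x\<bar>) ^ r \<le> 2 ^ r * (C0 + C1)" if t: "t > 0" for t x
  proof -
    define h where "h = norm ((fdiff ^^ j) (hk k (t\<^sup>2)) x)"
    have h: "h \<ge> 0" by (simp add: h_def)
    have s: "sqrt (1 + t\<^sup>2) > 0" by (simp add: add_pos_nonneg)
    have "t \<le> sqrt (1 + t\<^sup>2)" using t by (simp add: real_le_rsqrt)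
    then have "h * t ^ r \<le> h * sqrt (1 + t\<^sup>2) ^ r" using h t by (intro mult_left_mono power_mono) auto
    also have "\<dots> \<le> C0" using C0(2)[of "t\<^sup>2" x] by (simp add: h_def)
    finally have 0: "h * t ^ r \<le> C0" .
    have "((1 + \<bar>real_of_int x\<bar>) ^ r * h) * sqrt (1 + t\<^sup>2) ^ r \<le> C1 * sqrt (1 + t\<^sup>2) ^ r"
      using C1(2)[of "t\<^sup>2" x] by (simp add: h_def)
    then have "(1 + \<bar>real_of_int x\<bar>) ^ r * h \<le> C1" using s by (simp only: mult_le_cancel_right_pos[OF zero_less_power[OF s]])
    moreover have "h * \<bar>real_of_int x\<bar> ^ r \<le> h * (1 + \<bar>real_of_int x\<bar>) ^ r" using h by (intro mult_left_mono power_mono) auto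
    ultimately have 1: "h * \<bar>real_of_int x\<bar> ^ r \<le> C1" by (simp add: mult.commute)
    have "(t + \<bar>real_of_int x\<bar>) ^ r \<le> 2 ^ r * t ^ r + 2 ^ r * \<bar>real_of_int x\<bar> ^ r"
    proof (cases "t \<le> \<bar>real_of_int x\<bar>")
      case True
      then have "(t + \<bar>real_of_int x\<bar>) ^ r \<le> (2 * \<bar>real_of_int x\<bar>) ^ r" using t by (intro power_mono) auto
      then show ?thesis using t by (simp add: power_mult_distrib add_increasing)
    next
      case False
      then have "(t + \<bar>real_of_int x\<bar>) ^ r \<le> (2 * t) ^ r" using t by (intro power_mono) auto
      then show ?thesis using t by (simp add: power_mult_distrib add_increasing2)
    qed
    then have "h * (t + \<bar>real_of_int x\<bar>) ^ r \<le> h * (2 ^ r * t ^ r + 2 ^ r * \<bar>real_of_int x\<bar> ^ r)" using h by (rule mult_left_mono)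
    also have "\<dots> = 2 ^ r * (h * t ^ r + h * \<bar>real_of_int x\<bar> ^ r)" by (simp add: algebra_simps)
    also have "\<dots> \<le> 2 ^ r * (C0 + C1)" using 0 1 by (intro mult_left_mono add_mono) auto
    finally show ?thesis by (simp add: h_def)
  qed
  then show ?thesis using C0(1) C1(1) unfolding r_def by (intro exI[of _ "2 ^ Suc (j + 2 * k) * (C0 + C1)"]) simp
qed

section \<open>Tails of power sums and power integrals\<close>

lemma powr_tail_telescope:
  assumes e: "e > 1" and M: "M \<ge> 2"
  shows "(\<Sum>k\<in>{M..<M + K}. real k powr (- e)) \<le> (real (M - 1) powr (1 - e) - real (M + K - 1) powr (1 - e)) / (e - 1)"
proof (induction K)
  case (Suc K)
  define x where "x = real (M + K - 1)"
  have x: "x \<ge> 1" "real (M + K) = x + 1" "real (M + Suc K - 1) = x + 1" using M by (simp_all add: x_def of_nat_diff)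
  have der: "((\<lambda>y. y powr (1 - e)) has_real_derivative (1 - e) * y powr (- e)) (at y)" if "y > 0" for y :: real
    using that by (auto intro!: derivative_eq_intros)
  obtain z where z: "x < z" "z < x + 1" "(x + 1) powr (1 - e) - x powr (1 - e) = (x + 1 - x) * ((1 - e) * z powr (- e))"
    using MVT2[of x "x + 1" "\<lambda>y. y powr (1 - e)" "\<lambda>y. (1 - e) * y powr (- e)"] der x by force
  have "(x + 1) powr (- e) \<le> z powr (- e)" using z x e by (intro powr_mono2') auto
  then have "(e - 1) * (x + 1) powr (- e) \<le> (e - 1) * z powr (- e)" using e by (intro mult_left_mono) auto
  also have "\<dots> = x powr (1 - e) - (x + 1) powr (1 - e)" using z(3) by (simp add: algebra_simps)
  finally have "(x + 1) powr (- e) \<le> (x powr (1 - e) - (x + 1) powr (1 - e)) / (e - 1)" using e by (simp add: field_simps)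
  then have "(\<Sum>k\<in>{M..<M + K}. real k powr (- e)) + (x + 1) powr (- e)
      \<le> (real (M - 1) powr (1 - e) - x powr (1 - e)) / (e - 1) + (x powr (1 - e) - (x + 1) powr (1 - e)) / (e - 1)"
    using Suc.IH unfolding x_def[symmetric] by (rule add_mono[rotated])
  also have "\<dots> = (real (M - 1) powr (1 - e) - (x + 1) powr (1 - e)) / (e - 1)" by (simp add: diff_divide_distrib)
  finally show ?case unfolding x(3) by (simp only: sum.atLeastLessThan_Suc add_Suc_right le_add1 x(2))
qed simp

lemma powr_tail_int:
  assumes e: "e > 1" and L: "L \<ge> 1" and F: "finite F" "\<And>n. n \<in> F \<Longrightarrow> \<bar>n - c\<bar> \<ge> 2 * int L"
  shows "(\<Sum>n\<in>F. \<bar>real_of_int (n - c)\<bar> powr (- e)) \<le> 2 * (real L powr (1 - e) / (e - 1))"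
proof -
  define M where "M = 2 * L"
  define g where "g = (\<lambda>n. \<bar>real_of_int (n - c)\<bar> powr (- e))"
  obtain K where K: "\<And>n. n \<in> F \<Longrightarrow> nat \<bar>n - c\<bar> < M + K"
  proof
    fix n assume "n \<in> F"
    then have "nat \<bar>n - c\<bar> \<le> (\<Sum>n\<in>F. nat \<bar>n - c\<bar>)" by (intro member_le_sum F) auto
    then show "nat \<bar>n - c\<bar> < M + Suc (\<Sum>n\<in>F. nat \<bar>n - c\<bar>)" by simp
  qed
  define A where "A = (\<lambda>k. c + int k) ` {M..<M + K}"
  define A' where "A' = (\<lambda>k. c - int k) ` {M..<M + K}"
  have sub: "F \<subseteq> A \<union> A'"
  proof
    fix n assume n: "n \<in> F"
    define k where "k = nat \<bar>n - c\<bar>"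
    have k: "k \<in> {M..<M + K}" using F(2)[OF n] K[OF n] by (auto simp: k_def M_def)
    have "n = c + int k \<or> n = c - int k" by (auto simp: k_def)
    then show "n \<in> A \<union> A'" using k unfolding A_def A'_def by blast
  qed
  have S: "(\<Sum>k\<in>{M..<M + K}. real k powr (- e)) \<le> real L powr (1 - e) / (e - 1)"
  proof -
    have "(\<Sum>k\<in>{M..<M + K}. real k powr (- e)) \<le> (real (M - 1) powr (1 - e) - real (M + K - 1) powr (1 - e)) / (e - 1)"
      by (rule powr_tail_telescope[OF e]) (use L in \<open>simp add: M_def\<close>)
    also have "\<dots> \<le> real (M - 1) powr (1 - e) / (e - 1)" using e by (intro divide_right_mono) auto
    also have "\<dots> \<le> real L powr (1 - e) / (e - 1)" using e L by (intro divide_right_mono powr_mono2') (auto simp: M_def)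
    finally show ?thesis .
  qed
  have gA: "sum g A = (\<Sum>k\<in>{M..<M + K}. real k powr (- e))"
    unfolding A_def by (subst sum.reindex) (auto simp: inj_on_def g_def)
  have gA': "sum g A' = (\<Sum>k\<in>{M..<M + K}. real k powr (- e))"
    unfolding A'_def by (subst sum.reindex) (auto simp: inj_on_def g_def)
  have fin: "finite A" "finite A'" by (simp_all add: A_def A'_def)
  have "sum g F \<le> sum g (A \<union> A')" using sub fin by (intro sum_mono2) (auto simp: g_def)
  also have "\<dots> \<le> sum g A + sum g A'"
    using sum.union_inter[OF fin, of g] sum_nonneg[of "A \<inter> A'" g] by (simp add: g_def)
  finally show ?thesis using S unfolding gA gA' by (simp add: g_def)
qed

lemma nn_integral_inverse_power:
  assumes X: "X > 0" and D: "D \<ge> 0"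
  shows "(\<integral>\<^sup>+t\<in>{0..}. ennreal (D / (t + X) ^ Suc (Suc K)) \<partial>lborel) = ennreal (D / real (Suc K) / X ^ Suc K)"
proof -
  define F where "F = (\<lambda>t. - (D / real (Suc K)) / (t + X) ^ Suc K)"
  have "(\<integral>\<^sup>+t. ennreal (D / (t + X) ^ Suc (Suc K)) * indicator {0..} t \<partial>lborel) = ennreal (0 - F 0)"
  proof (rule nn_integral_FTC_atLeast)
    show "(\<lambda>t. D / (t + X) ^ Suc (Suc K)) \<in> borel_measurable borel" by measurable
    fix t :: real assume t: "0 \<le> t"
    define y where "y = t + X"
    have y: "y > 0" using t X by (simp add: y_def)
    have lin: "((\<lambda>t. t + X) has_real_derivative 1) (at t)" by (auto intro!: derivative_eq_intros)
    have "((\<lambda>t. (t + X) ^ Suc K) has_real_derivative real (Suc K) * y ^ K) (at t)"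
      using DERIV_power[OF lin, of "Suc K"] by (simp add: y_def)
    note der = this[unfolded y_def]
    have "(F has_real_derivative (0 * y ^ Suc K - - (D / real (Suc K)) * (real (Suc K) * y ^ K)) / (y ^ Suc K * y ^ Suc K)) (at t)"
      unfolding F_def y_def by (rule DERIV_divide[OF DERIV_const der]) (use t X in simp)
    also have "(0 * y ^ Suc K - - (D / real (Suc K)) * (real (Suc K) * y ^ K)) / (y ^ Suc K * y ^ Suc K) = D / y ^ Suc (Suc K)"
      using y by (simp add: divide_simps)
    finally show "(F has_real_derivative D / (t + X) ^ Suc (Suc K)) (at t)" by (simp add: y_def)
    show "0 \<le> D / (t + X) ^ Suc (Suc K)" using t X D by simp
  next
    have "filterlim (\<lambda>t. (t + X) ^ Suc K) at_top at_top"
      by (intro filterlim_pow_at_top filterlim_tendsto_add_at_top[OF tendsto_const filterlim_ident, simplified add.commute]) (auto simp: add.commute)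
    then show "(F \<longlongrightarrow> 0) at_top"
      unfolding F_def by (rule real_tendsto_divide_at_top[OF tendsto_const])
  qed
  then show ?thesis by (simp add: F_def)
qed

context hardy_exponent
begin

text \<open>\<open>Suc N\<close> differences of the kernel of order 1 give decay of order
  \<open>N + 4\<close> in space-time. The expansion costs \<open>Suc N\<close> powers of the length,
  and the l^1 norm of the atom the rest of the exponent.\<close>

lemma hconv_atom_far:
  "\<exists>C>0. \<forall>a c d n t m. c \<le> d \<longrightarrow> (\<forall>n. n \<notin> {c..d} \<longrightarrow> a n = 0) \<longrightarrow>
     (\<forall>n. norm (a n) \<le> real (card {c..d}) powr (- (1 / p))) \<longrightarrow> annihilates N a \<longrightarrow> t > 0 \<longrightarrow> real_of_int \<bar>m - n\<bar> < t \<longrightarrow>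
     \<bar>n - c\<bar> \<ge> 2 * int (card {c..d}) \<longrightarrow>
     norm (hconv 1 (t\<^sup>2) a m) \<le> C * real (card {c..d}) powr (real N + 2 - 1 / p) / (t + \<bar>real_of_int (n - c)\<bar>) ^ (N + 4)"
proof -
  obtain C where C: "C > 0" "\<And>t x. t > 0 \<Longrightarrow> norm ((fdiff ^^ Suc N) (hk 1 (t\<^sup>2)) x) * (t + \<bar>real_of_int x\<bar>) ^ Suc (Suc N + 2 * 1) \<le> C"
    using fdiff_hk_space_time[of "Suc N" 1] by blast
  have "norm (hconv 1 (t\<^sup>2) a m) \<le> (C * 3 ^ (N + 4)) * real (card {c..d}) powr (real N + 2 - 1 / p) / (t + \<bar>real_of_int (n - c)\<bar>) ^ (N + 4)"
    if cd: "c \<le> d" and supp: "\<forall>n. n \<notin> {c..d} \<longrightarrow> a n = 0" and bd: "\<forall>n. norm (a n) \<le> real (card {c..d}) powr (- (1 / p))"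
      and ann: "annihilates N a" and t: "t > 0" and mn: "real_of_int \<bar>m - n\<bar> < t" and far: "\<bar>n - c\<bar> \<ge> 2 * int (card {c..d})" for a c d n t m
  proof -
    define L where "L = real (card {c..d})"
    have Lr: "L = real_of_int (d - c) + 1" and L1: "L \<ge> 1" using cd by (simp_all add: L_def)
    define X where "X = \<bar>real_of_int (n - c)\<bar>"
    have X: "X \<ge> 2 * L" using far unfolding X_def L_def by linarith
    define B where "B = C * 3 ^ (N + 4) / (t + X) ^ (N + 4)"
    have tX: "t + X > 0" using t by (simp add: X_def)
    have "norm ((fdiff ^^ Suc N) (\<lambda>k. hk 1 (t\<^sup>2) (m - k)) k) \<le> B" if k: "k \<in> {c..d}" for k
    proof -
      have "(\<lambda>k. hk 1 (t\<^sup>2) (m - k)) = (\<lambda>k. hk 1 (t\<^sup>2) (k + - m))"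
        using hk_minus[of 1 "t\<^sup>2"] by (metis (no_types) minus_diff_eq uminus_add_conv_diff add.commute)
      then have eq: "(fdiff ^^ Suc N) (\<lambda>k. hk 1 (t\<^sup>2) (m - k)) k = (fdiff ^^ Suc N) (hk 1 (t\<^sup>2)) (k - m)"
        using fdiff_pow_shift[of "Suc N" "hk 1 (t\<^sup>2)" "- m" k] by simp
      define y where "y = t + \<bar>real_of_int (k - m)\<bar>"
      have kc: "\<bar>real_of_int (k - c)\<bar> \<le> L" using k unfolding Lr by auto
      \<comment> \<open>The support has length at most \<open>X / 2\<close> and \<open>m\<close> is
        within \<open>t\<close> of \<open>n\<close>, so \<open>y\<close> is at least
        \<open>t\<close> and at least \<open>X / 2\<close>.\<close>
      have "t + X \<le> 3 * y"
        using kc X mn L1 t unfolding X_def y_def by (simp add: abs_if split: if_splits)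
      then have "(t + X) ^ (N + 4) \<le> (3 * y) ^ (N + 4)" using tX by (intro power_mono) auto
      then have pw: "(t + X) ^ (N + 4) \<le> 3 ^ (N + 4) * y ^ (N + 4)" by (simp only: power_mult_distrib)
      define h where "h = norm ((fdiff ^^ Suc N) (hk 1 (t\<^sup>2)) (k - m))"
      have hy: "h * y ^ (N + 4) \<le> C" using C(2)[OF t, of "k - m"] unfolding h_def y_def by (simp add: eval_nat_numeral)
      have "h * (t + X) ^ (N + 4) \<le> h * (3 ^ (N + 4) * y ^ (N + 4))" using pw by (intro mult_left_mono) (auto simp: h_def)
      also have "\<dots> = 3 ^ (N + 4) * (h * y ^ (N + 4))" by (simp only: mult.left_commute)
      also have "\<dots> \<le> 3 ^ (N + 4) * C" using hy by (intro mult_left_mono) auto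
      finally show ?thesis unfolding eq B_def h_def[symmetric] using tX by (simp add: pos_le_divide_eq mult.commute)
    qed
    then have "norm (\<Sum>k\<in>{c..d}. hk 1 (t\<^sup>2) (m - k) * a k) \<le> B * real_of_int (d - c) ^ Suc N * (\<Sum>k\<in>{c..d}. norm (a k))"
      using annihilates_pairing_bound[OF cd _ ann, of "\<lambda>k. hk 1 (t\<^sup>2) (m - k)" B] supp by blast
    also have "\<dots> \<le> B * L ^ Suc N * (L * L powr (- (1 / p)))"
    proof (intro mult_mono power_mono)
      have "(\<Sum>k\<in>{c..d}. norm (a k)) \<le> (\<Sum>k\<in>{c..d}. L powr (- (1 / p)))" using bd by (intro sum_mono) (simp add: L_def)
      then show "(\<Sum>k\<in>{c..d}. norm (a k)) \<le> L * L powr (- (1 / p))" by (simp only: sum_constant L_def[symmetric])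
    qed (use C tX cd Lr in \<open>auto simp: B_def intro!: sum_nonneg\<close>)
    also have "L ^ Suc N = L powr real (Suc N)" using L1 by (intro powr_realpow[symmetric]) simp
    also have "B * L powr real (Suc N) * (L * L powr (- (1 / p))) = B * L powr (real N + 2 - 1 / p)"
    proof -
      have "L powr real (Suc N) * (L powr 1 * L powr (- (1 / p))) = L powr (real (Suc N) + (1 + - (1 / p)))"
        by (simp only: powr_add)
      then show ?thesis using L1 by (simp add: algebra_simps)
    qed
    finally show ?thesis
      using hconv_finite_support[of "{c..d}" a 1 "t\<^sup>2" m] supp by (simp add: B_def L_def X_def)
  qed
  then show ?thesis using C(1) by (intro exI[of _ "C * 3 ^ (N + 4)"]) simp
qed

text \<open>The cone volume cancels the weight, leaving \<open>t ^ 3\<close> against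
  \<open>2 * N + 8\<close> inverse powers of \<open>t + X\<close>. Integrating the resulting power
  \<open>2 * N + 5\<close> leaves \<open>2 * N + 4\<close>, the square of decay
  \<open>N + 2\<close>.\<close>

lemma ssq_atom_far:
  "\<exists>C>0. \<forall>a c d n. c \<le> d \<longrightarrow> (\<forall>n. n \<notin> {c..d} \<longrightarrow> a n = 0) \<longrightarrow>
     (\<forall>n. norm (a n) \<le> real (card {c..d}) powr (- (1 / p))) \<longrightarrow> annihilates N a \<longrightarrow>
     \<bar>n - c\<bar> \<ge> 2 * int (card {c..d}) \<longrightarrow>
     ssq a n \<le> ennreal ((C * real (card {c..d}) powr (real N + 2 - 1 / p) / \<bar>real_of_int (n - c)\<bar> ^ (N + 2))\<^sup>2)"
proof -
  obtain C where C: "C > 0" "\<And>a c d n t m. c \<le> d \<Longrightarrow> (\<forall>n. n \<notin> {c..d} \<longrightarrow> a n = 0) \<Longrightarrow>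
     (\<forall>n. norm (a n) \<le> real (card {c..d}) powr (- (1 / p))) \<Longrightarrow> annihilates N a \<Longrightarrow> t > 0 \<Longrightarrow> real_of_int \<bar>m - n\<bar> < t \<Longrightarrow>
     \<bar>n - c\<bar> \<ge> 2 * int (card {c..d}) \<Longrightarrow>
     norm (hconv 1 (t\<^sup>2) a m) \<le> C * real (card {c..d}) powr (real N + 2 - 1 / p) / (t + \<bar>real_of_int (n - c)\<bar>) ^ (N + 4)"
    using hconv_atom_far by blast
  have "ssq a n \<le> ennreal ((C * real (card {c..d}) powr (real N + 2 - 1 / p) / \<bar>real_of_int (n - c)\<bar> ^ (N + 2))\<^sup>2)"
    if cd: "c \<le> d" and supp: "\<forall>n. n \<notin> {c..d} \<longrightarrow> a n = 0" and bd: "\<forall>n. norm (a n) \<le> real (card {c..d}) powr (- (1 / p))"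
      and ann: "annihilates N a" and far: "\<bar>n - c\<bar> \<ge> 2 * int (card {c..d})" for a c d n
  proof -
    define D where "D = C * real (card {c..d}) powr (real N + 2 - 1 / p)"
    define X where "X = \<bar>real_of_int (n - c)\<bar>"
    have "card {c..d} \<ge> 1" using cd by simp
    then have X: "X > 0" using far unfolding X_def by linarith
    have D: "D \<ge> 0" using C(1) by (simp add: D_def)
    have "ssq a n \<le> (\<integral>\<^sup>+t\<in>{0..}. ennreal ((2 * D\<^sup>2) / (t + X) ^ Suc (Suc (2 * N + 3))) \<partial>lborel)"
      unfolding ssq_def
    proof (rule nn_integral_mono)
      fix t :: real
      show "ennreal ((\<Sum>m | real_of_int \<bar>m - n\<bar> < t. (norm (complex_of_real (t\<^sup>2) * hconv 1 (t\<^sup>2) a m))\<^sup>2) / (t * (t + 1))) * indicator {0<..} t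
          \<le> ennreal (2 * D\<^sup>2 / (t + X) ^ Suc (Suc (2 * N + 3))) * indicator {0..} t"
      proof (cases "t > 0")
        case True
        define y where "y = t + X"
        have y: "y > 0" "t \<le> y" using True X by (simp_all add: y_def)
        have "(\<Sum>m | real_of_int \<bar>m - n\<bar> < t. (norm (hconv 1 (t\<^sup>2) a m))\<^sup>2) \<le> (\<Sum>m | real_of_int \<bar>m - n\<bar> < t. (D / y ^ (N + 4))\<^sup>2)"
        proof (intro sum_mono power_mono)
          fix m assume "m \<in> {m. real_of_int \<bar>m - n\<bar> < t}"
          then have "real_of_int \<bar>m - n\<bar> < t" by (rule CollectD)
          from C(2)[OF cd supp bd ann True this far]
          show "norm (hconv 1 (t\<^sup>2) a m) \<le> D / y ^ (N + 4)" by (simp only: D_def y_def X_def)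
        qed simp
        also have "\<dots> = real (card {m. real_of_int \<bar>m - n\<bar> < t}) * (D / y ^ (N + 4))\<^sup>2" by simp
        also have "\<dots> \<le> (2 * (t + 1)) * (D / y ^ (N + 4))\<^sup>2" by (intro mult_right_mono card_near True) simp
        finally have "t ^ 3 / (t + 1) * (\<Sum>m | real_of_int \<bar>m - n\<bar> < t. (norm (hconv 1 (t\<^sup>2) a m))\<^sup>2)
            \<le> t ^ 3 / (t + 1) * ((2 * (t + 1)) * (D / y ^ (N + 4))\<^sup>2)" using True by (intro mult_left_mono) auto
        also have "\<dots> = t ^ 3 * (2 * (D / y ^ (N + 4))\<^sup>2)" using True by (simp add: divide_simps)
        also have "\<dots> \<le> y ^ 3 * (2 * (D / y ^ (N + 4))\<^sup>2)" using True y by (intro mult_right_mono power_mono) auto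
        also have "\<dots> = 2 * D\<^sup>2 / y ^ (2 * N + 5)"
        proof -
          have "y ^ 3 * y ^ (2 * N + 5) = (y ^ (N + 4))\<^sup>2" unfolding power_add[symmetric] power_mult[symmetric] by (rule arg_cong[where f = "(^) y"]) simp
          then show ?thesis using y(1) by (simp add: power_divide frac_eq_eq mult_ac) (simp only: mult.assoc[symmetric])?
        qed
        finally have "t ^ 3 / (t + 1) * (\<Sum>m | real_of_int \<bar>m - n\<bar> < t. (norm (hconv 1 (t\<^sup>2) a m))\<^sup>2) \<le> 2 * D\<^sup>2 / (t + X) ^ Suc (Suc (2 * N + 3))"
          by (simp add: y_def eval_nat_numeral)
        then show ?thesis unfolding near_term[OF True] using True by (simp add: ennreal_leI)
      qed simp
    qed
    also have "\<dots> = ennreal (2 * D\<^sup>2 / real (Suc (2 * N + 3)) / X ^ Suc (2 * N + 3))"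
      by (rule nn_integral_inverse_power[OF X]) simp
    also have "\<dots> \<le> ennreal ((D / X ^ (N + 2))\<^sup>2)"
    proof (rule ennreal_leI)
      have "2 * D\<^sup>2 / real (Suc (2 * N + 3)) \<le> D\<^sup>2 / 1"
      proof -
        have "2 * D\<^sup>2 \<le> real (Suc (2 * N + 3)) * D\<^sup>2" by (intro mult_right_mono) auto
        then show ?thesis by (simp add: divide_simps mult.commute)
      qed
      then have "2 * D\<^sup>2 / real (Suc (2 * N + 3)) / X ^ Suc (2 * N + 3) \<le> D\<^sup>2 / 1 / X ^ Suc (2 * N + 3)"
        using X by (intro divide_right_mono) auto
      also have "\<dots> = (D / X ^ (N + 2))\<^sup>2"
      proof -
        have "X ^ Suc (2 * N + 3) = (X ^ (N + 2))\<^sup>2" unfolding power_mult[symmetric] by (rule arg_cong[where f = "(^) X"]) simp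
        then show ?thesis by (simp only: power_divide div_by_1)
      qed
      finally show "2 * D\<^sup>2 / real (Suc (2 * N + 3)) / X ^ Suc (2 * N + 3) \<le> (D / X ^ (N + 2))\<^sup>2" .
    qed
    finally show ?thesis by (simp only: D_def X_def)
  qed
  then show ?thesis using C(1) by blast
qed

text \<open>Near the support the summed square function is controlled, far away it decays with
  exponent \<open>e = p * (N + 2) > 1\<close> in the p-th power. The powers of the length cancel in
  both parts, so the bound is the same for all atoms.\<close>

lemma sf_mass_batom:
  "\<exists>C>0. \<forall>a. batom a \<longrightarrow> (\<integral>\<^sup>+n. epowr (ssq a n) (p / 2) \<partial>count_space UNIV) \<le> ennreal C"
proof -
  obtain C where C: "C > 0" "\<And>a c d n. c \<le> d \<Longrightarrow> (\<forall>n. n \<notin> {c..d} \<longrightarrow> a n = 0) \<Longrightarrow>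
     (\<forall>n. norm (a n) \<le> real (card {c..d}) powr (- (1 / p))) \<Longrightarrow> annihilates N a \<Longrightarrow>
     \<bar>n - c\<bar> \<ge> 2 * int (card {c..d}) \<Longrightarrow>
     ssq a n \<le> ennreal ((C * real (card {c..d}) powr (real N + 2 - 1 / p) / \<bar>real_of_int (n - c)\<bar> ^ (N + 2))\<^sup>2)"
    using ssq_atom_far by blast
  define e where "e = p * (real N + 2)"
  have e: "e > 1" using N_gt by (simp add: e_def)
  define K where "K = 6 + 2 / cald 1 + C powr p * (2 / (e - 1))"
  have "(\<integral>\<^sup>+n. epowr (ssq a n) (p / 2) \<partial>count_space UNIV) \<le> ennreal K" if "batom a" for a
  proof -
    obtain c d where cd: "c \<le> d" and supp: "\<forall>n. n \<notin> {c..d} \<longrightarrow> a n = 0" and bd: "\<forall>n. norm (a n) \<le> real (card {c..d}) powr (- (1 / p))"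
      and ann: "annihilates N a" using \<open>batom a\<close> unfolding batom_def by blast
    define l where "l = card {c..d}"
    define L where "L = real l"
    have l1: "l \<ge> 1" using cd by (simp add: l_def)
    have L1: "L \<ge> 1" using l1 by (simp add: L_def)
    define U where "U = (\<lambda>n. ennreal (1 / L) * indicator {n. real_of_int \<bar>n - c\<bar> < 2 * L} n)"
    define V where "V = (\<lambda>n. ennreal (L powr (2 / p - 1)) * ssq a n)"
    define W where "W = (\<lambda>n. ennreal (C powr p * L powr (e - 1)) * (ennreal (\<bar>real_of_int (n - c)\<bar> powr (- e)) * indicator {n. \<bar>n - c\<bar> \<ge> 2 * int l} n))"
    have pt: "epowr (ssq a n) (p / 2) \<le> U n + (V n + W n)" for n
    proof (cases "\<bar>n - c\<bar> \<ge> 2 * int l")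
      case False
      then have "real_of_int \<bar>n - c\<bar> < 2 * L" unfolding L_def by linarith
      then have U: "U n = ennreal (1 / L)" by (simp add: U_def)
      have "epowr (ssq a n) (p / 2) \<le> ennreal (1 / L) + ennreal (L powr (2 / p - 1)) * ssq a n"
      proof (cases "ssq a n")
        case (real v)
        \<comment> \<open>\<open>x powr (p / 2) <= 1 + x\<close>, applied after scaling by the
          length, replaces Hoelder's inequality between the powers \<open>p\<close> and 2.\<close>
        define x where "x = v * L powr (2 / p)"
        have x: "x \<ge> 0" using real by (simp add: x_def)
        have "x powr (p / 2) \<le> 1 + x"
        proof (cases "x \<le> 1")
          case True
          then have "x powr (p / 2) \<le> 1" using x p0 by (intro powr_le1) auto
          then show ?thesis using x by simp
        next
          case False
          then have "x powr (p / 2) \<le> x powr 1" using p1 by (intro powr_mono) auto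
          then show ?thesis using x by simp
        qed
        moreover have "x powr (p / 2) = v powr (p / 2) * L" using real p0 L1 by (simp add: x_def powr_mult powr_powr)
        ultimately have "v powr (p / 2) \<le> (1 + x) / L" using L1 by (simp add: pos_le_divide_eq)
        also have "\<dots> = 1 / L + L powr (2 / p - 1) * v" using L1 by (simp add: x_def powr_diff add_divide_distrib)
        finally have "ennreal (v powr (p / 2)) \<le> ennreal (1 / L + L powr (2 / p - 1) * v)" by (rule ennreal_leI)
        also have "\<dots> = ennreal (1 / L) + ennreal (L powr (2 / p - 1)) * ssq a n"
          using real L1 by (simp add: ennreal_plus ennreal_mult)
        finally show ?thesis using real by (simp add: epowr_ennreal)
      next
        case top
        then show ?thesis using L1 by (simp add: ennreal_mult_top)
      qed
      then show ?thesis using U by (simp add: V_def add_increasing2 flip: add.assoc)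
    next
      case True
      define X where "X = \<bar>real_of_int (n - c)\<bar>"
      have X: "X > 0" using True l1 unfolding X_def by linarith
      define v where "v = C * L powr (real N + 2 - 1 / p) / X ^ (N + 2)"
      have v: "v \<ge> 0" using C(1) X by (simp add: v_def)
      have "epowr (ssq a n) (p / 2) \<le> epowr (ennreal (v\<^sup>2)) (p / 2)"
        using C(2)[OF cd supp bd ann True[unfolded l_def]] p0 by (intro epowr_mono) (simp_all add: v_def X_def L_def l_def)
      also have "\<dots> = ennreal (v powr p)"
        using v p0 by (simp add: epowr_ennreal powr_powr flip: powr_numeral)
      also have "v powr p = C powr p * L powr (e - 1) * X powr (- e)"
      proof -
        have "v = C * L powr (real N + 2 - 1 / p) * X powr (- (real N + 2))"
        proof -
          have "X ^ (N + 2) = X powr real (N + 2)" by (rule powr_realpow[OF X, symmetric])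
          also have "real (N + 2) = real N + 2" by simp
          finally show ?thesis unfolding v_def powr_minus_divide by simp
        qed
        then have "v powr p = C powr p * L powr ((real N + 2 - 1 / p) * p) * X powr (- (real N + 2) * p)"
          using C(1) X L1 by (simp only: powr_mult powr_powr)
        moreover have "(real N + 2 - 1 / p) * p = e - 1" "- (real N + 2) * p = - e"
          using p0 by (simp_all add: e_def field_simps)
        ultimately show ?thesis by simp
      qed
      also have "ennreal (C powr p * L powr (e - 1) * X powr (- e)) = W n"
        using True by (simp add: W_def X_def ennreal_mult)
      finally show ?thesis by (simp add: add_increasing)
    qed
    have U: "(\<integral>\<^sup>+n. U n \<partial>count_space UNIV) \<le> ennreal 6"
    proof -
      have "(\<integral>\<^sup>+n. U n \<partial>count_space UNIV) = (\<Sum>n | real_of_int \<bar>n - c\<bar> < 2 * L. U n)"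
        by (rule nn_integral_count_space'[OF finite_near]) (auto simp: U_def)
      also have "\<dots> = (\<Sum>n | real_of_int \<bar>n - c\<bar> < 2 * L. ennreal (1 / L))" by (rule sum.cong) (auto simp: U_def)
      also have "\<dots> = ennreal (real (card {n. real_of_int \<bar>n - c\<bar> < 2 * L}) * (1 / L))"
        using L1 by (simp only: sum_constant ennreal_of_nat_eq_real_of_nat) (rule ennreal_mult[symmetric], auto)
      also have "\<dots> \<le> ennreal (2 * (2 * L + 1) * (1 / L))" using L1 by (intro ennreal_leI mult_right_mono card_near) auto
      also have "\<dots> \<le> ennreal 6" using L1 by (intro ennreal_leI) (simp add: divide_simps)
      finally show ?thesis .
    qed
    have V: "(\<integral>\<^sup>+n. V n \<partial>count_space UNIV) \<le> ennreal (2 / cald 1)"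
    proof -
      have "(\<integral>\<^sup>+n. V n \<partial>count_space UNIV) = ennreal (L powr (2 / p - 1)) * (\<integral>\<^sup>+n. ssq a n \<partial>count_space UNIV)"
        unfolding V_def by (rule nn_integral_cmult) simp
      also have "\<dots> \<le> ennreal (L powr (2 / p - 1)) * ennreal (2 / cald 1 * (\<Sum>m\<in>{c..d}. (norm (a m))\<^sup>2))"
        using supp by (intro mult_left_mono nn_integral_ssq_le) auto
      also have "\<dots> = ennreal (L powr (2 / p - 1) * (2 / cald 1 * (\<Sum>m\<in>{c..d}. (norm (a m))\<^sup>2)))"
        using cald_pos[of 1] by (intro ennreal_mult[symmetric] mult_nonneg_nonneg divide_nonneg_pos sum_nonneg) auto
      also have "\<dots> \<le> ennreal (2 / cald 1)"
      proof (rule ennreal_leI)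
        have "(\<Sum>m\<in>{c..d}. (norm (a m))\<^sup>2) \<le> (\<Sum>m\<in>{c..d}. (L powr (- (1 / p)))\<^sup>2)"
          using bd by (intro sum_mono power_mono) (simp_all add: L_def l_def)
        also have "\<dots> = L powr (1 - 2 / p)"
          using L1 by (simp add: L_def l_def powr_diff powr_minus power_inverse divide_inverse flip: powr_numeral) (simp add: powr_powr mult.commute)
        finally have "L powr (2 / p - 1) * (\<Sum>m\<in>{c..d}. (norm (a m))\<^sup>2) \<le> L powr (2 / p - 1) * L powr (1 - 2 / p)"
          by (rule mult_left_mono) simp
        also have "\<dots> = 1" using L1 by (simp flip: powr_add)
        finally have "2 / cald 1 * (L powr (2 / p - 1) * (\<Sum>m\<in>{c..d}. (norm (a m))\<^sup>2)) \<le> 2 / cald 1 * 1"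
          using cald_pos[of 1] by (intro mult_left_mono) auto
        then show "L powr (2 / p - 1) * (2 / cald 1 * (\<Sum>m\<in>{c..d}. (norm (a m))\<^sup>2)) \<le> 2 / cald 1"
          by (simp only: mult.left_commute mult_1_right)
      qed
      finally show ?thesis .
    qed
    have W: "(\<integral>\<^sup>+n. W n \<partial>count_space UNIV) \<le> ennreal (C powr p * (2 / (e - 1)))"
    proof -
      have "(\<integral>\<^sup>+n. W n \<partial>count_space UNIV) = ennreal (C powr p * L powr (e - 1)) *
          (\<integral>\<^sup>+n. ennreal (\<bar>real_of_int (n - c)\<bar> powr (- e)) * indicator {n. \<bar>n - c\<bar> \<ge> 2 * int l} n \<partial>count_space UNIV)"
        unfolding W_def by (rule nn_integral_cmult) simp
      also have "\<dots> \<le> ennreal (C powr p * L powr (e - 1)) * ennreal (2 * (L powr (1 - e) / (e - 1)))"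
      proof (rule mult_left_mono[OF nn_integral_count_space_int_le])
        fix F :: "int set" assume F: "finite F"
        have "(\<Sum>n\<in>F. ennreal (\<bar>real_of_int (n - c)\<bar> powr (- e)) * indicator {n. \<bar>n - c\<bar> \<ge> 2 * int l} n)
            = (\<Sum>n\<in>F \<inter> {n. \<bar>n - c\<bar> \<ge> 2 * int l}. ennreal (\<bar>real_of_int (n - c)\<bar> powr (- e)))"
          using F by (intro sum.mono_neutral_cong_right) (auto simp: indicator_def)
        also have "\<dots> = ennreal (\<Sum>n\<in>F \<inter> {n. \<bar>n - c\<bar> \<ge> 2 * int l}. \<bar>real_of_int (n - c)\<bar> powr (- e))"
          by (rule sum_ennreal) simp
        also have "\<dots> \<le> ennreal (2 * (L powr (1 - e) / (e - 1)))"
          unfolding L_def using F by (intro ennreal_leI powr_tail_int[OF e l1]) auto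
        finally show "(\<Sum>n\<in>F. ennreal (\<bar>real_of_int (n - c)\<bar> powr (- e)) * indicator {n. \<bar>n - c\<bar> \<ge> 2 * int l} n)
            \<le> ennreal (2 * (L powr (1 - e) / (e - 1)))" .
      qed simp
      also have "\<dots> = ennreal (C powr p * L powr (e - 1) * (2 * (L powr (1 - e) / (e - 1))))"
        using e by (intro ennreal_mult[symmetric]) auto
      also have "C powr p * L powr (e - 1) * (2 * (L powr (1 - e) / (e - 1))) = C powr p * (2 / (e - 1)) * (L powr (e - 1) * L powr (1 - e))"
        by simp
      also have "L powr (e - 1) * L powr (1 - e) = 1" using L1 by (simp flip: powr_add)
      finally show ?thesis by simp
    qed
    have "(\<integral>\<^sup>+n. epowr (ssq a n) (p / 2) \<partial>count_space UNIV) \<le> (\<integral>\<^sup>+n. U n + (V n + W n) \<partial>count_space UNIV)"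
      by (rule nn_integral_mono) (rule pt)
    also have "\<dots> = (\<integral>\<^sup>+n. U n \<partial>count_space UNIV) + ((\<integral>\<^sup>+n. V n \<partial>count_space UNIV) + (\<integral>\<^sup>+n. W n \<partial>count_space UNIV))"
      by (simp add: nn_integral_add)
    also have "\<dots> \<le> ennreal 6 + (ennreal (2 / cald 1) + ennreal (C powr p * (2 / (e - 1))))"
      by (intro add_mono U V W)
    also have "\<dots> = ennreal K"
    proof -
      have add3: "ennreal 6 + (ennreal u + ennreal v) = ennreal (6 + u + v)" if "u \<ge> 0" "v \<ge> 0" for u v :: real
        using that by (simp only: ennreal_plus add_nonneg_nonneg zero_le_numeral add.assoc)
      show ?thesis unfolding K_def using cald_pos[of 1] e by (intro add3) auto
    qed
    finally show ?thesis .
  qed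
  moreover have "K > 0" unfolding K_def using cald_pos[of 1] e by (intro add_pos_nonneg) auto
  ultimately show ?thesis by blast
qed

end

section \<open>The square function of an atomic sum\<close>

text \<open>Cauchy-Schwarz for partial sums with weights \<open>w\<close>, then the limit; in
  \<open>ennreal\<close> the right side may be infinite.\<close>

lemma ennreal_cauchy_schwarz_series:
  fixes x :: "nat \<Rightarrow> complex"
  assumes x: "x sums y" and w: "\<And>j. w j > 0" "w sums W"
  shows "ennreal ((norm y)\<^sup>2) \<le> ennreal W * (\<Sum>j. ennreal ((norm (x j))\<^sup>2 / w j))"
proof (rule LIMSEQ_le_const2)
  show "(\<lambda>n. ennreal ((norm (\<Sum>j<n. x j))\<^sup>2)) \<longlonglongrightarrow> ennreal ((norm y)\<^sup>2)"
    using x unfolding sums_def by (intro tendsto_ennrealI tendsto_intros)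
  have "ennreal ((norm (\<Sum>j<n. x j))\<^sup>2) \<le> ennreal W * (\<Sum>j. ennreal ((norm (x j))\<^sup>2 / w j))" for n
  proof -
    have "norm (\<Sum>j<n. x j) \<le> (\<Sum>j<n. norm (x j))" by (rule norm_sum)
    also have "\<dots> = (\<Sum>j<n. sqrt (w j) * (norm (x j) / sqrt (w j)))"
      by (rule sum.cong) (use w(1) in \<open>auto simp: less_imp_neq[symmetric]\<close>)
    finally have "(norm (\<Sum>j<n. x j))\<^sup>2 \<le> (\<Sum>j<n. sqrt (w j) * (norm (x j) / sqrt (w j)))\<^sup>2"
      by (rule power_mono) simp
    also have "\<dots> \<le> (\<Sum>j<n. (sqrt (w j))\<^sup>2) * (\<Sum>j<n. (norm (x j) / sqrt (w j))\<^sup>2)"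
      by (rule Cauchy_Schwarz_ineq_sum)
    also have "\<dots> = (\<Sum>j<n. w j) * (\<Sum>j<n. (norm (x j))\<^sup>2 / w j)"
      using w(1) by (simp add: power_divide less_imp_le)
    also have "\<dots> \<le> W * (\<Sum>j<n. (norm (x j))\<^sup>2 / w j)"
    proof (rule mult_right_mono)
      show "(\<Sum>j<n. w j) \<le> W"
        using sum_le_suminf[OF sums_summable[OF w(2)], of "{..<n}"] w(1) sums_unique[OF w(2)] by (simp add: less_imp_le)
    qed (use w(1) in \<open>auto intro!: sum_nonneg divide_nonneg_pos\<close>)
    finally have "ennreal ((norm (\<Sum>j<n. x j))\<^sup>2) \<le> ennreal (W * (\<Sum>j<n. (norm (x j))\<^sup>2 / w j))" by (rule ennreal_leI)
    also have "\<dots> = ennreal W * (\<Sum>j<n. ennreal ((norm (x j))\<^sup>2 / w j))"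
    proof -
      have "W \<ge> 0" using w by (metis less_imp_le sums_le sums_zero)
      then have "ennreal (W * (\<Sum>j<n. (norm (x j))\<^sup>2 / w j)) = ennreal W * ennreal (\<Sum>j<n. (norm (x j))\<^sup>2 / w j)"
        using w(1) by (intro ennreal_mult) (auto intro!: sum_nonneg divide_nonneg_pos)
      also have "ennreal (\<Sum>j<n. (norm (x j))\<^sup>2 / w j) = (\<Sum>j<n. ennreal ((norm (x j))\<^sup>2 / w j))"
        using w(1) by (intro sum_ennreal[symmetric] divide_nonneg_pos) auto
      finally show ?thesis .
    qed
    also have "\<dots> \<le> ennreal W * (\<Sum>j. ennreal ((norm (x j))\<^sup>2 / w j))"
      by (intro mult_left_mono sum_le_suminf) auto
    finally show ?thesis .
  qed
  then show "\<exists>N. \<forall>n\<ge>N. ennreal ((norm (\<Sum>j<n. x j))\<^sup>2) \<le> ennreal W * (\<Sum>j. ennreal ((norm (x j))\<^sup>2 / w j))" by blast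
qed

text \<open>Minkowski's inequality, obtained from the Cauchy--Schwarz inequality with the weights
  \<open>norm (c j) * s j\<close>; the geometric term makes them positive.\<close>

lemma ssq_series:
  assumes F: "\<And>j. F j > 0" "\<And>j. poly_growth (F j) d (g j)"
    and sums: "\<And>t m. t > 0 \<Longrightarrow> (\<lambda>j. c j * hconv 1 (t\<^sup>2) (g j) m) sums hconv 1 (t\<^sup>2) f m"
    and s: "\<And>j. s j \<ge> 0" "\<And>j. ssq (g j) n \<le> ennreal ((s j)\<^sup>2)" and S: "(\<lambda>j. norm (c j) * s j) sums S"
  shows "ssq f n \<le> ennreal (S\<^sup>2)"
proof -
  have S0: "S \<ge> 0" by (rule sums_le[OF _ sums_zero S]) (use s(1) in simp)
  have main: "ssq f n \<le> ennreal ((S + \<epsilon>)\<^sup>2)" if \<epsilon>: "\<epsilon> > 0" for \<epsilon>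
  proof -
    define w where "w = (\<lambda>j. norm (c j) * s j + \<epsilon> * (1 / 2) ^ Suc j)"
    define W where "W = S + \<epsilon>"
    have w: "w j > 0" "norm (c j) * s j \<le> w j" for j
      using s(1)[of j] \<epsilon> by (auto simp: w_def intro!: add_nonneg_pos)
    have wW: "w sums W"
      unfolding w_def W_def using sums_add[OF S sums_mult[OF power_half_series, of \<epsilon>]] by simp
    define D where "D = (\<lambda>h t. (\<Sum>m | real_of_int \<bar>m - n\<bar> < t. (norm (complex_of_real (t\<^sup>2) * hconv 1 (t\<^sup>2) h m))\<^sup>2) / (t * (t + 1)))"
    have Dm [measurable]: "D (g j) \<in> borel_measurable borel" for j
      unfolding D_def by (rule ssq_integrand_measurable[OF F])
    have pt: "ennreal (D f t) * indicator {0<..} t \<le>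
        ennreal W * (\<Sum>j. ennreal ((norm (c j))\<^sup>2 / w j) * (ennreal (D (g j) t) * indicator {0<..} t))" for t
    proof (cases "t > 0")
      case True
      define near where "near = {m::int. real_of_int \<bar>m - n\<bar> < t}"
      define \<kappa> where "\<kappa> = t ^ 3 / (t + 1)"
      have \<kappa>: "\<kappa> \<ge> 0" using True by (simp add: \<kappa>_def)
      have D: "ennreal (D h t) = (\<Sum>m\<in>near. ennreal \<kappa> * ennreal ((norm (hconv 1 (t\<^sup>2) h m))\<^sup>2))" for h
      proof -
        have "D h t = (\<Sum>m\<in>near. \<kappa> * (norm (hconv 1 (t\<^sup>2) h m))\<^sup>2)"
          unfolding D_def near_term[OF True] near_def \<kappa>_def by (simp only: sum_distrib_left)
        then show ?thesis using \<kappa> by (simp add: ennreal_mult flip: sum_ennreal)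
      qed
      have "ennreal (D f t) \<le> (\<Sum>m\<in>near. ennreal \<kappa> * (ennreal W * (\<Sum>j. ennreal ((norm (c j * hconv 1 (t\<^sup>2) (g j) m))\<^sup>2 / w j))))"
        unfolding D by (intro sum_mono mult_left_mono ennreal_cauchy_schwarz_series[OF sums[OF True] w(1) wW]) simp
      also have "\<dots> = (\<Sum>m\<in>near. ennreal W * (\<Sum>j. ennreal ((norm (c j))\<^sup>2 / w j) * (ennreal \<kappa> * ennreal ((norm (hconv 1 (t\<^sup>2) (g j) m))\<^sup>2))))"
      proof (rule sum.cong[OF refl])
        fix m
        have "ennreal ((norm (c j * hconv 1 (t\<^sup>2) (g j) m))\<^sup>2 / w j) = ennreal ((norm (c j))\<^sup>2 / w j) * ennreal ((norm (hconv 1 (t\<^sup>2) (g j) m))\<^sup>2)" for j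
          using w(1)[of j] by (simp add: norm_mult power_mult_distrib flip: ennreal_mult)
        then have "ennreal \<kappa> * (ennreal W * (\<Sum>j. ennreal ((norm (c j * hconv 1 (t\<^sup>2) (g j) m))\<^sup>2 / w j)))
            = ennreal W * (ennreal \<kappa> * (\<Sum>j. ennreal ((norm (c j))\<^sup>2 / w j) * ennreal ((norm (hconv 1 (t\<^sup>2) (g j) m))\<^sup>2)))"
          by (simp add: mult.left_commute)
        also have "ennreal \<kappa> * (\<Sum>j. ennreal ((norm (c j))\<^sup>2 / w j) * ennreal ((norm (hconv 1 (t\<^sup>2) (g j) m))\<^sup>2))
            = (\<Sum>j. ennreal ((norm (c j))\<^sup>2 / w j) * (ennreal \<kappa> * ennreal ((norm (hconv 1 (t\<^sup>2) (g j) m))\<^sup>2)))"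
          by (simp add: mult.left_commute flip: ennreal_suminf_cmult)
        finally show "ennreal \<kappa> * (ennreal W * (\<Sum>j. ennreal ((norm (c j * hconv 1 (t\<^sup>2) (g j) m))\<^sup>2 / w j)))
            = ennreal W * (\<Sum>j. ennreal ((norm (c j))\<^sup>2 / w j) * (ennreal \<kappa> * ennreal ((norm (hconv 1 (t\<^sup>2) (g j) m))\<^sup>2)))" .
      qed
      also have "\<dots> = ennreal W * (\<Sum>j. \<Sum>m\<in>near. ennreal ((norm (c j))\<^sup>2 / w j) * (ennreal \<kappa> * ennreal ((norm (hconv 1 (t\<^sup>2) (g j) m))\<^sup>2)))"
        by (subst suminf_sum[OF summableI]) (simp only: sum_distrib_left)
      also have "\<dots> = ennreal W * (\<Sum>j. ennreal ((norm (c j))\<^sup>2 / w j) * ennreal (D (g j) t))"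
        by (simp only: D sum_distrib_left)
      finally show ?thesis using True by simp
    qed simp
    have "ssq f n = (\<integral>\<^sup>+t. ennreal (D f t) * indicator {0<..} t \<partial>lborel)" by (simp only: ssq_def D_def)
    also have "\<dots> \<le> (\<integral>\<^sup>+t. ennreal W * (\<Sum>j. ennreal ((norm (c j))\<^sup>2 / w j) * (ennreal (D (g j) t) * indicator {0<..} t)) \<partial>lborel)"
      by (rule nn_integral_mono) (rule pt)
    also have "\<dots> = ennreal W * (\<integral>\<^sup>+t. (\<Sum>j. ennreal ((norm (c j))\<^sup>2 / w j) * (ennreal (D (g j) t) * indicator {0<..} t)) \<partial>lborel)"
      by (rule nn_integral_cmult) measurable
    also have "(\<integral>\<^sup>+t. (\<Sum>j. ennreal ((norm (c j))\<^sup>2 / w j) * (ennreal (D (g j) t) * indicator {0<..} t)) \<partial>lborel)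
        = (\<Sum>j. \<integral>\<^sup>+t. ennreal ((norm (c j))\<^sup>2 / w j) * (ennreal (D (g j) t) * indicator {0<..} t) \<partial>lborel)"
      by (rule nn_integral_suminf) measurable
    also have "\<dots> = (\<Sum>j. ennreal ((norm (c j))\<^sup>2 / w j) * ssq (g j) n)"
    proof (rule suminf_cong)
      fix j
      have "ssq (g j) n = (\<integral>\<^sup>+t. ennreal (D (g j) t) * indicator {0<..} t \<partial>lborel)" by (simp only: ssq_def D_def)
      moreover have "(\<integral>\<^sup>+t. ennreal ((norm (c j))\<^sup>2 / w j) * (ennreal (D (g j) t) * indicator {0<..} t) \<partial>lborel)
          = ennreal ((norm (c j))\<^sup>2 / w j) * (\<integral>\<^sup>+t. ennreal (D (g j) t) * indicator {0<..} t \<partial>lborel)"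
        by (rule nn_integral_cmult) measurable
      ultimately show "(\<integral>\<^sup>+t. ennreal ((norm (c j))\<^sup>2 / w j) * (ennreal (D (g j) t) * indicator {0<..} t) \<partial>lborel)
          = ennreal ((norm (c j))\<^sup>2 / w j) * ssq (g j) n" by simp
    qed
    also have "ennreal W * \<dots> \<le> ennreal W * (\<Sum>j. ennreal (norm (c j) * s j))"
    proof (intro mult_left_mono suminf_le summableI)
      fix j
      have "ennreal ((norm (c j))\<^sup>2 / w j) * ssq (g j) n \<le> ennreal ((norm (c j))\<^sup>2 / w j) * ennreal ((s j)\<^sup>2)"
        by (intro mult_left_mono s(2)) simp
      also have "\<dots> = ennreal ((norm (c j) * s j) * (norm (c j) * s j) / w j)"
        using w(1)[of j] by (simp add: power2_eq_square mult_ac flip: ennreal_mult)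
      also have "\<dots> \<le> ennreal (norm (c j) * s j)"
      proof (rule ennreal_leI)
        have "(norm (c j) * s j) * (norm (c j) * s j) \<le> (norm (c j) * s j) * w j"
          using w(2)[of j] s(1)[of j] by (intro mult_left_mono) auto
        then show "(norm (c j) * s j) * (norm (c j) * s j) / w j \<le> norm (c j) * s j"
          using w(1)[of j] by (simp only: pos_divide_le_eq)
      qed
      finally show "ennreal ((norm (c j))\<^sup>2 / w j) * ssq (g j) n \<le> ennreal (norm (c j) * s j)" .
    qed simp
    also have "(\<Sum>j. ennreal (norm (c j) * s j)) = ennreal S"
      unfolding sums_unique[OF S] by (rule suminf_ennreal2[OF _ sums_summable[OF S]]) (use s(1) in simp)
    also have "ennreal W * ennreal S \<le> ennreal W * ennreal W"
      using \<epsilon> by (intro mult_left_mono ennreal_leI) (auto simp: W_def)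
    also have "\<dots> = ennreal ((S + \<epsilon>)\<^sup>2)" unfolding W_def power2_eq_square by (rule ennreal_mult[symmetric]) (use S0 \<epsilon> in auto)
    finally show ?thesis .
  qed
  show ?thesis
  proof (cases "ssq f n")
    case (real x)
    have "sqrt x \<le> S + \<epsilon>" if "\<epsilon> > 0" for \<epsilon>
    proof -
      have "x \<le> (S + \<epsilon>)\<^sup>2" using main[OF that] real by (simp add: ennreal_le_iff)
      then have "sqrt x \<le> sqrt ((S + \<epsilon>)\<^sup>2)" by (rule real_sqrt_le_mono)
      then show ?thesis using S0 that by simp
    qed
    then have "sqrt x \<le> S" by (rule field_le_epsilon)
    then have "(sqrt x)\<^sup>2 \<le> S\<^sup>2" using real by (intro power_mono) auto
    then show ?thesis using real by (simp add: ennreal_leI)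
  next
    case top
    then show ?thesis using main[of 1] by (simp add: top_unique)
  qed
qed

lemma l1_series_bound:
  fixes c :: "nat \<Rightarrow> complex" and a :: "nat \<Rightarrow> int \<Rightarrow> complex"
  assumes c: "summable (\<lambda>j. norm (c j))" and a: "\<And>j F. finite F \<Longrightarrow> (\<Sum>n\<in>F. norm (a j n)) \<le> 1"
    and f: "\<And>n. (\<lambda>j. c j * a j n) sums f n" and F: "finite F"
  shows "(\<Sum>n\<in>F. norm (f n)) \<le> (\<Sum>j. norm (c j))"
proof -
  have s: "summable (\<lambda>j. norm (c j * a j n))" for n
  proof (rule summable_comparison_test'[OF c])
    fix j
    have "norm (c j) * norm (a j n) \<le> norm (c j) * 1" using a[of "{n}" j] by (intro mult_left_mono) auto
    then show "norm (norm (c j * a j n)) \<le> norm (c j)" by (simp add: norm_mult)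
  qed
  have "(\<Sum>n\<in>F. norm (f n)) \<le> (\<Sum>n\<in>F. \<Sum>j. norm (c j * a j n))"
    by (intro sum_mono) (use summable_norm[OF s] sums_unique[OF f] in simp)
  also have "\<dots> = (\<Sum>j. \<Sum>n\<in>F. norm (c j * a j n))" by (rule suminf_sum[symmetric]) (rule s)
  also have "\<dots> \<le> (\<Sum>j. norm (c j))"
  proof (rule suminf_le)
    show "(\<Sum>n\<in>F. norm (c j * a j n)) \<le> norm (c j)" for j
      using mult_left_mono[OF a[OF F, of j], of "norm (c j)"] by (simp add: norm_mult sum_distrib_left)
    show "summable (\<lambda>j. \<Sum>n\<in>F. norm (c j * a j n))" by (intro summable_sum s)
  qed (rule c)
  finally show ?thesis .
qed

text \<open>Fubini over coefficients and sites: absolutely summable coefficients, bounded functions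
  and a summable kernel give a product majorant.\<close>

lemma hconv_series:
  assumes c: "summable (\<lambda>j. norm (c j :: complex))" and a: "\<And>j n. norm (a j n) \<le> 1"
    and f: "\<And>n. ((\<lambda>j. c j * a j n) has_sum f n) UNIV" and F: "F > 0" "poly_growth F d f" and s: "s \<ge> 0"
  shows "(\<lambda>j::nat. c j * hconv k s (a j) n) sums hconv k s f n"
proof (rule has_sum_imp_sums)
  obtain C where C: "C > 0" "\<And>i. norm (hk k s i) \<le> C / (1 + \<bar>real_of_int i\<bar>) ^ 2"
    using hk_decay_compact[of s k 2] s by force
  define b where "b = (\<lambda>i. C * (1 / (1 + \<bar>real_of_int (n - i)\<bar>) ^ 2))"
  have b: "b summable_on UNIV"
    unfolding b_def by (intro summable_on_cmult_right summable_on_inverse_square_int_shift)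
  have b0: "b i \<ge> 0" for i using C(1) by (simp add: b_def)
  define Z where "Z = infsum b UNIV"
  have Z: "(b has_sum Z) UNIV" unfolding Z_def by (rule has_sum_infsum[OF b])
  have cs: "(\<lambda>j. norm (c j)) summable_on UNIV"
    using c by (intro norm_summable_imp_summable_on) simp
  have H: "(\<lambda>(j, i). norm (c j) * b i) summable_on (UNIV \<times> UNIV)"
  proof (rule summable_on_SigmaI[where g = "\<lambda>j. norm (c j) * Z"])
    show "((\<lambda>i. case (j, i) of (j, i) \<Rightarrow> norm (c j) * b i) has_sum norm (c j) * Z) UNIV" for j
      using has_sum_cmult_right[OF Z] by simp
    show "(\<lambda>j. norm (c j) * Z) summable_on UNIV" by (rule summable_on_cmult_left[OF cs])
  qed (use b0 in auto)
  show "((\<lambda>j. c j * hconv k s (a j) n) has_sum hconv k s f n) UNIV"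
  proof (rule has_sum_fubini[where G = "\<lambda>(j, i). c j * (hk k s (n - i) * a j i)" and h = "\<lambda>i. hk k s (n - i) * f i"])
    show "(\<lambda>(j, i). norm (c j) * b i) summable_on UNIV" using H by simp
    show "norm (case (j, i) of (j, i) \<Rightarrow> c j * (hk k s (n - i) * a j i)) \<le> (case (j, i) of (j, i) \<Rightarrow> norm (c j) * b i)" for j i
    proof -
      have "norm (hk k s (n - i)) * norm (a j i) \<le> b i * 1"
        using C(2)[of "n - i"] a[of j i] b0[of i] by (intro mult_mono) (auto simp: b_def)
      then show ?thesis by (simp add: norm_mult mult_left_mono)
    qed
    show "((\<lambda>i. case (j, i) of (j, i) \<Rightarrow> c j * (hk k s (n - i) * a j i)) has_sum c j * hconv k s (a j) n) UNIV" for j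
    proof -
      have "poly_growth 1 0 (a j)" using a by (simp add: poly_growth_def)
      from has_sum_cmult_right[OF hconv_has_sum[OF zero_less_one this s]] show ?thesis by simp
    qed
    show "((\<lambda>j. case (j, i) of (j, i) \<Rightarrow> c j * (hk k s (n - i) * a j i)) has_sum hk k s (n - i) * f i) UNIV" for i
      using has_sum_cmult_right[OF f[of i], of "hk k s (n - i)"] by (simp add: mult_ac)
    show "((\<lambda>i. hk k s (n - i) * f i) has_sum hconv k s f n) UNIV" by (rule hconv_has_sum[OF F s])
  qed
qed

lemma schwartz_summable:
  assumes "\<phi> \<in> schwartz"
  shows "(\<lambda>n. norm (\<phi> n)) summable_on UNIV"
proof -
  have fin: "schwartz_seminorm 2 \<phi> < \<infinity>" using assms by (simp add: schwartz_def)
  define K where "K = enn2real (schwartz_seminorm 2 \<phi>)"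
  have K: "schwartz_seminorm 2 \<phi> = ennreal K" using fin by (simp add: K_def less_top)
  have "norm (\<phi> n) \<le> K * (1 / (1 + \<bar>real_of_int n\<bar>) ^ 2)" for n
  proof -
    have "ennreal ((1 + \<bar>real_of_int n\<bar>) ^ 2) * ennreal (norm (\<phi> n))
        \<le> ennreal ((1 + \<bar>real_of_int n\<bar>) ^ 2) * (SUP l\<in>{0..2}. ennreal (norm ((discrete_laplacian ^^ l) \<phi> n)))"
      by (intro mult_left_mono SUP_upper2[of 0]) auto
    also have "\<dots> \<le> schwartz_seminorm 2 \<phi>" unfolding schwartz_seminorm_def by (rule SUP_upper) simp
    finally have "ennreal ((1 + \<bar>real_of_int n\<bar>) ^ 2 * norm (\<phi> n)) \<le> ennreal K" by (simp add: K ennreal_mult)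
    then have "(1 + \<bar>real_of_int n\<bar>) ^ 2 * norm (\<phi> n) \<le> K" by (simp add: K_def)
    then show ?thesis by (simp add: pos_le_divide_eq mult.commute)
  qed
  then show ?thesis
    by (intro summable_on_norm_bound[OF summable_on_cmult_right[OF summable_on_inverse_square_int]]) auto
qed

lemma norm_pairing_le:
  assumes \<phi>: "\<phi> \<in> schwartz" and u: "\<And>n. norm (u n) \<le> b"
  shows "norm (pairing u \<phi>) \<le> b * (\<Sum>\<^sub>\<infinity>n. norm (\<phi> n))"
proof -
  have hb: "((\<lambda>n. b * norm (\<phi> n)) has_sum b * (\<Sum>\<^sub>\<infinity>n. norm (\<phi> n))) UNIV"
    by (intro has_sum_cmult_right has_sum_infsum schwartz_summable[OF \<phi>])
  have le: "norm (u n * \<phi> n) \<le> b * norm (\<phi> n)" for n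
    unfolding norm_mult by (intro mult_right_mono u) simp
  have hu: "((\<lambda>n. u n * \<phi> n) has_sum pairing u \<phi>) UNIV"
    unfolding pairing_def
    by (intro has_sum_infsum summable_on_norm_bound[OF summable_on_cmult_right[OF schwartz_summable[OF \<phi>], of b]] le)
  show ?thesis by (rule norm_infsum_le[OF hu hb le])
qed

text \<open>The supremum of the kernel of order \<open>k\<close>, times \<open>t ^ k\<close>, is of
  order \<open>1 / sqrt t\<close>. Against an l^1 function this bounds the evolution uniformly in
  \<open>n\<close>, and test functions are summable.\<close>

lemma vanishes_weakly_l1:
  assumes F: "F > 0" "poly_growth F d f" and f: "\<And>X. finite X \<Longrightarrow> (\<Sum>n\<in>X. norm (f n)) \<le> S"
  shows "vanishes_weakly_at_infinity f"
  unfolding vanishes_weakly_at_infinity_def tempered_tendsto_def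
proof (intro allI ballI)
  fix k \<phi> assume \<phi>: "\<phi> \<in> schwartz"
  obtain C where C: "C > 0" "\<And>s n. s \<ge> 0 \<Longrightarrow> norm (hk k s n) * sqrt (1 + s) ^ Suc (2 * k) \<le> C"
    using hk_bounded by blast
  have S0: "S \<ge> 0" using f[of "{}"] by simp
  have fs: "(\<lambda>n. norm (f n)) summable_on UNIV"
    by (rule nonneg_bdd_above_summable_on) (use f in \<open>auto intro!: bdd_aboveI[of _ S]\<close>)
  have fS: "(\<Sum>\<^sub>\<infinity>n. norm (f n)) \<le> S" by (rule infsum_le_finite_sums[OF fs]) (use f in auto)
  have bound: "norm ((t ^ k) *\<^sub>R hconv k t f n) \<le> C * S / sqrt t" if t: "t > 0" for t n
  proof -
    define r where "r = sqrt t"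
    have r: "r > 0" "t = r\<^sup>2" using t by (simp_all add: r_def)
    have hb: "norm (hk k t i) \<le> C / r ^ Suc (2 * k)" for i
    proof -
      have "norm (hk k t i) * r ^ Suc (2 * k) \<le> norm (hk k t i) * sqrt (1 + t) ^ Suc (2 * k)"
        using t by (intro mult_left_mono power_mono) (auto simp: r_def)
      also have "\<dots> \<le> C" using C(2)[of t i] t by simp
      finally show ?thesis using r by (simp add: pos_le_divide_eq)
    qed
    have "norm (hconv k t f n) \<le> C / r ^ Suc (2 * k) * (\<Sum>\<^sub>\<infinity>n. norm (f n))"
    proof (rule norm_infsum_le)
      show "((\<lambda>m. hk k t (n - m) * f m) has_sum hconv k t f n) UNIV" by (rule hconv_has_sum[OF F]) (use t in simp)
      show "((\<lambda>m. C / r ^ Suc (2 * k) * norm (f m)) has_sum C / r ^ Suc (2 * k) * (\<Sum>\<^sub>\<infinity>n. norm (f n))) UNIV"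
        by (intro has_sum_cmult_right has_sum_infsum fs)
      show "norm (hk k t (n - m) * f m) \<le> C / r ^ Suc (2 * k) * norm (f m)" for m
        unfolding norm_mult by (intro mult_right_mono hb) simp
    qed
    also have "\<dots> \<le> C / r ^ Suc (2 * k) * S" using C(1) r by (intro mult_left_mono fS) auto
    finally have "t ^ k * norm (hconv k t f n) \<le> t ^ k * (C / r ^ Suc (2 * k) * S)" using t by (intro mult_left_mono) auto
    also have "t ^ k = r ^ (2 * k)" by (simp add: r(2) power_mult)
    also have "r ^ (2 * k) * (C / r ^ Suc (2 * k) * S) = C * S / r" using r by (simp add: field_simps)
    finally show ?thesis using t by (simp add: r_def r(2)[symmetric] power_mult)
  qed
  define P where "P = (\<Sum>\<^sub>\<infinity>n. norm (\<phi> n))"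
  have "((\<lambda>t. C * S / sqrt t * P) \<longlongrightarrow> 0) at_top"
    by (intro tendsto_mult_left_zero real_tendsto_divide_at_top[OF tendsto_const] sqrt_at_top)
  then have "((\<lambda>t. pairing (((\<lambda>g n. complex_of_real t * discrete_laplacian g n) ^^ k) (heat_semigroup t f)) \<phi>) \<longlongrightarrow> 0) at_top"
  proof (rule Lim_null_comparison[rotated])
    show "\<forall>\<^sub>F t in at_top. norm (pairing (((\<lambda>g n. complex_of_real t * discrete_laplacian g n) ^^ k) (heat_semigroup t f)) \<phi>) \<le> C * S / sqrt t * P"
      using eventually_gt_at_top[of 0]
    proof eventually_elim
      fix t :: real assume "t > 0"
      then show "norm (pairing (((\<lambda>g n. complex_of_real t * discrete_laplacian g n) ^^ k) (heat_semigroup t f)) \<phi>) \<le> C * S / sqrt t * P"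
        unfolding P_def using scaled_laplacian_heat[OF F, of t k] bound by (intro norm_pairing_le[OF \<phi>]) simp
    qed
  qed
  then show "((\<lambda>t. pairing (((\<lambda>g n. complex_of_real t * discrete_laplacian g n) ^^ k) (heat_semigroup t f)) \<phi>) \<longlongrightarrow> pairing (\<lambda>n. 0) \<phi>) at_top"
    by (simp add: pairing_def)
qed

context hardy_exponent
begin

text \<open>Summing \<open>le_powr_scaled\<close> gives the embedding of l^p into l^1 with constant
  1, that is, subadditivity of the p-th power for series.\<close>

lemma summable_of_powr:
  assumes x: "\<And>j::nat. x j \<ge> 0" and s: "summable (\<lambda>j. x j powr p)"
  shows "summable x" "(\<Sum>j. x j) powr p \<le> (\<Sum>j. x j powr p)"
proof -
  define P where "P = (\<Sum>j. x j powr p)"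
  have xP: "x j powr p \<le> P" for j
    unfolding P_def using sum_le_suminf[OF s, of "{j}"] by simp
  have le: "x j \<le> x j powr p * P powr ((1 - p) / p)" for j by (rule le_powr_scaled[OF x xP])
  have s2: "summable (\<lambda>j. x j powr p * P powr ((1 - p) / p))" by (rule summable_mult2[OF s])
  show sx: "summable x" by (rule summable_comparison_test'[OF s2]) (use le x in simp)
  have P0: "P \<ge> 0" unfolding P_def by (intro suminf_nonneg s) simp
  have "(\<Sum>j. x j) \<le> P * P powr ((1 - p) / p)"
    using suminf_le[OF le sx s2] by (simp add: P_def suminf_mult2[OF s, symmetric])
  also have "\<dots> = P powr (1 / p)"
  proof -
    have "1 + (1 - p) / p = 1 / p" using p0 by (simp add: field_simps)
    then show ?thesis using P0 powr_add[of P 1 "(1 - p) / p"] by (cases "P = 0") simp_all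
  qed
  finally have "(\<Sum>j. x j) powr p \<le> (P powr (1 / p)) powr p"
    using p0 suminf_nonneg[OF sx x] by (intro powr_mono2) auto
  then show "(\<Sum>j. x j) powr p \<le> (\<Sum>j. x j powr p)" using p0 P0 by (simp add: powr_powr P_def)
qed

lemma batom_l1:
  assumes "batom a" "finite F"
  shows "(\<Sum>n\<in>F. norm (a n)) \<le> 1"
proof -
  obtain c d where cd: "c \<le> d" and supp: "\<forall>n. n \<notin> {c..d} \<longrightarrow> a n = 0" and bd: "\<forall>n. norm (a n) \<le> real (card {c..d}) powr (- (1 / p))"
    using \<open>batom a\<close> unfolding batom_def by blast
  define L where "L = real (card {c..d})"
  have L1: "L \<ge> 1" using cd by (simp add: L_def)
  have "(\<Sum>n\<in>F. norm (a n)) = (\<Sum>n\<in>F \<inter> {c..d}. norm (a n))"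
    using assms(2) supp by (intro sum.mono_neutral_right) auto
  also have "\<dots> \<le> (\<Sum>n\<in>{c..d}. norm (a n))" by (intro sum_mono2) auto
  also have "\<dots> \<le> (\<Sum>n\<in>{c..d}. L powr (- (1 / p)))" using bd by (intro sum_mono) (simp only: L_def)
  also have "\<dots> = L powr 1 * L powr (- (1 / p))" using L1 by (simp only: sum_constant L_def[symmetric]) simp
  also have "\<dots> = L powr (1 - 1 / p)" by (simp only: powr_add[symmetric] diff_conv_add_uminus)
  also have "\<dots> \<le> L powr 0" using L1 p0 p1 by (intro powr_mono) (auto simp: field_simps)
  finally show ?thesis using L1 by simp
qed

lemma asum_l1:
  assumes "asum B f"
  obtains S where "\<And>X. finite X \<Longrightarrow> (\<Sum>n\<in>X. norm (f n)) \<le> S" "poly_growth (1 + S) 0 f" "1 + S > 0"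
proof -
  obtain c a where ca: "\<And>j::nat. batom (a j)" "summable (\<lambda>j. norm (c j :: complex) powr p)"
     "\<And>n. ((\<lambda>j. c j * a j n) has_sum f n) UNIV"
    using assms unfolding asum_def by blast
  have cs: "summable (\<lambda>j. norm (c j))" by (rule summable_of_powr(1)[OF _ ca(2)]) simp
  define S where "S = (\<Sum>j. norm (c j))"
  have S: "(\<Sum>n\<in>X. norm (f n)) \<le> S" if "finite X" for X
    unfolding S_def by (rule l1_series_bound[OF cs batom_l1[OF ca(1)] has_sum_imp_sums[OF ca(3)] that])
  have "poly_growth (1 + S) 0 f" using S[of "{n}" for n] by (simp add: poly_growth_def add_increasing)
  moreover have "1 + S > 0" using S[of "{}"] by simp
  ultimately show thesis using that S by blast
qed

text \<open>The square function of the sum is at most the sum of the scaled square functions by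
  \<open>ssq_series\<close>, and its p-th power is subadditive. Summing over \<open>n\<close> leaves
  the uniform bound for atoms times the coefficient sum.\<close>

lemma square_function_asum:
  "\<exists>C>0. \<forall>B f. asum B f \<longrightarrow> f \<in> tempered \<and> vanishes_weakly_at_infinity f \<and> sf_mass p f \<le> ennreal (C * B)"
proof -
  obtain C where C: "C > 0" "\<And>a. batom a \<Longrightarrow> (\<integral>\<^sup>+n. epowr (ssq a n) (p / 2) \<partial>count_space UNIV) \<le> ennreal C"
    using sf_mass_batom by blast
  have "f \<in> tempered \<and> vanishes_weakly_at_infinity f \<and> sf_mass p f \<le> ennreal (C * B)" if fB: "asum B f" for f B
  proof (intro conjI)
    obtain S where S: "\<And>X. finite X \<Longrightarrow> (\<Sum>n\<in>X. norm (f n)) \<le> S" and F: "1 + S > 0" "poly_growth (1 + S) 0 f"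
      using asum_l1[OF fB] by blast
    show "f \<in> tempered" using F(2) unfolding tempered_def poly_growth_def by blast
    show "vanishes_weakly_at_infinity f" by (rule vanishes_weakly_l1[OF F S])
    obtain c a where ca: "\<And>j::nat. batom (a j)" "summable (\<lambda>j. norm (c j :: complex) powr p)" "(\<Sum>j. norm (c j) powr p) \<le> B"
       "\<And>n. ((\<lambda>j. c j * a j n) has_sum f n) UNIV"
      using fB unfolding asum_def by blast
    have cs: "summable (\<lambda>j. norm (c j))" by (rule summable_of_powr(1)[OF _ ca(2)]) simp
    have ag: "poly_growth 1 0 (a j)" for j using batom_norm[OF ca(1)] by (simp add: poly_growth_def)
    have afin: "ssq (a j) n < \<infinity>" for j n
    proof -
      obtain c' d' where "\<forall>n. n \<notin> {c'..d'} \<longrightarrow> a j n = 0" using ca(1)[of j] unfolding batom_def by blast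
      then have "(\<integral>\<^sup>+n. ssq (a j) n \<partial>count_space UNIV) \<le> ennreal (2 / cald 1 * (\<Sum>m\<in>{c'..d'}. (norm (a j m))\<^sup>2))"
        by (intro nn_integral_ssq_le) auto
      moreover have "ssq (a j) n \<le> (\<integral>\<^sup>+n. ssq (a j) n \<partial>count_space UNIV)" by (rule nn_integral_ge_point) simp
      ultimately show ?thesis by (metis ennreal_less_top infinity_ennreal_def order.strict_trans1 order_trans)
    qed
    have pt: "epowr (ssq f n) (p / 2) \<le> (\<Sum>j. ennreal (norm (c j) powr p) * epowr (ssq (a j) n) (p / 2))" for n
    proof -
      define s where "s = (\<lambda>j. sqrt (enn2real (ssq (a j) n)))"
      have s0: "s j \<ge> 0" for j by (simp add: s_def)
      have ss: "ssq (a j) n = ennreal ((s j)\<^sup>2)" for j using afin[of j n] by (simp add: s_def less_top)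
      have RHS: "ennreal (norm (c j) powr p) * epowr (ssq (a j) n) (p / 2) = ennreal ((norm (c j) * s j) powr p)" for j
        using s0[of j] by (simp add: ss epowr_ennreal powr_powr powr_mult flip: powr_numeral ennreal_mult)
      show ?thesis
      \<comment> \<open>If the right side is infinite the claim is trivial; otherwise its finiteness
        gives the summability that \<open>ssq_series\<close> assumes.\<close>
      proof (cases "(\<Sum>j. ennreal (norm (c j) powr p) * epowr (ssq (a j) n) (p / 2)) = top")
        case False
        then have P: "summable (\<lambda>j. (norm (c j) * s j) powr p)"
          unfolding RHS by (intro summable_suminf_not_top) auto
        note xs = summable_of_powr[OF _ P]
        define T where "T = (\<Sum>j. norm (c j) * s j)"
        have T: "(\<lambda>j. norm (c j) * s j) sums T" unfolding T_def using xs(1) s0 by (intro summable_sums) simp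
        have T0: "T \<ge> 0" by (rule sums_le[OF _ sums_zero T]) (use s0 in simp)
        have "ssq f n \<le> ennreal (T\<^sup>2)"
        proof (rule ssq_series[where g = a and c = c and s = s and F = "\<lambda>_. 1" and d = 0, OF _ ag _ s0 _ T])
          fix t :: real and m
          show "(\<lambda>j. c j * hconv 1 (t\<^sup>2) (a j) m) sums hconv 1 (t\<^sup>2) f m"
            by (rule hconv_series[OF cs batom_norm[OF ca(1)] ca(4) F]) simp
        qed (simp_all add: ss)
        then have "epowr (ssq f n) (p / 2) \<le> epowr (ennreal (T\<^sup>2)) (p / 2)" using p0 by (intro epowr_mono) auto
        also have "\<dots> = ennreal (T powr p)" using T0 by (simp add: epowr_ennreal powr_powr flip: powr_numeral)
        also have "\<dots> \<le> ennreal (\<Sum>j. (norm (c j) * s j) powr p)"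
          unfolding T_def using xs(2) s0 by (intro ennreal_leI) simp
        also have "\<dots> = (\<Sum>j. ennreal ((norm (c j) * s j) powr p))" by (rule suminf_ennreal2[symmetric]) (use P in auto)
        finally show ?thesis unfolding RHS .
      qed simp
    qed
    have "sf_mass p f = (\<integral>\<^sup>+n. epowr (ssq f n) (p / 2) \<partial>count_space UNIV)"
      unfolding sf_mass_def square_function_ssq[OF F] epowr_epowr by simp
    also have "\<dots> \<le> (\<integral>\<^sup>+n. (\<Sum>j. ennreal (norm (c j) powr p) * epowr (ssq (a j) n) (p / 2)) \<partial>count_space UNIV)"
      by (rule nn_integral_mono) (rule pt)
    also have "\<dots> = (\<Sum>j. \<integral>\<^sup>+n. ennreal (norm (c j) powr p) * epowr (ssq (a j) n) (p / 2) \<partial>count_space UNIV)"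
      by (rule nn_integral_suminf) simp
    also have "\<dots> = (\<Sum>j. ennreal (norm (c j) powr p) * (\<integral>\<^sup>+n. epowr (ssq (a j) n) (p / 2) \<partial>count_space UNIV))"
      by (simp add: nn_integral_cmult)
    also have "\<dots> \<le> (\<Sum>j. ennreal (norm (c j) powr p) * ennreal C)"
      by (intro suminf_le mult_left_mono C(2) ca summableI) simp
    also have "\<dots> = (\<Sum>j. ennreal (norm (c j) powr p)) * ennreal C" by (rule ennreal_suminf_multc)
    also have "(\<Sum>j. ennreal (norm (c j) powr p)) = ennreal (\<Sum>j. norm (c j) powr p)"
      by (rule suminf_ennreal2) (use ca(2) in auto)
    also have "\<dots> * ennreal C \<le> ennreal B * ennreal C" by (intro mult_right_mono ennreal_leI ca(3)) simp
    also have "\<dots> = ennreal (C * B)" using asum_nonneg[OF fB] C(1) by (simp add: mult.commute flip: ennreal_mult)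
    finally show "sf_mass p f \<le> ennreal (C * B)" .
  qed
  then show ?thesis using C(1) by blast
qed

end

section \<open>Comparison with the classical atomic Hardy space\<close>

lemma lq_norm_1: "lq_norm 1 g = (\<integral>\<^sup>+n. g n \<partial>count_space UNIV)"
  by (simp add: lq_norm_def epowr_1)

lemma lq_norm_finite_support:
  assumes r: "r > 0" and S: "finite S" "\<And>n. n \<notin> S \<Longrightarrow> a n = 0"
  shows "lq_norm (ennreal r) (\<lambda>n. ennreal (norm (a n))) = ennreal ((\<Sum>n\<in>S. norm (a n) powr r) powr (1 / r))"
proof -
  have "(\<integral>\<^sup>+n. epowr (ennreal (norm (a n))) r \<partial>count_space UNIV) = (\<Sum>n\<in>S. epowr (ennreal (norm (a n))) r)"
    by (rule nn_integral_count_space'[OF S(1)]) (use S(2) in \<open>auto simp: epowr_def\<close>)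
  also have "\<dots> = ennreal (\<Sum>n\<in>S. norm (a n) powr r)" by (simp add: epowr_ennreal sum_ennreal)
  finally show ?thesis using r by (simp add: lq_norm_def epowr_ennreal sum_nonneg)
qed

lemma enn2real_inverse: "r > 0 \<Longrightarrow> enn2real (1 / ennreal r) = 1 / r"
  by (simp add: divide_ennreal flip: ennreal_1)

lemma pairing_tendsto_uniform:
  assumes \<phi>: "\<phi> \<in> schwartz" and f: "\<And>n. norm (f n) \<le> B"
    and u: "\<And>N n. norm (f n - u N n) \<le> r N" and r: "r \<longlonglongrightarrow> (0::real)"
  shows "(\<lambda>N::nat. pairing (u N) \<phi>) \<longlonglongrightarrow> pairing f \<phi>"
proof (rule Lim_transform2[OF tendsto_const])
  have sm: "(\<lambda>n. v n * \<phi> n) summable_on UNIV" if "\<And>n. norm (v n) \<le> b" for v b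
    by (rule summable_on_norm_bound[OF summable_on_cmult_right[OF schwartz_summable[OF \<phi>], of b]])
      (use that in \<open>auto simp: norm_mult mult_right_mono\<close>)
  have le: "norm (pairing f \<phi> - pairing (u N) \<phi>) \<le> r N * (\<Sum>\<^sub>\<infinity>n. norm (\<phi> n))" for N
  proof -
    have "norm (u N n) \<le> B + r N" for n
    proof -
      have "norm (u N n) \<le> norm (f n) + norm (f n - u N n)"
        by (metis norm_minus_commute norm_triangle_sub add.commute)
      then show ?thesis using f[of n] u[of n N] by linarith
    qed
    then have "pairing f \<phi> - pairing (u N) \<phi> = pairing (\<lambda>n. f n - u N n) \<phi>"
      unfolding pairing_def left_diff_distrib using sm[of f B] sm[of "u N" "B + r N"] f
      by (intro infsumI[symmetric] has_sum_minus has_sum_infsum) auto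
    then show ?thesis using norm_pairing_le[OF \<phi> u] by simp
  qed
  have "(\<lambda>N. r N * (\<Sum>\<^sub>\<infinity>n. norm (\<phi> n))) \<longlonglongrightarrow> 0" by (rule tendsto_mult_left_zero[OF r])
  then show "(\<lambda>N. pairing f \<phi> - pairing (u N) \<phi>) \<longlonglongrightarrow> 0"
    by (rule Lim_null_comparison[rotated]) (intro always_eventually allI le)
qed

context hardy_exponent
begin

lemma asum_scale:
  assumes "asum B f"
  shows "asum (norm z powr p * B) (\<lambda>n. z * f n)"
proof -
  obtain c a where ca: "\<And>j::nat. batom (a j)" "summable (\<lambda>j. norm (c j :: complex) powr p)" "(\<Sum>j. norm (c j) powr p) \<le> B"
     "\<And>n. ((\<lambda>j. c j * a j n) has_sum f n) UNIV"
    using assms unfolding asum_def by blast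
  have eq: "norm (z * c j) powr p = norm z powr p * norm (c j) powr p" for j by (simp add: norm_mult powr_mult)
  have "summable (\<lambda>j. norm (z * c j) powr p)" unfolding eq by (rule summable_mult[OF ca(2)])
  moreover have "(\<Sum>j. norm (z * c j) powr p) \<le> norm z powr p * B"
    unfolding eq suminf_mult[OF ca(2)] by (intro mult_left_mono ca(3)) simp
  moreover have "((\<lambda>j. z * c j * a j n) has_sum z * f n) UNIV" for n
    using has_sum_cmult_right[OF ca(4)] by (simp add: mult.assoc)
  ultimately show ?thesis
    unfolding asum_def using ca(1) by (intro exI[of _ "\<lambda>j. z * c j"] exI[of _ a]) blast
qed

lemma asum_norm_le:
  assumes "asum B f"
  shows "norm (f n) \<le> B powr (1 / p)"
proof -
  obtain c a where ca: "\<And>j::nat. batom (a j)" "summable (\<lambda>j. norm (c j :: complex) powr p)" "(\<Sum>j. norm (c j) powr p) \<le> B"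
     "\<And>n. ((\<lambda>j. c j * a j n) has_sum f n) UNIV"
    using assms unfolding asum_def by blast
  note cs = summable_of_powr[OF norm_ge_zero ca(2)]
  have "norm (f n) \<le> (\<Sum>j. norm (c j))"
    using l1_series_bound[OF cs(1) batom_l1[OF ca(1)] has_sum_imp_sums[OF ca(4)], of "{n}"] by simp
  also have "\<dots> = ((\<Sum>j. norm (c j)) powr p) powr (1 / p)"
    using p0 suminf_nonneg[OF cs(1)] by (simp add: powr_powr)
  also have "\<dots> \<le> B powr (1 / p)" using cs(2) ca(3) p0 by (intro powr_mono2) auto
  finally show ?thesis .
qed

text \<open>Take \<open>B\<close> as the length to the power \<open>- 1 / p\<close>; then the cost
  \<open>B powr p\<close> times the length is 1. Finite \<open>q\<close> goes through
  \<open>asum_powr\<close>, infinite \<open>q\<close> is already bounded.\<close>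

lemma asum_of_hardy_atom:
  assumes q: "ennreal p < q" "1 \<le> q"
  shows "\<exists>K>0. \<forall>a. hardy_atom p q a \<longrightarrow> asum K a"
proof -
  have ann: "annihilates N a" if "\<And>n. n \<notin> {c..d} \<Longrightarrow> a n = 0"
    "\<forall>\<alpha>::nat. real \<alpha> \<le> 1 / p - 1 \<longrightarrow> (\<Sum>n\<in>{c..d}. of_int n ^ \<alpha> * a n) = 0" for a c d
    using that N_iff by (subst annihilates_iff_monomials[of "{c..d}"]) auto
  have unit: "(real (card {c..d}) powr (- (1 / p))) powr p * real (card {c..d}) = 1" if "c \<le> d" for c d :: int
  proof -
    define L where "L = real (card {c..d})"
    have "L > 0" using that by (simp add: L_def)
    then have "(L powr (- (1 / p))) powr p * L = 1"
      unfolding powr_powr using p0 by (simp add: powr_minus)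
    then show ?thesis by (simp only: L_def)
  qed
  show ?thesis
  proof (cases q)
    case top
    have "asum 1 a" if atom: "hardy_atom p q a" for a
    proof -
      obtain c d where cd: "c \<le> d" "{n. a n \<noteq> 0} \<subseteq> {c..d}"
        "lq_norm q (\<lambda>n. ennreal (norm (a n))) \<le> ennreal (real (card {c..d}) powr (enn2real (1 / q) - 1 / p))"
        "\<forall>\<alpha>::nat. real \<alpha> \<le> 1 / p - 1 \<longrightarrow> (\<Sum>n\<in>{c..d}. of_int n ^ \<alpha> * a n) = 0"
        using atom unfolding hardy_atom_def by blast
      have supp: "n \<notin> {c..d} \<Longrightarrow> a n = 0" for n using cd(2) by blast
      have "norm (a n) \<le> real (card {c..d}) powr (- (1 / p))" for n
      proof -
        have "ennreal (norm (a n)) \<le> (SUP n. ennreal (norm (a n)))" by (rule SUP_upper) simp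
        also have "\<dots> \<le> ennreal (real (card {c..d}) powr (- (1 / p)))" using cd(3) top by (simp add: lq_norm_def)
        finally show ?thesis by (simp only: ennreal_le_iff powr_ge_zero)
      qed
      from asum_bounded[OF cd(1) supp this ann[OF supp cd(4)]] show ?thesis unfolding unit[OF cd(1)] .
    qed
    then show ?thesis using zero_less_one by blast
  next
    case (real r)
    have r: "r \<ge> 1" "r > p" using q real p0 by (auto simp: ennreal_less_iff simp flip: ennreal_1)
    obtain K where K: "K > 0" "\<And>c d a B. c \<le> d \<Longrightarrow> B > 0 \<Longrightarrow> (\<forall>n. n \<notin> {c..d} \<longrightarrow> a n = 0) \<Longrightarrow>
      (\<Sum>n\<in>{c..d}. norm (a n) powr r) \<le> B powr r * real (card {c..d}) \<Longrightarrow> annihilates N a \<Longrightarrow>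
      asum (K * B powr p * real (card {c..d})) a"
      using asum_powr[OF r] by blast
    have "asum K a" if atom: "hardy_atom p q a" for a
    proof -
      obtain c d where cd: "c \<le> d" "{n. a n \<noteq> 0} \<subseteq> {c..d}"
        "lq_norm q (\<lambda>n. ennreal (norm (a n))) \<le> ennreal (real (card {c..d}) powr (enn2real (1 / q) - 1 / p))"
        "\<forall>\<alpha>::nat. real \<alpha> \<le> 1 / p - 1 \<longrightarrow> (\<Sum>n\<in>{c..d}. of_int n ^ \<alpha> * a n) = 0"
        using atom unfolding hardy_atom_def by blast
      have supp: "n \<notin> {c..d} \<Longrightarrow> a n = 0" for n using cd(2) by blast
      define L where "L = real (card {c..d})"
      have L: "L > 0" using cd(1) by (simp add: L_def)
      define S where "S = (\<Sum>n\<in>{c..d}. norm (a n) powr r)"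
      have "lq_norm q (\<lambda>n. ennreal (norm (a n))) = ennreal (S powr (1 / r))"
        unfolding real(2) S_def by (rule lq_norm_finite_support) (use r supp in auto)
      then have "S powr (1 / r) \<le> L powr (1 / r - 1 / p)"
        using cd(3) r unfolding real(2) by (simp add: enn2real_inverse L_def)
      then have "(S powr (1 / r)) powr r \<le> (L powr (1 / r - 1 / p)) powr r" using r by (intro powr_mono2) auto
      moreover have "(S powr (1 / r)) powr r = S" using r by (simp add: powr_powr S_def sum_nonneg)
      moreover have "(L powr (1 / r - 1 / p)) powr r = (L powr (- (1 / p))) powr r * L"
      proof -
        have "(1 / r - 1 / p) * r = - (1 / p) * r + 1" using r by (simp add: algebra_simps)
        then show ?thesis using L by (simp only: powr_powr powr_add powr_one)
      qed
      ultimately have "S \<le> (L powr (- (1 / p))) powr r * L" by simp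
      then have "asum (K * (L powr (- (1 / p))) powr p * L) a"
        unfolding L_def S_def using supp L by (intro K(2) cd(1) ann[OF supp cd(4)]) (auto simp: L_def)
      then show ?thesis using unit[OF cd(1)] by (simp only: L_def mult.assoc mult_1_right)
    qed
    then show ?thesis using K(1) by blast
  qed
qed

text \<open>Both modes of convergence in the definition imply pointwise convergence, the second by
  testing with a point mass.\<close>

lemma atomic_decomposition_pointwise:
  assumes "atomic_decomposition p q f c a"
  shows "(\<lambda>N. \<Sum>j<N. c j * a j n) \<longlonglongrightarrow> f n"
proof (cases "p = 1")
  case True
  define g where "g = (\<lambda>N n. norm (f n - (\<Sum>j<N. c j * a j n)))"
  have lim: "(\<lambda>N. \<integral>\<^sup>+n. ennreal (g N n) \<partial>count_space UNIV) \<longlonglongrightarrow> 0"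
    using assms True unfolding atomic_decomposition_def lq_norm_1 g_def by simp
  have "(\<lambda>N. ennreal (g N n)) \<longlonglongrightarrow> 0"
    by (rule tendsto_sandwich[OF _ _ tendsto_const lim]) (auto intro!: always_eventually nn_integral_ge_point)
  then have "(\<lambda>N. g N n) \<longlonglongrightarrow> 0"
    by (subst (asm) ennreal_0[symmetric], subst (asm) tendsto_ennreal_iff) (auto simp: g_def)
  then have "(\<lambda>N. f n - (\<Sum>j<N. c j * a j n)) \<longlonglongrightarrow> 0" unfolding g_def by (rule tendsto_norm_zero_cancel)
  then show ?thesis by (rule Lim_transform2[OF tendsto_const])
next
  case False
  then have "tempered_tendsto (\<lambda>N n. \<Sum>j<N. c j * a j n) f sequentially"
    using assms unfolding atomic_decomposition_def by simp
  then show ?thesis by (rule tempered_tendsto_pointwise)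
qed

text \<open>Atoms with \<open>asum K\<close> are uniformly bounded, so the partial sums converge
  absolutely, and the limit of the given decomposition is the unordered sum that
  \<open>asum_countable\<close> needs.\<close>

lemma asum_of_atomic_decomposition:
  assumes K: "\<And>a. hardy_atom p q a \<Longrightarrow> asum K a" and ad: "atomic_decomposition p q f c a"
  shows "asum (K * (\<Sum>j. norm (c j) powr p)) f"
proof -
  have a: "asum K (a j)" for j using ad K unfolding atomic_decomposition_def by blast
  have cp: "summable (\<lambda>j. norm (c j) powr p)" using ad unfolding atomic_decomposition_def by blast
  have cs: "summable (\<lambda>j. norm (c j))" by (rule summable_of_powr(1)[OF _ cp]) simp
  have K0: "K \<ge> 0" by (rule asum_nonneg[OF a])
  show ?thesis
  proof (rule asum_countable[of "\<lambda>j. norm (c j) powr p * K" "\<lambda>j n. c j * a j n"])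
    show "asum (norm (c j) powr p * K) (\<lambda>n. c j * a j n)" for j by (rule asum_scale[OF a])
    show "((\<lambda>j. norm (c j) powr p * K) has_sum K * (\<Sum>j. norm (c j) powr p)) UNIV"
      using K0 sums_mult2[OF summable_sums[OF cp], of K] by (subst has_sum_nat_iff_sums) (auto simp: mult.commute)
    show "((\<lambda>j. c j * a j n) has_sum f n) UNIV" for n
    proof (rule norm_summable_imp_has_sum)
      show "summable (\<lambda>j. norm (c j * a j n))"
        by (rule summable_comparison_test'[OF summable_mult2[OF cs, of "K powr (1 / p)"]])
          (use asum_norm_le[OF a] in \<open>auto simp: norm_mult intro!: mult_left_mono\<close>)
      show "(\<lambda>j. c j * a j n) sums f n"
        unfolding sums_def by (rule atomic_decomposition_pointwise[OF ad])
    qed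
  qed
qed

text \<open>A supremum bound on an interval implies the q-th power bound there, with the factor
  length to the power \<open>1 / q\<close>.\<close>

lemma hardy_atom_of_batom:
  assumes q: "1 \<le> q" and a: "batom a"
  shows "hardy_atom p q a"
proof -
  obtain c d where cd: "c \<le> d" and supp: "\<And>n. n \<notin> {c..d} \<Longrightarrow> a n = 0" and bd: "\<And>n. norm (a n) \<le> real (card {c..d}) powr (- (1 / p))"
    and ann: "annihilates N a" using a unfolding batom_def by blast
  have "lq_norm q (\<lambda>n. ennreal (norm (a n))) \<le> ennreal (real (card {c..d}) powr (enn2real (1 / q) - 1 / p))"
  proof (cases q)
    case top
    then show ?thesis using bd by (auto simp: lq_norm_def intro!: SUP_least ennreal_leI)
  next
    case (real r)
    have r: "r \<ge> 1" using q real by (simp flip: ennreal_1)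
    define L where "L = real (card {c..d})"
    have L: "L > 0" using cd by (simp add: L_def)
    define S where "S = (\<Sum>n\<in>{c..d}. norm (a n) powr r)"
    have "S \<le> (\<Sum>n\<in>{c..d}. (L powr (- (1 / p))) powr r)"
      unfolding S_def using bd r by (intro sum_mono powr_mono2) (auto simp only: L_def norm_ge_zero)
    also have "\<dots> = L powr 1 * L powr (- (1 / p) * r)" using L by (simp only: sum_constant L_def[symmetric] powr_powr powr_one)
    also have "\<dots> = L powr (1 + - (1 / p) * r)" by (simp only: powr_add)
    finally have "S powr (1 / r) \<le> (L powr (1 + - (1 / p) * r)) powr (1 / r)"
      using r by (intro powr_mono2) (auto simp: S_def intro!: sum_nonneg)
    also have "\<dots> = L powr (1 / r - 1 / p)"
    proof -
      have "(1 + - (1 / p) * r) * (1 / r) = 1 / r - 1 / p" using r by (simp add: algebra_simps)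
      then show ?thesis by (simp only: powr_powr)
    qed
    finally have "ennreal (S powr (1 / r)) \<le> ennreal (L powr (1 / r - 1 / p))" by (rule ennreal_leI)
    moreover have "lq_norm q (\<lambda>n. ennreal (norm (a n))) = ennreal (S powr (1 / r))"
      unfolding real(2) S_def by (rule lq_norm_finite_support) (use r supp in auto)
    ultimately show ?thesis using r unfolding real(2) by (simp add: enn2real_inverse L_def)
  qed
  moreover have "\<forall>\<alpha>::nat. real \<alpha> \<le> 1 / p - 1 \<longrightarrow> (\<Sum>n\<in>{c..d}. of_int n ^ \<alpha> * a n) = 0"
    using ann annihilates_iff_monomials[of "{c..d}" a N] supp N_iff by auto
  moreover have "{n. a n \<noteq> 0} \<subseteq> {c..d}" using supp by blast
  ultimately show ?thesis unfolding hardy_atom_def using cd by blast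
qed

text \<open>The l^1 norm of the remainder is at most the tail of the coefficient series. This gives
  l^1 convergence outright, and convergence against test functions because it bounds the remainder
  uniformly.\<close>

lemma atomic_decomposition_of_asum:
  assumes q: "1 \<le> q" and f: "asum B f"
  obtains c a where "atomic_decomposition p q f c a" "(\<Sum>j. norm (c j) powr p) \<le> B"
proof -
  obtain c a where ca: "\<And>j::nat. batom (a j)" "summable (\<lambda>j. norm (c j :: complex) powr p)" "(\<Sum>j. norm (c j) powr p) \<le> B"
     "\<And>n. ((\<lambda>j. c j * a j n) has_sum f n) UNIV"
    using f unfolding asum_def by blast
  have cs: "summable (\<lambda>j. norm (c j))" by (rule summable_of_powr(1)[OF _ ca(2)]) simp
  define r where "r = (\<lambda>N. \<Sum>j. norm (c (j + N)))"
  have r: "r \<longlonglongrightarrow> 0" unfolding r_def by (rule suminf_exist_split2[OF cs])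
  have tail: "(\<Sum>n\<in>X. norm (f n - (\<Sum>j<N. c j * a j n))) \<le> r N" if X: "finite X" for X N
    unfolding r_def
  proof (rule l1_series_bound[OF _ _ _ X])
    show "summable (\<lambda>j. norm (c (j + N)))" using cs by (rule summable_ignore_initial_segment)
    show "(\<lambda>j. c (j + N) * a (j + N) n) sums (f n - (\<Sum>j<N. c j * a j n))" for n
      by (rule sums_split_initial_segment[OF has_sum_imp_sums[OF ca(4)]])
  qed (rule batom_l1[OF ca(1)])
  have "atomic_decomposition p q f c a"
    unfolding atomic_decomposition_def
  proof (intro conjI allI)
    show "if p = 1 then (\<lambda>N. lq_norm 1 (\<lambda>n. ennreal (norm (f n - (\<Sum>j<N. c j * a j n))))) \<longlonglongrightarrow> 0
      else tempered_tendsto (\<lambda>N n. \<Sum>j<N. c j * a j n) f sequentially"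
    proof (cases "p = 1")
      case True
      have le: "lq_norm 1 (\<lambda>n. ennreal (norm (f n - (\<Sum>j<N. c j * a j n)))) \<le> ennreal (r N)" for N
        unfolding lq_norm_1 by (rule nn_integral_count_space_int_le) (use tail in \<open>simp add: sum_ennreal ennreal_leI\<close>)
      have lim: "(\<lambda>N. ennreal (r N)) \<longlonglongrightarrow> 0" using tendsto_ennrealI[OF r] by simp
      have "(\<lambda>N. lq_norm 1 (\<lambda>n. ennreal (norm (f n - (\<Sum>j<N. c j * a j n))))) \<longlonglongrightarrow> 0"
        by (rule tendsto_sandwich[OF _ _ tendsto_const lim]) (use le in \<open>auto intro!: always_eventually\<close>)
      then show ?thesis using True by simp
    next
      case False
      have "tempered_tendsto (\<lambda>N n. \<Sum>j<N. c j * a j n) f sequentially"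
        unfolding tempered_tendsto_def
      proof
        fix \<phi> assume \<phi>: "\<phi> \<in> schwartz"
        show "(\<lambda>N. pairing (\<lambda>n. \<Sum>j<N. c j * a j n) \<phi>) \<longlonglongrightarrow> pairing f \<phi>"
          by (rule pairing_tendsto_uniform[OF \<phi> asum_norm_le[OF f] _ r]) (use tail[of "{n}" for n] in simp)
      qed
      then show ?thesis using False by simp
    qed
  qed (use ca(1,2) hardy_atom_of_batom[OF q] in auto)
  then show thesis using ca(3) that by blast
qed

lemma hardy_classical_of_asum:
  assumes q: "1 \<le> q" and f: "asum B f"
  shows "f \<in> hardy_classical p q"
proof -
  obtain S where S: "\<And>X. finite X \<Longrightarrow> (\<Sum>n\<in>X. norm (f n)) \<le> S" "poly_growth (1 + S) 0 f"
    using asum_l1[OF f] by blast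
  have "lq_norm 1 (\<lambda>n. ennreal (norm (f n))) \<le> ennreal S"
    unfolding lq_norm_1 by (rule nn_integral_count_space_int_le) (use S(1) in \<open>simp add: sum_ennreal ennreal_leI\<close>)
  then have "lq_norm 1 (\<lambda>n. ennreal (norm (f n))) < \<infinity>" by (simp add: order.strict_trans1)
  moreover have "f \<in> tempered" using S(2) unfolding tempered_def poly_growth_def by blast
  moreover obtain c a where "atomic_decomposition p q f c a" using atomic_decomposition_of_asum[OF q f] by blast
  ultimately show ?thesis unfolding hardy_classical_def by auto
qed

end

section \<open>Equality of the spaces and equivalence of the norms\<close>

lemma ennreal_le_cmult_Inf:
  fixes x :: ennreal
  assumes k: "k > 0" and le: "\<And>s. s \<in> A \<Longrightarrow> x \<le> ennreal k * s"
  shows "x \<le> ennreal k * Inf A"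
proof -
  have inv: "ennreal (1 / k) * (ennreal k * y) = y" "ennreal k * (ennreal (1 / k) * y) = y" for y
    using k by (simp_all flip: mult.assoc ennreal_mult)
  have "ennreal (1 / k) * x \<le> Inf A"
  proof (rule Inf_greatest)
    fix s assume "s \<in> A"
    then have "ennreal (1 / k) * x \<le> ennreal (1 / k) * (ennreal k * s)" by (intro mult_left_mono le) auto
    then show "ennreal (1 / k) * x \<le> s" by (simp only: inv)
  qed
  then have "ennreal k * (ennreal (1 / k) * x) \<le> ennreal k * Inf A" by (rule mult_left_mono) simp
  then show ?thesis by (simp only: inv)
qed

lemma epowr_le_cmult:
  assumes "x \<le> ennreal k * y" "k > 0" "r \<ge> 0" "k powr r \<le> C"
  shows "epowr x r \<le> ennreal C * epowr y r"
proof -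
  have "epowr x r \<le> epowr (ennreal k * y) r" using assms by (intro epowr_mono)
  also have "\<dots> = ennreal (k powr r) * epowr y r" using assms by (intro epowr_cmult)
  also have "\<dots> \<le> ennreal C * epowr y r" using assms by (intro mult_right_mono ennreal_leI) auto
  finally show ?thesis .
qed

theorem theorem3p14:
  fixes p :: real and q :: ennreal
  assumes "0 < p" and "p \<le> 1" and "ennreal p < q" and "1 \<le> q"
  shows "hardy_laplacian p = hardy_classical p q \<and>
    (\<exists>C>0. \<forall>f\<in>hardy_laplacian p.
        hardy_laplacian_norm p f \<le> ennreal C * hardy_classical_norm p q f \<and>
        hardy_classical_norm p q f \<le> ennreal C * hardy_laplacian_norm p f)"
proof -
  interpret hardy_exponent p by unfold_locales (use assms in auto)
  obtain K1 where K1: "K1 > 0" "\<And>f. f \<in> tempered \<Longrightarrow> vanishes_weakly_at_infinity f \<Longrightarrow> sf_mass p f < \<infinity> \<Longrightarrow>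
      asum (K1 * enn2real (sf_mass p f)) f"
    using asum_of_square_function by blast
  obtain C2 where C2: "C2 > 0" "\<And>B f. asum B f \<Longrightarrow> f \<in> tempered \<and> vanishes_weakly_at_infinity f \<and> sf_mass p f \<le> ennreal (C2 * B)"
    using square_function_asum by blast
  obtain K3 where K3: "K3 > 0" "\<And>a. hardy_atom p q a \<Longrightarrow> asum K3 a"
    using asum_of_hardy_atom[OF assms(3,4)] by blast
  have finite_norm: "hardy_laplacian_norm p f < \<infinity> \<longleftrightarrow> sf_mass p f < \<infinity>" for f
    using epowr_eq_top_iff[of "sf_mass p f" "1 / p"]
    by (simp add: hardy_laplacian_norm_sf_mass[OF assms(1)] less_top[symmetric])
  have lap: "asum (K1 * enn2real (sf_mass p f)) f" "sf_mass p f < \<infinity>" if "f \<in> hardy_laplacian p" for f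
    using that K1(2) unfolding hardy_laplacian_def finite_norm by blast+
  \<comment> \<open>Every decomposition bounds the square function by its own coefficient sum, so
    the infimum may be taken afterwards.\<close>
  have dec: "sf_mass p f \<le> ennreal (C2 * K3) * ennreal (\<Sum>j. norm (c j) powr p)" "f \<in> hardy_laplacian p"
    if ad: "atomic_decomposition p q f c a" for f c a
  proof -
    note as = C2(2)[OF asum_of_atomic_decomposition[OF K3(2) ad]]
    have "(\<Sum>j. norm (c j) powr p) \<ge> 0" using ad unfolding atomic_decomposition_def by (intro suminf_nonneg) auto
    then show "sf_mass p f \<le> ennreal (C2 * K3) * ennreal (\<Sum>j. norm (c j) powr p)"
      using as C2(1) K3(1) by (simp add: mult.assoc flip: ennreal_mult)
    have "sf_mass p f < \<infinity>" using as by (auto intro: order.strict_trans1)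
    then show "f \<in> hardy_laplacian p" using as unfolding hardy_laplacian_def finite_norm by blast
  qed
  \<comment> \<open>The comparisons hold for p-th powers; passing to the norms raises their
    constants to the power \<open>1 / p\<close>.\<close>
  define C where "C = max (K1 powr (1 / p)) ((C2 * K3) powr (1 / p))"
  have "C > 0" unfolding C_def using K1(1) by (simp add: less_max_iff_disj)
  moreover have "hardy_laplacian_norm p f \<le> ennreal C * hardy_classical_norm p q f \<and>
      hardy_classical_norm p q f \<le> ennreal C * hardy_laplacian_norm p f" if f: "f \<in> hardy_laplacian p" for f
  proof
    define A where "A = {ennreal (\<Sum>j. norm (c j) powr p) |c a. atomic_decomposition p q f c a}"
    have "sf_mass p f \<le> ennreal (C2 * K3) * Inf A"
      by (rule ennreal_le_cmult_Inf) (use C2(1) K3(1) dec(1) in \<open>auto simp: A_def\<close>)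
    then show "hardy_laplacian_norm p f \<le> ennreal C * hardy_classical_norm p q f"
      unfolding hardy_laplacian_norm_sf_mass[OF assms(1)] hardy_classical_norm_def A_def[symmetric]
      by (rule epowr_le_cmult) (use C2(1) K3(1) assms(1) in \<open>auto simp: C_def\<close>)
    obtain c a where ca: "atomic_decomposition p q f c a" "(\<Sum>j. norm (c j) powr p) \<le> K1 * enn2real (sf_mass p f)"
      using atomic_decomposition_of_asum[OF assms(4) lap(1)[OF f]] by blast
    have "Inf A \<le> ennreal (\<Sum>j. norm (c j) powr p)" using ca(1) unfolding A_def by (intro Inf_lower) blast
    also have "\<dots> \<le> ennreal (K1 * enn2real (sf_mass p f))" by (rule ennreal_leI[OF ca(2)])
    also have "\<dots> = ennreal K1 * sf_mass p f" using K1(1) lap(2)[OF f] by (simp add: ennreal_mult less_top)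
    finally show "hardy_classical_norm p q f \<le> ennreal C * hardy_laplacian_norm p f"
      unfolding hardy_laplacian_norm_sf_mass[OF assms(1)] hardy_classical_norm_def A_def[symmetric]
      by (rule epowr_le_cmult) (use K1(1) assms(1) in \<open>auto simp: C_def\<close>)
  qed
  moreover have "hardy_laplacian p = hardy_classical p q"
    using hardy_classical_of_asum[OF assms(4) lap(1)] dec(2) unfolding hardy_classical_def by blast
  ultimately show ?thesis by blast
qed

end
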